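(* Let $(R,\mathfrak m)$ be a Cohen-Macaulay local ring of dimension $d\ge 1$ possessing a canonical module. Let $I$ be an $\mathfrak m$-primary ideal of $R$ containing a parameter ideal $Q$ as a reduction, and assume that $I$ is Gorenstein (i.e., $R/I$ is a Gorenstein ring). Let $M,N$ be finite $R$-modules such that $\operatorname{Ext}_R^i(\operatorname{Tr}M,N)=0$ for all $i=1,\ldots,d+1$. (a) Suppose that $M/IM$ is a free $R/I$-module, $M^*$ is Ulrich with respect to $I$, and $N$ is maximal Cohen-Macaulay. Then $M\otimes_R N$ is Ulrich with respect to $I$ if and only if $N/IN$ is a free $R/I$-module. (b) Suppose that $M^*$ is maximal Cohen-Macaulay and $N$ is Ulrich with respect to $I$. Then $M\otimes_R N$ is Ulrich with respect to $I$ if and only if $M/IM$ is a free $R/I$-module.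
   Context: All rings are commutative Noetherian with $1\ne 0$; finite module means finitely generated module. A finite module $M$ over a local ring $R$ is maximal Cohen-Macaulay if $\operatorname{depth}_R M=\dim R$; the zero module has depth $+\infty$ and so is not maximal Cohen-Macaulay. A parameter ideal is an ideal generated by a system of parameters of $R$; an ideal $Q\subseteq I$ is a reduction of $I$ if $I^{n+1}=QI^n$ for some $n\ge 0$. For $R$, $I$, $Q$ as in the statement, a finite $R$-module $M$ is Ulrich with respect to $I$ if (1) $M$ is a maximal Cohen-Macaulay $R$-module, (2) $IM=QM$, and (3) $M/IM$ is a free $R/I$-module. $M^*=\operatorname{Hom}_R(M,R)$. The (Auslander) transpose $\operatorname{Tr}M$ is the cokernel of $\partial_1^*=\operatorname{Hom}_R(\partial_1,R):F_0^*\to F_1^*$, where $F_1\xrightarrow{\partial_1}F_0\to M\to 0$ is a minimal free presentation of $M$; it is unique up to isomorphism. *)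

theory Defs
  imports "HOL-Algebra.Ring_Divisibility" "HOL-Algebra.Ideal_Product" "HOL-Algebra.Module"
    "HOL-Library.Extended_Nat"
begin

text \<open>
  Rings and modules are the carrier-based records of HOL-Algebra.  The fields mult and one, which
  every module record inherits from the ring record, are irrelevant for modules.
\<close>

section \<open>Local rings\<close>

definition local_ring :: "('a, 'r) ring_scheme \<Rightarrow> bool" where
  "local_ring R \<longleftrightarrow> cring R \<and> noetherian_ring R \<and> (\<exists>!P. maximalideal P R)"

definition max_ideal :: "('a, 'r) ring_scheme \<Rightarrow> 'a set" where
  "max_ideal R = (THE P. maximalideal P R)"

definition krull_dim :: "('a, 'r) ring_scheme \<Rightarrow> enat" where
  "krull_dim R = (SUP n \<in> {n. \<exists>P. (\<forall>i\<le>n. primeideal (P i) R) \<and> (\<forall>i<n. P i \<subset> P (Suc i))}. enat n)"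

definition radical :: "('a, 'r) ring_scheme \<Rightarrow> 'a set \<Rightarrow> 'a set" where
  "radical R I = {a \<in> carrier R. \<exists>n::nat. a [^]\<^bsub>R\<^esub> n \<in> I}"

definition primary_ideal :: "('a, 'r) ring_scheme \<Rightarrow> 'a set \<Rightarrow> bool" where
  "primary_ideal R I \<longleftrightarrow> ideal I R \<and> I \<noteq> carrier R \<and>
     (\<forall>a \<in> carrier R. \<forall>b \<in> carrier R. a \<otimes>\<^bsub>R\<^esub> b \<in> I \<longrightarrow> a \<in> I \<or> (\<exists>n::nat. b [^]\<^bsub>R\<^esub> n \<in> I))"

definition max_primary :: "('a, 'r) ring_scheme \<Rightarrow> 'a set \<Rightarrow> bool" where
  "max_primary R I \<longleftrightarrow> primary_ideal R I \<and> radical R I = max_ideal R"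

definition system_of_parameters :: "('a, 'r) ring_scheme \<Rightarrow> 'a list \<Rightarrow> bool" where
  "system_of_parameters R xs \<longleftrightarrow>
     enat (length xs) = krull_dim R \<and> set xs \<subseteq> max_ideal R \<and> max_primary R (genideal R (set xs))"

definition parameter_ideal :: "('a, 'r) ring_scheme \<Rightarrow> 'a set \<Rightarrow> bool" where
  "parameter_ideal R Q \<longleftrightarrow> (\<exists>xs. system_of_parameters R xs \<and> Q = genideal R (set xs))"

text \<open>Powers are taken in the monoid of ideals, whose unit is the whole ring.\<close>

definition reduction :: "('a, 'r) ring_scheme \<Rightarrow> 'a set \<Rightarrow> 'a set \<Rightarrow> bool" where
  "reduction R Q I \<longleftrightarrow> ideal Q R \<and> Q \<subseteq> I \<and>
     (\<exists>n::nat. I [^]\<^bsub>ideals_set R\<^esub> (n + 1) = ideal_prod R Q (I [^]\<^bsub>ideals_set R\<^esub> n))"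

section \<open>Modules\<close>

definition gen_submodule ::
  "('a, 'r) ring_scheme \<Rightarrow> ('a, 'm, 'x) module_scheme \<Rightarrow> 'm set \<Rightarrow> 'm set" where
  "gen_submodule R M S = \<Inter>{H. submodule H R M \<and> S \<subseteq> H}"

definition finite_module :: "('a, 'r) ring_scheme \<Rightarrow> ('a, 'm, 'x) module_scheme \<Rightarrow> bool" where
  "finite_module R M \<longleftrightarrow> module R M \<and>
     (\<exists>S. finite S \<and> S \<subseteq> carrier M \<and> gen_submodule R M S = carrier M)"

definition zero_module :: "('a, 'm, 'x) module_scheme \<Rightarrow> bool" where
  "zero_module M \<longleftrightarrow> carrier M = {\<zero>\<^bsub>M\<^esub>}"

definition ideal_smult ::
  "('a, 'r) ring_scheme \<Rightarrow> 'a set \<Rightarrow> ('a, 'm, 'x) module_scheme \<Rightarrow> 'm set" where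
  "ideal_smult R I M = gen_submodule R M {a \<odot>\<^bsub>M\<^esub> x | a x. a \<in> I \<and> x \<in> carrier M}"

definition ring_module :: "('a, 'r) ring_scheme \<Rightarrow> ('a, 'a) module" where
  "ring_module R = \<lparr>carrier = carrier R, monoid.mult = monoid.mult R, one = one R,
     ring.zero = ring.zero R, ring.add = ring.add R, smult = monoid.mult R\<rparr>"

definition quot_module :: "('a, 'm, 'x) module_scheme \<Rightarrow> 'm set \<Rightarrow> ('a, 'm set) module" where
  "quot_module M H = \<lparr>carrier = a_rcosets\<^bsub>M\<^esub> H, monoid.mult = undefined, one = undefined,
     ring.zero = H, ring.add = set_add M, smult = (\<lambda>a X. \<Union>x\<in>X. H +>\<^bsub>M\<^esub> (a \<odot>\<^bsub>M\<^esub> x))\<rparr>"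

text \<open>
  A module \<open>V\<close> annihilated by the ideal \<open>J\<close>, regarded as a module over \<open>R Quot J\<close>: a coset \<open>A\<close> of
  \<open>J\<close> acts as any of its representatives.
\<close>

definition over_quot :: "('a, 'v, 'x) module_scheme \<Rightarrow> ('a set, 'v) module" where
  "over_quot V = \<lparr>carrier = carrier V, monoid.mult = undefined, one = undefined,
     ring.zero = ring.zero V, ring.add = ring.add V, smult = (\<lambda>A x. THE y. \<exists>a\<in>A. y = a \<odot>\<^bsub>V\<^esub> x)\<rparr>"

definition module_basis ::
  "('a, 'r) ring_scheme \<Rightarrow> ('a, 'm, 'x) module_scheme \<Rightarrow> 'm set \<Rightarrow> bool" where
  "module_basis R M B \<longleftrightarrow> B \<subseteq> carrier M \<and>
     (\<forall>x \<in> carrier M. \<exists>F c. finite F \<and> F \<subseteq> B \<and> c \<in> F \<rightarrow> carrier R \<and>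
        x = (\<Oplus>\<^bsub>M\<^esub>b\<in>F. c b \<odot>\<^bsub>M\<^esub> b)) \<and>
     (\<forall>F c. finite F \<and> F \<subseteq> B \<and> c \<in> F \<rightarrow> carrier R \<and> (\<Oplus>\<^bsub>M\<^esub>b\<in>F. c b \<odot>\<^bsub>M\<^esub> b) = \<zero>\<^bsub>M\<^esub>
        \<longrightarrow> (\<forall>b\<in>F. c b = \<zero>\<^bsub>R\<^esub>))"

definition free_module :: "('a, 'r) ring_scheme \<Rightarrow> ('a, 'm, 'x) module_scheme \<Rightarrow> bool" where
  "free_module R M \<longleftrightarrow> module R M \<and> (\<exists>B. module_basis R M B)"

definition free_mod_ideal ::
  "('a, 'r) ring_scheme \<Rightarrow> 'a set \<Rightarrow> ('a, 'm, 'x) module_scheme \<Rightarrow> bool" where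
  "free_mod_ideal R I M \<longleftrightarrow>
     free_module (R Quot I) (over_quot (quot_module M (ideal_smult R I M)))"

text \<open>Homomorphisms are extensional, so that equal maps are equal as functions.\<close>

definition mod_hom :: "('a, 'r) ring_scheme \<Rightarrow> ('a, 'm, 'x) module_scheme \<Rightarrow>
    ('a, 'n, 'y) module_scheme \<Rightarrow> ('m \<Rightarrow> 'n) set" where
  "mod_hom R M N = {f \<in> carrier M \<rightarrow>\<^sub>E carrier N.
     (\<forall>x \<in> carrier M. \<forall>y \<in> carrier M. f (x \<oplus>\<^bsub>M\<^esub> y) = f x \<oplus>\<^bsub>N\<^esub> f y) \<and>
     (\<forall>a \<in> carrier R. \<forall>x \<in> carrier M. f (a \<odot>\<^bsub>M\<^esub> x) = a \<odot>\<^bsub>N\<^esub> f x)}"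

definition mod_ker ::
  "('a, 'm, 'x) module_scheme \<Rightarrow> ('a, 'n, 'y) module_scheme \<Rightarrow> ('m \<Rightarrow> 'n) \<Rightarrow> 'm set" where
  "mod_ker M N f = {x \<in> carrier M. f x = \<zero>\<^bsub>N\<^esub>}"

definition Hom_module :: "('a, 'r) ring_scheme \<Rightarrow> ('a, 'm, 'x) module_scheme \<Rightarrow>
    ('a, 'n, 'y) module_scheme \<Rightarrow> ('a, 'm \<Rightarrow> 'n) module" where
  "Hom_module R M N = \<lparr>carrier = mod_hom R M N, monoid.mult = undefined, one = undefined,
     ring.zero = (\<lambda>x\<in>carrier M. \<zero>\<^bsub>N\<^esub>),
     ring.add = (\<lambda>f g. \<lambda>x\<in>carrier M. f x \<oplus>\<^bsub>N\<^esub> g x),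
     smult = (\<lambda>a f. \<lambda>x\<in>carrier M. a \<odot>\<^bsub>N\<^esub> f x)\<rparr>"

definition dual :: "('a, 'r) ring_scheme \<Rightarrow> ('a, 'm, 'x) module_scheme \<Rightarrow> ('a, 'm \<Rightarrow> 'a) module" where
  "dual R M = Hom_module R M (ring_module R)"

text \<open>The free module on a set, as finitely supported functions vanishing outside the set.\<close>

definition free_on :: "('a, 'r) ring_scheme \<Rightarrow> 's set \<Rightarrow> ('a, 's \<Rightarrow> 'a) module" where
  "free_on R S = \<lparr>carrier = {f. (\<forall>s\<in>S. f s \<in> carrier R) \<and> (\<forall>s. s \<notin> S \<longrightarrow> f s = \<zero>\<^bsub>R\<^esub>) \<and>
                              finite {s. f s \<noteq> \<zero>\<^bsub>R\<^esub>}},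
     monoid.mult = undefined, one = undefined, ring.zero = (\<lambda>s. \<zero>\<^bsub>R\<^esub>),
     ring.add = (\<lambda>f g s. f s \<oplus>\<^bsub>R\<^esub> g s), smult = (\<lambda>a f s. a \<otimes>\<^bsub>R\<^esub> f s)\<rparr>"

definition finite_free :: "('a, 'r) ring_scheme \<Rightarrow> nat \<Rightarrow> ('a, nat \<Rightarrow> 'a) module" where
  "finite_free R n = free_on R {..<n}"

definition unit_vec :: "('a, 'r) ring_scheme \<Rightarrow> 's \<Rightarrow> 's \<Rightarrow> 'a" where
  "unit_vec R s = (\<lambda>t. if t = s then \<one>\<^bsub>R\<^esub> else \<zero>\<^bsub>R\<^esub>)"

definition tensor_relations :: "('a, 'r) ring_scheme \<Rightarrow> ('a, 'm, 'x) module_scheme \<Rightarrow>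
    ('a, 'n, 'y) module_scheme \<Rightarrow> ('m \<times> 'n \<Rightarrow> 'a) set" where
  "tensor_relations R M N =
    (let F = free_on R (carrier M \<times> carrier N); e = (\<lambda>x y. unit_vec R (x, y)) in
      {e (x \<oplus>\<^bsub>M\<^esub> x') y \<ominus>\<^bsub>F\<^esub> (e x y \<oplus>\<^bsub>F\<^esub> e x' y) | x x' y.
         x \<in> carrier M \<and> x' \<in> carrier M \<and> y \<in> carrier N} \<union>
      {e x (y \<oplus>\<^bsub>N\<^esub> y') \<ominus>\<^bsub>F\<^esub> (e x y \<oplus>\<^bsub>F\<^esub> e x y') | x y y'.
         x \<in> carrier M \<and> y \<in> carrier N \<and> y' \<in> carrier N} \<union>
      {e (a \<odot>\<^bsub>M\<^esub> x) y \<ominus>\<^bsub>F\<^esub> (a \<odot>\<^bsub>F\<^esub> e x y) | a x y.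
         a \<in> carrier R \<and> x \<in> carrier M \<and> y \<in> carrier N} \<union>
      {e x (a \<odot>\<^bsub>N\<^esub> y) \<ominus>\<^bsub>F\<^esub> (a \<odot>\<^bsub>F\<^esub> e x y) | a x y.
         a \<in> carrier R \<and> x \<in> carrier M \<and> y \<in> carrier N})"

definition tensor :: "('a, 'r) ring_scheme \<Rightarrow> ('a, 'm, 'x) module_scheme \<Rightarrow>
    ('a, 'n, 'y) module_scheme \<Rightarrow> ('a, ('m \<times> 'n \<Rightarrow> 'a) set) module" where
  "tensor R M N = (let F = free_on R (carrier M \<times> carrier N)
     in quot_module F (gen_submodule R F (tensor_relations R M N)))"

section \<open>Depth and maximal Cohen-Macaulay modules\<close>

definition regular_seq ::
  "('a, 'r) ring_scheme \<Rightarrow> ('a, 'm, 'x) module_scheme \<Rightarrow> 'a list \<Rightarrow> bool" where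
  "regular_seq R M xs \<longleftrightarrow>
     (let M' = (\<lambda>i. quot_module M (ideal_smult R (genideal R (set (take i xs))) M)) in
       (\<forall>i<length xs. \<forall>y \<in> carrier (M' i). (xs ! i) \<odot>\<^bsub>M' i\<^esub> y = \<zero>\<^bsub>M' i\<^esub> \<longrightarrow> y = \<zero>\<^bsub>M' i\<^esub>) \<and>
       \<not> zero_module (M' (length xs)))"

definition depth :: "('a, 'r) ring_scheme \<Rightarrow> ('a, 'm, 'x) module_scheme \<Rightarrow> enat" where
  "depth R M = (if zero_module M then \<infinity>
     else (SUP xs \<in> {xs. set xs \<subseteq> max_ideal R \<and> regular_seq R M xs}. enat (length xs)))"

definition MCM :: "('a, 'r) ring_scheme \<Rightarrow> ('a, 'm, 'x) module_scheme \<Rightarrow> bool" where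
  "MCM R M \<longleftrightarrow> finite_module R M \<and> depth R M = krull_dim R"

definition CM_local_ring :: "('a, 'r) ring_scheme \<Rightarrow> bool" where
  "CM_local_ring R \<longleftrightarrow> local_ring R \<and> MCM R (ring_module R)"

definition ulrich ::
  "('a, 'r) ring_scheme \<Rightarrow> 'a set \<Rightarrow> 'a set \<Rightarrow> ('a, 'm, 'x) module_scheme \<Rightarrow> bool" where
  "ulrich R I Q M \<longleftrightarrow> MCM R M \<and> ideal_smult R I M = ideal_smult R Q M \<and> free_mod_ideal R I M"

section \<open>Resolutions, Ext and the transpose\<close>

text \<open>
  A resolution \<open>\<cdots> \<rightarrow> F 1 \<rightarrow> F 0 \<rightarrow> X \<rightarrow> 0\<close> with \<open>F i = finite_free R (b i)\<close>,
  \<open>D i : F (i + 1) \<rightarrow> F i\<close> and augmentation \<open>\<epsilon>\<close>.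
\<close>

definition free_resolution :: "('a, 'r) ring_scheme \<Rightarrow> ('a, 'm, 'x) module_scheme \<Rightarrow> (nat \<Rightarrow> nat) \<Rightarrow>
    (nat \<Rightarrow> (nat \<Rightarrow> 'a) \<Rightarrow> (nat \<Rightarrow> 'a)) \<Rightarrow> ((nat \<Rightarrow> 'a) \<Rightarrow> 'm) \<Rightarrow> bool" where
  "free_resolution R X b D \<epsilon> \<longleftrightarrow>
     (let F = (\<lambda>i. finite_free R (b i)) in
       \<epsilon> \<in> mod_hom R (F 0) X \<and> (\<forall>i. D i \<in> mod_hom R (F (Suc i)) (F i)) \<and>
       \<epsilon> ` carrier (F 0) = carrier X \<and>
       mod_ker (F 0) X \<epsilon> = D 0 ` carrier (F 1) \<and>
       (\<forall>i. mod_ker (F (Suc i)) (F i) (D i) = D (Suc i) ` carrier (F (Suc (Suc i)))))"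

definition cohomology :: "(nat \<Rightarrow> ('a, 'm) module) \<Rightarrow>
    (nat \<Rightarrow> 'm \<Rightarrow> 'm) \<Rightarrow> nat \<Rightarrow> ('a, 'm set) module" where
  "cohomology C \<delta> i =
     quot_module ((C i)\<lparr>carrier := mod_ker (C i) (C (Suc i)) (\<delta> i)\<rparr>)
       (case i of 0 \<Rightarrow> {\<zero>\<^bsub>C 0\<^esub>} | Suc j \<Rightarrow> \<delta> j ` carrier (C j))"

text \<open>
  Ext for a finite module \<open>X\<close> over a Noetherian ring: such an \<open>X\<close> has a resolution by finite free
  modules, and the result does not depend, up to isomorphism, on the one that is chosen.
\<close>

definition Ext :: "('a, 'r) ring_scheme \<Rightarrow> nat \<Rightarrow> ('a, 'm, 'x) module_scheme \<Rightarrow>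
    ('a, 'n, 'y) module_scheme \<Rightarrow> ('a, ((nat \<Rightarrow> 'a) \<Rightarrow> 'n) set) module" where
  "Ext R i X N =
     (let (b, D, \<epsilon>) = (SOME (b, D, \<epsilon>). free_resolution R X b D \<epsilon>) in
       cohomology (\<lambda>j. Hom_module R (finite_free R (b j)) N)
         (\<lambda>j \<phi>. compose (carrier (finite_free R (b (Suc j)))) \<phi> (D j)) i)"

definition minimal_presentation :: "('a, 'r) ring_scheme \<Rightarrow> ('a, 'm, 'x) module_scheme \<Rightarrow>
    nat \<Rightarrow> nat \<Rightarrow> ((nat \<Rightarrow> 'a) \<Rightarrow> (nat \<Rightarrow> 'a)) \<Rightarrow> ((nat \<Rightarrow> 'a) \<Rightarrow> 'm) \<Rightarrow> bool" where
  "minimal_presentation R M b0 b1 D \<epsilon> \<longleftrightarrow>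
     (let F0 = finite_free R b0; F1 = finite_free R b1 in
       \<epsilon> \<in> mod_hom R F0 M \<and> D \<in> mod_hom R F1 F0 \<and>
       \<epsilon> ` carrier F0 = carrier M \<and> mod_ker F0 M \<epsilon> = D ` carrier F1 \<and>
       D ` carrier F1 \<subseteq> ideal_smult R (max_ideal R) F0 \<and>
       mod_ker F1 F0 D \<subseteq> ideal_smult R (max_ideal R) F1)"

definition transpose_module :: "('a, 'r) ring_scheme \<Rightarrow> ('a, 'm, 'x) module_scheme \<Rightarrow>
    ('a, ((nat \<Rightarrow> 'a) \<Rightarrow> 'a) set) module" where
  "transpose_module R M =
     (let (b0, b1, D, \<epsilon>) = (SOME (b0, b1, D, \<epsilon>). minimal_presentation R M b0 b1 D \<epsilon>);
          F0 = finite_free R b0; F1 = finite_free R b1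
      in quot_module (dual R F1) ((\<lambda>\<phi>. compose (carrier F1) \<phi> D) ` carrier (dual R F0)))"

section \<open>Gorenstein rings and canonical modules\<close>

text \<open>
  HOL cannot quantify over all modules, so the test modules \<open>B\<close> live on a fixed type.  This is no
  restriction: the type accommodates the free module of rank one and its submodules, the ideals,
  which suffice by Baer's criterion.
\<close>

definition injective_module :: "('a, 'r) ring_scheme \<Rightarrow> ('a, 'e, 'x) module_scheme \<Rightarrow> bool" where
  "injective_module R E \<longleftrightarrow> module R E \<and>
     (\<forall>(B :: ('a, nat \<Rightarrow> 'a) module) A f.
        module R B \<and> submodule A R B \<and> f \<in> mod_hom R (B\<lparr>carrier := A\<rparr>) E \<longrightarrow>
        (\<exists>g \<in> mod_hom R B E. \<forall>x \<in> A. g x = f x))"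

text \<open>
  Existence of an exact sequence \<open>0 \<rightarrow> M \<rightarrow> E 0 \<rightarrow> \<cdots> \<rightarrow> E r \<rightarrow> 0\<close> with all \<open>E j\<close> injective.  The type of
  the \<open>E j\<close> is no restriction for a finite module \<open>M\<close> over a Noetherian ring \<open>R\<close>: in a minimal
  injective resolution each \<open>E j\<close> is a direct sum of injective hulls of residue class rings by
  primes, each prime occurring finitely often.  Such a hull is a countable union of finite modules
  over the localization, so \<open>E j\<close> has at most \<open>max \<bar>R\<bar> \<aleph>\<^sub>0\<close> elements and, for \<open>R \<noteq> 0\<close>, embeds into
  the type \<open>nat \<Rightarrow> 'a\<close>.
\<close>

definition finite_inj_dim :: "('a, 'r) ring_scheme \<Rightarrow> ('a, 'm, 'x) module_scheme \<Rightarrow> bool" where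
  "finite_inj_dim R M \<longleftrightarrow>
     (\<exists>(E :: nat \<Rightarrow> ('a, nat \<Rightarrow> 'a) module) \<delta> \<eta> r.
        (\<forall>j. injective_module R (E j)) \<and> (\<forall>j>r. zero_module (E j)) \<and>
        \<eta> \<in> mod_hom R M (E 0) \<and> (\<forall>j. \<delta> j \<in> mod_hom R (E j) (E (Suc j))) \<and>
        inj_on \<eta> (carrier M) \<and>
        mod_ker (E 0) (E 1) (\<delta> 0) = \<eta> ` carrier M \<and>
        (\<forall>j. mod_ker (E (Suc j)) (E (Suc (Suc j))) (\<delta> (Suc j)) = \<delta> j ` carrier (E j)))"

definition gorenstein_local_ring :: "('a, 'r) ring_scheme \<Rightarrow> bool" where
  "gorenstein_local_ring R \<longleftrightarrow> local_ring R \<and> finite_inj_dim R (ring_module R)"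

definition residue_field :: "('a, 'r) ring_scheme \<Rightarrow> ('a, 'a set) module" where
  "residue_field R = quot_module (ring_module R) (max_ideal R)"

text \<open>
  The type of \<open>M\<close> is the dimension of \<open>Ext\<^sup>t(k, M)\<close> over the residue field \<open>k\<close>, where \<open>t\<close> is the
  depth of \<open>M\<close>.
\<close>

definition has_CM_type ::
  "('a, 'r) ring_scheme \<Rightarrow> ('a, 'm, 'x) module_scheme \<Rightarrow> nat \<Rightarrow> bool" where
  "has_CM_type R M n \<longleftrightarrow>
     (\<exists>t B. depth R M = enat t \<and> finite B \<and> card B = n \<and>
        module_basis (R Quot (max_ideal R)) (over_quot (Ext R t (residue_field R) M)) B)"

definition canonical_module :: "('a, 'r) ring_scheme \<Rightarrow> ('a, 'm, 'x) module_scheme \<Rightarrow> bool" where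
  "canonical_module R K \<longleftrightarrow> MCM R K \<and> has_CM_type R K 1 \<and> finite_inj_dim R K"

end

theory Submission
  imports Defs
begin

text \<open>
  Let \<open>R\<^sup>k \<rightarrow> R\<^sup>n \<rightarrow> M \<rightarrow> 0\<close> be a minimal presentation.  Its dual \<open>R\<^sup>n \<rightarrow> R\<^sup>k\<close> continues to the left to a
  free resolution of \<open>Tr M\<close>, whose next map \<open>R\<^sup>b \<rightarrow> R\<^sup>n\<close> has image \<open>M\<^sup>*\<close>.  Applying \<open>Hom(-, N)\<close> gives a complex
  \<open>N\<^sup>k \<rightarrow> N\<^sup>n \<rightarrow> N\<^sup>b \<rightarrow> \<cdots>\<close> whose first map has cokernel \<open>M \<otimes> N\<close>, and the vanishing of \<open>Ext\<close> makes it exact at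
  \<open>d + 1\<close> consecutive places.  In all cases \<open>N\<close> is maximal Cohen-Macaulay, so a system of parameters
  \<open>x\<close> generating \<open>Q\<close> is \<open>N\<close>-regular, and each element of \<open>x\<close> costs one place of exactness: modulo \<open>x\<close>
  the complex is still exact at \<open>N\<^sup>n\<close>.  Hence \<open>x\<close> is regular on \<open>M \<otimes> N\<close>, which is therefore maximal
  Cohen-Macaulay, and \<open>M \<otimes> N\<close> modulo \<open>Q\<close> embeds into \<open>N\<^sup>b\<close> modulo \<open>Q\<close>.  The embedding is given by
  functionals on \<open>M\<close>, so that \<open>I (M \<otimes> N)\<close> vanishes modulo \<open>Q\<close> as soon as \<open>I N = Q N\<close> or
  \<open>I M\<^sup>* = Q M\<^sup>*\<close>.

  Finally, \<open>X / I X\<close> is free over \<open>R / I\<close> if and only if all relations between minimal generators of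
  \<open>X\<close> have their coefficients in \<open>I\<close>, and the relations of \<open>M \<otimes> N\<close> between products of minimal
  generators are those coming from \<open>M\<close> and from \<open>N\<close>.
\<close>

text \<open>The parameters generating \<open>Q\<close> are given in advance, whereas
  \<open>depth\<close> only provides some regular sequence of length \<open>d\<close> in the maximal
  ideal. The passage from one to the other, and the upper bound for the depth of
  \<open>M \<otimes> N\<close>, rest on the Koszul complex: a regular sequence whose elements have
  powers in \<open>(x)\<close> makes the Koszul cohomology of \<open>x\<close> vanish in all degrees
  below its length, and over a local ring this vanishing in turn makes \<open>x\<close> regular.

  The bound \<open>d + 1\<close> is a count: exactness at \<open>N^n\<close> after reduction by
  \<open>d\<close> elements consumes exactness at \<open>d + 1\<close> places.

  \<open>Ext\<close> and the transpose are both built from arbitrary choices. Vanishing must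
  therefore be carried to a resolution that starts with the transposed matrix of exactly the
  presentation chosen for the transpose.

  Homological statements are made modulo \<open>(X)\<close> inside the modules themselves. Quotients
  would live on a new type at each step, which blocks induction along a sequence.\<close>

section \<open>Linear maps between modules\<close>

text \<open>Linearity without the extensionality that \<open>mod_hom\<close> demands, so that
  composites and other lambda terms need no restriction to a carrier; \<open>restrict\<close>
  restores membership in \<open>mod_hom\<close>.\<close>

definition lin :: "('a, 'r) ring_scheme \<Rightarrow> ('a, 'm, 'x) module_scheme \<Rightarrow>
    ('a, 'n, 'y) module_scheme \<Rightarrow> ('m \<Rightarrow> 'n) \<Rightarrow> bool" where
  "lin R M N f \<longleftrightarrow> f \<in> carrier M \<rightarrow> carrier N \<and>
     (\<forall>x \<in> carrier M. \<forall>y \<in> carrier M. f (x \<oplus>\<^bsub>M\<^esub> y) = f x \<oplus>\<^bsub>N\<^esub> f y) \<and>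
     (\<forall>a \<in> carrier R. \<forall>x \<in> carrier M. f (a \<odot>\<^bsub>M\<^esub> x) = a \<odot>\<^bsub>N\<^esub> f x)"

lemma linI:
  assumes "\<And>x. x \<in> carrier M \<Longrightarrow> f x \<in> carrier N"
    and "\<And>x y. x \<in> carrier M \<Longrightarrow> y \<in> carrier M \<Longrightarrow> f (x \<oplus>\<^bsub>M\<^esub> y) = f x \<oplus>\<^bsub>N\<^esub> f y"
    and "\<And>a x. a \<in> carrier R \<Longrightarrow> x \<in> carrier M \<Longrightarrow> f (a \<odot>\<^bsub>M\<^esub> x) = a \<odot>\<^bsub>N\<^esub> f x"
  shows "lin R M N f"
  using assms by (auto simp: lin_def)

lemma lin_closed: "lin R M N f \<Longrightarrow> x \<in> carrier M \<Longrightarrow> f x \<in> carrier N"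
  by (auto simp: lin_def)

lemma lin_add: "lin R M N f \<Longrightarrow> x \<in> carrier M \<Longrightarrow> y \<in> carrier M \<Longrightarrow> f (x \<oplus>\<^bsub>M\<^esub> y) = f x \<oplus>\<^bsub>N\<^esub> f y"
  by (auto simp: lin_def)

lemma lin_smult: "lin R M N f \<Longrightarrow> a \<in> carrier R \<Longrightarrow> x \<in> carrier M \<Longrightarrow> f (a \<odot>\<^bsub>M\<^esub> x) = a \<odot>\<^bsub>N\<^esub> f x"
  by (auto simp: lin_def)

lemma lin_comp: "lin R M N f \<Longrightarrow> lin R N P g \<Longrightarrow> lin R M P (\<lambda>x. g (f x))"
  by (auto simp: lin_def Pi_iff)

lemma mod_hom_iff: "f \<in> mod_hom R M N \<longleftrightarrow> lin R M N f \<and> f \<in> extensional (carrier M)"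
  by (auto simp: mod_hom_def lin_def PiE_def)

lemma mod_hom_lin: "f \<in> mod_hom R M N \<Longrightarrow> lin R M N f"
  by (simp add: mod_hom_iff)

lemma lin_cong:
  assumes "module R M" "lin R M N f" "\<And>x. x \<in> carrier M \<Longrightarrow> f x = g x"
  shows "lin R M N g"
proof -
  interpret module R M by fact
  show ?thesis using assms(2,3) by (auto simp: lin_def Pi_iff)
qed

lemma restrict_mod_hom: "module R M \<Longrightarrow> lin R M N f \<Longrightarrow> restrict f (carrier M) \<in> mod_hom R M N"
  by (auto simp: mod_hom_iff intro: lin_cong)

lemma lin_zero:
  assumes "module R M" "module R N" "lin R M N f"
  shows "f \<zero>\<^bsub>M\<^esub> = \<zero>\<^bsub>N\<^esub>"
proof -
  interpret M: module R M by fact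
  interpret N: module R N by fact
  have "f (\<zero>\<^bsub>R\<^esub> \<odot>\<^bsub>M\<^esub> \<zero>\<^bsub>M\<^esub>) = \<zero>\<^bsub>R\<^esub> \<odot>\<^bsub>N\<^esub> f \<zero>\<^bsub>M\<^esub>"
    using lin_smult[OF assms(3), of "\<zero>\<^bsub>R\<^esub>" "\<zero>\<^bsub>M\<^esub>"] by simp
  thus ?thesis using lin_closed[OF assms(3), of "\<zero>\<^bsub>M\<^esub>"] by simp
qed

lemma lin_neg:
  assumes "module R M" "module R N" "lin R M N f" "x \<in> carrier M"
  shows "f (\<ominus>\<^bsub>M\<^esub> x) = \<ominus>\<^bsub>N\<^esub> f x"
proof -
  interpret M: module R M by fact
  interpret N: module R N by fact
  have "f ((\<ominus>\<^bsub>R\<^esub> \<one>\<^bsub>R\<^esub>) \<odot>\<^bsub>M\<^esub> x) = (\<ominus>\<^bsub>R\<^esub> \<one>\<^bsub>R\<^esub>) \<odot>\<^bsub>N\<^esub> f x"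
    using lin_smult[OF assms(3)] assms(4) by simp
  thus ?thesis using lin_closed[OF assms(3,4)] assms(4)
    by (simp add: M.smult_l_minus N.smult_l_minus)
qed

lemma lin_minus:
  assumes "module R M" "module R N" "lin R M N f" "x \<in> carrier M" "y \<in> carrier M"
  shows "f (x \<ominus>\<^bsub>M\<^esub> y) = f x \<ominus>\<^bsub>N\<^esub> f y"
proof -
  interpret M: module R M by fact
  interpret N: module R N by fact
  show ?thesis
    using assms(4,5) by (simp add: a_minus_def lin_add[OF assms(3)] lin_neg[OF assms(1-3)])
qed

lemma lin_finsum:
  assumes "module R M" "module R N" "lin R M N f" "finite A" "g \<in> A \<rightarrow> carrier M"
  shows "f (finsum M g A) = (\<Oplus>\<^bsub>N\<^esub>i\<in>A. f (g i))"
proof -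
  interpret M: module R M by fact
  interpret N: module R N by fact
  show ?thesis using assms(4,5)
  proof (induction A rule: finite_induct)
    case empty thus ?case using lin_zero[OF assms(1-3)] by simp
  next
    case (insert x F)
    have "finsum M g F \<in> carrier M" using insert by (intro M.finsum_closed) auto
    moreover have "(\<lambda>i. f (g i)) \<in> F \<rightarrow> carrier N" "f (g x) \<in> carrier N"
      using insert.prems lin_closed[OF assms(3)] by auto
    ultimately show ?case
      using insert by (simp add: Pi_iff lin_add[OF assms(3)])
  qed
qed

lemma lin_add_fun:
  assumes "module R M" "module R N" "lin R M N f" "lin R M N g"
  shows "lin R M N (\<lambda>x. f x \<oplus>\<^bsub>N\<^esub> g x)"
proof -
  interpret M: module R M by fact
  interpret N: module R N by fact
  show ?thesis
    by (rule linI) (simp_all add: lin_closed[OF assms(3)] lin_closed[OF assms(4)] lin_add[OF assms(3)]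
      lin_add[OF assms(4)] lin_smult[OF assms(3)] lin_smult[OF assms(4)] N.a_ac N.smult_r_distr)
qed

lemma lin_neg_fun:
  assumes "module R M" "module R N" "lin R M N f"
  shows "lin R M N (\<lambda>x. \<ominus>\<^bsub>N\<^esub> f x)"
proof -
  interpret M: module R M by fact
  interpret N: module R N by fact
  show ?thesis
    by (rule linI) (simp_all add: lin_closed[OF assms(3)] lin_add[OF assms(3)]
      lin_smult[OF assms(3)] N.minus_add N.smult_r_minus)
qed

lemma lin_minus_fun:
  assumes "module R M" "module R N" "lin R M N f" "lin R M N g"
  shows "lin R M N (\<lambda>x. f x \<ominus>\<^bsub>N\<^esub> g x)"
  unfolding a_minus_def by (intro lin_add_fun lin_neg_fun assms)

lemma lin_smult_fun:
  assumes "module R M" "module R N" "lin R M N f" "a \<in> carrier R"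
  shows "lin R M N (\<lambda>x. a \<odot>\<^bsub>N\<^esub> f x)"
proof -
  interpret M: module R M by fact
  interpret N: module R N by fact
  show ?thesis using assms(4)
    by (intro linI) (simp_all add: lin_closed[OF assms(3)] lin_add[OF assms(3)]
      lin_smult[OF assms(3)] N.smult_r_distr M.m_comm flip: N.smult_assoc1)
qed

section \<open>Submodules\<close>

lemma sub_carr: "submodule H R M \<Longrightarrow> x \<in> H \<Longrightarrow> x \<in> carrier M"
  by (metis partial_object.select_convs(1) subgroup.mem_carrier submodule.axioms(1))

lemma sub_add: "submodule H R M \<Longrightarrow> x \<in> H \<Longrightarrow> y \<in> H \<Longrightarrow> x \<oplus>\<^bsub>M\<^esub> y \<in> H"
  using subgroup.m_closed[of H "add_monoid M" x y] by (simp add: submodule_def)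

lemma sub_zero: "submodule H R M \<Longrightarrow> \<zero>\<^bsub>M\<^esub> \<in> H"
  using subgroup.one_closed[of H "add_monoid M"] by (simp add: submodule_def)

lemma sub_neg: "submodule H R M \<Longrightarrow> x \<in> H \<Longrightarrow> \<ominus>\<^bsub>M\<^esub> x \<in> H"
  using subgroup.m_inv_closed[of H "add_monoid M"] by (simp add: submodule_def a_inv_def)

lemma sub_minus: "submodule H R M \<Longrightarrow> x \<in> H \<Longrightarrow> y \<in> H \<Longrightarrow> x \<ominus>\<^bsub>M\<^esub> y \<in> H"
  by (simp add: a_minus_def sub_add sub_neg)

lemma sub_smult: "submodule H R M \<Longrightarrow> a \<in> carrier R \<Longrightarrow> x \<in> H \<Longrightarrow> a \<odot>\<^bsub>M\<^esub> x \<in> H"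
  by (simp add: submodule.smult_closed)

text \<open>Negation is scalar multiplication by minus one, so the remaining closure conditions
  suffice.\<close>

lemma subI:
  assumes "module R M" "\<And>x. x \<in> H \<Longrightarrow> x \<in> carrier M" "\<zero>\<^bsub>M\<^esub> \<in> H"
    "\<And>x y. x \<in> H \<Longrightarrow> y \<in> H \<Longrightarrow> x \<oplus>\<^bsub>M\<^esub> y \<in> H"
    "\<And>a x. a \<in> carrier R \<Longrightarrow> x \<in> H \<Longrightarrow> a \<odot>\<^bsub>M\<^esub> x \<in> H"
  shows "submodule H R M"
proof -
  interpret module R M by fact
  have "\<ominus>\<^bsub>M\<^esub> x \<in> H" if "x \<in> H" for x
    using assms(5)[of "\<ominus>\<^bsub>R\<^esub> \<one>\<^bsub>R\<^esub>" x] that assms(2)[of x] by (simp add: smult_l_minus)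
  thus ?thesis using assms by (intro submoduleI) auto
qed

lemma sub_finsum:
  assumes "module R M" "submodule H R M" "finite A" "g \<in> A \<rightarrow> H"
  shows "finsum M g A \<in> H"
proof -
  interpret module R M by fact
  show ?thesis using assms(3,4)
  proof (induction A rule: finite_induct)
    case empty thus ?case using sub_zero[OF assms(2)] by simp
  next
    case (insert x F)
    hence "g \<in> F \<rightarrow> carrier M" "g x \<in> carrier M" using sub_carr[OF assms(2)] by auto
    thus ?case using insert sub_add[OF assms(2)] by (simp add: Pi_iff)
  qed
qed

lemma sub_add_cancel:
  assumes "module R M" "submodule H R M" "x \<oplus>\<^bsub>M\<^esub> y \<in> H" "y \<in> H" "x \<in> carrier M"
  shows "x \<in> H"
proof -
  interpret module R M by fact
  have "(x \<oplus>\<^bsub>M\<^esub> y) \<ominus>\<^bsub>M\<^esub> y = x" using assms(4,5) sub_carr[OF assms(2)]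
    by (simp add: a_minus_def M.a_assoc M.r_neg)
  thus ?thesis using sub_minus[OF assms(2,3,4)] by simp
qed

lemma sub_vimage:
  assumes "module R M" "module R N" "lin R M N f" "submodule H R N"
  shows "submodule {x \<in> carrier M. f x \<in> H} R M"
proof -
  interpret M: module R M by fact
  show ?thesis
    by (rule subI[OF assms(1)]) (auto simp: lin_zero[OF assms(1-3)] lin_add[OF assms(3)] lin_smult[OF assms(3)]
      sub_zero[OF assms(4)] sub_add[OF assms(4)] sub_smult[OF assms(4)])
qed

lemma sub_image:
  assumes "module R M" "module R N" "lin R M N f" "submodule H R M"
  shows "submodule (f ` H) R N"
proof -
  interpret N: module R N by fact
  show ?thesis
  proof (rule subI[OF assms(2)])
    show "\<zero>\<^bsub>N\<^esub> \<in> f ` H" using sub_zero[OF assms(4)] lin_zero[OF assms(1-3)] by force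
    show "x \<in> f ` H \<Longrightarrow> x \<in> carrier N" for x
      using lin_closed[OF assms(3)] sub_carr[OF assms(4)] by auto
  next
    fix x y assume "x \<in> f ` H" "y \<in> f ` H"
    then obtain u v where "u \<in> H" "v \<in> H" "x = f u" "y = f v" by auto
    moreover from this have "x \<oplus>\<^bsub>N\<^esub> y = f (u \<oplus>\<^bsub>M\<^esub> v)"
      using lin_add[OF assms(3)] sub_carr[OF assms(4)] by auto
    ultimately show "x \<oplus>\<^bsub>N\<^esub> y \<in> f ` H" using sub_add[OF assms(4)] by auto
  next
    fix a x assume "a \<in> carrier R" "x \<in> f ` H"
    then obtain u where "u \<in> H" "x = f u" by auto
    moreover from this have "a \<odot>\<^bsub>N\<^esub> x = f (a \<odot>\<^bsub>M\<^esub> u)"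
      using lin_smult[OF assms(3) \<open>a \<in> carrier R\<close>] sub_carr[OF assms(4)] by auto
    ultimately show "a \<odot>\<^bsub>N\<^esub> x \<in> f ` H" using sub_smult[OF assms(4) \<open>a \<in> carrier R\<close>] by auto
  qed
qed

lemma sub_carrier: "module R M \<Longrightarrow> submodule (carrier M) R M"
  by (rule module.carrier_is_submodule)

lemma sub_zero_sub: "module R M \<Longrightarrow> submodule {\<zero>\<^bsub>M\<^esub>} R M"
proof -
  assume "module R M"
  then interpret module R M .
  show ?thesis by (rule subI) (auto intro: module_axioms)
qed

lemma sub_ker:
  assumes "module R M" "module R N" "lin R M N f"
  shows "submodule (mod_ker M N f) R M"
  using sub_vimage[OF assms sub_zero_sub[OF assms(2)]] by (simp add: mod_ker_def)

lemma sub_sum: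
  assumes "module R M" "submodule H R M" "submodule K R M"
  shows "submodule {x \<oplus>\<^bsub>M\<^esub> y | x y. x \<in> H \<and> y \<in> K} R M"
proof -
  interpret module R M by fact
  note [simp] = sub_carr[OF assms(2)] sub_carr[OF assms(3)]
  show ?thesis
  proof (rule subI[OF assms(1)], goal_cases)
    case (1 x) thus ?case by auto
  next
    case 2
    have "\<zero>\<^bsub>M\<^esub> = \<zero>\<^bsub>M\<^esub> \<oplus>\<^bsub>M\<^esub> \<zero>\<^bsub>M\<^esub>" by simp
    thus ?case using sub_zero[OF assms(2)] sub_zero[OF assms(3)] by blast
  next
    case (3 x y)
    then obtain a b c d where *: "a \<in> H" "b \<in> K" "c \<in> H" "d \<in> K" "x = a \<oplus>\<^bsub>M\<^esub> b" "y = c \<oplus>\<^bsub>M\<^esub> d" by blast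
    hence "x \<oplus>\<^bsub>M\<^esub> y = (a \<oplus>\<^bsub>M\<^esub> c) \<oplus>\<^bsub>M\<^esub> (b \<oplus>\<^bsub>M\<^esub> d)" by (simp add: M.a_ac)
    thus ?case using * sub_add[OF assms(2)] sub_add[OF assms(3)] by blast
  next
    case (4 a x)
    then obtain b c where *: "b \<in> H" "c \<in> K" "x = b \<oplus>\<^bsub>M\<^esub> c" by blast
    hence "a \<odot>\<^bsub>M\<^esub> x = a \<odot>\<^bsub>M\<^esub> b \<oplus>\<^bsub>M\<^esub> a \<odot>\<^bsub>M\<^esub> c" using 4 by (simp add: smult_r_distr)
    thus ?case using * 4 sub_smult[OF assms(2)] sub_smult[OF assms(3)] by blast
  qed
qed

lemma gen_sub:
  assumes "module R M" "S \<subseteq> carrier M"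
  shows "submodule (gen_submodule R M S) R M"
proof (rule subI[OF assms(1)])
  show "x \<in> gen_submodule R M S \<Longrightarrow> x \<in> carrier M" for x
    using sub_carrier[OF assms(1)] assms(2) by (auto simp: gen_submodule_def)
qed (auto simp: gen_submodule_def intro: sub_add sub_zero sub_smult)

lemma gen_incl: "S \<subseteq> gen_submodule R M S"
  by (auto simp: gen_submodule_def)

lemma gen_least: "submodule H R M \<Longrightarrow> S \<subseteq> H \<Longrightarrow> gen_submodule R M S \<subseteq> H"
  by (auto simp: gen_submodule_def)

lemma gen_mono: "S \<subseteq> T \<Longrightarrow> gen_submodule R M S \<subseteq> gen_submodule R M T"
  by (auto simp: gen_submodule_def)

section \<open>The ring as a module\<close>

lemma ring_module_simps [simp]:
  "carrier (ring_module R) = carrier R" "\<zero>\<^bsub>ring_module R\<^esub> = \<zero>\<^bsub>R\<^esub>"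
  "x \<oplus>\<^bsub>ring_module R\<^esub> y = x \<oplus>\<^bsub>R\<^esub> y" "x \<odot>\<^bsub>ring_module R\<^esub> y = x \<otimes>\<^bsub>R\<^esub> y"
  by (simp_all add: ring_module_def)

lemma ring_module_module:
  assumes "cring R" shows "module R (ring_module R)"
proof -
  interpret cring R by fact
  show ?thesis
    apply (intro moduleI assms abelian_groupI)
    using l_neg by (auto simp: a_ac m_assoc l_distr r_distr)
qed

text \<open>Through this, images, preimages and generation of submodules become available for
  ideals.\<close>

lemma ideal_iff_submodule:
  assumes "cring R" shows "ideal J R \<longleftrightarrow> submodule J R (ring_module R)"
proof
  interpret cring R by fact
  assume "ideal J R"
  then interpret J: ideal J R .
  show "submodule J R (ring_module R)"
    by (rule subI[OF ring_module_module[OF assms]]) (auto intro: J.I_l_closed)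
next
  interpret cring R by fact
  assume J: "submodule J R (ring_module R)"
  show "ideal J R"
  proof (rule idealI[OF ring_axioms])
    have neg: "\<ominus>\<^bsub>R\<^esub> x \<in> J" if "x \<in> J" for x
      using sub_smult[OF J, of "\<ominus>\<^bsub>R\<^esub> \<one>\<^bsub>R\<^esub>" x] that sub_carr[OF J that] by (simp add: l_minus)
    show "subgroup J (add_monoid R)"
      using sub_zero[OF J] sub_add[OF J] sub_carr[OF J] neg
      by (intro add.subgroupI) (auto simp flip: a_inv_def)
    show "x \<otimes>\<^bsub>R\<^esub> a \<in> J" if "a \<in> J" "x \<in> carrier R" for a x
      using sub_smult[OF J that(2,1)] by simp
    show "a \<otimes>\<^bsub>R\<^esub> x \<in> J" if "a \<in> J" "x \<in> carrier R" for a x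
      using sub_smult[OF J that(2,1)] that sub_carr[OF J that(1)] by (simp add: m_comm)
  qed
qed

lemma ideal_subI:
  assumes "cring R" "\<And>x. x \<in> J \<Longrightarrow> x \<in> carrier R" "\<zero>\<^bsub>R\<^esub> \<in> J"
    "\<And>x y. x \<in> J \<Longrightarrow> y \<in> J \<Longrightarrow> x \<oplus>\<^bsub>R\<^esub> y \<in> J"
    "\<And>a x. a \<in> carrier R \<Longrightarrow> x \<in> J \<Longrightarrow> a \<otimes>\<^bsub>R\<^esub> x \<in> J"
  shows "ideal J R"
  unfolding ideal_iff_submodule[OF assms(1)]
  by (rule subI[OF ring_module_module[OF assms(1)]]) (use assms in auto)

section \<open>Ideal multiples of a module\<close>

lemma ismult_sub:
  assumes "module R M" "I \<subseteq> carrier R"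
  shows "submodule (ideal_smult R I M) R M"
proof -
  interpret module R M by fact
  show ?thesis unfolding ideal_smult_def using assms(2)
    by (intro gen_sub assms) auto
qed

lemma ismult_mem: "a \<in> I \<Longrightarrow> x \<in> carrier M \<Longrightarrow> a \<odot>\<^bsub>M\<^esub> x \<in> ideal_smult R I M"
  unfolding ideal_smult_def by (rule subsetD[OF gen_incl]) auto

lemma ismult_least:
  assumes "submodule H R M" "\<And>a x. a \<in> I \<Longrightarrow> x \<in> carrier M \<Longrightarrow> a \<odot>\<^bsub>M\<^esub> x \<in> H"
  shows "ideal_smult R I M \<subseteq> H"
  unfolding ideal_smult_def by (rule gen_least) (use assms in auto)

lemma ismult_mono: "I \<subseteq> J \<Longrightarrow> ideal_smult R I M \<subseteq> ideal_smult R J M"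
  unfolding ideal_smult_def by (intro gen_mono) auto

lemma lin_ismult:
  assumes "module R M" "module R N" "lin R M N f" "I \<subseteq> carrier R" "x \<in> ideal_smult R I M"
  shows "f x \<in> ideal_smult R I N"
proof -
  have "ideal_smult R I M \<subseteq> {x \<in> carrier M. f x \<in> ideal_smult R I N}"
  proof (rule ismult_least)
    show "submodule {x \<in> carrier M. f x \<in> ideal_smult R I N} R M"
      by (rule sub_vimage[OF assms(1-3) ismult_sub[OF assms(2,4)]])
    interpret M: module R M by fact
    show "\<And>a x. a \<in> I \<Longrightarrow> x \<in> carrier M \<Longrightarrow> a \<odot>\<^bsub>M\<^esub> x \<in> {x \<in> carrier M. f x \<in> ideal_smult R I N}"
      using assms(4) lin_closed[OF assms(3)] by (auto simp: lin_smult[OF assms(3)] subset_iff intro: ismult_mem)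
  qed
  thus ?thesis using assms(5) by auto
qed

lemma genideal_ideal': "cring R \<Longrightarrow> X \<subseteq> carrier R \<Longrightarrow> ideal (genideal R X) R"
  by (simp add: cring.axioms(1) ring.genideal_ideal)

lemma genideal_carr: "cring R \<Longrightarrow> X \<subseteq> carrier R \<Longrightarrow> genideal R X \<subseteq> carrier R"
  by (meson genideal_ideal' ideal.Icarr subsetI)

lemma genideal_incl: "X \<subseteq> genideal R X"
  by (auto simp: genideal_def)

lemma genideal_least: "ideal J R \<Longrightarrow> X \<subseteq> J \<Longrightarrow> genideal R X \<subseteq> J"
  by (auto simp: genideal_def)

section \<open>Multiples of a module by the ideal of a set\<close>

text \<open>The submodule \<open>(X) M\<close>. A set in place of a list suits inductions that add
  one element with \<open>insert\<close>; the order of a sequence matters only in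
  \<open>regular_list\<close>.\<close>

definition xsub :: "('a, 'r) ring_scheme \<Rightarrow> ('a, 'm, 'x) module_scheme \<Rightarrow> 'a set \<Rightarrow> 'm set" where
  "xsub R M X = ideal_smult R (genideal R X) M"

lemma xsub_sub: "module R M \<Longrightarrow> X \<subseteq> carrier R \<Longrightarrow> submodule (xsub R M X) R M"
  unfolding xsub_def by (intro ismult_sub genideal_carr) (auto simp: module_def)

lemma xsub_mem: "x \<in> X \<Longrightarrow> u \<in> carrier M \<Longrightarrow> x \<odot>\<^bsub>M\<^esub> u \<in> xsub R M X"
  unfolding xsub_def by (intro ismult_mem subsetD[OF genideal_incl])

text \<open>The scalars that carry all of \<open>M\<close> into \<open>H\<close> form an ideal, so
  it is enough that this ideal contains \<open>X\<close>.\<close>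

lemma xsub_least:
  assumes "module R M" "X \<subseteq> carrier R" "submodule H R M"
    "\<And>x u. x \<in> X \<Longrightarrow> u \<in> carrier M \<Longrightarrow> x \<odot>\<^bsub>M\<^esub> u \<in> H"
  shows "xsub R M X \<subseteq> H"
proof -
  interpret module R M by fact
  have "genideal R X \<subseteq> {a \<in> carrier R. \<forall>u\<in>carrier M. a \<odot>\<^bsub>M\<^esub> u \<in> H}"
    using assms(2,4) sub_zero[OF assms(3)] sub_add[OF assms(3)] sub_smult[OF assms(3)]
    by (intro genideal_least ideal_subI) (auto intro: R.is_cring simp: smult_l_distr smult_assoc1)
  thus ?thesis unfolding xsub_def by (intro ismult_least[OF assms(3)]) blast
qed

lemma xsub_mono:
  assumes "module R M" "Y \<subseteq> carrier R" "X \<subseteq> Y" shows "xsub R M X \<subseteq> xsub R M Y"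
  by (intro xsub_least xsub_sub assms) (use assms in \<open>auto intro: xsub_mem\<close>)

lemma lin_xsub:
  assumes "module R M" "module R N" "lin R M N f" "X \<subseteq> carrier R" "x \<in> xsub R M X"
  shows "f x \<in> xsub R N X"
  using lin_ismult[OF assms(1-3) genideal_carr] assms(1,4,5) by (auto simp: xsub_def module_def)

lemma xsub_empty: "module R M \<Longrightarrow> xsub R M {} = {\<zero>\<^bsub>M\<^esub>}"
proof -
  assume M: "module R M"
  have "xsub R M {} \<subseteq> {\<zero>\<^bsub>M\<^esub>}" by (intro xsub_least sub_zero_sub M) auto
  moreover have "\<zero>\<^bsub>M\<^esub> \<in> xsub R M {}" by (rule sub_zero, rule xsub_sub[OF M]) auto
  ultimately show ?thesis by auto
qed

lemma sub_smult_image: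
  assumes "module R M" "x \<in> carrier R"
  shows "submodule ((\<lambda>u. x \<odot>\<^bsub>M\<^esub> u) ` carrier M) R M"
proof -
  interpret module R M by fact
  have "lin R M M (\<lambda>u. x \<odot>\<^bsub>M\<^esub> u)"
    by (rule lin_smult_fun[OF assms(1) assms(1) _ assms(2)]) (simp add: lin_def)
  from sub_image[OF assms(1,1) this sub_carrier[OF assms(1)]] show ?thesis .
qed

text \<open>The inclusion of \<open>(x, X) M\<close> in \<open>(X) M + x M\<close>, by which the
  exactness arguments add or remove a single element.\<close>

lemma xsub_insertE:
  assumes "module R M" "X \<subseteq> carrier R" "x \<in> carrier R" "v \<in> xsub R M (insert x X)"
  obtains l u where "l \<in> xsub R M X" "u \<in> carrier M" "v = l \<oplus>\<^bsub>M\<^esub> x \<odot>\<^bsub>M\<^esub> u"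
proof -
  interpret module R M by fact
  let ?H = "{a \<oplus>\<^bsub>M\<^esub> b | a b. a \<in> xsub R M X \<and> b \<in> (\<lambda>u. x \<odot>\<^bsub>M\<^esub> u) ` carrier M}"
  note s = xsub_sub[OF assms(1,2)] sub_smult_image[OF assms(1,3)]
  have "xsub R M (insert x X) \<subseteq> ?H"
  proof (rule xsub_least)
    show "submodule ?H R M" by (intro sub_sum assms s)
    fix y u assume yu: "y \<in> insert x X" "u \<in> carrier M"
    have z: "\<zero>\<^bsub>M\<^esub> = x \<odot>\<^bsub>M\<^esub> \<zero>\<^bsub>M\<^esub>" using assms by simp
    show "y \<odot>\<^bsub>M\<^esub> u \<in> ?H"
    proof (cases "y = x")
      case True
      hence "y \<odot>\<^bsub>M\<^esub> u = \<zero>\<^bsub>M\<^esub> \<oplus>\<^bsub>M\<^esub> x \<odot>\<^bsub>M\<^esub> u" using yu assms by simp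
      thus ?thesis using yu sub_zero[OF s(1)] by blast
    next
      case False
      hence "y \<odot>\<^bsub>M\<^esub> u = y \<odot>\<^bsub>M\<^esub> u \<oplus>\<^bsub>M\<^esub> \<zero>\<^bsub>M\<^esub>" using yu assms by auto
      moreover have "y \<odot>\<^bsub>M\<^esub> u \<in> xsub R M X" using False yu by (intro xsub_mem) auto
      ultimately show ?thesis using yu z M.zero_closed by blast
    qed
  qed (use assms in auto)
  thus ?thesis using assms(4) that by blast
qed

section \<open>Finite powers\<close>

text \<open>One encoding for \<open>N^n\<close>, for finite free modules and for Koszul cochains.
  Values outside \<open>S\<close> are fixed to zero, so equality of elements is equality of
  functions.\<close>

definition pow_module :: "('a, 'm, 'x) module_scheme \<Rightarrow> 's set \<Rightarrow> ('a, 's \<Rightarrow> 'm) module" where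
  "pow_module M S = \<lparr>carrier = {c. (\<forall>s\<in>S. c s \<in> carrier M) \<and> (\<forall>s. s \<notin> S \<longrightarrow> c s = \<zero>\<^bsub>M\<^esub>)},
     monoid.mult = undefined, one = undefined, ring.zero = (\<lambda>s. \<zero>\<^bsub>M\<^esub>),
     ring.add = (\<lambda>f g s. f s \<oplus>\<^bsub>M\<^esub> g s), smult = (\<lambda>a f s. a \<odot>\<^bsub>M\<^esub> f s)\<rparr>"

lemma pow_simps [simp]:
  "\<zero>\<^bsub>pow_module M S\<^esub> = (\<lambda>s. \<zero>\<^bsub>M\<^esub>)"
  "f \<oplus>\<^bsub>pow_module M S\<^esub> g = (\<lambda>s. f s \<oplus>\<^bsub>M\<^esub> g s)" "a \<odot>\<^bsub>pow_module M S\<^esub> f = (\<lambda>s. a \<odot>\<^bsub>M\<^esub> f s)"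
  by (simp_all add: pow_module_def)

lemma pow_carrier: "c \<in> carrier (pow_module M S) \<longleftrightarrow>
    (\<forall>s\<in>S. c s \<in> carrier M) \<and> (\<forall>s. s \<notin> S \<longrightarrow> c s = \<zero>\<^bsub>M\<^esub>)"
  by (simp add: pow_module_def)

lemma pow_module_module:
  assumes "module R M" shows "module R (pow_module M S)"
proof -
  interpret module R M by fact
  show ?thesis
  proof (intro moduleI abelian_groupI, goal_cases)
    case (7 x)
    hence "(\<lambda>s. \<ominus>\<^bsub>M\<^esub> x s) \<in> carrier (pow_module M S)" by (auto simp: pow_carrier)
    moreover have "x s \<in> carrier M" for s using 7 by (cases "s \<in> S") (auto simp: pow_carrier)
    ultimately show ?case by (intro bexI[of _ "\<lambda>s. \<ominus>\<^bsub>M\<^esub> x s"]) (auto simp: M.l_neg)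
  next
    case 1 show ?case by (rule R.is_cring)
  qed (auto simp: pow_carrier fun_eq_iff M.a_ac smult_l_distr smult_r_distr smult_assoc1,
      (metis M.zero_closed M.a_assoc M.a_comm M.l_zero smult_r_null smult_one smult_l_distr smult_r_distr smult_assoc1
        R.a_closed R.m_closed)+)
qed

lemma pow_val: "module R M \<Longrightarrow> c \<in> carrier (pow_module M S) \<Longrightarrow> c s \<in> carrier M"
proof -
  assume "module R M" "c \<in> carrier (pow_module M S)"
  then interpret module R M by blast
  show ?thesis using \<open>c \<in> _\<close> by (cases "s \<in> S") (auto simp: pow_carrier)
qed

lemma pow_neg:
  assumes "module R M" "c \<in> carrier (pow_module M S)"
  shows "\<ominus>\<^bsub>pow_module M S\<^esub> c = (\<lambda>s. \<ominus>\<^bsub>M\<^esub> c s)"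
proof -
  interpret M: module R M by fact
  interpret P: module R "pow_module M S" by (rule pow_module_module) fact
  have c: "(\<lambda>s. \<ominus>\<^bsub>M\<^esub> c s) \<in> carrier (pow_module M S)" using assms(2) by (auto simp: pow_carrier)
  have "(\<lambda>s. \<ominus>\<^bsub>M\<^esub> c s) \<oplus>\<^bsub>pow_module M S\<^esub> c = \<zero>\<^bsub>pow_module M S\<^esub>"
    using pow_val[OF assms] by (auto simp: M.l_neg)
  from P.minus_equality[OF this assms(2) c] show ?thesis .
qed

lemma pow_minus:
  assumes "module R M" "c \<in> carrier (pow_module M S)" "d \<in> carrier (pow_module M S)"
  shows "c \<ominus>\<^bsub>pow_module M S\<^esub> d = (\<lambda>s. c s \<ominus>\<^bsub>M\<^esub> d s)"
  by (simp add: a_minus_def pow_neg[OF assms(1,3)])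

lemma lin_pow_eval:
  assumes "module R M" shows "lin R (pow_module M S) M (\<lambda>c. c s)"
  by (rule linI) (auto intro: pow_val assms)

definition single :: "('a, 'm, 'x) module_scheme \<Rightarrow> 's \<Rightarrow> 'm \<Rightarrow> 's \<Rightarrow> 'm" where
  "single M s x = (\<lambda>t. if s = t then x else \<zero>\<^bsub>M\<^esub>)"

lemma lin_single:
  assumes "module R M" "s \<in> S" shows "lin R M (pow_module M S) (single M s)"
proof -
  interpret module R M by fact
  show ?thesis using assms(2) by (intro linI) (auto simp: single_def pow_carrier)
qed

lemma pow_decomp:
  assumes "module R M" "finite S" "c \<in> carrier (pow_module M S)"
  shows "c = (\<Oplus>\<^bsub>pow_module M S\<^esub>s\<in>S. single M s (c s))"
proof
  interpret M: module R M by fact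
  fix t
  have *: "(\<lambda>s. single M s (c s)) \<in> S \<rightarrow> carrier (pow_module M S)"
    by (auto intro!: lin_closed[OF lin_single[OF assms(1)]] pow_val[OF assms(1,3)])
  have "(\<Oplus>\<^bsub>pow_module M S\<^esub>s\<in>S. single M s (c s)) t = (\<Oplus>\<^bsub>M\<^esub>s\<in>S. single M s (c s) t)"
    by (rule lin_finsum[OF pow_module_module[OF assms(1)] assms(1) lin_pow_eval[OF assms(1)] assms(2) *])
  also have "\<dots> = c t"
  proof (cases "t \<in> S")
    case True
    have "(\<Oplus>\<^bsub>M\<^esub>s\<in>S. single M s (c s) t) = (\<Oplus>\<^bsub>M\<^esub>s\<in>S. if t = s then c s else \<zero>\<^bsub>M\<^esub>)"
      by (rule M.finsum_cong') (use pow_val[OF assms(1,3)] in \<open>auto simp: single_def\<close>)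
    also have "\<dots> = c t"
      using pow_val[OF assms(1,3)] by (intro M.finsum_singleton[OF True assms(2)]) auto
    finally show ?thesis .
  next
    case False
    have "(\<Oplus>\<^bsub>M\<^esub>s\<in>S. single M s (c s) t) = (\<Oplus>\<^bsub>M\<^esub>s\<in>S. \<zero>\<^bsub>M\<^esub>)"
      by (rule M.finsum_cong') (use False in \<open>auto simp: single_def\<close>)
    thus ?thesis using False assms(3) by (simp add: pow_carrier)
  qed
  finally show "c t = (\<Oplus>\<^bsub>pow_module M S\<^esub>s\<in>S. single M s (c s)) t" by simp
qed

text \<open>Evaluation at a coordinate gives one direction. For the other, finiteness of
  \<open>S\<close> writes \<open>c\<close> as the sum of its one-coordinate parts, each the image of
  an element of \<open>I M\<close> under \<open>single\<close>.\<close>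

lemma pow_ismult:
  assumes "module R M" "finite S" "I \<subseteq> carrier R"
  shows "c \<in> ideal_smult R I (pow_module M S) \<longleftrightarrow>
    c \<in> carrier (pow_module M S) \<and> (\<forall>s\<in>S. c s \<in> ideal_smult R I M)"
proof
  note P = pow_module_module[OF assms(1), of S]
  assume c: "c \<in> ideal_smult R I (pow_module M S)"
  hence "c \<in> carrier (pow_module M S)" by (rule sub_carr[OF ismult_sub[OF P assms(3)]])
  moreover have "c s \<in> ideal_smult R I M" for s
    by (rule lin_ismult[OF P assms(1) lin_pow_eval[OF assms(1)] assms(3) c])
  ultimately show "c \<in> carrier (pow_module M S) \<and> (\<forall>s\<in>S. c s \<in> ideal_smult R I M)" by auto
next
  note P = pow_module_module[OF assms(1), of S]
  assume c: "c \<in> carrier (pow_module M S) \<and> (\<forall>s\<in>S. c s \<in> ideal_smult R I M)"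
  have "(\<Oplus>\<^bsub>pow_module M S\<^esub>s\<in>S. single M s (c s)) \<in> ideal_smult R I (pow_module M S)"
    using c by (intro sub_finsum[OF P ismult_sub[OF P assms(3)] assms(2)])
      (auto intro: lin_ismult[OF assms(1) P lin_single[OF assms(1)] assms(3)])
  thus "c \<in> ideal_smult R I (pow_module M S)" using pow_decomp[OF assms(1,2)] c by simp
qed

lemma pow_xsub:
  assumes "module R M" "finite S" "X \<subseteq> carrier R"
  shows "c \<in> xsub R (pow_module M S) X \<longleftrightarrow>
    c \<in> carrier (pow_module M S) \<and> (\<forall>s\<in>S. c s \<in> xsub R M X)"
  using pow_ismult[OF assms(1,2) genideal_carr] assms by (auto simp: xsub_def module_def)

section \<open>Finite free modules\<close>

lemma finite_free_pow: "finite_free R n = pow_module (ring_module R) {..<n}"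
proof -
  have "finite {s. f s \<noteq> \<zero>\<^bsub>R\<^esub>}" if "\<forall>s. s \<notin> {..<n} \<longrightarrow> f s = \<zero>\<^bsub>R\<^esub>" for f :: "nat \<Rightarrow> 'a"
    by (rule finite_subset[of _ "{..<n}"]) (use that in auto)
  hence "carrier (finite_free R n) = carrier (pow_module (ring_module R) {..<n})"
    unfolding finite_free_def free_on_def pow_module_def by auto
  thus ?thesis by (simp add: finite_free_def free_on_def pow_module_def ring_module_def fun_eq_iff)
qed

lemma finite_free_simps [simp]:
  "\<zero>\<^bsub>finite_free R n\<^esub> = (\<lambda>s. \<zero>\<^bsub>R\<^esub>)"
  "f \<oplus>\<^bsub>finite_free R n\<^esub> g = (\<lambda>s. f s \<oplus>\<^bsub>R\<^esub> g s)" "a \<odot>\<^bsub>finite_free R n\<^esub> f = (\<lambda>s. a \<otimes>\<^bsub>R\<^esub> f s)"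
  by (simp_all add: finite_free_pow)

lemma finite_free_carrier: "c \<in> carrier (finite_free R n) \<longleftrightarrow>
    (\<forall>s<n. c s \<in> carrier R) \<and> (\<forall>s. s \<ge> n \<longrightarrow> c s = \<zero>\<^bsub>R\<^esub>)"
  by (auto simp: finite_free_pow pow_carrier)

lemma finite_free_module: "cring R \<Longrightarrow> module R (finite_free R n)"
  unfolding finite_free_pow by (intro pow_module_module ring_module_module)

lemma finite_free_val: "cring R \<Longrightarrow> c \<in> carrier (finite_free R n) \<Longrightarrow> c s \<in> carrier R"
  using pow_val[OF ring_module_module, of R c "{..<n}" s] by (simp add: finite_free_pow)

lemma unit_vec_carrier: "cring R \<Longrightarrow> i < n \<Longrightarrow> unit_vec R i \<in> carrier (finite_free R n)"
proof -
  assume "cring R" "i < n"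
  then interpret cring R by blast
  show ?thesis using \<open>i < n\<close> by (auto simp: unit_vec_def finite_free_carrier)
qed

text \<open>As a function of \<open>r\<close> this is the map from \<open>R^n\<close> to
  \<open>M\<close> with prescribed images of the unit vectors; as a function of \<open>u\<close> it
  applies a row with entries \<open>r\<close> to a vector in \<open>M^n\<close>. Both readings
  occur.\<close>

definition lincomb :: "('a, 'm, 'x) module_scheme \<Rightarrow> nat \<Rightarrow> (nat \<Rightarrow> 'm) \<Rightarrow> (nat \<Rightarrow> 'a) \<Rightarrow> 'm" where
  "lincomb M n u r = (\<Oplus>\<^bsub>M\<^esub>i\<in>{..<n}. r i \<odot>\<^bsub>M\<^esub> u i)"

lemma lin_lincomb:
  assumes "module R M" "u \<in> {..<n} \<rightarrow> carrier M"
  shows "lin R (finite_free R n) M (lincomb M n u)"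
proof -
  interpret module R M by fact
  note v = finite_free_val[OF R.is_cring]
  show ?thesis
  proof (rule linI)
    fix x y assume x: "x \<in> carrier (finite_free R n)" and y: "y \<in> carrier (finite_free R n)"
    show "lincomb M n u x \<in> carrier M" unfolding lincomb_def
      using v[OF x] assms(2) by (intro M.finsum_closed) auto
    have "lincomb M n u (x \<oplus>\<^bsub>finite_free R n\<^esub> y) = (\<Oplus>\<^bsub>M\<^esub>i\<in>{..<n}. x i \<odot>\<^bsub>M\<^esub> u i \<oplus>\<^bsub>M\<^esub> y i \<odot>\<^bsub>M\<^esub> u i)"
      unfolding lincomb_def
      by (rule M.finsum_cong') (use v[OF x] v[OF y] assms(2) in \<open>auto simp: smult_l_distr Pi_iff\<close>)
    also have "\<dots> = lincomb M n u x \<oplus>\<^bsub>M\<^esub> lincomb M n u y" unfolding lincomb_def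
      using v[OF x] v[OF y] assms(2) by (intro M.finsum_addf) auto
    finally show "lincomb M n u (x \<oplus>\<^bsub>finite_free R n\<^esub> y) = lincomb M n u x \<oplus>\<^bsub>M\<^esub> lincomb M n u y" .
  next
    fix a x assume a: "a \<in> carrier R" and x: "x \<in> carrier (finite_free R n)"
    have "lincomb M n u (a \<odot>\<^bsub>finite_free R n\<^esub> x) = (\<Oplus>\<^bsub>M\<^esub>i\<in>{..<n}. a \<odot>\<^bsub>M\<^esub> (x i \<odot>\<^bsub>M\<^esub> u i))"
      unfolding lincomb_def
      by (rule M.finsum_cong') (use v[OF x] a assms(2) in \<open>auto simp: smult_assoc1 Pi_iff\<close>)
    also have "\<dots> = a \<odot>\<^bsub>M\<^esub> lincomb M n u x" unfolding lincomb_def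
      using v[OF x] a assms(2) by (intro finsum_smult_ldistr[symmetric]) auto
    finally show "lincomb M n u (a \<odot>\<^bsub>finite_free R n\<^esub> x) = a \<odot>\<^bsub>M\<^esub> lincomb M n u x" .
  qed
qed

lemma lincomb_unit:
  assumes "module R M" "u \<in> {..<n} \<rightarrow> carrier M" "i < n"
  shows "lincomb M n u (unit_vec R i) = u i"
proof -
  interpret module R M by fact
  have "lincomb M n u (unit_vec R i) = (\<Oplus>\<^bsub>M\<^esub>j\<in>{..<n}. if i = j then u j else \<zero>\<^bsub>M\<^esub>)"
    unfolding lincomb_def by (rule M.finsum_cong') (use assms in \<open>auto simp: unit_vec_def Pi_iff\<close>)
  also have "\<dots> = u i" using assms by (intro M.finsum_singleton) auto
  finally show ?thesis .
qed

lemma free_decomp: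
  assumes "cring R" "r \<in> carrier (finite_free R n)"
  shows "r = lincomb (finite_free R n) n (unit_vec R) r"
proof -
  interpret F: module R "finite_free R n" by (rule finite_free_module) fact
  have "r = (\<Oplus>\<^bsub>finite_free R n\<^esub>i\<in>{..<n}. single (ring_module R) i (r i))"
    using pow_decomp[OF ring_module_module[OF assms(1)], of "{..<n}" r] assms(2)
    by (simp add: finite_free_pow)
  also have "\<dots> = lincomb (finite_free R n) n (unit_vec R) r" unfolding lincomb_def
    using finite_free_val[OF assms] unit_vec_carrier[OF assms(1), of _ n]
    by (intro F.finsum_cong' funcsetI F.smult_closed) (auto simp: single_def unit_vec_def fun_eq_iff)
  finally show ?thesis .
qed

lemma lin_lincomb_comp:
  assumes "module R M" "module R N" "lin R M N f" "u \<in> {..<n} \<rightarrow> carrier M"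
    "r \<in> {..<n} \<rightarrow> carrier R"
  shows "f (lincomb M n u r) = lincomb N n (\<lambda>i. f (u i)) r"
proof -
  interpret M: module R M by fact
  interpret N: module R N by fact
  have "f (lincomb M n u r) = (\<Oplus>\<^bsub>N\<^esub>i\<in>{..<n}. f (r i \<odot>\<^bsub>M\<^esub> u i))" unfolding lincomb_def
    using assms by (intro lin_finsum) auto
  also have "\<dots> = lincomb N n (\<lambda>i. f (u i)) r" unfolding lincomb_def
    using assms by (intro N.finsum_cong') (auto simp: lin_smult Pi_iff lin_closed)
  finally show ?thesis .
qed

lemma lin_free_eq:
  assumes "module R M" "lin R (finite_free R n) M f" "r \<in> carrier (finite_free R n)"
  shows "f r = lincomb M n (\<lambda>i. f (unit_vec R i)) r"
proof -
  interpret M: module R M by fact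
  note F = finite_free_module[OF M.R.is_cring]
  have "f r = f (lincomb (finite_free R n) n (unit_vec R) r)"
    using free_decomp[OF M.R.is_cring assms(3)] by simp
  also have "\<dots> = lincomb M n (\<lambda>i. f (unit_vec R i)) r"
    using finite_free_val[OF M.R.is_cring assms(3)] unit_vec_carrier[OF M.R.is_cring]
    by (intro lin_lincomb_comp[OF F assms(1,2)]) auto
  finally show ?thesis .
qed

section \<open>Finite generation\<close>

definition fg :: "('a, 'r) ring_scheme \<Rightarrow> ('a, 'm, 'x) module_scheme \<Rightarrow> 'm set \<Rightarrow> bool" where
  "fg R M H \<longleftrightarrow> (\<exists>S. finite S \<and> S \<subseteq> carrier M \<and> gen_submodule R M S = H)"

lemma finite_module_fg: "finite_module R M \<longleftrightarrow> module R M \<and> fg R M (carrier M)"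
  by (auto simp: finite_module_def fg_def)

lemma lincomb_in_sub:
  assumes "module R M" "submodule H R M" "\<And>i. i < n \<Longrightarrow> r i \<odot>\<^bsub>M\<^esub> u i \<in> H"
  shows "lincomb M n u r \<in> H"
  unfolding lincomb_def using assms by (intro sub_finsum) auto

lemma gen_family:
  assumes "module R M" "u \<in> {..<n} \<rightarrow> carrier M"
  shows "gen_submodule R M (u ` {..<n}) = lincomb M n u ` carrier (finite_free R n)"
proof
  interpret module R M by fact
  note F = finite_free_module[OF R.is_cring, of n]
  show "gen_submodule R M (u ` {..<n}) \<subseteq> lincomb M n u ` carrier (finite_free R n)"
  proof (rule gen_least)
    show "submodule (lincomb M n u ` carrier (finite_free R n)) R M"
      by (rule sub_image[OF F assms(1) lin_lincomb[OF assms] sub_carrier[OF F]])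
    show "u ` {..<n} \<subseteq> lincomb M n u ` carrier (finite_free R n)"
    proof
      fix y assume "y \<in> u ` {..<n}"
      then obtain i where "i < n" "y = u i" by auto
      thus "y \<in> lincomb M n u ` carrier (finite_free R n)"
        using lincomb_unit[OF assms] unit_vec_carrier[OF R.is_cring] by (metis image_eqI)
    qed
  qed
  have s: "submodule (gen_submodule R M (u ` {..<n})) R M" using assms(2) by (intro gen_sub assms(1)) auto
  show "lincomb M n u ` carrier (finite_free R n) \<subseteq> gen_submodule R M (u ` {..<n})"
  proof (rule image_subsetI)
    fix r assume "r \<in> carrier (finite_free R n)"
    thus "lincomb M n u r \<in> gen_submodule R M (u ` {..<n})"
      using finite_free_val[OF R.is_cring, of r n]
      by (intro lincomb_in_sub[OF assms(1) s] sub_smult[OF s] subsetD[OF gen_incl]) auto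
  qed
qed

lemma fg_family:
  assumes "module R M" "fg R M H"
  obtains n u where "u \<in> {..<n} \<rightarrow> H" "u \<in> {..<n} \<rightarrow> carrier M" "H = lincomb M n u ` carrier (finite_free R n)"
proof -
  obtain S where S: "finite S" "S \<subseteq> carrier M" "gen_submodule R M S = H"
    using assms(2) by (auto simp: fg_def)
  obtain xs where xs: "set xs = S" using finite_list[OF S(1)] by auto
  have im: "(!) xs ` {..<length xs} = S" using xs by (auto simp: set_conv_nth)
  have u: "(!) xs \<in> {..<length xs} \<rightarrow> carrier M" using im S(2) by auto
  show ?thesis
  proof (rule that[of "(!) xs" "length xs"])
    show "(!) xs \<in> {..<length xs} \<rightarrow> H" using gen_incl[of S R M] S(3) im by auto
    show "H = lincomb M (length xs) ((!) xs) ` carrier (finite_free R (length xs))"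
      using gen_family[OF assms(1) u] im S(3) by simp
  qed (rule u)
qed

lemma fgI_family:
  assumes "module R M" "u \<in> {..<n} \<rightarrow> carrier M" "H = lincomb M n u ` carrier (finite_free R n)"
  shows "fg R M H"
  unfolding fg_def using assms gen_family[OF assms(1,2)]
  by (intro exI[of _ "u ` {..<n}"]) auto

lemma gen_image:
  assumes "module R M" "module R N" "lin R M N f" "S \<subseteq> carrier M"
  shows "gen_submodule R N (f ` S) = f ` gen_submodule R M S"
proof
  have fS: "f ` S \<subseteq> carrier N" using assms(4) lin_closed[OF assms(3)] by auto
  show "gen_submodule R N (f ` S) \<subseteq> f ` gen_submodule R M S"
    by (rule gen_least) (use gen_incl[of S R M] in \<open>auto intro!: sub_image[OF assms(1-3)] gen_sub assms\<close>)
  have "gen_submodule R M S \<subseteq> {x \<in> carrier M. f x \<in> gen_submodule R N (f ` S)}"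
    using gen_incl[of "f ` S" R N] assms(4)
    by (intro gen_least sub_vimage[OF assms(1-3)] gen_sub[OF assms(2) fS]) auto
  thus "f ` gen_submodule R M S \<subseteq> gen_submodule R N (f ` S)" by auto
qed

lemma fg_image:
  assumes "module R M" "module R N" "lin R M N f" "fg R M H"
  shows "fg R N (f ` H)"
proof -
  obtain S where S: "finite S" "S \<subseteq> carrier M" "gen_submodule R M S = H"
    using assms(4) by (auto simp: fg_def)
  thus ?thesis unfolding fg_def using gen_image[OF assms(1-3) S(2)] lin_closed[OF assms(3)]
    by (intro exI[of _ "f ` S"]) auto
qed

lemma genideal_eq_gen:
  assumes "cring R" "S \<subseteq> carrier R"
  shows "genideal R S = gen_submodule R (ring_module R) S"
  unfolding genideal_def gen_submodule_def ideal_iff_submodule[OF assms(1)] by simp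

text \<open>Induction on \<open>n\<close>. The last coordinates of \<open>H\<close> form a finitely
  generated ideal; lifts of its generators, together with generators of the part of \<open>H\<close>
  whose last coordinate is zero, generate \<open>H\<close>.\<close>

lemma noetherian_free:
  assumes "cring R" "noetherian_ring R" "submodule H R (finite_free R n)"
  shows "fg R (finite_free R n) H"
  using assms(3)
proof (induction n arbitrary: H)
  case 0
  have c: "carrier (finite_free R 0) = {\<lambda>_. \<zero>\<^bsub>R\<^esub>}" by (auto simp: finite_free_carrier)
  hence "H = {\<lambda>_. \<zero>\<^bsub>R\<^esub>}" using subsetI[OF sub_carr[OF 0]] sub_zero[OF 0] unfolding c by force
  moreover have "gen_submodule R (finite_free R 0) {} = {\<lambda>_. \<zero>\<^bsub>R\<^esub>}"
    proof -
    have g: "submodule (gen_submodule R (finite_free R 0) {}) R (finite_free R 0)"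
      by (rule gen_sub[OF finite_free_module[OF assms(1)]]) simp
    show ?thesis using subsetI[OF sub_carr[OF g]] sub_zero[OF g] unfolding c by force
  qed
  ultimately show ?case unfolding fg_def by (intro exI[of _ "{}"]) auto
next
  case (Suc n)
  interpret cring R by fact
  interpret noetherian_ring R by fact
  let ?F = "finite_free R (Suc n)" and ?G = "finite_free R n"
  note F = finite_free_module[OF assms(1), of "Suc n"] and G = finite_free_module[OF assms(1), of n]
  interpret F: module R ?F by (rule F)
  have GF: "carrier ?G \<subseteq> carrier ?F" by (auto simp: finite_free_carrier le_less_Suc_eq)
    (metis not_less zero_closed)
  have ev: "lin R ?F (ring_module R) (\<lambda>c. c n)"
    unfolding finite_free_pow by (rule lin_pow_eval[OF ring_module_module[OF assms(1)]])
  let ?J = "(\<lambda>c. c n) ` H"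
  have J: "ideal ?J R" unfolding ideal_iff_submodule[OF assms(1)]
    by (rule sub_image[OF F ring_module_module[OF assms(1)] ev Suc.prems])
  obtain A where A: "A \<subseteq> carrier R" "finite A" "?J = genideal R A" using finetely_gen[OF J] by metis
  have "\<forall>a\<in>A. \<exists>h\<in>H. h n = a"
  proof
    fix a assume "a \<in> A"
    hence "a \<in> ?J" using genideal_incl[of A R] A(3) by auto
    thus "\<exists>h\<in>H. h n = a" by auto
  qed
  then obtain l where l: "\<And>a. a \<in> A \<Longrightarrow> l a \<in> H" "\<And>a. a \<in> A \<Longrightarrow> l a n = a" by metis
  have HF: "H \<subseteq> carrier ?F" using sub_carr[OF Suc.prems] by auto
  have lA: "l ` A \<subseteq> carrier ?F" using l(1) HF by auto
  let ?H = "{h \<in> carrier ?G. h \<in> H}"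
  \<comment> \<open>Vectors are functions on all naturals that vanish from the rank onwards, so
    \<open>R^n\<close> lies literally in \<open>R^(n+1)\<close> and the inclusion is the identity
    function.\<close>
  have inc: "lin R ?G ?F (\<lambda>h. h)" using GF by (intro linI) auto
  have "submodule ?H R ?G" by (rule sub_vimage[OF G F inc Suc.prems])
  from Suc.IH[OF this] obtain S where S: "finite S" "S \<subseteq> carrier ?G" "gen_submodule R ?G S = ?H"
    by (auto simp: fg_def)
  have HS: "gen_submodule R ?F S = ?H"
    using gen_image[OF G F inc S(2)] S(3) by simp
  let ?T = "gen_submodule R ?F (l ` A \<union> S)"
  have TF: "l ` A \<union> S \<subseteq> carrier ?F" using lA S(2) GF by auto
  note T = gen_sub[OF F TF]
  have "?T \<subseteq> H" using l(1) HS gen_incl[of S R ?F] by (intro gen_least Suc.prems) auto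
  moreover have "H \<subseteq> ?T"
  proof
    fix h assume h: "h \<in> H"
    have "genideal R A = (\<lambda>c. c n) ` gen_submodule R ?F (l ` A)"
      using gen_image[OF F ring_module_module[OF assms(1)] ev lA] l(2) genideal_eq_gen[OF assms(1) A(1)]
      by (simp add: image_image)
    moreover have "h n \<in> genideal R A" using A(3) h by auto
    ultimately obtain t where t: "t \<in> gen_submodule R ?F (l ` A)" "t n = h n" by auto
    have tT: "t \<in> ?T" using t(1) gen_mono[of "l ` A" "l ` A \<union> S"] by blast
    have tH: "t \<in> H" using t(1) l(1) gen_least[OF Suc.prems, of "l ` A"] by auto
    have hF: "h \<in> carrier ?F" and tF: "t \<in> carrier ?F" using h tH HF by auto
    have d: "h \<ominus>\<^bsub>?F\<^esub> t = (\<lambda>s. h s \<ominus>\<^bsub>R\<^esub> t s)"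
    proof -
      have "h \<ominus>\<^bsub>?F\<^esub> t = (\<lambda>s. h s \<ominus>\<^bsub>ring_module R\<^esub> t s)"
        using pow_minus[OF ring_module_module[OF assms(1)]] hF tF by (simp add: finite_free_pow)
      moreover have "a \<ominus>\<^bsub>ring_module R\<^esub> b = a \<ominus>\<^bsub>R\<^esub> b" for a b
        by (simp add: a_minus_def a_inv_def m_inv_def)
      ultimately show ?thesis by simp
    qed
    have "(\<lambda>s. h s \<ominus>\<^bsub>R\<^esub> t s) \<in> carrier ?G"
    proof -
      have "h s \<ominus>\<^bsub>R\<^esub> t s = \<zero>\<^bsub>R\<^esub>" if "s \<ge> n" for s
      proof (cases "s = n")
        case True thus ?thesis using t(2) finite_free_val[OF assms(1) hF, of n] by (simp add: r_right_minus_eq)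
      next
        case False
        hence "h s = \<zero>\<^bsub>R\<^esub>" "t s = \<zero>\<^bsub>R\<^esub>" using that hF tF by (auto simp: finite_free_carrier)
        thus ?thesis by (simp add: r_right_minus_eq)
      qed
      thus ?thesis using finite_free_val[OF assms(1) hF] finite_free_val[OF assms(1) tF]
        by (auto simp: finite_free_carrier)
    qed
    moreover have "h \<ominus>\<^bsub>?F\<^esub> t \<in> H" by (rule sub_minus[OF Suc.prems h tH])
    ultimately have "h \<ominus>\<^bsub>?F\<^esub> t \<in> gen_submodule R ?F S" using HS d by simp
    hence hT: "h \<ominus>\<^bsub>?F\<^esub> t \<in> ?T" using gen_mono[of S "l ` A \<union> S"] by blast
    have "(h \<ominus>\<^bsub>?F\<^esub> t) \<oplus>\<^bsub>?F\<^esub> t = h"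
      using hF tF by (simp add: a_minus_def F.M.a_assoc F.M.l_neg del: finite_free_simps)
    thus "h \<in> ?T" using sub_add[OF T hT tT] by simp
  qed
  ultimately have "?T = H" by blast
  thus ?case unfolding fg_def using A(2) S(1) TF by (intro exI[of _ "l ` A \<union> S"]) auto
qed

text \<open>\<open>H\<close> is pulled back along a surjection from a finite free module, where the
  induction on the rank applies.\<close>

lemma noetherian_module:
  assumes "noetherian_ring R" "finite_module R M" "submodule H R M"
  shows "fg R M H"
proof -
  interpret module R M using assms(2) by (simp add: finite_module_def)
  obtain n u where u: "u \<in> {..<n} \<rightarrow> carrier M" "carrier M = lincomb M n u ` carrier (finite_free R n)"
    using fg_family[OF module_axioms] assms(2) unfolding finite_module_fg by metis
  note F = finite_free_module[OF R.is_cring, of n] and l = lin_lincomb[OF module_axioms u(1)]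
  let ?K = "{x \<in> carrier (finite_free R n). lincomb M n u x \<in> H}"
  have "submodule ?K R (finite_free R n)" by (rule sub_vimage[OF F module_axioms l assms(3)])
  hence "fg R M (lincomb M n u ` ?K)"
    by (intro fg_image[OF F module_axioms l] noetherian_free R.is_cring assms(1))
  moreover have "lincomb M n u ` ?K = H" using u(2) sub_carr[OF assms(3)] by auto
  ultimately show ?thesis by simp
qed

lemma sub_module: "module R M \<Longrightarrow> submodule H R M \<Longrightarrow> module R (M\<lparr>carrier := H\<rparr>)"
  by (rule submodule.submodule_is_module)

lemma lin_incl:
  assumes "submodule H R M" shows "lin R (M\<lparr>carrier := H\<rparr>) M (\<lambda>x. x)"
  using sub_carr[OF assms] by (intro linI) auto

lemma fg_sub_finite:
  assumes "module R M" "submodule H R M" "fg R M H"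
  shows "finite_module R (M\<lparr>carrier := H\<rparr>)"
proof -
  note H = sub_module[OF assms(1,2)] and i = lin_incl[OF assms(2)]
  obtain S where S: "finite S" "S \<subseteq> carrier M" "gen_submodule R M S = H"
    using assms(3) by (auto simp: fg_def)
  have SH: "S \<subseteq> H" using gen_incl[of S R M] S(3) by auto
  have "gen_submodule R (M\<lparr>carrier := H\<rparr>) S = H"
    using gen_image[OF H assms(1) i, of S] SH S(3) by simp
  thus ?thesis unfolding finite_module_def using S(1) SH H by (intro conjI exI[of _ S]) auto
qed

lemma lincomb_sub:
  assumes "module R M" "submodule H R M" "u \<in> {..<n} \<rightarrow> H" "r \<in> {..<n} \<rightarrow> carrier R"
  shows "lincomb (M\<lparr>carrier := H\<rparr>) n u r = lincomb M n u r"
  using lin_lincomb_comp[OF sub_module[OF assms(1,2)] assms(1) lin_incl[OF assms(2)] _ assms(4), of u] assms(3)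
  by simp

text \<open>The last three assumptions characterise \<open>K\<close> as the sum of the
  \<open>H s\<close>, that is, as the least submodule containing all of them.\<close>

lemma fg_sum:
  assumes "module R M" "\<And>s. s \<in> S \<Longrightarrow> fg R M (H s)" "finite S" "\<And>s. s \<in> S \<Longrightarrow> H s \<subseteq> K" "submodule K R M"
    "\<And>L. submodule L R M \<Longrightarrow> (\<And>s. s \<in> S \<Longrightarrow> H s \<subseteq> L) \<Longrightarrow> K \<subseteq> L"
  shows "fg R M K"
proof -
  have "\<forall>s\<in>S. \<exists>G. finite G \<and> G \<subseteq> carrier M \<and> gen_submodule R M G = H s" using assms(2) by (simp add: fg_def)
  then obtain G where G: "\<And>s. s \<in> S \<Longrightarrow> finite (G s)" "\<And>s. s \<in> S \<Longrightarrow> G s \<subseteq> carrier M"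
    "\<And>s. s \<in> S \<Longrightarrow> gen_submodule R M (G s) = H s" by metis
  have "gen_submodule R M (\<Union>s\<in>S. G s) = K"
  proof
    show "gen_submodule R M (\<Union>s\<in>S. G s) \<subseteq> K"
      using subset_trans[OF gen_incl[of _ R M]] G(3) assms(4) by (intro gen_least[OF assms(5)] UN_least) metis
    show "K \<subseteq> gen_submodule R M (\<Union>s\<in>S. G s)"
    proof (rule assms(6))
      show "submodule (gen_submodule R M (\<Union>s\<in>S. G s)) R M" using G(2) by (intro gen_sub[OF assms(1)]) auto
      show "H s \<subseteq> gen_submodule R M (\<Union>s\<in>S. G s)" if "s \<in> S" for s
        using G(3)[OF that] gen_mono[of "G s" "\<Union>s\<in>S. G s"] that by blast
    qed
  qed
  thus ?thesis unfolding fg_def using G assms(3) by (intro exI[of _ "\<Union>s\<in>S. G s"]) auto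
qed

lemma pow_finite_module:
  assumes "finite_module R M" "finite S"
  shows "finite_module R (pow_module M S)"
proof -
  have M: "module R M" using assms(1) by (simp add: finite_module_def)
  note P = pow_module_module[OF M, of S]
  have "fg R (pow_module M S) (carrier (pow_module M S))"
  proof (rule fg_sum[where S = S and H = "\<lambda>s. single M s ` carrier M"])
    show "fg R (pow_module M S) (single M s ` carrier M)" if "s \<in> S" for s
      using assms(1) by (intro fg_image[OF M P lin_single[OF M that]]) (simp add: finite_module_fg)
    show "single M s ` carrier M \<subseteq> carrier (pow_module M S)" if "s \<in> S" for s
      using lin_closed[OF lin_single[OF M that]] by auto
    fix L assume L: "submodule L R (pow_module M S)" "\<And>s. s \<in> S \<Longrightarrow> single M s ` carrier M \<subseteq> L"
    show "carrier (pow_module M S) \<subseteq> L"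
    proof
      fix c assume c: "c \<in> carrier (pow_module M S)"
      have "(\<Oplus>\<^bsub>pow_module M S\<^esub>s\<in>S. single M s (c s)) \<in> L"
        using L(2) pow_val[OF M c] by (intro sub_finsum[OF P L(1) assms(2)]) auto
      thus "c \<in> L" using pow_decomp[OF M assms(2) c] by simp
    qed
  qed (auto intro: P sub_carrier assms)
  thus ?thesis using P by (simp add: finite_module_fg)
qed

section \<open>Local rings and Nakayama's lemma\<close>

lemma local_cring: "local_ring R \<Longrightarrow> cring R" and local_noetherian: "local_ring R \<Longrightarrow> noetherian_ring R"
  by (simp_all add: local_ring_def)

lemma max_ideal_maximal: "local_ring R \<Longrightarrow> maximalideal (max_ideal R) R"
  unfolding local_ring_def max_ideal_def by (metis theI')

lemma max_ideal_ideal: "local_ring R \<Longrightarrow> ideal (max_ideal R) R"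
  by (simp add: max_ideal_maximal maximalideal.axioms(1))

lemma max_ideal_carr: "local_ring R \<Longrightarrow> a \<in> max_ideal R \<Longrightarrow> a \<in> carrier R"
  by (rule ideal.Icarr[OF max_ideal_ideal])

lemma max_ideal_one: "local_ring R \<Longrightarrow> \<one>\<^bsub>R\<^esub> \<notin> max_ideal R"
  using max_ideal_maximal[of R] ideal.one_imp_carrier[OF max_ideal_ideal, of R] maximalideal.I_notcarr by metis

text \<open>An ideal over \<open>J\<close> that is maximal among those omitting the unit is a
  maximal ideal, and a local ring has only one.\<close>

lemma ideal_le_max:
  assumes "local_ring R" "ideal J R" "\<one>\<^bsub>R\<^esub> \<notin> J"
  shows "J \<subseteq> max_ideal R"
proof -
  interpret cring R by (rule local_cring) fact
  interpret noetherian_ring R by (rule local_noetherian) fact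
  let ?A = "{L. ideal L R \<and> J \<subseteq> L \<and> \<one>\<^bsub>R\<^esub> \<notin> L}"
  have "\<exists>L\<in>?A. \<forall>X\<in>?A. L \<subseteq> X \<longrightarrow> X = L"
  proof (rule subset_Zorn_nonempty)
    show "?A \<noteq> {}" using assms by auto
    fix C assume C: "C \<noteq> {}" "subset.chain ?A C"
    hence *: "subset.chain {L. ideal L R} C" "C \<subseteq> ?A" by (auto simp: pred_on.chain_def)
    \<comment> \<open>In a Noetherian ring a nonempty chain of ideals contains its own union, so
      Zorn's lemma applies.\<close>
    from subsetD[OF *(2) ideal_chain_is_trivial[OF C(1) *(1)]] show "\<Union>C \<in> ?A" .
  qed
  then obtain L where L0: "L \<in> ?A" and mx0: "\<forall>X\<in>?A. L \<subseteq> X \<longrightarrow> X = L" by (rule bexE)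
  have L: "ideal L R" "J \<subseteq> L" "\<one>\<^bsub>R\<^esub> \<notin> L" using L0 by simp_all
  have mx: "X = L" if "ideal X R" "\<one>\<^bsub>R\<^esub> \<notin> X" "L \<subseteq> X" for X
    using bspec[OF mx0, of X] that L(2) by simp
  have "maximalideal L R"
  proof (rule maximalidealI[OF L(1)])
    show "carrier R \<noteq> L" using L(3) by auto
    show "X = L \<or> X = carrier R" if "ideal X R" "L \<subseteq> X" for X
      using mx[OF that(1) _ that(2)] ideal.one_imp_carrier[OF that(1)] by metis
  qed
  hence "L = max_ideal R" using assms(1) max_ideal_maximal[OF assms(1)] unfolding local_ring_def by metis
  thus ?thesis using L(2) by simp
qed

lemma local_unit:
  assumes "local_ring R" "a \<in> carrier R" "a \<notin> max_ideal R"
  shows "a \<in> Units R"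
proof (rule ccontr)
  assume a: "a \<notin> Units R"
  interpret cring R by (rule local_cring) fact
  have "\<one>\<^bsub>R\<^esub> \<notin> genideal R {a}"
  proof
    assume "\<one>\<^bsub>R\<^esub> \<in> genideal R {a}"
    then obtain x where "x \<in> carrier R" "\<one>\<^bsub>R\<^esub> = x \<otimes>\<^bsub>R\<^esub> a"
      using assms(2) by (auto simp: cgenideal_eq_genideal[symmetric] cgenideal_def)
    thus False using a assms(2) m_comm unfolding Units_def by auto
  qed
  hence "genideal R {a} \<subseteq> max_ideal R" using assms(2) by (intro ideal_le_max assms(1) genideal_ideal) auto
  thus False using assms(3) genideal_incl[of "{a}" R] by auto
qed

lemma ideal_add: "ideal J R \<Longrightarrow> a \<in> J \<Longrightarrow> b \<in> J \<Longrightarrow> a \<oplus>\<^bsub>R\<^esub> b \<in> J"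
  by (simp add: additive_subgroup.a_closed ideal.axioms(1))

lemma ideal_zero: "ideal J R \<Longrightarrow> \<zero>\<^bsub>R\<^esub> \<in> J"
  by (simp add: additive_subgroup.zero_closed ideal.axioms(1))

lemma local_one_minus:
  assumes "local_ring R" "a \<in> max_ideal R"
  shows "\<one>\<^bsub>R\<^esub> \<ominus>\<^bsub>R\<^esub> a \<in> Units R"
proof (rule local_unit[OF assms(1)])
  interpret cring R by (rule local_cring) fact
  note a = max_ideal_carr[OF assms]
  show "\<one>\<^bsub>R\<^esub> \<ominus>\<^bsub>R\<^esub> a \<in> carrier R" using a by simp
  have "(\<one>\<^bsub>R\<^esub> \<ominus>\<^bsub>R\<^esub> a) \<oplus>\<^bsub>R\<^esub> a = \<one>\<^bsub>R\<^esub>" using a by algebra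
  thus "\<one>\<^bsub>R\<^esub> \<ominus>\<^bsub>R\<^esub> a \<notin> max_ideal R"
    using ideal_add[OF max_ideal_ideal[OF assms(1)] _ assms(2)] max_ideal_one[OF assms(1)] by metis
qed

lemma sub_unit_cancel:
  assumes "module R M" "submodule H R M" "a \<in> Units R" "x \<in> carrier M" "a \<odot>\<^bsub>M\<^esub> x \<in> H"
  shows "x \<in> H"
proof -
  interpret module R M by fact
  have "(inv\<^bsub>R\<^esub> a) \<odot>\<^bsub>M\<^esub> (a \<odot>\<^bsub>M\<^esub> x) = x"
    using assms(3,4) smult_assoc1[of "inv\<^bsub>R\<^esub> a" a x] R.Units_closed[OF assms(3)] by simp
  thus ?thesis using sub_smult[OF assms(2) _ assms(5)] assms(3) by (metis R.Units_inv_closed)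
qed

lemma lincomb_Suc:
  assumes "module R M" "u \<in> {..<Suc n} \<rightarrow> carrier M" "r \<in> {..<Suc n} \<rightarrow> carrier R"
  shows "lincomb M (Suc n) u r = lincomb M n u r \<oplus>\<^bsub>M\<^esub> r n \<odot>\<^bsub>M\<^esub> u n"
proof -
  interpret module R M by fact
  have "lincomb M n u r \<in> carrier M" unfolding lincomb_def using assms(2,3)
    by (intro M.finsum_closed) (auto simp: Pi_iff)
  moreover have "r i \<odot>\<^bsub>M\<^esub> u i \<in> carrier M" if "i \<le> n" for i
    using that assms(2,3) by (intro smult_closed) auto
  ultimately show ?thesis unfolding lincomb_def lessThan_Suc
    by (subst M.finsum_insert) (auto simp: M.a_comm)
qed

lemma lincomb_closed:
  assumes "module R M" "u \<in> {..<n} \<rightarrow> carrier M" "r \<in> {..<n} \<rightarrow> carrier R"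
  shows "lincomb M n u r \<in> carrier M"
proof -
  interpret module R M by fact
  show ?thesis unfolding lincomb_def using assms(2,3) by (intro M.finsum_closed) auto
qed

lemma lin_smult_left:
  assumes "module R M" "x \<in> carrier M"
  shows "lin R (ring_module R) M (\<lambda>a. a \<odot>\<^bsub>M\<^esub> x)"
proof -
  interpret module R M by fact
  show ?thesis using assms(2) by (intro linI) (auto simp: smult_l_distr smult_assoc1)
qed

text \<open>Stated for a finite family because it is applied to cocycles modulo coboundaries and to
  the coefficients of a relation inside the ring. Induction on \<open>n\<close>: enlarging
  \<open>B\<close> by \<open>z n\<close> captures the other \<open>z i\<close>; substituted into the
  equation for \<open>z n\<close>, this leaves \<open>z n\<close> in \<open>B\<close> plus a
  multiple of \<open>z n\<close> by an element of the maximal ideal, and one minus that element is a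
  unit.\<close>

lemma nakayama:
  assumes "local_ring R" "module R M" "submodule B R M" "z \<in> {..<n} \<rightarrow> carrier M"
    "\<And>i. i < n \<Longrightarrow> \<exists>b\<in>B. \<exists>c\<in>{..<n} \<rightarrow> max_ideal R. z i = b \<oplus>\<^bsub>M\<^esub> lincomb M n z c"
  shows "i < n \<Longrightarrow> z i \<in> B"
  using assms(3-5)
proof (induction n arbitrary: B i)
  case (Suc n)
  interpret module R M by fact
  note B = Suc.prems(2)
  have z: "z \<in> {..<n} \<rightarrow> carrier M" "z n \<in> carrier M" using Suc.prems(3) by auto
  note li = lin_smult_left[OF assms(2) z(2)] and RM = ring_module_module[OF R.is_cring]
  \<comment> \<open>\<open>?B1\<close> allows arbitrary multiples of \<open>z n\<close>, as the
    induction hypothesis needs; \<open>?B2\<close> allows only multiples from the maximal ideal, as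
    the final cancellation needs.\<close>
  let ?B1 = "{b \<oplus>\<^bsub>M\<^esub> y | b y. b \<in> B \<and> y \<in> (\<lambda>a. a \<odot>\<^bsub>M\<^esub> z n) ` carrier R}"
  let ?B2 = "{b \<oplus>\<^bsub>M\<^esub> y | b y. b \<in> B \<and> y \<in> (\<lambda>a. a \<odot>\<^bsub>M\<^esub> z n) ` max_ideal R}"
  have B1: "submodule ?B1 R M"
    using sub_image[OF RM assms(2) li sub_carrier[OF RM]] by (intro sub_sum assms B) simp
  have mx: "submodule (max_ideal R) R (ring_module R)"
    using max_ideal_ideal[OF assms(1)] by (simp add: ideal_iff_submodule[OF R.is_cring])
  have B2: "submodule ?B2 R M"
    using sub_image[OF RM assms(2) li mx] by (intro sub_sum assms B) simp
  note mc = max_ideal_carr[OF assms(1)]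
  have IH: "z i \<in> ?B1" if i: "i < n" for i
  proof (rule Suc.IH[OF i B1 z(1)])
    fix i assume "i < n"
    then obtain b c where bc: "b \<in> B" "c \<in> {..<Suc n} \<rightarrow> max_ideal R" "z i = b \<oplus>\<^bsub>M\<^esub> lincomb M (Suc n) z c"
      using Suc.prems(4)[of i] by auto
    have c': "c \<in> {..<Suc n} \<rightarrow> carrier R" using bc(2) mc by auto
    have cl: "lincomb M n z c \<in> carrier M" using c' by (intro lincomb_closed[OF assms(2) z(1)]) auto
    have "z i = (b \<oplus>\<^bsub>M\<^esub> c n \<odot>\<^bsub>M\<^esub> z n) \<oplus>\<^bsub>M\<^esub> lincomb M n z c"
      using bc(3) lincomb_Suc[OF assms(2) Suc.prems(3) c'] cl c' z sub_carr[OF B bc(1)]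
      by (simp add: M.a_ac Pi_iff)
    moreover have "b \<oplus>\<^bsub>M\<^esub> c n \<odot>\<^bsub>M\<^esub> z n \<in> ?B1" using bc(1) c' by auto
    moreover have "c \<in> {..<n} \<rightarrow> max_ideal R" using bc(2) by auto
    ultimately show "\<exists>b\<in>?B1. \<exists>c\<in>{..<n} \<rightarrow> max_ideal R. z i = b \<oplus>\<^bsub>M\<^esub> lincomb M n z c" by blast
  qed
  obtain b c where bc: "b \<in> B" "c \<in> {..<Suc n} \<rightarrow> max_ideal R" "z n = b \<oplus>\<^bsub>M\<^esub> lincomb M (Suc n) z c"
    using Suc.prems(4)[of n] by auto
  have bB2: "x \<in> ?B2" if "x \<in> B" for x
  proof -
    have "x = x \<oplus>\<^bsub>M\<^esub> \<zero>\<^bsub>R\<^esub> \<odot>\<^bsub>M\<^esub> z n" using sub_carr[OF B that] z(2) by simp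
    thus ?thesis using that ideal_zero[OF max_ideal_ideal[OF assms(1)]] by blast
  qed
  have "lincomb M (Suc n) z c \<in> ?B2"
  proof (rule lincomb_in_sub[OF assms(2) B2])
    fix i assume i: "i < Suc n"
    hence ci: "c i \<in> max_ideal R" "c i \<in> carrier R" using bc(2) mc by auto
    show "c i \<odot>\<^bsub>M\<^esub> z i \<in> ?B2"
    proof (cases "i = n")
      case True
      have "c n \<odot>\<^bsub>M\<^esub> z n = \<zero>\<^bsub>M\<^esub> \<oplus>\<^bsub>M\<^esub> c n \<odot>\<^bsub>M\<^esub> z n" using ci z(2) True by simp
      thus ?thesis using True ci sub_zero[OF B] by blast
    next
      case False
      hence "z i \<in> ?B1" using IH i by simp
      then obtain b' r where br: "b' \<in> B" "r \<in> carrier R" "z i = b' \<oplus>\<^bsub>M\<^esub> r \<odot>\<^bsub>M\<^esub> z n" by auto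
      have "c i \<odot>\<^bsub>M\<^esub> z i = c i \<odot>\<^bsub>M\<^esub> b' \<oplus>\<^bsub>M\<^esub> (c i \<otimes>\<^bsub>R\<^esub> r) \<odot>\<^bsub>M\<^esub> z n"
        using br ci z(2) sub_carr[OF B br(1)] by (simp add: smult_r_distr smult_assoc1)
      moreover have "c i \<odot>\<^bsub>M\<^esub> b' \<in> B" by (rule sub_smult[OF B ci(2) br(1)])
      moreover have "c i \<otimes>\<^bsub>R\<^esub> r \<in> max_ideal R"
        using ideal.I_r_closed[OF max_ideal_ideal[OF assms(1)] ci(1) br(2)] .
      ultimately show ?thesis by blast
    qed
  qed
  hence "z n \<in> ?B2" using sub_add[OF B2 bB2[OF bc(1)]] bc(3) by simp
  then obtain b' a where ba: "b' \<in> B" "a \<in> max_ideal R" "z n = b' \<oplus>\<^bsub>M\<^esub> a \<odot>\<^bsub>M\<^esub> z n" by blast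
  have ac: "a \<in> carrier R" by (rule mc[OF ba(2)])
  have "(\<one>\<^bsub>R\<^esub> \<ominus>\<^bsub>R\<^esub> a) \<odot>\<^bsub>M\<^esub> z n = z n \<ominus>\<^bsub>M\<^esub> a \<odot>\<^bsub>M\<^esub> z n"
    using ac z(2) by (simp add: a_minus_def smult_l_distr smult_l_minus)
  also have "\<dots> = (b' \<oplus>\<^bsub>M\<^esub> a \<odot>\<^bsub>M\<^esub> z n) \<ominus>\<^bsub>M\<^esub> a \<odot>\<^bsub>M\<^esub> z n" using ba(3) by simp
  also have "\<dots> = b'" using sub_carr[OF B ba(1)] ac z(2) by (simp add: a_minus_def M.a_assoc M.r_neg)
  finally have "z n \<in> B" using sub_unit_cancel[OF assms(2) B local_one_minus[OF assms(1) ba(2)] z(2)] ba(1) by simp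
  moreover have "z i \<in> B" if "i < n" for i
    using IH[OF that] \<open>z n \<in> B\<close> sub_add[OF B] sub_smult[OF B] by auto
  ultimately show ?case using Suc.prems(1) less_Suc_eq by auto
qed simp

lemma ideal_vec_sub:
  assumes "cring R" "ideal J R"
  shows "submodule {c \<in> carrier (finite_free R n). \<forall>i<n. c i \<in> J} R (finite_free R n)"
proof -
  interpret cring R by fact
  show ?thesis
    using ideal_add[OF assms(2)] ideal_zero[OF assms(2)] ideal.I_l_closed[OF assms(2)]
    by (intro subI[OF finite_free_module[OF assms(1)]]) (auto simp: finite_free_carrier)
qed

lemma ismult_family:
  assumes "module R M" "ideal J R" "u \<in> {..<n} \<rightarrow> carrier M" "carrier M = lincomb M n u ` carrier (finite_free R n)"
  shows "ideal_smult R J M = lincomb M n u ` {c \<in> carrier (finite_free R n). \<forall>i<n. c i \<in> J}" (is "_ = ?f ` ?K")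
proof
  interpret module R M by fact
  note F = finite_free_module[OF R.is_cring, of n] and l = lin_lincomb[OF assms(1,3)]
  have JR: "J \<subseteq> carrier R" using ideal.Icarr[OF assms(2)] by auto
  show "ideal_smult R J M \<subseteq> ?f ` ?K"
  proof (rule ismult_least)
    show "submodule (?f ` ?K) R M" by (rule sub_image[OF F assms(1) l ideal_vec_sub[OF R.is_cring assms(2)]])
    fix a x assume a: "a \<in> J" and "x \<in> carrier M"
    then obtain r where r: "r \<in> carrier (finite_free R n)" "x = ?f r" using assms(4) by auto
    have "a \<odot>\<^bsub>M\<^esub> x = ?f (a \<odot>\<^bsub>finite_free R n\<^esub> r)" using lin_smult[OF l _ r(1)] a JR r(2) by auto
    moreover have "a \<odot>\<^bsub>finite_free R n\<^esub> r \<in> ?K"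
      using a JR r(1) ideal.I_r_closed[OF assms(2) a] by (auto simp: finite_free_carrier)
    ultimately show "a \<odot>\<^bsub>M\<^esub> x \<in> ?f ` ?K" by blast
  qed
  show "?f ` ?K \<subseteq> ideal_smult R J M"
    using assms(3) by (auto intro!: lincomb_in_sub[OF assms(1) ismult_sub[OF assms(1) JR]] ismult_mem)
qed

lemma nakayama_module:
  assumes "local_ring R" "finite_module R M" "submodule B R M"
    "\<And>x. x \<in> carrier M \<Longrightarrow> \<exists>b\<in>B. \<exists>y\<in>ideal_smult R (max_ideal R) M. x = b \<oplus>\<^bsub>M\<^esub> y"
  shows "B = carrier M"
proof -
  interpret module R M using assms(2) by (simp add: finite_module_def)
  obtain n u where u: "u \<in> {..<n} \<rightarrow> carrier M" "carrier M = lincomb M n u ` carrier (finite_free R n)"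
    using fg_family[OF module_axioms] assms(2) unfolding finite_module_fg by metis
  note im = ismult_family[OF module_axioms max_ideal_ideal[OF assms(1)] u]
  have "u i \<in> B" if "i < n" for i
  proof (rule nakayama[OF assms(1) module_axioms assms(3) u(1) _ that])
    fix i assume "i < n"
    hence "u i \<in> carrier M" using u(1) by auto
    from assms(4)[OF this] obtain b c where "b \<in> B" "\<forall>i<n. c i \<in> max_ideal R" "u i = b \<oplus>\<^bsub>M\<^esub> lincomb M n u c"
      unfolding im by auto
    thus "\<exists>b\<in>B. \<exists>c\<in>{..<n} \<rightarrow> max_ideal R. u i = b \<oplus>\<^bsub>M\<^esub> lincomb M n u c" by auto
  qed
  hence "lincomb M n u r \<in> B" if "r \<in> carrier (finite_free R n)" for r
    using finite_free_val[OF R.is_cring that] by (intro lincomb_in_sub[OF module_axioms assms(3)] sub_smult[OF assms(3)])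
  thus ?thesis using u(2) sub_carr[OF assms(3)] by auto
qed

section \<open>Minimal generators\<close>

definition gens :: "('a, 'r) ring_scheme \<Rightarrow> ('a, 'm, 'x) module_scheme \<Rightarrow> nat \<Rightarrow> (nat \<Rightarrow> 'm) \<Rightarrow> bool" where
  "gens R M n u \<longleftrightarrow> u \<in> {..<n} \<rightarrow> carrier M \<and> carrier M = lincomb M n u ` carrier (finite_free R n)"

text \<open>For the maximal ideal this is minimality of the generators. Keeping \<open>J\<close>
  arbitrary lets the same transfer lemmas serve minimality and freeness modulo
  \<open>I\<close>.\<close>

definition rels_in :: "('a, 'r) ring_scheme \<Rightarrow> ('a, 'm, 'x) module_scheme \<Rightarrow> nat \<Rightarrow> (nat \<Rightarrow> 'm) \<Rightarrow> 'a set \<Rightarrow> bool" where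
  "rels_in R M n u J \<longleftrightarrow>
     (\<forall>r \<in> carrier (finite_free R n). lincomb M n u r = \<zero>\<^bsub>M\<^esub> \<longrightarrow> (\<forall>i<n. r i \<in> J))"

text \<open>In a generating set of least cardinality no relation has a unit coefficient, since the
  corresponding generator could be solved for and removed.\<close>

lemma min_gens_exist:
  assumes "local_ring R" "finite_module R M"
  obtains n u where "gens R M n u" "rels_in R M n u (max_ideal R)"
proof -
  interpret module R M using assms(2) by (simp add: finite_module_def)
  define P where "P = (\<lambda>S. finite S \<and> S \<subseteq> carrier M \<and> gen_submodule R M S = carrier M)"
  have "\<exists>S. P S" using assms(2) by (auto simp: finite_module_def P_def)
  then obtain S where S: "P S" and mn: "\<And>T. P T \<Longrightarrow> card S \<le> card T"
    using ex_has_least_nat[of P _ card] by blast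
  obtain u where u: "bij_betw u {0..<card S} S" using ex_bij_betw_nat_finite S unfolding P_def by blast
  let ?n = "card S"
  have im: "u ` {..<?n} = S" using u by (simp add: bij_betw_def atLeast0LessThan)
  have uc: "u \<in> {..<?n} \<rightarrow> carrier M" using im S unfolding P_def by auto
  have g: "gens R M ?n u" using gen_family[OF module_axioms uc] im S uc unfolding gens_def P_def by simp
  have "rels_in R M ?n u (max_ideal R)" unfolding rels_in_def
  proof (intro ballI impI allI, rule ccontr)
    fix r i assume r: "r \<in> carrier (finite_free R ?n)" "lincomb M ?n u r = \<zero>\<^bsub>M\<^esub>" and i: "i < ?n"
      and n: "r i \<notin> max_ideal R"
    note rv = finite_free_val[OF R.is_cring r(1)]
    have un: "r i \<in> Units R" by (rule local_unit[OF assms(1) rv n])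
    let ?T = "S - {u i}"
    have uiS: "u i \<in> S" using im i by auto
    have TM: "?T \<subseteq> carrier M" using S unfolding P_def by auto
    note G = gen_sub[OF module_axioms TM]
    have o: "u j \<in> gen_submodule R M ?T" if "j < ?n" "j \<noteq> i" for j
    proof -
      have "u j \<noteq> u i" using u that i by (auto simp: bij_betw_def inj_on_def)
      thus ?thesis using im that gen_incl[of ?T R M] by auto
    qed
    have "\<zero>\<^bsub>M\<^esub> = r i \<odot>\<^bsub>M\<^esub> u i \<oplus>\<^bsub>M\<^esub> (\<Oplus>\<^bsub>M\<^esub>j\<in>{..<?n} - {i}. r j \<odot>\<^bsub>M\<^esub> u j)"
    proof -
      have e: "{..<?n} = insert i ({..<?n} - {i})" using i by auto
      have "lincomb M ?n u r = (\<Oplus>\<^bsub>M\<^esub>j\<in>insert i ({..<?n} - {i}). r j \<odot>\<^bsub>M\<^esub> u j)"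
        unfolding lincomb_def using e by simp
      also have "\<dots> = r i \<odot>\<^bsub>M\<^esub> u i \<oplus>\<^bsub>M\<^esub> (\<Oplus>\<^bsub>M\<^esub>j\<in>{..<?n} - {i}. r j \<odot>\<^bsub>M\<^esub> u j)"
        using rv uc i by (intro M.finsum_insert) auto
      finally show ?thesis using r(2) by simp
    qed
    hence s0: "r i \<odot>\<^bsub>M\<^esub> u i \<oplus>\<^bsub>M\<^esub> (\<Oplus>\<^bsub>M\<^esub>j\<in>{..<?n} - {i}. r j \<odot>\<^bsub>M\<^esub> u j) \<in> gen_submodule R M ?T"
      using sub_zero[OF G] by metis
    have s1: "(\<Oplus>\<^bsub>M\<^esub>j\<in>{..<?n} - {i}. r j \<odot>\<^bsub>M\<^esub> u j) \<in> gen_submodule R M ?T"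
      using o rv by (intro sub_finsum[OF module_axioms G]) (auto intro: sub_smult[OF G])
    have ui: "u i \<in> carrier M" using uc i by auto
    hence "r i \<odot>\<^bsub>M\<^esub> u i \<in> gen_submodule R M ?T"
      using rv ui by (intro sub_add_cancel[OF module_axioms G s0 s1] smult_closed)
    hence "u i \<in> gen_submodule R M ?T"
      by (rule sub_unit_cancel[OF module_axioms G un ui])
    hence "S \<subseteq> gen_submodule R M ?T" using gen_incl[of ?T R M] by auto
    hence "carrier M \<subseteq> gen_submodule R M ?T" using gen_least[OF G, of S] S unfolding P_def by simp
    hence "P ?T" using S TM subsetI[OF sub_carr[OF G]] unfolding P_def by blast
    moreover have "card ?T < card S" using S uiS unfolding P_def by (meson card_Diff1_less)
    ultimately show False using mn[of ?T] by simp
  qed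
  thus ?thesis using that g by blast
qed

lemma ideal_vec_ismult:
  assumes "cring R" "ideal J R" "c \<in> carrier (finite_free R n)" "\<And>i. i < n \<Longrightarrow> c i \<in> J"
  shows "c \<in> ideal_smult R J (finite_free R n)"
proof -
  interpret cring R by fact
  have "c i \<in> ideal_smult R J (ring_module R)" if "i < n" for i
    using ismult_mem[of "c i" J "\<one>\<^bsub>R\<^esub>" "ring_module R" R] assms(4)[OF that] ideal.Icarr[OF assms(2)] by simp
  moreover have "J \<subseteq> carrier R" using ideal.Icarr[OF assms(2)] by auto
  ultimately show ?thesis unfolding finite_free_pow
    using pow_ismult[OF ring_module_module[OF assms(1)], of "{..<n}" J c] assms(3) by (simp add: finite_free_pow)
qed

lemma ismult_vec:
  assumes "cring R" "ideal J R" "c \<in> ideal_smult R J (finite_free R n)" "i < n"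
  shows "c i \<in> J"
proof -
  interpret cring R by fact
  have J: "J \<subseteq> carrier R" using ideal.Icarr[OF assms(2)] by auto
  have "ideal_smult R J (ring_module R) \<subseteq> J"
    using assms(2) ideal.I_r_closed[OF assms(2)] by (intro ismult_least) (auto simp: ideal_iff_submodule[OF assms(1)])
  moreover have "c i \<in> ideal_smult R J (ring_module R)"
    using pow_ismult[OF ring_module_module[OF assms(1)], of "{..<n}" J c] J assms(3,4) by (simp add: finite_free_pow)
  ultimately show ?thesis by auto
qed

text \<open>The transpose selects a presentation with \<open>SOME\<close>, which is meaningful only
  once one exists. Minimal generators are taken for \<open>M\<close> and then for the kernel of the
  resulting cover, which is finite because the ring is Noetherian.\<close>

lemma minimal_presentation_exists:
  assumes "local_ring R" "finite_module R M"
  shows "\<exists>b0 b1 D \<epsilon>. minimal_presentation R M b0 b1 D \<epsilon>"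
proof -
  have M: "module R M" using assms(2) by (simp add: finite_module_def)
  note cr = local_cring[OF assms(1)] and mi = max_ideal_ideal[OF assms(1)]
  obtain n u where u: "gens R M n u" "rels_in R M n u (max_ideal R)" using min_gens_exist[OF assms] .
  let ?F0 = "finite_free R n"
  note F0 = finite_free_module[OF cr, of n]
  define \<epsilon> where "\<epsilon> = restrict (lincomb M n u) (carrier ?F0)"
  have le: "lin R ?F0 M (lincomb M n u)" using u(1) unfolding gens_def by (intro lin_lincomb M) blast
  have eps: "\<epsilon> \<in> mod_hom R ?F0 M" unfolding \<epsilon>_def by (rule restrict_mod_hom[OF F0 le])
  let ?K = "mod_ker ?F0 M \<epsilon>"
  have K: "submodule ?K R ?F0" by (rule sub_ker[OF F0 M mod_hom_lin[OF eps]])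
  have "finite_module R (?F0\<lparr>carrier := ?K\<rparr>)"
    by (intro fg_sub_finite F0 K noetherian_free cr local_noetherian assms(1))
  then obtain k v where v: "gens R (?F0\<lparr>carrier := ?K\<rparr>) k v" "rels_in R (?F0\<lparr>carrier := ?K\<rparr>) k v (max_ideal R)"
    using min_gens_exist[OF assms(1)] by metis
  let ?F1 = "finite_free R k"
  note F1 = finite_free_module[OF cr, of k]
  have vK: "v \<in> {..<k} \<rightarrow> ?K" using v(1) by (simp add: gens_def)
  hence vF: "v \<in> {..<k} \<rightarrow> carrier ?F0" using sub_carr[OF K] by auto
  have eq: "lincomb (?F0\<lparr>carrier := ?K\<rparr>) k v r = lincomb ?F0 k v r" if "r \<in> carrier ?F1" for r
    using finite_free_val[OF cr that] by (intro lincomb_sub[OF F0 K vK]) auto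
  define D where "D = restrict (lincomb ?F0 k v) (carrier ?F1)"
  have D: "D \<in> mod_hom R ?F1 ?F0" unfolding D_def by (rule restrict_mod_hom[OF F1 lin_lincomb[OF F0 vF]])
  have im: "D ` carrier ?F1 = ?K" using v(1) eq unfolding gens_def D_def by simp
  have "?K \<subseteq> ideal_smult R (max_ideal R) ?F0"
    using u(2) by (auto simp: mod_ker_def \<epsilon>_def rels_in_def intro!: ideal_vec_ismult[OF cr mi])
  moreover have "mod_ker ?F1 ?F0 D \<subseteq> ideal_smult R (max_ideal R) ?F1"
    using v(2) eq by (auto simp: mod_ker_def D_def rels_in_def intro!: ideal_vec_ismult[OF cr mi])
  moreover have "\<epsilon> ` carrier ?F0 = carrier M" using u(1) by (simp add: gens_def \<epsilon>_def)
  ultimately have "minimal_presentation R M n k D \<epsilon>"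
    unfolding minimal_presentation_def Let_def using eps D im by simp
  thus ?thesis by blast
qed

lemma (in abelian_group) minus_zero_right [simp]: "x \<in> carrier G \<Longrightarrow> x \<ominus> \<zero> = x"
  by (simp add: a_minus_def)

section \<open>Quotient modules\<close>

lemma module_transport:
  assumes "module R M" "carrier Q = q ` carrier M"
    "\<And>x y. x \<in> carrier M \<Longrightarrow> y \<in> carrier M \<Longrightarrow> q x \<oplus>\<^bsub>Q\<^esub> q y = q (x \<oplus>\<^bsub>M\<^esub> y)"
    "\<And>a x. a \<in> carrier R \<Longrightarrow> x \<in> carrier M \<Longrightarrow> a \<odot>\<^bsub>Q\<^esub> q x = q (a \<odot>\<^bsub>M\<^esub> x)"
    "\<zero>\<^bsub>Q\<^esub> = q \<zero>\<^bsub>M\<^esub>"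
  shows "module R Q"
proof -
  interpret module R M by fact
  show ?thesis
  proof (intro moduleI abelian_groupI)
    fix x assume "x \<in> carrier Q"
    then obtain u where u: "u \<in> carrier M" "x = q u" using assms(2) by auto
    thus "\<exists>y\<in>carrier Q. y \<oplus>\<^bsub>Q\<^esub> x = \<zero>\<^bsub>Q\<^esub>"
      by (intro bexI[of _ "q (\<ominus>\<^bsub>M\<^esub> u)"]) (simp_all add: assms M.l_neg)
  qed (auto simp: assms M.a_ac smult_l_distr smult_r_distr smult_assoc1 intro: R.is_cring)
qed

lemma sub_abelian_subgroup:
  assumes "module R M" "submodule H R M" shows "abelian_subgroup H M"
proof -
  interpret module R M by fact
  show ?thesis
    by (rule abelian_subgroupI3[OF additive_subgroup.intro M.abelian_group_axioms])
      (rule submodule.axioms(1)[OF assms(2)])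
qed

lemma coset_eq_iff:
  assumes "module R M" "submodule H R M" "x \<in> carrier M" "y \<in> carrier M"
  shows "H +>\<^bsub>M\<^esub> x = H +>\<^bsub>M\<^esub> y \<longleftrightarrow> x \<ominus>\<^bsub>M\<^esub> y \<in> H"
proof -
  interpret module R M by fact
  interpret abelian_subgroup H M by (rule sub_abelian_subgroup[OF assms(1,2)])
  have e: "x \<in> H +>\<^bsub>M\<^esub> y \<longleftrightarrow> x \<ominus>\<^bsub>M\<^esub> y \<in> H"
    using a_rcos_module[OF assms(4,3)] by (simp add: a_minus_def)
  show ?thesis using e a_rcos_self[OF assms(3)] a_repr_independence'[OF _ assms(4), of x]
    by metis
qed

lemma quot_simps:
  assumes "module R M" "submodule H R M"
  shows "carrier (quot_module M H) = (\<lambda>x. H +>\<^bsub>M\<^esub> x) ` carrier M"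
    and "x \<in> carrier M \<Longrightarrow> y \<in> carrier M \<Longrightarrow>
      (H +>\<^bsub>M\<^esub> x) \<oplus>\<^bsub>quot_module M H\<^esub> (H +>\<^bsub>M\<^esub> y) = H +>\<^bsub>M\<^esub> (x \<oplus>\<^bsub>M\<^esub> y)"
    and "a \<in> carrier R \<Longrightarrow> x \<in> carrier M \<Longrightarrow>
      a \<odot>\<^bsub>quot_module M H\<^esub> (H +>\<^bsub>M\<^esub> x) = H +>\<^bsub>M\<^esub> (a \<odot>\<^bsub>M\<^esub> x)"
    and "\<zero>\<^bsub>quot_module M H\<^esub> = H +>\<^bsub>M\<^esub> \<zero>\<^bsub>M\<^esub>"
    and "\<zero>\<^bsub>quot_module M H\<^esub> = H"
proof -
  interpret module R M by fact
  interpret abelian_subgroup H M by (rule sub_abelian_subgroup[OF assms(1,2)])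
  show "carrier (quot_module M H) = (\<lambda>x. H +>\<^bsub>M\<^esub> x) ` carrier M"
    by (auto simp: quot_module_def A_RCOSETS_def')
  show "x \<in> carrier M \<Longrightarrow> y \<in> carrier M \<Longrightarrow>
      (H +>\<^bsub>M\<^esub> x) \<oplus>\<^bsub>quot_module M H\<^esub> (H +>\<^bsub>M\<^esub> y) = H +>\<^bsub>M\<^esub> (x \<oplus>\<^bsub>M\<^esub> y)"
    by (simp add: quot_module_def a_rcos_sum)
  show "a \<odot>\<^bsub>quot_module M H\<^esub> (H +>\<^bsub>M\<^esub> x) = H +>\<^bsub>M\<^esub> (a \<odot>\<^bsub>M\<^esub> x)" if a: "a \<in> carrier R" and x: "x \<in> carrier M"
  proof -
    have "H +>\<^bsub>M\<^esub> (a \<odot>\<^bsub>M\<^esub> z) = H +>\<^bsub>M\<^esub> (a \<odot>\<^bsub>M\<^esub> x)" if z: "z \<in> H +>\<^bsub>M\<^esub> x" for z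
    proof -
      obtain h where h: "h \<in> H" "z = h \<oplus>\<^bsub>M\<^esub> x" using z by (auto simp: a_r_coset_def')
      hence "a \<odot>\<^bsub>M\<^esub> z \<ominus>\<^bsub>M\<^esub> a \<odot>\<^bsub>M\<^esub> x = a \<odot>\<^bsub>M\<^esub> h" using a x
        by (simp add: a_minus_def smult_r_distr M.a_assoc M.r_neg)
      thus ?thesis using a x h sub_smult[OF assms(2) a h(1)] by (subst coset_eq_iff[OF assms]) auto
    qed
    \<comment> \<open>Scalar multiplication in the quotient is a union over all representatives;
      every member of this union is the same coset, and the index set is not empty.\<close>
    hence "(\<Union>z\<in>H +>\<^bsub>M\<^esub> x. H +>\<^bsub>M\<^esub> (a \<odot>\<^bsub>M\<^esub> z)) = (\<Union>z\<in>H +>\<^bsub>M\<^esub> x. H +>\<^bsub>M\<^esub> (a \<odot>\<^bsub>M\<^esub> x))"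
      by (rule SUP_cong[OF refl])
    also have "\<dots> = H +>\<^bsub>M\<^esub> (a \<odot>\<^bsub>M\<^esub> x)" by (rule cSUP_const) (use a_rcos_self[OF x] in auto)
    finally show ?thesis by (simp add: quot_module_def)
  qed
  show "\<zero>\<^bsub>quot_module M H\<^esub> = H +>\<^bsub>M\<^esub> \<zero>\<^bsub>M\<^esub>" using M.a_coset_add_zero[OF a_subset]
    by (simp add: quot_module_def)
  show "\<zero>\<^bsub>quot_module M H\<^esub> = H" by (simp add: quot_module_def)
qed

lemma quot_module_module: "module R M \<Longrightarrow> submodule H R M \<Longrightarrow> module R (quot_module M H)"
  by (rule module_transport[of R M _ "\<lambda>x. H +>\<^bsub>M\<^esub> x"]) (simp_all add: quot_simps(1-4))

lemma lin_quot: "module R M \<Longrightarrow> submodule H R M \<Longrightarrow> lin R M (quot_module M H) (\<lambda>x. H +>\<^bsub>M\<^esub> x)"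
  by (rule linI) (simp_all add: quot_simps(1-4))

lemma quot_zero_iff:
  assumes "module R M" "submodule H R M" "x \<in> carrier M"
  shows "H +>\<^bsub>M\<^esub> x = \<zero>\<^bsub>quot_module M H\<^esub> \<longleftrightarrow> x \<in> H"
proof -
  interpret module R M by fact
  show ?thesis unfolding quot_simps(4)[OF assms(1,2)]
    using assms(3) by (subst coset_eq_iff[OF assms(1,2)]) auto
qed

section \<open>Regular sequences\<close>

text \<open>\<open>x\<close> is a nonzerodivisor on \<open>M / (X) M\<close>, expressed inside
  \<open>M\<close> so that the type of elements stays the same along a sequence.\<close>

definition regular_mod :: "('a, 'r) ring_scheme \<Rightarrow> ('a, 'm, 'x) module_scheme \<Rightarrow> 'a set \<Rightarrow> 'a \<Rightarrow> bool" where
  "regular_mod R M X x \<longleftrightarrow> (\<forall>u\<in>carrier M. x \<odot>\<^bsub>M\<^esub> u \<in> xsub R M X \<longrightarrow> u \<in> xsub R M X)"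

text \<open>Only the nonzerodivisor conditions. That \<open>(xs) M\<close> differs from
  \<open>M\<close> is kept apart, because it comes from Nakayama's lemma instead.\<close>

definition regular_list :: "('a, 'r) ring_scheme \<Rightarrow> ('a, 'm, 'x) module_scheme \<Rightarrow> 'a list \<Rightarrow> bool" where
  "regular_list R M xs \<longleftrightarrow> (\<forall>i<length xs. regular_mod R M (set (take i xs)) (xs ! i))"

lemma set_take_carr: "set xs \<subseteq> A \<Longrightarrow> set (take i xs) \<subseteq> A"
  by (meson order_trans set_take_subset)

lemma regular_seq_iff:
  assumes "module R M" "set xs \<subseteq> carrier R"
  shows "regular_seq R M xs \<longleftrightarrow> regular_list R M xs \<and> xsub R M (set xs) \<noteq> carrier M"
proof -
  interpret module R M by fact
  have s: "submodule (xsub R M (set (take i xs))) R M" for i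
    by (intro xsub_sub assms set_take_carr)
  have 1: "(\<forall>y\<in>carrier (quot_module M (xsub R M (set (take i xs)))).
      (xs ! i) \<odot>\<^bsub>quot_module M (xsub R M (set (take i xs)))\<^esub> y = \<zero>\<^bsub>quot_module M (xsub R M (set (take i xs)))\<^esub> \<longrightarrow>
      y = \<zero>\<^bsub>quot_module M (xsub R M (set (take i xs)))\<^esub>) \<longleftrightarrow> regular_mod R M (set (take i xs)) (xs ! i)"
    if i: "i < length xs" for i
  proof -
    have x: "xs ! i \<in> carrier R" using assms(2) nth_mem[OF i] by auto
    have "(xs ! i) \<odot>\<^bsub>quot_module M (xsub R M (set (take i xs)))\<^esub> (xsub R M (set (take i xs)) +>\<^bsub>M\<^esub> u) =
       \<zero>\<^bsub>quot_module M (xsub R M (set (take i xs)))\<^esub> \<longleftrightarrow> xs ! i \<odot>\<^bsub>M\<^esub> u \<in> xsub R M (set (take i xs))" if u: "u \<in> carrier M" for u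
      using quot_simps(3)[OF assms(1) s x u] quot_zero_iff[OF assms(1) s, of "xs ! i \<odot>\<^bsub>M\<^esub> u"] x u by simp
    thus ?thesis
      unfolding regular_mod_def quot_simps(1)[OF assms(1) s]
      using quot_zero_iff[OF assms(1) s] by simp
  qed
  have "zero_module (quot_module M (xsub R M (set xs))) \<longleftrightarrow> xsub R M (set xs) = carrier M"
  proof -
    have t: "submodule (xsub R M (set xs)) R M" using s[of "length xs"] by simp
    have "zero_module (quot_module M (xsub R M (set xs))) \<longleftrightarrow>
       (\<forall>u\<in>carrier M. xsub R M (set xs) +>\<^bsub>M\<^esub> u = \<zero>\<^bsub>quot_module M (xsub R M (set xs))\<^esub>)"
      unfolding zero_module_def quot_simps(1)[OF assms(1) t] by auto
    also have "\<dots> \<longleftrightarrow> (\<forall>u\<in>carrier M. u \<in> xsub R M (set xs))" using quot_zero_iff[OF assms(1) t] by simp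
    also have "\<dots> \<longleftrightarrow> xsub R M (set xs) = carrier M" using subsetI[OF sub_carr[OF t]] by blast
    finally show ?thesis .
  qed
  thus ?thesis unfolding regular_seq_def Let_def regular_list_def using 1 by (simp flip: xsub_def)
qed

lemma regular_mod_pow:
  assumes "module R M" "finite S" "X \<subseteq> carrier R" "regular_mod R M X x"
  shows "regular_mod R (pow_module M S) X x"
  using assms(4) pow_xsub[OF assms(1-3)] unfolding regular_mod_def by (auto simp: pow_val[OF assms(1)])

lemma sub_minus_cancel:
  assumes "module R M" "submodule H R M" "x \<ominus>\<^bsub>M\<^esub> y \<in> H" "y \<in> H" "x \<in> carrier M"
  shows "x \<in> H"
proof -
  interpret module R M by fact
  have "\<ominus>\<^bsub>M\<^esub> y \<in> H" by (rule sub_neg[OF assms(2,4)])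
  thus ?thesis using sub_add_cancel[OF assms(1,2), of x "\<ominus>\<^bsub>M\<^esub> y"] assms(3,5) by (simp add: a_minus_def)
qed

lemma sub_minus_swap:
  assumes "module R M" "submodule H R M" "x \<ominus>\<^bsub>M\<^esub> y \<in> H" "x \<in> carrier M" "y \<in> carrier M"
  shows "y \<ominus>\<^bsub>M\<^esub> x \<in> H"
proof -
  interpret module R M by fact
  have "\<ominus>\<^bsub>M\<^esub> (x \<ominus>\<^bsub>M\<^esub> y) = y \<ominus>\<^bsub>M\<^esub> x" using assms(4,5)
    by (simp add: a_minus_def M.minus_add M.a_comm)
  thus ?thesis using sub_neg[OF assms(2,3)] by simp
qed

lemma sub_minus_trans:
  assumes "module R M" "submodule H R M" "x \<ominus>\<^bsub>M\<^esub> y \<in> H" "y \<ominus>\<^bsub>M\<^esub> z \<in> H" "x \<in> carrier M" "y \<in> carrier M" "z \<in> carrier M"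
  shows "x \<ominus>\<^bsub>M\<^esub> z \<in> H"
proof -
  interpret module R M by fact
  have "(x \<ominus>\<^bsub>M\<^esub> y) \<oplus>\<^bsub>M\<^esub> (y \<ominus>\<^bsub>M\<^esub> z) = x \<ominus>\<^bsub>M\<^esub> z" using assms(5-7)
    by (simp add: a_minus_def M.a_assoc M.r_neg1 M.r_neg2)
  thus ?thesis using sub_add[OF assms(2-4)] by simp
qed

lemma (in module) minus_smult: "a \<in> carrier R \<Longrightarrow> x \<in> carrier M \<Longrightarrow> y \<in> carrier M \<Longrightarrow>
    a \<odot>\<^bsub>M\<^esub> (x \<ominus>\<^bsub>M\<^esub> y) = a \<odot>\<^bsub>M\<^esub> x \<ominus>\<^bsub>M\<^esub> a \<odot>\<^bsub>M\<^esub> y"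
  by (simp add: a_minus_def smult_r_distr smult_r_minus)

lemma (in abelian_group) minus_minus_right_comm:
  "x \<in> carrier G \<Longrightarrow> y \<in> carrier G \<Longrightarrow> z \<in> carrier G \<Longrightarrow> (x \<ominus> y) \<ominus> z = (x \<ominus> z) \<ominus> y"
  by (simp add: a_minus_def a_ac)

lemma (in abelian_group) minus_add_right:
  "x \<in> carrier G \<Longrightarrow> y \<in> carrier G \<Longrightarrow> z \<in> carrier G \<Longrightarrow> (x \<oplus> y) \<ominus> z = x \<oplus> (y \<ominus> z)"
  by (simp add: a_minus_def a_ac)

lemma (in abelian_group) add_minus_cancel:
  "x \<in> carrier G \<Longrightarrow> y \<in> carrier G \<Longrightarrow> (x \<oplus> y) \<ominus> y = x"
  "x \<in> carrier G \<Longrightarrow> y \<in> carrier G \<Longrightarrow> (x \<oplus> y) \<ominus> x = y"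
  "x \<in> carrier G \<Longrightarrow> y \<in> carrier G \<Longrightarrow> (x \<ominus> y) \<oplus> y = x"
  "x \<in> carrier G \<Longrightarrow> y \<in> carrier G \<Longrightarrow> x \<ominus> (x \<ominus> y) = y"
  by (simp_all add: a_minus_def a_assoc r_neg l_neg minus_add r_neg1 r_neg2)
    (metis a_comm a_inv_closed a_lcomm r_neg r_zero)

section \<open>Exactness of a complex modulo an ideal\<close>

text \<open>Exactness in degree \<open>i + 1\<close> of the complex \<open>C / (X) C\<close>, phrased without the quotient.\<close>

definition exact_mod :: "('a, 'r) ring_scheme \<Rightarrow> (nat \<Rightarrow> ('a, 'c) module) \<Rightarrow> (nat \<Rightarrow> 'c \<Rightarrow> 'c) \<Rightarrow>
    'a set \<Rightarrow> nat \<Rightarrow> bool" where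
  "exact_mod R C \<delta> X i \<longleftrightarrow> (\<forall>c\<in>carrier (C (Suc i)). \<delta> (Suc i) c \<in> xsub R (C (Suc (Suc i))) X \<longrightarrow>
     (\<exists>e\<in>carrier (C i). c \<ominus>\<^bsub>C (Suc i)\<^esub> \<delta> i e \<in> xsub R (C (Suc i)) X))"

lemma exact_modE:
  assumes "exact_mod R C \<delta> X i" "c \<in> carrier (C (Suc i))" "\<delta> (Suc i) c \<in> xsub R (C (Suc (Suc i))) X"
  obtains e where "e \<in> carrier (C i)" "c \<ominus>\<^bsub>C (Suc i)\<^esub> \<delta> i e \<in> xsub R (C (Suc i)) X"
  using assms unfolding exact_mod_def by blast

locale complex =
  fixes R :: "('a, 'r) ring_scheme" and C :: "nat \<Rightarrow> ('a, 'c) module" and \<delta> :: "nat \<Rightarrow> 'c \<Rightarrow> 'c"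
  assumes mod: "\<And>i. module R (C i)" and lin_\<delta>: "\<And>i. lin R (C i) (C (Suc i)) (\<delta> i)"
    and \<delta>\<delta>: "\<And>i c. c \<in> carrier (C i) \<Longrightarrow> \<delta> (Suc i) (\<delta> i c) = \<zero>\<^bsub>C (Suc (Suc i))\<^esub>"
begin

text \<open>The part of the long exact sequence for multiplication by \<open>x\<close> on
  \<open>C / (X) C\<close> that bounds the cohomology modulo \<open>(x, X)\<close> by that modulo
  \<open>X\<close> in the same and in the next degree; hence one degree of exactness is lost. The
  chase: if \<open>\<delta> c = l + x e\<close>, regularity makes \<open>e\<close> a cocycle modulo
  \<open>X\<close>, so \<open>e\<close> agrees with some \<open>\<delta> f\<close> modulo
  \<open>X\<close>, and \<open>c - x f\<close> is a cocycle modulo \<open>X\<close>.\<close>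

lemma exact_step_up:
  assumes "exact_mod R C \<delta> X i" "exact_mod R C \<delta> X (Suc i)" "regular_mod R (C (Suc (Suc (Suc i)))) X x"
    "X \<subseteq> carrier R" "x \<in> carrier R"
  shows "exact_mod R C \<delta> (insert x X) i"
  unfolding exact_mod_def
proof (intro ballI impI)
  let ?C1 = "C (Suc i)" and ?C2 = "C (Suc (Suc i))" and ?C3 = "C (Suc (Suc (Suc i)))"
  let ?d1 = "\<delta> (Suc i)" and ?d2 = "\<delta> (Suc (Suc i))"
  interpret C1: module R ?C1 by (rule mod)
  interpret C2: module R ?C2 by (rule mod)
  interpret C3: module R ?C3 by (rule mod)
  note s = xsub_sub[OF mod assms(4)]
  note d1 = lin_closed[OF lin_\<delta>, of _ "Suc i"] and d2 = lin_closed[OF lin_\<delta>, of _ "Suc (Suc i)"]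
  fix c assume c: "c \<in> carrier ?C1" "?d1 c \<in> xsub R ?C2 (insert x X)"
  obtain l e where le: "l \<in> xsub R ?C2 X" "e \<in> carrier ?C2" "?d1 c = l \<oplus>\<^bsub>?C2\<^esub> x \<odot>\<^bsub>?C2\<^esub> e"
    using xsub_insertE[OF mod assms(4,5) c(2)] by metis
  note lc = sub_carr[OF s le(1)]
  have "?d2 l \<oplus>\<^bsub>?C3\<^esub> x \<odot>\<^bsub>?C3\<^esub> ?d2 e = \<zero>\<^bsub>?C3\<^esub>"
    using \<delta>\<delta>[OF c(1)] le lc assms(5) by (simp add: lin_add[OF lin_\<delta>] lin_smult[OF lin_\<delta>])
  moreover have "?d2 l \<in> xsub R ?C3 X" by (rule lin_xsub[OF mod mod lin_\<delta> assms(4) le(1)])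
  ultimately have "x \<odot>\<^bsub>?C3\<^esub> ?d2 e \<in> xsub R ?C3 X"
    using d2[OF lc] d2[OF le(2)] assms(5) sub_zero[OF s] 
    by (rule_tac sub_add_cancel[OF mod s, where y = "?d2 l"]) (simp_all add: C3.M.a_comm)
  hence "?d2 e \<in> xsub R ?C3 X" using assms(3) d2[OF le(2)] by (simp add: regular_mod_def)
  then obtain f where f: "f \<in> carrier ?C1" "e \<ominus>\<^bsub>?C2\<^esub> ?d1 f \<in> xsub R ?C2 X"
    using exact_modE[OF assms(2) le(2)] by metis
  have "?d1 (c \<ominus>\<^bsub>?C1\<^esub> x \<odot>\<^bsub>?C1\<^esub> f) = (l \<oplus>\<^bsub>?C2\<^esub> x \<odot>\<^bsub>?C2\<^esub> e) \<ominus>\<^bsub>?C2\<^esub> x \<odot>\<^bsub>?C2\<^esub> ?d1 f"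
    using c(1) f(1) assms(5) le(3) by (simp add: lin_minus[OF mod mod lin_\<delta>] lin_smult[OF lin_\<delta>])
  also have "\<dots> = l \<oplus>\<^bsub>?C2\<^esub> x \<odot>\<^bsub>?C2\<^esub> (e \<ominus>\<^bsub>?C2\<^esub> ?d1 f)"
    using lc le(2) d1[OF f(1)] assms(5) by (simp add: C2.M.minus_add_right C2.minus_smult)
  also have "\<dots> \<in> xsub R ?C2 X" by (rule sub_add[OF s le(1) sub_smult[OF s assms(5) f(2)]])
  finally have dc: "?d1 (c \<ominus>\<^bsub>?C1\<^esub> x \<odot>\<^bsub>?C1\<^esub> f) \<in> xsub R ?C2 X" .
  have "c \<ominus>\<^bsub>?C1\<^esub> x \<odot>\<^bsub>?C1\<^esub> f \<in> carrier ?C1" using c(1) f(1) assms(5) by simp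
  from exact_modE[OF assms(1) this dc]
  obtain g where g: "g \<in> carrier (C i)" "(c \<ominus>\<^bsub>?C1\<^esub> x \<odot>\<^bsub>?C1\<^esub> f) \<ominus>\<^bsub>?C1\<^esub> \<delta> i g \<in> xsub R ?C1 X" .
  have iX: "insert x X \<subseteq> carrier R" using assms by auto
  have dg: "\<delta> i g \<in> carrier ?C1" by (rule lin_closed[OF lin_\<delta> g(1)])
  have "(c \<ominus>\<^bsub>?C1\<^esub> \<delta> i g) \<ominus>\<^bsub>?C1\<^esub> x \<odot>\<^bsub>?C1\<^esub> f \<in> xsub R ?C1 (insert x X)"
    using g(2) c(1) f(1) dg assms(5) xsub_mono[OF mod iX, of X "Suc i"]
      C1.M.minus_minus_right_comm[of c "x \<odot>\<^bsub>?C1\<^esub> f" "\<delta> i g"] by auto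
  moreover have "x \<odot>\<^bsub>?C1\<^esub> f \<in> xsub R ?C1 (insert x X)" by (rule xsub_mem) (use f(1) in auto)
  ultimately have "c \<ominus>\<^bsub>?C1\<^esub> \<delta> i g \<in> xsub R ?C1 (insert x X)"
    by (rule sub_minus_cancel[OF mod xsub_sub[OF mod iX]]) (use c(1) dg in simp)
  thus "\<exists>e\<in>carrier (C i). c \<ominus>\<^bsub>?C1\<^esub> \<delta> i e \<in> xsub R ?C1 (insert x X)" using g(1) by blast
qed

text \<open>Another part of that long exact sequence: vanishing of the cohomology modulo
  \<open>(y, Y)\<close> in one degree makes multiplication by \<open>y\<close> injective on the
  cohomology modulo \<open>Y\<close> in the next degree.\<close>

lemma exact_step_down:
  assumes "exact_mod R C \<delta> (insert y Y) i" "regular_mod R (C (Suc (Suc i))) Y y"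
    "Y \<subseteq> carrier R" "y \<in> carrier R" "c \<in> carrier (C (Suc (Suc i)))"
    "e \<in> carrier (C (Suc i))" "y \<odot>\<^bsub>C (Suc (Suc i))\<^esub> c \<ominus>\<^bsub>C (Suc (Suc i))\<^esub> \<delta> (Suc i) e \<in> xsub R (C (Suc (Suc i))) Y"
  obtains g where "g \<in> carrier (C (Suc i))" "c \<ominus>\<^bsub>C (Suc (Suc i))\<^esub> \<delta> (Suc i) g \<in> xsub R (C (Suc (Suc i))) Y"
proof -
  let ?C1 = "C (Suc i)" and ?C2 = "C (Suc (Suc i))" and ?d1 = "\<delta> (Suc i)"
  interpret C1: module R ?C1 by (rule mod)
  interpret C2: module R ?C2 by (rule mod)
  note s = xsub_sub[OF mod assms(3)]
  have iY: "insert y Y \<subseteq> carrier R" using assms by auto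
  note si = xsub_sub[OF mod iY]
  note d1 = lin_closed[OF lin_\<delta>, of _ "Suc i"]
  have yc: "y \<odot>\<^bsub>?C2\<^esub> c \<in> carrier ?C2" using assms by simp
  have "?d1 e \<ominus>\<^bsub>?C2\<^esub> y \<odot>\<^bsub>?C2\<^esub> c \<in> xsub R ?C2 Y"
    by (rule sub_minus_swap[OF mod s assms(7) yc d1[OF assms(6)]])
  hence "?d1 e \<in> xsub R ?C2 (insert y Y)"
    using xsub_mono[OF mod iY, of Y "Suc (Suc i)"] xsub_mem[of y "insert y Y" c ?C2 R] assms(5) d1[OF assms(6)]
    by (rule_tac sub_minus_cancel[OF mod si, where y = "y \<odot>\<^bsub>?C2\<^esub> c"]) auto
  then obtain f where f: "f \<in> carrier (C i)" "e \<ominus>\<^bsub>?C1\<^esub> \<delta> i f \<in> xsub R ?C1 (insert y Y)"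
    using exact_modE[OF assms(1,6)] by metis
  obtain l g where lg: "l \<in> xsub R ?C1 Y" "g \<in> carrier ?C1" "e \<ominus>\<^bsub>?C1\<^esub> \<delta> i f = l \<oplus>\<^bsub>?C1\<^esub> y \<odot>\<^bsub>?C1\<^esub> g"
    using xsub_insertE[OF mod assms(3,4) f(2)] by metis
  note df = lin_closed[OF lin_\<delta> f(1)]
  have "?d1 (e \<ominus>\<^bsub>?C1\<^esub> \<delta> i f) = ?d1 e"
    using \<delta>\<delta>[OF f(1)] assms(6) df d1[OF assms(6)] by (simp add: lin_minus[OF mod mod lin_\<delta>])
  hence de: "?d1 e = ?d1 l \<oplus>\<^bsub>?C2\<^esub> y \<odot>\<^bsub>?C2\<^esub> ?d1 g"
    using lg sub_carr[OF s lg(1)] assms(4) by (simp add: lin_add[OF lin_\<delta>] lin_smult[OF lin_\<delta>])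
  have "?d1 e \<ominus>\<^bsub>?C2\<^esub> y \<odot>\<^bsub>?C2\<^esub> ?d1 g \<in> xsub R ?C2 Y"
    using lin_xsub[OF mod mod lin_\<delta> assms(3) lg(1)] d1[OF sub_carr[OF s lg(1)]] d1[OF lg(2)] assms(4)
    unfolding de by (simp add: C2.M.add_minus_cancel)
  hence "y \<odot>\<^bsub>?C2\<^esub> c \<ominus>\<^bsub>?C2\<^esub> y \<odot>\<^bsub>?C2\<^esub> ?d1 g \<in> xsub R ?C2 Y"
    using sub_minus_trans[OF mod s assms(7)] yc d1[OF assms(6)] d1[OF lg(2)] assms(4) by simp
  hence "y \<odot>\<^bsub>?C2\<^esub> (c \<ominus>\<^bsub>?C2\<^esub> ?d1 g) \<in> xsub R ?C2 Y"
    using assms(4,5) d1[OF lg(2)] by (simp add: C2.minus_smult)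
  hence "c \<ominus>\<^bsub>?C2\<^esub> ?d1 g \<in> xsub R ?C2 Y" using assms(2,5) d1[OF lg(2)] by (simp add: regular_mod_def)
  thus ?thesis using that lg(2) by blast
qed

text \<open>Multiplication by \<open>y\<close> is injective on the cohomology and some power of it
  is zero, so the cohomology is zero; the factors \<open>y\<close> are removed one at a time. The
  last assumption will be supplied by a null-homotopy.\<close>

lemma exact_step_down_power:
  fixes n :: nat
  assumes "exact_mod R C \<delta> (insert y Y) i" "regular_mod R (C (Suc (Suc i))) Y y"
    "Y \<subseteq> carrier R" "y \<in> carrier R"
    "\<And>c. c \<in> carrier (C (Suc (Suc i))) \<Longrightarrow> \<delta> (Suc (Suc i)) c \<in> xsub R (C (Suc (Suc (Suc i)))) Y \<Longrightarrow>
      \<exists>e\<in>carrier (C (Suc i)). (y [^]\<^bsub>R\<^esub> n) \<odot>\<^bsub>C (Suc (Suc i))\<^esub> c \<ominus>\<^bsub>C (Suc (Suc i))\<^esub> \<delta> (Suc i) e \<in> xsub R (C (Suc (Suc i))) Y"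
  shows "exact_mod R C \<delta> Y (Suc i)"
proof -
  let ?C1 = "C (Suc i)" and ?C2 = "C (Suc (Suc i))" and ?C3 = "C (Suc (Suc (Suc i)))" and ?d1 = "\<delta> (Suc i)" and ?d2 = "\<delta> (Suc (Suc i))"
  interpret C2: module R ?C2 by (rule mod)
  note s = xsub_sub[OF mod assms(3)]
  have "\<exists>e\<in>carrier ?C1. c \<ominus>\<^bsub>?C2\<^esub> ?d1 e \<in> xsub R ?C2 Y"
    if "c \<in> carrier ?C2" "?d2 c \<in> xsub R ?C3 Y"
      "\<exists>e\<in>carrier ?C1. (y [^]\<^bsub>R\<^esub> m) \<odot>\<^bsub>?C2\<^esub> c \<ominus>\<^bsub>?C2\<^esub> ?d1 e \<in> xsub R ?C2 Y" for m :: nat and c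
    using that
  proof (induction m arbitrary: c)
    case (Suc m)
    have yc: "y \<odot>\<^bsub>?C2\<^esub> c \<in> carrier ?C2" using Suc.prems(1) assms(4) by simp
    have "?d2 (y \<odot>\<^bsub>?C2\<^esub> c) \<in> xsub R ?C3 Y"
      using Suc.prems(1,2) assms(4) by (simp add: lin_smult[OF lin_\<delta>] sub_smult[OF s])
    moreover have "(y [^]\<^bsub>R\<^esub> m) \<odot>\<^bsub>?C2\<^esub> (y \<odot>\<^bsub>?C2\<^esub> c) = (y [^]\<^bsub>R\<^esub> Suc m) \<odot>\<^bsub>?C2\<^esub> c"
      using Suc.prems(1) assms(4) by (simp add: C2.smult_assoc1)
    ultimately obtain e where "e \<in> carrier ?C1" "y \<odot>\<^bsub>?C2\<^esub> c \<ominus>\<^bsub>?C2\<^esub> ?d1 e \<in> xsub R ?C2 Y"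
      using Suc.IH[OF yc] Suc.prems(3) by auto
    thus ?case using exact_step_down[OF assms(1-4) Suc.prems(1)] by metis
  qed simp
  thus ?thesis unfolding exact_mod_def using assms(5) by blast
qed

text \<open>In the lowest degree only zero is a coboundary, so a class is an element of
  \<open>C (Suc 0)\<close> modulo \<open>Y\<close>, on which \<open>y\<close> is regular by
  assumption.\<close>

lemma exact_bottom_power:
  fixes n :: nat
  assumes "zero_module (C 0)" "regular_mod R (C (Suc 0)) Y y" "Y \<subseteq> carrier R" "y \<in> carrier R"
    "\<And>c. c \<in> carrier (C (Suc 0)) \<Longrightarrow> \<delta> (Suc 0) c \<in> xsub R (C (Suc (Suc 0))) Y \<Longrightarrow>
      \<exists>e\<in>carrier (C 0). (y [^]\<^bsub>R\<^esub> n) \<odot>\<^bsub>C (Suc 0)\<^esub> c \<ominus>\<^bsub>C (Suc 0)\<^esub> \<delta> 0 e \<in> xsub R (C (Suc 0)) Y"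
  shows "exact_mod R C \<delta> Y 0"
proof -
  interpret C1: module R "C (Suc 0)" by (rule mod)
  have z: "x \<ominus>\<^bsub>C (Suc 0)\<^esub> \<delta> 0 e = x" if "x \<in> carrier (C (Suc 0))" "e \<in> carrier (C 0)" for x e
    using that assms(1) lin_zero[OF mod mod lin_\<delta>, of 0] by (simp add: zero_module_def)
  have *: "c \<in> xsub R (C (Suc 0)) Y" if "c \<in> carrier (C (Suc 0))" "(y [^]\<^bsub>R\<^esub> m) \<odot>\<^bsub>C (Suc 0)\<^esub> c \<in> xsub R (C (Suc 0)) Y" for m :: nat and c
    using that
  proof (induction m arbitrary: c)
    case (Suc m)
    have e: "(y [^]\<^bsub>R\<^esub> m) \<odot>\<^bsub>C (Suc 0)\<^esub> (y \<odot>\<^bsub>C (Suc 0)\<^esub> c) = (y [^]\<^bsub>R\<^esub> Suc m) \<odot>\<^bsub>C (Suc 0)\<^esub> c"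
      using Suc.prems(1) assms(4) by (simp add: C1.smult_assoc1)
    have "y \<odot>\<^bsub>C (Suc 0)\<^esub> c \<in> xsub R (C (Suc 0)) Y"
      by (rule Suc.IH) (use e Suc.prems assms(4) in simp_all)
    thus ?case using assms(2) Suc.prems(1) unfolding regular_mod_def by metis
  qed simp
  show ?thesis unfolding exact_mod_def
  proof (intro ballI impI)
    fix c assume c: "c \<in> carrier (C (Suc 0))" "\<delta> (Suc 0) c \<in> xsub R (C (Suc (Suc 0))) Y"
    then obtain e where e: "e \<in> carrier (C 0)" "(y [^]\<^bsub>R\<^esub> n) \<odot>\<^bsub>C (Suc 0)\<^esub> c \<ominus>\<^bsub>C (Suc 0)\<^esub> \<delta> 0 e \<in> xsub R (C (Suc 0)) Y"
      using assms(5)[of c] by metis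
    have "(y [^]\<^bsub>R\<^esub> n) \<odot>\<^bsub>C (Suc 0)\<^esub> c \<in> xsub R (C (Suc 0)) Y"
      using e(2) z[OF _ e(1), of "(y [^]\<^bsub>R\<^esub> n) \<odot>\<^bsub>C (Suc 0)\<^esub> c"] c(1) assms(4) by simp
    hence "c \<in> xsub R (C (Suc 0)) Y" by (rule *[OF c(1)])
    thus "\<exists>e\<in>carrier (C 0). c \<ominus>\<^bsub>C (Suc 0)\<^esub> \<delta> 0 e \<in> xsub R (C (Suc 0)) Y"
      using z[OF c(1) e(1)] e(1) by (intro bexI[of _ e]) simp_all
  qed
qed

end

section \<open>The Koszul complex\<close>

text \<open>
  Cochains are functions on bit lists: a list of length \<open>k\<close> is a subset of the \<open>k\<close> elements, and
  the complex for \<open>x # xs\<close> is the mapping cone of \<open>x\<close> on the complex for \<open>xs\<close>.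
\<close>

fun koszul :: "('a, 'm, 'x) module_scheme \<Rightarrow> 'a list \<Rightarrow> (bool list \<Rightarrow> 'm) \<Rightarrow> bool list \<Rightarrow> 'm" where
  "koszul M [] c v = \<zero>\<^bsub>M\<^esub>"
| "koszul M (x # xs) c [] = \<zero>\<^bsub>M\<^esub>"
| "koszul M (x # xs) c (False # w) = koszul M xs (\<lambda>w. c (False # w)) w"
| "koszul M (x # xs) c (True # w) = x \<odot>\<^bsub>M\<^esub> c (False # w) \<ominus>\<^bsub>M\<^esub> koszul M xs (\<lambda>w. c (True # w)) w"

text \<open>The contraction that makes multiplication by the \<open>j\<close>-th element null-homotopic.\<close>

fun contraction :: "('a, 'm, 'x) module_scheme \<Rightarrow> nat \<Rightarrow> (bool list \<Rightarrow> 'm) \<Rightarrow> bool list \<Rightarrow> 'm" where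
  "contraction M j c [] = \<zero>\<^bsub>M\<^esub>"
| "contraction M 0 c (b # w) = (if b then \<zero>\<^bsub>M\<^esub> else c (True # w))"
| "contraction M (Suc j) c (b # w) =
     (if b then \<ominus>\<^bsub>M\<^esub> contraction M j (\<lambda>w. c (True # w)) w else contraction M j (\<lambda>w. c (False # w)) w)"

lemma bits_cases [case_names Nil False True]:
  obtains "v = []" | w where "v = False # w" | w where "v = True # w"
  by (metis (full_types) neq_Nil_conv)

text \<open>Integer-valued, because degrees are lowered by one without a case distinction and may
  become \<open>-1\<close>.\<close>

definition weight :: "bool list \<Rightarrow> int" where
  "weight v = int (count_list v True)"

lemma weight_simps [simp]: "weight [] = 0" "weight (True # w) = weight w + 1" "weight (False # w) = weight w"
  by (simp_all add: weight_def)

text \<open>Position \<open>i\<close> holds the cochains of degree \<open>i - 1\<close>. Position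
  \<open>0\<close> is therefore the zero module, as \<open>exact_bottom_power\<close> requires, and
  \<open>exact_mod\<close> at \<open>i\<close> speaks about Koszul degree \<open>i\<close>.\<close>

definition kos_index :: "nat \<Rightarrow> nat \<Rightarrow> bool list set" where
  "kos_index k i = {v. length v = k \<and> weight v + 1 = int i}"

lemma finite_kos_index: "finite (kos_index k i)"
  by (rule finite_subset[OF _ finite_lists_length_eq[of UNIV k]]) (auto simp: kos_index_def)

lemma weight_le: "weight v \<le> length v" and weight_full: "weight v = length v \<longleftrightarrow> v = replicate (length v) True"
proof (induction v)
  case (Cons b v)
  { case 1 show ?case using Cons by (cases b) auto }
  { case 2 show ?case using Cons by (cases b) auto }
qed auto

lemma weight_nonneg: "weight v \<ge> 0" by (simp add: weight_def)

text \<open>Cochains of degree \<open>j\<close> on \<open>k\<close> elements. Fixing the first bit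
  to \<open>False\<close> or \<open>True\<close> gives cochains of degree \<open>j\<close> or
  \<open>j - 1\<close> on one element less, which drives the inductions below.\<close>

definition supported :: "('a, 'm, 'x) module_scheme \<Rightarrow> nat \<Rightarrow> int \<Rightarrow> (bool list \<Rightarrow> 'm) \<Rightarrow> bool" where
  "supported M k j c \<longleftrightarrow> (\<forall>v. c v \<in> carrier M) \<and> (\<forall>v. \<not> (length v = k \<and> weight v = j) \<longrightarrow> c v = \<zero>\<^bsub>M\<^esub>)"

lemma kos_carrier:
  assumes "module R M"
  shows "c \<in> carrier (pow_module M (kos_index k i)) \<longleftrightarrow> supported M k (int i - 1) c"
proof -
  have e: "v \<in> kos_index k i \<longleftrightarrow> length v = k \<and> weight v = int i - 1" for v
    by (auto simp: kos_index_def)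
  interpret module R M by fact
  show ?thesis unfolding pow_carrier supported_def e[symmetric] by (metis M.zero_closed)
qed

section \<open>Differential, degree and contraction of Koszul cochains\<close>

context module
begin

lemma koszul_closed: "set xs \<subseteq> carrier R \<Longrightarrow> (\<And>v. c v \<in> carrier M) \<Longrightarrow> koszul M xs c v \<in> carrier M"
proof (induction xs arbitrary: c v)
  case (Cons x xs)
  show ?case by (cases v rule: bits_cases) (use Cons in auto)
qed simp

lemma koszul_add: "set xs \<subseteq> carrier R \<Longrightarrow> (\<And>v. c v \<in> carrier M) \<Longrightarrow> (\<And>v. e v \<in> carrier M) \<Longrightarrow>
    koszul M xs (\<lambda>v. c v \<oplus>\<^bsub>M\<^esub> e v) v = koszul M xs c v \<oplus>\<^bsub>M\<^esub> koszul M xs e v"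
proof (induction xs arbitrary: c e v)
  case (Cons x xs)
  have cl: "koszul M xs (\<lambda>w. c (b # w)) w \<in> carrier M" "koszul M xs (\<lambda>w. e (b # w)) w \<in> carrier M" for b w
    using Cons.prems by (auto intro!: koszul_closed)
  show ?case
  proof (cases v rule: bits_cases)
    case (True w)
    thus ?thesis using Cons cl[of True]
      by (simp add: smult_r_distr a_minus_def M.minus_add M.a_ac)
  qed (use Cons in auto)
qed simp

lemma koszul_smult: "set xs \<subseteq> carrier R \<Longrightarrow> (\<And>v. c v \<in> carrier M) \<Longrightarrow> a \<in> carrier R \<Longrightarrow>
    koszul M xs (\<lambda>v. a \<odot>\<^bsub>M\<^esub> c v) v = a \<odot>\<^bsub>M\<^esub> koszul M xs c v"
proof (induction xs arbitrary: c v)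
  case (Cons x xs)
  have cl: "koszul M xs (\<lambda>w. c (b # w)) w \<in> carrier M" for b w
    using Cons.prems by (auto intro!: koszul_closed)
  show ?case
  proof (cases v rule: bits_cases)
    case (True w)
    thus ?thesis using Cons cl[of True]
      by (simp add: minus_smult R.m_comm flip: smult_assoc1)
  qed (use Cons in auto)
qed simp

lemma koszul_zero: "set xs \<subseteq> carrier R \<Longrightarrow> (\<And>v. c v = \<zero>\<^bsub>M\<^esub>) \<Longrightarrow> koszul M xs c v = \<zero>\<^bsub>M\<^esub>"
proof (induction xs arbitrary: c v)
  case (Cons x xs)
  show ?case by (cases v rule: bits_cases) (use Cons in auto)
qed simp

lemma koszul_neg: "set xs \<subseteq> carrier R \<Longrightarrow> (\<And>v. c v \<in> carrier M) \<Longrightarrow>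
    koszul M xs (\<lambda>v. \<ominus>\<^bsub>M\<^esub> c v) v = \<ominus>\<^bsub>M\<^esub> koszul M xs c v"
  using koszul_smult[of xs c "\<ominus>\<^bsub>R\<^esub> \<one>\<^bsub>R\<^esub>" v] by (simp add: smult_l_minus koszul_closed)

lemma koszul_minus: "set xs \<subseteq> carrier R \<Longrightarrow> (\<And>v. c v \<in> carrier M) \<Longrightarrow> (\<And>v. e v \<in> carrier M) \<Longrightarrow>
    koszul M xs (\<lambda>v. c v \<ominus>\<^bsub>M\<^esub> e v) v = koszul M xs c v \<ominus>\<^bsub>M\<^esub> koszul M xs e v"
  by (simp add: a_minus_def koszul_add koszul_neg)

text \<open>On the half with first bit \<open>True\<close>, \<open>x\<close> times the differential
  of the other half occurs twice with opposite signs; this is the purpose of the minus sign in the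
  mapping cone.\<close>

lemma koszul_koszul: "set xs \<subseteq> carrier R \<Longrightarrow> (\<And>v. c v \<in> carrier M) \<Longrightarrow>
    koszul M xs (koszul M xs c) v = \<zero>\<^bsub>M\<^esub>"
proof (induction xs arbitrary: c v)
  case (Cons x xs)
  have cl: "koszul M xs (\<lambda>w. c (b # w)) w \<in> carrier M" for b w
    using Cons.prems by (auto intro!: koszul_closed)
  have IH: "koszul M xs (koszul M xs (\<lambda>w. c (b # w))) w = \<zero>\<^bsub>M\<^esub>" for b w
    using Cons.prems by (intro Cons.IH) auto
  show ?case
  proof (cases v rule: bits_cases)
    case (True w)
    thus ?thesis using Cons.prems cl[of True] cl[of False] IH
      by (simp add: koszul_minus koszul_smult) (simp add: a_minus_def M.r_neg)
  next
    case (False w)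
    thus ?thesis using IH[of False w] by simp
  qed (use Cons in auto)
qed simp

lemma koszul_supported: "set xs \<subseteq> carrier R \<Longrightarrow> supported M (length xs) j c \<Longrightarrow>
    supported M (length xs) (j + 1) (koszul M xs c)"
proof -
  have "koszul M xs c v = \<zero>\<^bsub>M\<^esub>"
    if "set xs \<subseteq> carrier R" "supported M (length xs) j c" "\<not> (length v = length xs \<and> weight v = j + 1)" for xs j c v
    using that
  proof (induction xs arbitrary: c j v)
    case (Cons x xs)
    have F: "supported M (length xs) j (\<lambda>w. c (False # w))" and T: "supported M (length xs) (j - 1) (\<lambda>w. c (True # w))"
      using Cons.prems(2) by (auto simp: supported_def)
    show ?case
    proof (cases v rule: bits_cases)
      case (True w)
      thus ?thesis using Cons.IH[OF _ T, of w] Cons.prems by (auto simp: supported_def)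
    next
      case (False w)
      thus ?thesis using Cons.IH[OF _ F, of w] Cons.prems by auto
    qed (use Cons in auto)
  qed simp
  note z = this
  assume c: "set xs \<subseteq> carrier R" "supported M (length xs) j c"
  show ?thesis unfolding supported_def using z[OF c] c koszul_closed[of xs c] by (auto simp: supported_def)
qed

lemma contraction_closed: "(\<And>v. c v \<in> carrier M) \<Longrightarrow> contraction M j c v \<in> carrier M"
proof (induction v arbitrary: c j)
  case (Cons b v)
  show ?case by (cases j) (use Cons in auto)
qed simp

lemma contraction_add: "(\<And>v. c v \<in> carrier M) \<Longrightarrow> (\<And>v. e v \<in> carrier M) \<Longrightarrow>
    contraction M j (\<lambda>v. c v \<oplus>\<^bsub>M\<^esub> e v) v = contraction M j c v \<oplus>\<^bsub>M\<^esub> contraction M j e v"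
proof (induction v arbitrary: c e j)
  case (Cons b v)
  show ?case using Cons by (cases j) (simp_all add: M.minus_add contraction_closed)
qed simp

lemma contraction_smult: "(\<And>v. c v \<in> carrier M) \<Longrightarrow> a \<in> carrier R \<Longrightarrow>
    contraction M j (\<lambda>v. a \<odot>\<^bsub>M\<^esub> c v) v = a \<odot>\<^bsub>M\<^esub> contraction M j c v"
proof (induction v arbitrary: c j)
  case (Cons b v)
  show ?case using Cons by (cases j) (simp_all add: smult_r_minus contraction_closed)
qed simp

lemma contraction_minus: "(\<And>v. c v \<in> carrier M) \<Longrightarrow> (\<And>v. e v \<in> carrier M) \<Longrightarrow>
    contraction M j (\<lambda>v. c v \<ominus>\<^bsub>M\<^esub> e v) v = contraction M j c v \<ominus>\<^bsub>M\<^esub> contraction M j e v"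
proof -
  assume c: "\<And>v. c v \<in> carrier M" and e: "\<And>v. e v \<in> carrier M"
  have "contraction M j (\<lambda>v. \<ominus>\<^bsub>M\<^esub> e v) v = \<ominus>\<^bsub>M\<^esub> contraction M j e v"
    using contraction_smult[of e "\<ominus>\<^bsub>R\<^esub> \<one>\<^bsub>R\<^esub>" j v] e by (simp add: smult_l_minus contraction_closed)
  thus ?thesis using c e by (simp add: a_minus_def contraction_add)
qed

lemma contraction_supported: "supported M k i c \<Longrightarrow> supported M k (i - 1) (contraction M j c)"
proof -
  have "contraction M j c v = \<zero>\<^bsub>M\<^esub>" if "supported M k i c" "\<not> (length v = k \<and> weight v = i - 1)" for k i j c v
    using that
  proof (induction v arbitrary: c j k i)
    case (Cons b w)
    show ?case
    proof (cases k)
      case 0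
      hence z: "c v = \<zero>\<^bsub>M\<^esub>" if "v \<noteq> []" for v using Cons.prems(1) that by (auto simp: supported_def)
      hence "supported M 0 i (\<lambda>w. c (b # w))" for b by (simp add: supported_def)
      hence *: "contraction M j' (\<lambda>w. c (b # w)) w = \<zero>\<^bsub>M\<^esub>" if "w \<noteq> []" for j' b using Cons.IH[of 0 i] that by auto
      show ?thesis using z * by (cases j; cases "w = []") auto
    next
      case (Suc k')
      have F: "supported M k' i (\<lambda>w. c (False # w))" and T: "supported M k' (i - 1) (\<lambda>w. c (True # w))"
        using Cons.prems(1) Suc by (auto simp: supported_def)
      show ?thesis
        using Cons.IH[OF F] Cons.IH[OF T] Cons.prems Suc by (cases j; cases b) (auto simp: supported_def)
    qed
  qed simp
  note z = this
  assume c: "supported M k i c"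
  show ?thesis unfolding supported_def using z[OF c] c contraction_closed[of c j] by (auto simp: supported_def)
qed

text \<open>For \<open>j = 0\<close> the contraction moves the \<open>True\<close> half to the
  \<open>False\<close> half, and the cone differential returns \<open>x\<close> times the cochain.
  For larger \<open>j\<close> it acts on the two halves with opposite signs, so the terms containing
  \<open>x\<close> cancel and the induction hypothesis remains.\<close>

lemma contraction_homotopy: "set xs \<subseteq> carrier R \<Longrightarrow> (\<And>v. c v \<in> carrier M) \<Longrightarrow> j < length xs \<Longrightarrow> length v = length xs \<Longrightarrow>
    koszul M xs (contraction M j c) v \<oplus>\<^bsub>M\<^esub> contraction M j (koszul M xs c) v = (xs ! j) \<odot>\<^bsub>M\<^esub> c v"
proof (induction xs arbitrary: c j v)
  case (Cons x xs)
  have cl: "koszul M xs (\<lambda>w. c (b # w)) w \<in> carrier M" for b w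
    using Cons.prems by (auto intro!: koszul_closed)
  have xc: "x \<in> carrier R" and xsc: "set xs \<subseteq> carrier R" using Cons.prems(1) by auto
  have cc: "c v \<in> carrier M" for v by (rule Cons.prems)
  obtain b w where v: "v = b # w" "length w = length xs" using Cons.prems(4) by (cases v) auto
  show ?case
  proof (cases j)
    case 0
    show ?thesis
    proof (cases b)
      case True
      have "koszul M xs (\<lambda>w. \<zero>\<^bsub>M\<^esub>) w = \<zero>\<^bsub>M\<^esub>" by (rule koszul_zero[OF xsc]) simp
      thus ?thesis using 0 v True xc cc by simp
    next
      case False
      thus ?thesis using 0 v xc cc cl[of True w]
        by (simp add: a_minus_def) (metis M.a_comm M.a_inv_closed M.a_lcomm M.r_neg M.r_zero smult_closed)
    qed
  next
    case (Suc i)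
    hence i: "i < length xs" using Cons.prems(3) by simp
    have IH: "koszul M xs (contraction M i (\<lambda>w. c (b # w))) w \<oplus>\<^bsub>M\<^esub> contraction M i (koszul M xs (\<lambda>w. c (b # w))) w
        = (xs ! i) \<odot>\<^bsub>M\<^esub> c (b # w)" for b
      by (rule Cons.IH[OF xsc cc i v(2)])
    have hc: "contraction M i (\<lambda>w. c (b # w)) w \<in> carrier M" for b w by (rule contraction_closed) (rule cc)
    have khc: "koszul M xs (contraction M i (\<lambda>w. c (b # w))) w \<in> carrier M" for b
      by (rule koszul_closed[OF xsc hc])
    have hkc: "contraction M i (koszul M xs (\<lambda>w. c (b # w))) w \<in> carrier M" for b
      by (rule contraction_closed) (rule cl)
    have e1: "koszul M xs (\<lambda>w. \<ominus>\<^bsub>M\<^esub> contraction M i (\<lambda>w. c (True # w)) w) w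
        = \<ominus>\<^bsub>M\<^esub> koszul M xs (contraction M i (\<lambda>w. c (True # w))) w"
      by (rule koszul_neg[OF xsc hc])
    have e2: "contraction M i (\<lambda>w. x \<odot>\<^bsub>M\<^esub> c (False # w) \<ominus>\<^bsub>M\<^esub> koszul M xs (\<lambda>w. c (True # w)) w) w
        = x \<odot>\<^bsub>M\<^esub> contraction M i (\<lambda>w. c (False # w)) w \<ominus>\<^bsub>M\<^esub> contraction M i (koszul M xs (\<lambda>w. c (True # w))) w"
      using xc cc cl[of True] by (subst contraction_minus) (simp_all add: contraction_smult)
    show ?thesis
    proof (cases b)
      case True
      let ?A = "x \<odot>\<^bsub>M\<^esub> contraction M i (\<lambda>w. c (False # w)) w" and ?B = "koszul M xs (contraction M i (\<lambda>w. c (True # w))) w"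
        and ?C = "contraction M i (koszul M xs (\<lambda>w. c (True # w))) w"
      have "koszul M (x # xs) (contraction M j c) v \<oplus>\<^bsub>M\<^esub> contraction M j (koszul M (x # xs) c) v
        = (?A \<oplus>\<^bsub>M\<^esub> ?B) \<oplus>\<^bsub>M\<^esub> \<ominus>\<^bsub>M\<^esub> (?A \<ominus>\<^bsub>M\<^esub> ?C)"
        using v True Suc e1 e2 khc[of True] by (simp add: a_minus_def)
      also have "\<dots> = ?B \<oplus>\<^bsub>M\<^esub> ?C"
      proof -
        have A: "?A \<in> carrier M" using hc xc by simp
        have "(?A \<oplus>\<^bsub>M\<^esub> ?B) \<oplus>\<^bsub>M\<^esub> \<ominus>\<^bsub>M\<^esub> (?A \<ominus>\<^bsub>M\<^esub> ?C) = (\<ominus>\<^bsub>M\<^esub> ?A \<oplus>\<^bsub>M\<^esub> ?A) \<oplus>\<^bsub>M\<^esub> (?B \<oplus>\<^bsub>M\<^esub> ?C)"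
          using A khc[of True] hkc[of True] by (simp add: a_minus_def M.minus_add M.a_ac del: M.l_neg M.r_neg)
        thus ?thesis using A khc[of True] hkc[of True] by (simp add: M.l_neg)
      qed
      also have "\<dots> = xs ! i \<odot>\<^bsub>M\<^esub> c v" using IH[of True] v True by simp
      finally show ?thesis using Suc by simp
    next
      case False
      thus ?thesis using IH[of False] v Suc by simp
    qed
  qed
qed simp

end

definition koszul_mod :: "('a, 'm, 'x) module_scheme \<Rightarrow> 'a list \<Rightarrow> nat \<Rightarrow> ('a, bool list \<Rightarrow> 'm) module" where
  "koszul_mod M xs i = pow_module M (kos_index (length xs) i)"

lemma koszul_mod_carrier:
  assumes "module R M" shows "c \<in> carrier (koszul_mod M xs i) \<longleftrightarrow> supported M (length xs) (int i - 1) c"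
  unfolding koszul_mod_def by (rule kos_carrier[OF assms])

lemma koszul_mod_simps [simp]:
  "\<zero>\<^bsub>koszul_mod M xs i\<^esub> = (\<lambda>s. \<zero>\<^bsub>M\<^esub>)" "f \<oplus>\<^bsub>koszul_mod M xs i\<^esub> g = (\<lambda>s. f s \<oplus>\<^bsub>M\<^esub> g s)"
  "a \<odot>\<^bsub>koszul_mod M xs i\<^esub> f = (\<lambda>s. a \<odot>\<^bsub>M\<^esub> f s)"
  by (simp_all add: koszul_mod_def)

lemma supported_val: "supported M k j c \<Longrightarrow> c v \<in> carrier M"
  by (simp add: supported_def)

lemma koszul_complex:
  assumes "module R M" "set xs \<subseteq> carrier R"
  shows "complex R (koszul_mod M xs) (\<lambda>_. koszul M xs)"
proof (rule complex.intro)
  interpret module R M by fact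
  fix i
  show "Module.module R (koszul_mod M xs i)" unfolding koszul_mod_def by (rule pow_module_module[OF assms(1)])
  note val = supported_val[OF koszul_mod_carrier[OF assms(1), THEN iffD1]]
  show "lin R (koszul_mod M xs i) (koszul_mod M xs (Suc i)) (koszul M xs)"
  proof (rule linI)
    show "koszul M xs c \<in> carrier (koszul_mod M xs (Suc i))" if "c \<in> carrier (koszul_mod M xs i)" for c
      using koszul_supported[OF assms(2), of "int i - 1" c] that by (simp add: koszul_mod_carrier[OF assms(1)])
  qed (auto simp: fun_eq_iff koszul_add[OF assms(2)] koszul_smult[OF assms(2)] val)
  show "koszul M xs (koszul M xs c) = \<zero>\<^bsub>koszul_mod M xs (Suc (Suc i))\<^esub>" if "c \<in> carrier (koszul_mod M xs i)" for c
    using val[OF that] by (auto simp: fun_eq_iff koszul_koszul[OF assms(2)])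
qed

text \<open>The scalars \<open>a\<close> for which \<open>a c\<close> is a coboundary modulo
  \<open>Y\<close> form an ideal, and the contraction homotopies put every element of
  \<open>xs\<close> into it.\<close>

lemma koszul_homotopic_zero:
  assumes "module R M" "set xs \<subseteq> carrier R" "Y \<subseteq> carrier R" "a \<in> genideal R (set xs)"
    "c \<in> carrier (koszul_mod M xs (Suc i))" "koszul M xs c \<in> xsub R (koszul_mod M xs (Suc (Suc i))) Y"
  shows "\<exists>e\<in>carrier (koszul_mod M xs i).
    a \<odot>\<^bsub>koszul_mod M xs (Suc i)\<^esub> c \<ominus>\<^bsub>koszul_mod M xs (Suc i)\<^esub> koszul M xs e \<in> xsub R (koszul_mod M xs (Suc i)) Y"
proof -
  interpret module R M by fact
  interpret complex R "koszul_mod M xs" "\<lambda>_. koszul M xs" by (rule koszul_complex[OF assms(1,2)])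
  let ?C = "koszul_mod M xs"
  interpret C: module R "?C (Suc i)" by (rule mod)
  note s = xsub_sub[OF mod assms(3)]
  let ?B = "{x \<oplus>\<^bsub>?C (Suc i)\<^esub> y | x y. x \<in> koszul M xs ` carrier (?C i) \<and> y \<in> xsub R (?C (Suc i)) Y}"
  have B: "submodule ?B R (?C (Suc i))"
    by (intro sub_sum[OF mod _ s] sub_image[OF mod mod lin_\<delta> sub_carrier[OF mod]])
  have cv: "c v \<in> carrier M" for v using assms(5) by (auto simp: koszul_mod_carrier[OF assms(1)] supported_def)
  have lc: "lin R (?C (Suc (Suc i))) (?C (Suc i)) (contraction M j)" for j
  proof (rule linI)
    show "contraction M j e \<in> carrier (?C (Suc i))" if "e \<in> carrier (?C (Suc (Suc i)))" for e
      using contraction_supported[of "length xs" "1 + int i" e j] that by (simp add: koszul_mod_carrier[OF assms(1)])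
  qed (auto simp: fun_eq_iff koszul_mod_carrier[OF assms(1)] contraction_add contraction_smult supported_def)
  have l: "lin R (ring_module R) (?C (Suc i)) (\<lambda>a. a \<odot>\<^bsub>?C (Suc i)\<^esub> c)"
    by (rule lin_smult_left[OF mod]) (rule assms(5))
  have "genideal R (set xs) \<subseteq> {a \<in> carrier R. a \<odot>\<^bsub>?C (Suc i)\<^esub> c \<in> ?B}"
  proof (rule genideal_least)
    show "ideal {a \<in> carrier R. a \<odot>\<^bsub>?C (Suc i)\<^esub> c \<in> ?B} R"
      unfolding ideal_iff_submodule[OF R.is_cring]
      using sub_vimage[OF ring_module_module[OF R.is_cring] mod l B] by simp
    show "set xs \<subseteq> {a \<in> carrier R. a \<odot>\<^bsub>?C (Suc i)\<^esub> c \<in> ?B}"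
    proof
      fix x assume x: "x \<in> set xs"
      then obtain j where j: "j < length xs" "x = xs ! j" by (auto simp: in_set_conv_nth)
      have hc: "contraction M j c \<in> carrier (?C i)"
        using contraction_supported[of "length xs" "int i" c j] assms(5) by (simp add: koszul_mod_carrier[OF assms(1)])
      have "x \<odot>\<^bsub>?C (Suc i)\<^esub> c = koszul M xs (contraction M j c) \<oplus>\<^bsub>?C (Suc i)\<^esub> contraction M j (koszul M xs c)"
      proof
        fix v
        show "(x \<odot>\<^bsub>?C (Suc i)\<^esub> c) v = (koszul M xs (contraction M j c) \<oplus>\<^bsub>?C (Suc i)\<^esub> contraction M j (koszul M xs c)) v"
        \<comment> \<open>The homotopy identity concerns words of full length; on all other words
          both sides vanish by support.\<close>
        proof (cases "length v = length xs")
          case True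
          thus ?thesis using contraction_homotopy[OF assms(2) cv j(1) True] j(2) by simp
        next
          case False
          have "koszul M xs (contraction M j c) \<in> carrier (?C (Suc i))" by (rule lin_closed[OF lin_\<delta> hc])
          moreover have "contraction M j (koszul M xs c) \<in> carrier (?C (Suc i))"
            by (rule lin_closed[OF lc lin_closed[OF lin_\<delta> assms(5)]])
          ultimately show ?thesis using False assms(2,5) x by (auto simp: koszul_mod_carrier[OF assms(1)] supported_def)
        qed
      qed
      moreover have "contraction M j (koszul M xs c) \<in> xsub R (?C (Suc i)) Y"
        by (rule lin_xsub[OF mod mod lc assms(3,6)])
      ultimately show "x \<in> {a \<in> carrier R. a \<odot>\<^bsub>?C (Suc i)\<^esub> c \<in> ?B}" using x assms(2) hc by blast
    qed
  qed
  then obtain e l where e: "e \<in> carrier (?C i)" "l \<in> xsub R (?C (Suc i)) Y"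
    "a \<odot>\<^bsub>?C (Suc i)\<^esub> c = koszul M xs e \<oplus>\<^bsub>?C (Suc i)\<^esub> l" using assms(4) by blast
  have "a \<odot>\<^bsub>?C (Suc i)\<^esub> c \<ominus>\<^bsub>?C (Suc i)\<^esub> koszul M xs e = l"
    unfolding e(3) using C.M.add_minus_cancel(2) lin_closed[OF lin_\<delta> e(1)] sub_carr[OF s e(2)] by blast
  thus ?thesis using e(1,2) by auto
qed

lemma regular_mod_koszul:
  assumes "module R M" "X \<subseteq> carrier R" "regular_mod R M X x"
  shows "regular_mod R (koszul_mod M xs i) X x"
  unfolding koszul_mod_def by (rule regular_mod_pow[OF assms(1) finite_kos_index assms(2,3)])

text \<open>
  A power of \<open>y = ys ! k\<close> is null-homotopic and \<open>y\<close> is regular on the cochains, so exactness in degree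
  \<open>i + 1\<close> modulo \<open>take k ys\<close> follows from exactness in degree \<open>i\<close> modulo \<open>take (k + 1) ys\<close>.
\<close>

theorem koszul_exact:
  assumes "module R M" "set xs \<subseteq> carrier R" "set ys \<subseteq> carrier R" "regular_list R M ys"
    "\<And>y. y \<in> set ys \<Longrightarrow> \<exists>n::nat. y [^]\<^bsub>R\<^esub> n \<in> genideal R (set xs)" "i + k < length ys"
  shows "exact_mod R (koszul_mod M xs) (\<lambda>_. koszul M xs) (set (take k ys)) i"
  using assms(6)
proof (induction i arbitrary: k)
  interpret complex R "koszul_mod M xs" "\<lambda>_. koszul M xs" by (rule koszul_complex[OF assms(1,2)])
  {
    case 0
    have y: "ys ! k \<in> set ys" "ys ! k \<in> carrier R" using 0 assms(3) nth_mem[of k ys] by auto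
    obtain n :: nat where n: "(ys ! k) [^]\<^bsub>R\<^esub> n \<in> genideal R (set xs)" using assms(5)[OF y(1)] by blast
    note Y = set_take_carr[OF assms(3), of k]
    have r: "regular_mod R (koszul_mod M xs i) (set (take k ys)) (ys ! k)" for i
      using assms(4) 0 by (intro regular_mod_koszul[OF assms(1) Y]) (simp add: regular_list_def)
    \<comment> \<open>Weights are nonnegative, so position \<open>0\<close>, of degree
      \<open>-1\<close>, carries only the zero cochain.\<close>
    have "v \<notin> kos_index k 0" for k v using weight_nonneg[of v] by (simp add: kos_index_def)
    hence z: "zero_module (koszul_mod M xs 0)"
      by (auto simp: zero_module_def koszul_mod_def pow_carrier set_eq_iff)
    show ?case
      using koszul_homotopic_zero[OF assms(1,2) Y n, of _ 0]
      by (intro exact_bottom_power[OF z r Y y(2), of n])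
  next
    case (Suc i)
    have y: "ys ! k \<in> set ys" "ys ! k \<in> carrier R" using Suc.prems assms(3) nth_mem[of k ys] by auto
    obtain n :: nat where n: "(ys ! k) [^]\<^bsub>R\<^esub> n \<in> genideal R (set xs)" using assms(5)[OF y(1)] by blast
    note Y = set_take_carr[OF assms(3), of k]
    have r: "regular_mod R (koszul_mod M xs i) (set (take k ys)) (ys ! k)" for i
      using assms(4) Suc.prems by (intro regular_mod_koszul[OF assms(1) Y]) (simp add: regular_list_def)
    have "set (take (Suc k) ys) = insert (ys ! k) (set (take k ys))"
      using Suc.prems by (simp add: take_Suc_conv_app_nth)
    hence ex: "exact_mod R (koszul_mod M xs) (\<lambda>_. koszul M xs) (insert (ys ! k) (set (take k ys))) i"
      using Suc.IH[of "Suc k"] Suc.prems by simp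
    show ?case
      by (rule exact_step_down_power[OF ex r Y y(2), of n]) (rule koszul_homotopic_zero[OF assms(1,2) Y n])
  }
qed

lemma exact_mod_empty:
  assumes "complex R C \<delta>"
  shows "exact_mod R C \<delta> {} i \<longleftrightarrow>
    (\<forall>c\<in>carrier (C (Suc i)). \<delta> (Suc i) c = \<zero>\<^bsub>C (Suc (Suc i))\<^esub> \<longrightarrow> (\<exists>e\<in>carrier (C i). c = \<delta> i e))"
proof -
  interpret complex R C \<delta> by fact
  interpret M: module R "C (Suc i)" by (rule mod)
  have "c \<ominus>\<^bsub>C (Suc i)\<^esub> \<delta> i e = \<zero>\<^bsub>C (Suc i)\<^esub> \<longleftrightarrow> c = \<delta> i e" if "c \<in> carrier (C (Suc i))" "e \<in> carrier (C i)" for c e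
  proof -
    have d: "\<delta> i e \<in> carrier (C (Suc i))" by (rule lin_closed[OF lin_\<delta> that(2)])
    show ?thesis using M.M.add_minus_cancel(3)[OF that(1) d] d by (auto simp: a_minus_def M.M.r_neg)
  qed
  thus ?thesis unfolding exact_mod_def by (simp add: xsub_empty[OF mod] cong: ball_cong bex_cong)
qed

section \<open>The top degree of the Koszul complex\<close>

context module
begin

lemma koszul_top_in: "set xs \<subseteq> carrier R \<Longrightarrow> (\<And>v. c v \<in> carrier M) \<Longrightarrow> koszul M xs c v \<in> xsub R M (set xs)"
proof (induction xs arbitrary: c v)
  case Nil
  show ?case using sub_zero[OF xsub_sub[OF module_axioms, of "{}"]] by simp
next
  case (Cons x xs)
  note s = xsub_sub[OF module_axioms Cons.prems(1)]
  have "set xs \<subseteq> set (x # xs)" by auto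
  note mono = subsetD[OF xsub_mono[OF module_axioms Cons.prems(1) this]]
  have t: "koszul M xs (\<lambda>w. c (b # w)) w \<in> xsub R M (set (x # xs))" for b w
    using Cons.prems by (intro mono Cons.IH) auto
  show ?case
  proof (cases v rule: bits_cases)
    case Nil thus ?thesis using sub_zero[OF s] by simp
  next
    case (False w) thus ?thesis using t by simp
  next
    case (True w)
    have "x \<odot>\<^bsub>M\<^esub> c (False # w) \<in> xsub R M (set (x # xs))" by (rule xsub_mem) (use Cons.prems(2) in auto)
    thus ?thesis using sub_minus[OF s _ t] True by simp
  qed
qed

lemma contraction_full: "contraction M j c (replicate k True) = \<zero>\<^bsub>M\<^esub>"
proof (induction k arbitrary: j c)
  case (Suc k)
  show ?case using Suc by (cases j) auto
qed simp

lemma supported_full: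
  assumes "supported M k (int k) c" "v \<noteq> replicate k True" shows "c v = \<zero>\<^bsub>M\<^esub>"
  using assms weight_full[of v] by (auto simp: supported_def)

lemma supported_beyond:
  assumes "supported M k j c" "j > int k" shows "c v = \<zero>\<^bsub>M\<^esub>"
  using assms weight_le[of v] by (auto simp: supported_def)

text \<open>The top cochain with value \<open>u\<close>: the only word of length and weight
  \<open>k\<close> is the one with all bits \<open>True\<close>.\<close>

definition full :: "nat \<Rightarrow> 'c \<Rightarrow> bool list \<Rightarrow> 'c" where
  "full k u = (\<lambda>v. if v = replicate k True then u else \<zero>\<^bsub>M\<^esub>)"

lemma weight_replicate: "weight (replicate k True) = int k"
  using weight_full[of "replicate k True"] by simp

lemma full_supported: "u \<in> carrier M \<Longrightarrow> supported M k (int k) (full k u)"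
  by (auto simp: supported_def full_def weight_replicate)

text \<open>Together with \<open>koszul_top_in\<close> this identifies the top cohomology with
  \<open>M / (xs) M\<close>. A multiple \<open>x u\<close> is a value of the differential of the
  contraction of \<open>full k u\<close>, because the other term of the homotopy is itself a
  contraction and vanishes at the all-\<open>True\<close> word.\<close>

lemma koszul_top:
  assumes "set xs \<subseteq> carrier R" "u \<in> xsub R M (set xs)"
  obtains e where "supported M (length xs) (int (length xs) - 1) e" "koszul M xs e (replicate (length xs) True) = u"
proof -
  interpret complex R "koszul_mod M xs" "\<lambda>_. koszul M xs" by (rule koszul_complex[OF module_axioms assms(1)])
  let ?k = "length xs"
  let ?T = "replicate ?k True"
  let ?K = "koszul_mod M xs ?k"
  have l: "lin R ?K M (\<lambda>e. koszul M xs e ?T)"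
    using lin_comp[OF lin_\<delta>[of ?k] lin_pow_eval[OF module_axioms, of "kos_index ?k (Suc ?k)" ?T, folded koszul_mod_def]] .
  have "xsub R M (set xs) \<subseteq> (\<lambda>e. koszul M xs e ?T) ` carrier ?K"
  proof (rule xsub_least[OF module_axioms assms(1) sub_image[OF mod module_axioms l sub_carrier[OF mod]]])
    fix x u assume x: "x \<in> set xs" and u: "u \<in> carrier M"
    then obtain j where j: "j < ?k" "x = xs ! j" by (auto simp: in_set_conv_nth)
    have s: "supported M ?k (int ?k) (full ?k u)" by (rule full_supported[OF u])
    have v: "full ?k u v \<in> carrier M" for v by (rule supported_val[OF s])
    have c: "contraction M j (full ?k u) \<in> carrier ?K"
      using contraction_supported[OF s] by (simp add: koszul_mod_carrier[OF module_axioms])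
    have "koszul M xs (contraction M j (full ?k u)) ?T \<in> carrier M"
      by (rule koszul_closed[OF assms(1) contraction_closed[OF v]])
    hence "koszul M xs (contraction M j (full ?k u)) ?T = x \<odot>\<^bsub>M\<^esub> u"
      using contraction_homotopy[OF assms(1), of "full ?k u" j ?T] v j contraction_full by (simp add: full_def)
    thus "x \<odot>\<^bsub>M\<^esub> u \<in> (\<lambda>e. koszul M xs e ?T) ` carrier ?K" using c by (intro image_eqI[OF _ c]) simp
  qed
  then obtain e where "e \<in> carrier ?K" "koszul M xs e ?T = u" using assms(2) by auto
  thus ?thesis using that[of e] by (simp add: koszul_mod_carrier[OF module_axioms])
qed

end

text \<open>
  Here Nakayama's lemma turns surjectivity of \<open>x\<close> on the cohomology of the tail into vanishing.
\<close>

lemma koszul_tail: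
  assumes "local_ring R" "finite_module R M" "set (x # xs) \<subseteq> max_ideal R"
    "\<And>i. i < Suc (length xs) \<Longrightarrow> exact_mod R (koszul_mod M (x # xs)) (\<lambda>_. koszul M (x # xs)) {} i"
  shows "i < length xs \<Longrightarrow> exact_mod R (koszul_mod M xs) (\<lambda>_. koszul M xs) {} i"
    and "regular_mod R M (set xs) x"
proof -
  interpret module R M using assms(2) by (simp add: finite_module_def)
  have X: "set (x # xs) \<subseteq> carrier R" using assms(3) max_ideal_carr[OF assms(1)] by auto
  hence xs: "set xs \<subseteq> carrier R" and x: "x \<in> carrier R" by auto
  note cX = koszul_complex[OF module_axioms X] and cx = koszul_complex[OF module_axioms xs]
  interpret complex R "koszul_mod M xs" "\<lambda>_. koszul M xs" by (rule cx)
  note car = koszul_mod_carrier[OF module_axioms]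
  let ?k = "length xs"
  have ex: "\<exists>e. supported M (Suc ?k) (int i - 1) e \<and> c = koszul M (x # xs) e"
    if "i < Suc ?k" "supported M (Suc ?k) (int i) c" "\<And>v. koszul M (x # xs) c v = \<zero>\<^bsub>M\<^esub>" for i c
  proof -
    have "\<exists>e\<in>carrier (koszul_mod M (x # xs) i). c = koszul M (x # xs) e"
      using assms(4)[OF that(1)] that(2,3) unfolding exact_mod_empty[OF cX]
      by (auto simp: car fun_eq_iff)
    thus ?thesis by (auto simp: car)
  qed
  show "exact_mod R (koszul_mod M xs) (\<lambda>_. koszul M xs) {} i" if i: "i < ?k" for i
    unfolding exact_mod_empty[OF cx]
  proof (intro ballI impI)
    fix c assume c: "c \<in> carrier (koszul_mod M xs (Suc i))" "koszul M xs c = \<zero>\<^bsub>koszul_mod M xs (Suc (Suc i))\<^esub>"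
    let ?C = "koszul_mod M xs (Suc i)"
    let ?Z = "mod_ker ?C (koszul_mod M xs (Suc (Suc i))) (koszul M xs)"
    let ?B = "koszul M xs ` carrier (koszul_mod M xs i)"
    have Z: "submodule ?Z R ?C" by (rule sub_ker[OF mod mod lin_\<delta>])
    have B: "submodule ?B R ?C" by (rule sub_image[OF mod mod lin_\<delta> sub_carrier[OF mod]])
    have "fg R ?C ?Z"
      using pow_finite_module[OF assms(2) finite_kos_index]
      by (intro noetherian_module[OF local_noetherian[OF assms(1)] _ Z]) (simp add: koszul_mod_def)
    then obtain n z where z: "z \<in> {..<n} \<rightarrow> ?Z" "z \<in> {..<n} \<rightarrow> carrier ?C" "?Z = lincomb ?C n z ` carrier (finite_free R n)"
      using fg_family[OF mod] by metis
    interpret C: module R ?C by (rule mod)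
    \<comment> \<open>The long exact sequence of the mapping cone: vanishing of the cohomology of
      \<open>x # xs\<close> in the next degree makes \<open>x\<close> surjective on the cohomology
      of \<open>xs\<close>, so every cocycle is a coboundary plus \<open>x\<close> times a
      cocycle.\<close>
    have key: "\<exists>b\<in>?B. \<exists>w\<in>?Z. h = b \<oplus>\<^bsub>?C\<^esub> x \<odot>\<^bsub>?C\<^esub> w" if h: "h \<in> ?Z" for h
    proof -
      have hs: "supported M ?k (int i) h" and hk: "koszul M xs h w = \<zero>\<^bsub>M\<^esub>" for w
        using h by (auto simp: mod_ker_def car fun_eq_iff)
      \<comment> \<open>The cocycle \<open>h\<close> is placed on the half with first bit
        \<open>True\<close>; a primitive of it then has a cocycle as its \<open>False\<close>
        half.\<close>
      define g where "g = (\<lambda>v. case v of True # w \<Rightarrow> h w | _ \<Rightarrow> \<zero>\<^bsub>M\<^esub>)"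
      have gs: "g [] = \<zero>\<^bsub>M\<^esub>" "g (False # w) = \<zero>\<^bsub>M\<^esub>" "g (True # w) = h w" for w by (auto simp: g_def)
      have gS: "supported M (Suc ?k) (int (Suc i)) g"
        unfolding supported_def
      proof (intro conjI allI impI)
        fix v show "g v \<in> carrier M" using supported_val[OF hs] by (cases v rule: bits_cases) (auto simp: gs)
        assume "\<not> (length v = Suc ?k \<and> weight v = int (Suc i))"
        thus "g v = \<zero>\<^bsub>M\<^esub>" using hs by (cases v rule: bits_cases) (auto simp: gs supported_def)
      qed
      have gk: "koszul M (x # xs) g v = \<zero>\<^bsub>M\<^esub>" for v
        by (cases v rule: bits_cases) (use x hk koszul_zero[OF xs, of "\<lambda>_. \<zero>\<^bsub>M\<^esub>"] in \<open>auto simp: gs\<close>)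
      obtain e where e: "supported M (Suc ?k) (int i) e" "g = koszul M (x # xs) e"
        using ex[OF _ gS gk] i by auto
      have e0: "supported M ?k (int i) (\<lambda>w. e (False # w))" and e1: "supported M ?k (int i - 1) (\<lambda>w. e (True # w))"
        using e(1) by (auto simp: supported_def)
      have k0: "koszul M xs (\<lambda>w. e (False # w)) w = \<zero>\<^bsub>M\<^esub>" for w using gs(2)[of w] e(2) by simp
      have k1: "h w = x \<odot>\<^bsub>M\<^esub> e (False # w) \<ominus>\<^bsub>M\<^esub> koszul M xs (\<lambda>w. e (True # w)) w" for w using gs(3)[of w] e(2) by simp
      have v1: "e v \<in> carrier M" for v by (rule supported_val[OF e(1)])
      have "h = koszul M xs (\<lambda>w. \<ominus>\<^bsub>M\<^esub> e (True # w)) \<oplus>\<^bsub>?C\<^esub> x \<odot>\<^bsub>?C\<^esub> (\<lambda>w. e (False # w))"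
        using k1 v1 x xs by (auto simp: fun_eq_iff koszul_neg koszul_closed a_minus_def M.a_comm)
      moreover have "(\<lambda>w. \<ominus>\<^bsub>M\<^esub> e (True # w)) \<in> carrier (koszul_mod M xs i)"
        using e1 by (auto simp: car supported_def)
      moreover have "(\<lambda>w. e (False # w)) \<in> ?Z" using e0 k0 by (auto simp: mod_ker_def car fun_eq_iff)
      ultimately show ?thesis by blast
    qed
    \<comment> \<open>Since \<open>x\<close> lies in the maximal ideal, writing the second cocycle
      in the generators \<open>z\<close> gives an expression with coefficients in that
      ideal.\<close>
    have "z l \<in> ?B" if l: "l < n" for l
    proof (rule nakayama[OF assms(1) mod B z(2) _ l])
      fix l assume "l < n"
      hence "z l \<in> ?Z" using z(1) by auto
      from key[OF this] obtain b w where bw: "b \<in> ?B" "w \<in> ?Z" "z l = b \<oplus>\<^bsub>?C\<^esub> x \<odot>\<^bsub>?C\<^esub> w" by blast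
      then obtain r where r: "r \<in> carrier (finite_free R n)" "w = lincomb ?C n z r" using z(3) by auto
      have "x \<odot>\<^bsub>?C\<^esub> w = lincomb ?C n z (x \<odot>\<^bsub>finite_free R n\<^esub> r)"
        using lin_smult[OF lin_lincomb[OF mod z(2)] x r(1)] r(2) by simp
      moreover have "(x \<odot>\<^bsub>finite_free R n\<^esub> r) \<in> {..<n} \<rightarrow> max_ideal R"
        using assms(3) finite_free_val[OF R.is_cring r(1)] ideal.I_r_closed[OF max_ideal_ideal[OF assms(1)]] by auto
      ultimately show "\<exists>b\<in>?B. \<exists>c\<in>{..<n} \<rightarrow> max_ideal R. z l = b \<oplus>\<^bsub>?C\<^esub> lincomb ?C n z c" using bw by metis
    qed
    hence "lincomb ?C n z r \<in> ?B" if "r \<in> carrier (finite_free R n)" for r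
      using finite_free_val[OF R.is_cring that] by (intro lincomb_in_sub[OF mod B] sub_smult[OF B])
    moreover have "c \<in> ?Z" using c by (simp add: mod_ker_def)
    ultimately show "\<exists>e\<in>carrier (koszul_mod M xs i). c = koszul M xs e" using z(3) by auto
  qed
  show "regular_mod R M (set xs) x" unfolding regular_mod_def
  proof (intro ballI impI)
    fix u assume u: "u \<in> carrier M" "x \<odot>\<^bsub>M\<^esub> u \<in> xsub R M (set xs)"
    let ?T = "replicate ?k True"
    obtain e where e: "supported M ?k (int ?k - 1) e" "koszul M xs e ?T = x \<odot>\<^bsub>M\<^esub> u"
      using koszul_top[OF xs u(2)] .
    \<comment> \<open>The equation \<open>x u = \<partial> e\<close> at the top says that
      \<open>full ?k u\<close> and \<open>e\<close> together form a cocycle of the mapping cone, one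
      degree below its top.\<close>
    define c where "c = (\<lambda>v. case v of [] \<Rightarrow> \<zero>\<^bsub>M\<^esub> | b # w \<Rightarrow> if b then e w else full ?k u w)"
    have cs: "c [] = \<zero>\<^bsub>M\<^esub>" "c (False # w) = full ?k u w" "c (True # w) = e w" for w by (auto simp: c_def)
    note fs = full_supported[OF u(1), of ?k]
    have cS: "supported M (Suc ?k) (int ?k) c"
      unfolding supported_def
    proof (intro conjI allI impI)
      fix v show "c v \<in> carrier M" using supported_val[OF e(1)] supported_val[OF fs] by (cases v rule: bits_cases) (auto simp: cs)
      assume "\<not> (length v = Suc ?k \<and> weight v = int ?k)"
      thus "c v = \<zero>\<^bsub>M\<^esub>" using e(1) fs by (cases v rule: bits_cases) (auto simp: cs supported_def)
    qed
    have kf: "koszul M xs (full ?k u) w = \<zero>\<^bsub>M\<^esub>" for w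
      by (rule supported_beyond[OF koszul_supported[OF xs fs]]) simp
    have ke: "koszul M xs e w = \<zero>\<^bsub>M\<^esub>" if "w \<noteq> ?T" for w
      using koszul_supported[OF xs e(1)] that by (intro supported_full[of ?k]) simp
    have "koszul M (x # xs) c v = \<zero>\<^bsub>M\<^esub>" for v
    proof (cases v rule: bits_cases)
      case (True w)
      show ?thesis
      proof (cases "w = ?T")
        case True2: True
        thus ?thesis using True e(2) u(1) x by (simp add: cs full_def a_minus_def M.r_neg)
      next
        case False
        thus ?thesis using True ke x by (simp add: cs full_def)
      qed
    qed (use kf in \<open>auto simp: cs\<close>)
    then obtain f where f: "supported M (Suc ?k) (int ?k - 1) f" "c = koszul M (x # xs) f" using ex[OF _ cS] by auto
    \<comment> \<open>The \<open>False\<close> half of a primitive exhibits \<open>u\<close> itself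
      as a value of the differential for \<open>xs\<close>.\<close>
    have "u = koszul M xs (\<lambda>w. f (False # w)) ?T" using cs(2)[of ?T] f(2) by (simp add: full_def)
    thus "u \<in> xsub R M (set xs)" using koszul_top_in[OF xs] supported_val[OF f(1)] by simp
  qed
qed

text \<open>Each use of \<open>koszul_tail\<close> discards the first element of the list and keeps
  exactness below the top degree; once \<open>x\<close> comes first, the second half of that lemma
  gives its regularity modulo the rest.\<close>

lemma koszul_regular:
  assumes "local_ring R" "finite_module R M" "set (as @ x # bs) \<subseteq> max_ideal R"
    "\<And>i. i < length (as @ x # bs) \<Longrightarrow> exact_mod R (koszul_mod M (as @ x # bs)) (\<lambda>_. koszul M (as @ x # bs)) {} i"
  shows "regular_mod R M (set bs) x"
  using assms(3,4)
proof (induction as)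
  case Nil
  thus ?case using koszul_tail(2)[OF assms(1,2), of x bs] by simp
next
  case (Cons a as)
  show ?case
  proof (rule Cons.IH)
    fix i assume "i < length (as @ x # bs)"
    thus "exact_mod R (koszul_mod M (as @ x # bs)) (\<lambda>_. koszul M (as @ x # bs)) {} i"
      using Cons.prems by (intro koszul_tail(1)[OF assms(1,2), of a "as @ x # bs"]) auto
  qed (use Cons.prems in auto)
qed

section \<open>Depth\<close>

text \<open>
  The Koszul complex of \<open>rev xs\<close> is exact below the top degree because \<open>ys\<close> is regular; splitting off
  the elements of \<open>rev xs\<close> one by one, each of them is regular modulo the remaining ones.
\<close>

theorem regular_exchange:
  assumes "local_ring R" "finite_module R M" "set xs \<subseteq> max_ideal R" "set ys \<subseteq> max_ideal R"
    "\<And>y. y \<in> set ys \<Longrightarrow> \<exists>n::nat. y [^]\<^bsub>R\<^esub> n \<in> genideal R (set xs)"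
    "regular_list R M ys" "length xs = length ys"
  shows "regular_list R M xs"
  unfolding regular_list_def
proof (intro allI impI)
  fix i assume i: "i < length xs"
  have M: "module R M" using assms(2) by (simp add: finite_module_def)
  note mc = max_ideal_carr[OF assms(1)]
  \<comment> \<open>The list is reversed because the cone splits off the first element and makes it
    regular modulo the later ones, whereas a regular sequence refers to the earlier ones.\<close>
  have e: "rev xs = rev (drop (Suc i) xs) @ xs ! i # rev (take i xs)"
    using arg_cong[OF id_take_nth_drop[OF i], of rev] by simp
  have rx: "set (rev xs) \<subseteq> carrier R" and yc: "set ys \<subseteq> carrier R" using assms(3,4) mc by auto
  have "regular_mod R M (set (rev (take i xs))) (xs ! i)"
  proof (rule koszul_regular[OF assms(1,2), of "rev (drop (Suc i) xs)"])
    fix j assume "j < length (rev (drop (Suc i) xs) @ xs ! i # rev (take i xs))"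
    hence "j + 0 < length ys" using assms(7) i by (simp flip: e)
    from koszul_exact[OF M rx yc assms(6) _ this] assms(5)
    show "exact_mod R (koszul_mod M (rev (drop (Suc i) xs) @ xs ! i # rev (take i xs)))
       (\<lambda>_. koszul M (rev (drop (Suc i) xs) @ xs ! i # rev (take i xs))) {} j"
      by (simp add: flip: e)
  qed (use assms(3) in \<open>simp flip: e\<close>)
  thus "regular_mod R M (set (take i xs)) (xs ! i)" by simp
qed

text \<open>If \<open>ys\<close> were longer than \<open>xs\<close>, exactness would reach the top
  Koszul degree of \<open>xs\<close>, where the cohomology is \<open>M / (xs) M\<close>.\<close>

lemma regular_length_le:
  assumes "module R M" "set xs \<subseteq> carrier R" "set ys \<subseteq> carrier R"
    "\<And>y. y \<in> set ys \<Longrightarrow> \<exists>n::nat. y [^]\<^bsub>R\<^esub> n \<in> genideal R (set xs)"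
    "regular_list R M ys" "xsub R M (set xs) \<noteq> carrier M"
  shows "length ys \<le> length xs"
proof (rule ccontr)
  assume "\<not> length ys \<le> length xs"
  hence l: "length xs + 0 < length ys" by simp
  interpret module R M by fact
  let ?k = "length xs"
  have ex: "exact_mod R (koszul_mod M xs) (\<lambda>_. koszul M xs) {} ?k"
    using koszul_exact[OF assms(1-3,5,4) l] by simp
  have "carrier M \<subseteq> xsub R M (set xs)"
  proof
    fix u assume u: "u \<in> carrier M"
    note fs = full_supported[OF u, of ?k]
    have kf: "koszul M xs (full ?k u) w = \<zero>\<^bsub>M\<^esub>" for w
      by (rule supported_beyond[OF koszul_supported[OF assms(2) fs]]) simp
    have "full ?k u \<in> carrier (koszul_mod M xs (Suc ?k))" using fs by (simp add: koszul_mod_carrier[OF assms(1)])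
    moreover have "koszul M xs (full ?k u) = \<zero>\<^bsub>koszul_mod M xs (Suc (Suc ?k))\<^esub>" using kf by (simp add: fun_eq_iff)
    ultimately obtain e where e: "e \<in> carrier (koszul_mod M xs ?k)" "full ?k u = koszul M xs e"
      using ex unfolding exact_mod_empty[OF koszul_complex[OF assms(1,2)]] by blast
    have "u = koszul M xs e (replicate ?k True)" unfolding e(2)[symmetric] by (simp add: full_def)
    thus "u \<in> xsub R M (set xs)"
      using koszul_top_in[OF assms(2)] e(1) by (simp add: koszul_mod_carrier[OF assms(1)] supported_def)
  qed
  thus False using assms(6) sub_carr[OF xsub_sub[OF assms(1,2)]] by blast
qed

lemma xsub_ne_carrier:
  assumes "local_ring R" "finite_module R M" "set xs \<subseteq> max_ideal R" "\<not> zero_module M"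
  shows "xsub R M (set xs) \<noteq> carrier M"
proof
  assume e: "xsub R M (set xs) = carrier M"
  interpret module R M using assms(2) by (simp add: finite_module_def)
  have "xsub R M (set xs) \<subseteq> ideal_smult R (max_ideal R) M"
    unfolding xsub_def by (intro ismult_mono genideal_least max_ideal_ideal assms)
  hence "{\<zero>\<^bsub>M\<^esub>} = carrier M"
    using e by (intro nakayama_module[OF assms(1,2) sub_zero_sub[OF module_axioms]]) (auto dest: M.l_zero[symmetric])
  thus False using assms(4) by (simp add: zero_module_def)
qed

text \<open>A finite supremum bounds the set, so it is a maximum; for lengths of regular sequences
  this yields one whose length is the depth.\<close>

lemma enat_Sup_attained:
  fixes A :: "nat set"
  assumes "A \<noteq> {}" "(SUP n\<in>A. enat n) = enat d"
  shows "d \<in> A"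
proof -
  have le: "n \<le> d" if "n \<in> A" for n using SUP_upper[OF that, of enat] assms(2) by simp
  hence fin: "finite A" by (meson finite_nat_set_iff_bounded_le)
  have "(SUP n\<in>A. enat n) \<le> enat (Max A)" by (rule SUP_least) (use fin in simp)
  hence "d \<le> Max A" using assms(2) by simp
  moreover have "Max A \<in> A" by (rule Max_in[OF fin assms(1)])
  ultimately show ?thesis using le by (metis le_antisym)
qed

lemma depth_regular_list:
  assumes "local_ring R" "finite_module R M" "depth R M = enat d"
  shows "\<not> zero_module M" and "\<exists>ys. set ys \<subseteq> max_ideal R \<and> length ys = d \<and> regular_list R M ys"
proof -
  have M: "module R M" using assms(2) by (simp add: finite_module_def)
  show z: "\<not> zero_module M" using assms(3) by (auto simp: depth_def)
  let ?A = "{xs. set xs \<subseteq> max_ideal R \<and> regular_seq R M xs}"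
  have "[] \<in> ?A" using regular_seq_iff[OF M, of "[]"] z by (auto simp: regular_list_def xsub_empty[OF M] zero_module_def)
  moreover have "(SUP n\<in>length ` ?A. enat n) = enat d" using assms(3) z by (simp add: depth_def image_image)
  ultimately have "d \<in> length ` ?A" by (intro enat_Sup_attained) blast+
  then obtain ys where ys: "set ys \<subseteq> max_ideal R" "regular_seq R M ys" "length ys = d" by auto
  have "set ys \<subseteq> carrier R" using ys(1) max_ideal_carr[OF assms(1)] by auto
  thus "\<exists>ys. set ys \<subseteq> max_ideal R \<and> length ys = d \<and> regular_list R M ys"
    using ys regular_seq_iff[OF M] by blast
qed

text \<open>No regular sequence is longer, by \<open>regular_length_le\<close>, since every element
  of the maximal ideal has a power in the ideal of \<open>xs\<close>.\<close>

lemma depth_eqI: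
  assumes "local_ring R" "finite_module R M" "\<not> zero_module M" "set xs \<subseteq> max_ideal R"
    "\<And>y. y \<in> max_ideal R \<Longrightarrow> \<exists>n::nat. y [^]\<^bsub>R\<^esub> n \<in> genideal R (set xs)" "regular_list R M xs"
  shows "depth R M = enat (length xs)"
proof -
  have M: "module R M" using assms(2) by (simp add: finite_module_def)
  note mc = max_ideal_carr[OF assms(1)]
  have xc: "set xs \<subseteq> carrier R" using assms(4) mc by auto
  note ne = xsub_ne_carrier[OF assms(1,2,4,3)]
  have "(SUP ys\<in>{xs. set xs \<subseteq> max_ideal R \<and> regular_seq R M xs}. enat (length ys)) = enat (length xs)"
  proof (rule antisym)
    show "(SUP ys\<in>{xs. set xs \<subseteq> max_ideal R \<and> regular_seq R M xs}. enat (length ys)) \<le> enat (length xs)"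
    proof (rule SUP_least)
      fix ys assume ys: "ys \<in> {xs. set xs \<subseteq> max_ideal R \<and> regular_seq R M xs}"
      hence yc: "set ys \<subseteq> carrier R" using mc by auto
      have "length ys \<le> length xs"
        using ys regular_seq_iff[OF M yc] assms(5) by (intro regular_length_le[OF M xc yc _ _ ne]) auto
      thus "enat (length ys) \<le> enat (length xs)" by simp
    qed
    show "enat (length xs) \<le> (SUP ys\<in>{xs. set xs \<subseteq> max_ideal R \<and> regular_seq R M xs}. enat (length ys))"
      using assms(4,6) ne regular_seq_iff[OF M xc] by (intro SUP_upper) auto
  qed
  thus ?thesis using assms(3) by (simp add: depth_def)
qed

section \<open>Free resolutions\<close>

lemma lincomb_cong:
  assumes "module R M" "\<And>i. i < n \<Longrightarrow> u i = v i" "\<And>i. i < n \<Longrightarrow> r i = q i"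
    "\<And>i. i < n \<Longrightarrow> v i \<in> carrier M" "\<And>i. i < n \<Longrightarrow> q i \<in> carrier R"
  shows "lincomb M n u r = lincomb M n v q"
proof -
  interpret module R M by fact
  show ?thesis unfolding lincomb_def using assms(2-5) by (intro M.finsum_cong') auto
qed

text \<open>Unit vectors are lifted one by one. In place of surjectivity of \<open>g\<close>, the
  values of \<open>h\<close> are required to be attained, because a differential of a resolution is
  onto a kernel only.\<close>

lemma free_lift:
  assumes "module R Y" "module R Z" "lin R (finite_free R n) Y h" "lin R Z Y g"
    "\<And>x. x \<in> carrier (finite_free R n) \<Longrightarrow> h x \<in> g ` carrier Z"
  obtains k where "lin R (finite_free R n) Z k" "\<And>x. x \<in> carrier (finite_free R n) \<Longrightarrow> g (k x) = h x"
proof -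
  interpret Z: module R Z by fact
  note uv = unit_vec_carrier[OF Z.R.is_cring]
  have "\<forall>i\<in>{..<n}. \<exists>z\<in>carrier Z. g z = h (unit_vec R i)"
  proof
    fix i assume "i \<in> {..<n}"
    hence "h (unit_vec R i) \<in> g ` carrier Z" by (intro assms(5) uv) simp
    thus "\<exists>z\<in>carrier Z. g z = h (unit_vec R i)" by auto
  qed
  then obtain u where u: "\<And>i. i < n \<Longrightarrow> u i \<in> carrier Z" "\<And>i. i < n \<Longrightarrow> g (u i) = h (unit_vec R i)"
    unfolding Ball_def Bex_def lessThan_iff by metis
  have uc: "u \<in> {..<n} \<rightarrow> carrier Z" using u(1) by auto
  note lk = lin_lincomb[OF assms(2) uc]
  show ?thesis
  proof (rule that[OF lk])
    fix x assume x: "x \<in> carrier (finite_free R n)"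
    have "g (lincomb Z n u x) = lincomb Y n (\<lambda>i. g (lincomb Z n u (unit_vec R i))) x"
      by (rule lin_free_eq[OF assms(1) lin_comp[OF lk assms(4)] x])
    also have "\<dots> = lincomb Y n (\<lambda>i. h (unit_vec R i)) x"
      using lincomb_unit[OF assms(2) uc] u(2) lin_closed[OF assms(3) uv] finite_free_val[OF Z.R.is_cring x]
      by (intro lincomb_cong[OF assms(1)]) auto
    also have "\<dots> = h x" by (rule lin_free_eq[OF assms(1,3) x, symmetric])
    finally show "g (lincomb Z n u x) = h x" .
  qed
qed

lemma free_cover_ker:
  assumes "cring R" "noetherian_ring R" "lin R (finite_free R n) Y f" "module R Y"
  shows "\<exists>k g. g \<in> mod_hom R (finite_free R k) (finite_free R n) \<and>
    mod_ker (finite_free R n) Y f = g ` carrier (finite_free R k)"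
proof -
  note F = finite_free_module[OF assms(1)]
  have "fg R (finite_free R n) (mod_ker (finite_free R n) Y f)"
    by (rule noetherian_free[OF assms(1,2) sub_ker[OF F assms(4,3)]])
  then obtain k u where u: "u \<in> {..<k} \<rightarrow> carrier (finite_free R n)"
    "mod_ker (finite_free R n) Y f = lincomb (finite_free R n) k u ` carrier (finite_free R k)"
    using fg_family[OF F] by metis
  have "restrict (lincomb (finite_free R n) k u) (carrier (finite_free R k)) \<in> mod_hom R (finite_free R k) (finite_free R n)"
    by (rule restrict_mod_hom[OF F lin_lincomb[OF F u(1)]])
  moreover have "mod_ker (finite_free R n) Y f =
    restrict (lincomb (finite_free R n) k u) (carrier (finite_free R k)) ` carrier (finite_free R k)"
    using u(2) by simp
  ultimately show ?thesis by blast
qed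

text \<open>The augmentation and the first differential are prescribed, so that a resolution can be
  made to start with a given matrix.\<close>

lemma free_resolution_extend:
  assumes "cring R" "noetherian_ring R" "module R X"
    "\<epsilon> \<in> mod_hom R (finite_free R b0) X" "D0 \<in> mod_hom R (finite_free R b1) (finite_free R b0)"
    "\<epsilon> ` carrier (finite_free R b0) = carrier X"
    "mod_ker (finite_free R b0) X \<epsilon> = D0 ` carrier (finite_free R b1)"
  shows "\<exists>b D. free_resolution R X b D \<epsilon> \<and> b 0 = b0 \<and> b 1 = b1 \<and> D 0 = D0"
proof -
  note F = finite_free_module[OF assms(1)]
  \<comment> \<open>A state \<open>(k, m, f)\<close> is a map from \<open>R^k\<close> to
    \<open>R^m\<close>; consecutive states share a rank, and each new map is onto the kernel of the
    one before.\<close>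
  define P where "P = (\<lambda>(n::nat) (k, m, f). f \<in> mod_hom R (finite_free R k) (finite_free R m) \<and> (n = 0 \<longrightarrow> (k, m, f) = (b1, b0, D0)))"
  define Q where "Q = (\<lambda>(n::nat) (k, m::nat, f) (k', m', f').
     m' = k \<and> mod_ker (finite_free R k) (finite_free R m) f = f' ` carrier (finite_free R k'))"
  have "\<exists>S. \<forall>n. P n (S n) \<and> Q n (S n) (S (Suc n))"
  proof (rule dependent_nat_choice)
    show "\<exists>x. P 0 x" unfolding P_def using assms(5) by auto
    fix x n assume x: "P n x"
    obtain k m f where xe: "x = (k, m, f)" by (cases x)
    have f: "f \<in> mod_hom R (finite_free R k) (finite_free R m)" using x by (simp add: P_def xe)
    obtain k' g where "g \<in> mod_hom R (finite_free R k') (finite_free R k)"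
      "mod_ker (finite_free R k) (finite_free R m) f = g ` carrier (finite_free R k')"
      using free_cover_ker[OF assms(1,2) mod_hom_lin[OF f] F] by metis
    thus "\<exists>y. P (Suc n) y \<and> Q n x y" by (intro exI[of _ "(k', k, g)"]) (simp add: P_def Q_def xe)
  qed
  then obtain S where S: "\<And>n. P n (S n)" "\<And>n. Q n (S n) (S (Suc n))" by blast
  define b where "b = (\<lambda>i. case i of 0 \<Rightarrow> b0 | Suc j \<Rightarrow> fst (S j))"
  define D where "D = (\<lambda>i. snd (snd (S i)))"
  have Se: "S i = (b (Suc i), b i, D i)" for i
  proof (cases i)
    case 0 thus ?thesis using S(1)[of 0] by (simp add: P_def b_def D_def split: prod.splits)
  next
    case (Suc j)
    thus ?thesis using S(2)[of j] by (cases "S j"; cases "S (Suc j)") (simp add: Q_def b_def D_def)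
  qed
  have S0: "S 0 = (b1, b0, D0)" using S(1)[of 0] by (simp add: P_def split: prod.splits)
  have D0: "D 0 = D0" "b 1 = b1" "b 0 = b0" using S0 Se[of 0] by auto
  have 1: "D i \<in> mod_hom R (finite_free R (b (Suc i))) (finite_free R (b i))" for i
    using S(1)[of i] by (simp add: Se P_def)
  have 2: "mod_ker (finite_free R (b (Suc i))) (finite_free R (b i)) (D i) = D (Suc i) ` carrier (finite_free R (b (Suc (Suc i))))" for i
    using S(2)[of i] by (simp add: Se Q_def)
  have "free_resolution R X b D \<epsilon>"
    unfolding free_resolution_def Let_def using 1 2 assms(4,6,7) D0 by simp
  thus ?thesis using D0 by blast
qed

lemma free_resolutionD:
  assumes "free_resolution R X b D \<epsilon>"
  shows "lin R (finite_free R (b 0)) X \<epsilon>"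
    and "lin R (finite_free R (b (Suc i))) (finite_free R (b i)) (D i)"
    and "\<epsilon> ` carrier (finite_free R (b 0)) = carrier X"
    and "mod_ker (finite_free R (b 0)) X \<epsilon> = D 0 ` carrier (finite_free R (b (Suc 0)))"
    and "mod_ker (finite_free R (b (Suc i))) (finite_free R (b i)) (D i) = D (Suc i) ` carrier (finite_free R (b (Suc (Suc i))))"
  using assms unfolding free_resolution_def Let_def by (auto simp: mod_hom_lin)

lemma resolution_zero:
  assumes "free_resolution R X b D \<epsilon>"
  shows "x \<in> carrier (finite_free R (b (Suc (Suc i)))) \<Longrightarrow> D i (D (Suc i) x) = \<zero>\<^bsub>finite_free R (b i)\<^esub>"
    and "x \<in> carrier (finite_free R (b (Suc 0))) \<Longrightarrow> \<epsilon> (D 0 x) = \<zero>\<^bsub>X\<^esub>"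
proof -
  show "D i (D (Suc i) x) = \<zero>\<^bsub>finite_free R (b i)\<^esub>" if "x \<in> carrier (finite_free R (b (Suc (Suc i))))"
  proof -
    have "D (Suc i) x \<in> mod_ker (finite_free R (b (Suc i))) (finite_free R (b i)) (D i)"
      unfolding free_resolutionD(5)[OF assms] using that by (rule imageI)
    thus ?thesis by (simp add: mod_ker_def)
  qed
  show "\<epsilon> (D 0 x) = \<zero>\<^bsub>X\<^esub>" if "x \<in> carrier (finite_free R (b (Suc 0)))"
  proof -
    have "D 0 x \<in> mod_ker (finite_free R (b 0)) X \<epsilon>"
      unfolding free_resolutionD(4)[OF assms] using that by (rule imageI)
    thus ?thesis by (simp add: mod_ker_def)
  qed
qed

section \<open>Comparison of free resolutions\<close>

text \<open>The comparison map over the identity of \<open>X\<close>, lifted degree by degree: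
  exactness of the target puts the composite with the previous map into the image of the next
  differential.\<close>

lemma chain_map_exists:
  assumes "cring R" "module R X" "free_resolution R X b D \<epsilon>" "free_resolution R X b' D' \<epsilon>'"
  obtains f where "\<And>i. lin R (finite_free R (b i)) (finite_free R (b' i)) (f i)"
    "\<And>x. x \<in> carrier (finite_free R (b 0)) \<Longrightarrow> \<epsilon>' (f 0 x) = \<epsilon> x"
    "\<And>i x. x \<in> carrier (finite_free R (b (Suc i))) \<Longrightarrow> D' i (f (Suc i) x) = f i (D i x)"
proof -
  let ?F = "\<lambda>i. finite_free R (b i)" and ?G = "\<lambda>i. finite_free R (b' i)"
  note F = finite_free_module[OF assms(1)]
  note r = free_resolutionD[OF assms(3)] and r' = free_resolutionD[OF assms(4)]
  have nxt: "\<exists>w. lin R (?F (Suc (Suc i))) (?G (Suc (Suc i))) w \<and> (\<forall>x\<in>carrier (?F (Suc (Suc i))). D' (Suc i) (w x) = v (D (Suc i) x))"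
    if v: "lin R (?F (Suc i)) (?G (Suc i)) v" "lin R (?F i) (?G i) u"
      "\<And>x. x \<in> carrier (?F (Suc i)) \<Longrightarrow> D' i (v x) = u (D i x)" for i u v
  proof -
    have "v (D (Suc i) x) \<in> D' (Suc i) ` carrier (?G (Suc (Suc i)))" if x: "x \<in> carrier (?F (Suc (Suc i)))" for x
    proof -
      note dx = lin_closed[OF r(2) x]
      have "D' i (v (D (Suc i) x)) = \<zero>\<^bsub>?G i\<^esub>"
        using v(3)[OF dx] resolution_zero(1)[OF assms(3) x] lin_zero[OF F F v(2)] by simp
      hence "v (D (Suc i) x) \<in> mod_ker (?G (Suc i)) (?G i) (D' i)" using lin_closed[OF v(1) dx] by (simp add: mod_ker_def)
      thus ?thesis unfolding r'(5) .
    qed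
    from free_lift[OF F F lin_comp[OF r(2) v(1)] r'(2) this] show ?thesis by metis
  qed
  obtain f0 where f0: "lin R (?F 0) (?G 0) f0" "\<And>x. x \<in> carrier (?F 0) \<Longrightarrow> \<epsilon>' (f0 x) = \<epsilon> x"
    using free_lift[OF assms(2) F r(1) r'(1)] r'(3) lin_closed[OF r(1)] by metis
  have im: "f0 (D 0 x) \<in> D' 0 ` carrier (?G (Suc 0))" if x: "x \<in> carrier (?F (Suc 0))" for x
  proof -
    note dx = lin_closed[OF r(2) x]
    have "f0 (D 0 x) \<in> mod_ker (?G 0) X \<epsilon>'"
      using f0(2)[OF dx] resolution_zero(2)[OF assms(3) x] lin_closed[OF f0(1) dx] by (simp add: mod_ker_def)
    thus ?thesis unfolding r'(4) .
  qed
  obtain f1 where f1: "lin R (?F (Suc 0)) (?G (Suc 0)) f1" "\<And>x. x \<in> carrier (?F (Suc 0)) \<Longrightarrow> D' 0 (f1 x) = f0 (D 0 x)"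
    using free_lift[OF F F lin_comp[OF r(2) f0(1)] r'(2) im] by metis
  \<comment> \<open>The choice runs over pairs of adjacent maps, since the next lift is possible
    only if the square below it commutes.\<close>
  define P where "P = (\<lambda>i (u, v). lin R (?F i) (?G i) u \<and> lin R (?F (Suc i)) (?G (Suc i)) v \<and>
     (\<forall>x\<in>carrier (?F (Suc i)). D' i (v x) = u (D i x)) \<and> (i = 0 \<longrightarrow> u = f0))"
  define Q where "Q = (\<lambda>(i::nat) (u::(nat \<Rightarrow> 'a) \<Rightarrow> (nat \<Rightarrow> 'a), v::(nat \<Rightarrow> 'a) \<Rightarrow> (nat \<Rightarrow> 'a)) (u'::(nat \<Rightarrow> 'a) \<Rightarrow> (nat \<Rightarrow> 'a), v'::(nat \<Rightarrow> 'a) \<Rightarrow> (nat \<Rightarrow> 'a)). u' = v)"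
  have "\<exists>S. \<forall>n. P n (S n) \<and> Q n (S n) (S (Suc n))"
  proof (rule dependent_nat_choice)
    show "\<exists>x. P 0 x" using f0 f1 by (intro exI[of _ "(f0, f1)"]) (simp add: P_def)
    fix x i assume x: "P i x"
    obtain u v where xe: "x = (u, v)" by (cases x)
    obtain w where "lin R (?F (Suc (Suc i))) (?G (Suc (Suc i))) w"
      "\<forall>x\<in>carrier (?F (Suc (Suc i))). D' (Suc i) (w x) = v (D (Suc i) x)"
      using nxt[of i v u] x unfolding P_def xe by auto
    thus "\<exists>y. P (Suc i) y \<and> Q i x y" using x by (intro exI[of _ "(v, w)"]) (simp add: P_def Q_def xe)
  qed
  then obtain S where S: "\<And>n. P n (S n)" "\<And>n. Q n (S n) (S (Suc n))" by blast
  have s: "snd (S i) = fst (S (Suc i))" for i using S(2)[of i] by (simp add: Q_def split: prod.splits)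
  show ?thesis
  proof (rule that[of "\<lambda>i. fst (S i)"])
    show "lin R (?F i) (?G i) (fst (S i))" for i using S(1)[of i] by (simp add: P_def split: prod.splits)
    show "\<epsilon>' (fst (S 0) x) = \<epsilon> x" if "x \<in> carrier (?F 0)" for x
      using S(1)[of 0] f0(2)[OF that] by (simp add: P_def split: prod.splits)
    show "D' i (fst (S (Suc i)) x) = fst (S i) (D i x)" if "x \<in> carrier (?F (Suc i))" for i x
      using S(1)[of i] that s[of i] by (simp add: P_def split: prod.splits)
  qed
qed

text \<open>A chain map over the identity of \<open>X\<close> is homotopic to the identity. The
  homotopy formula is recorded in positive degrees, where it will be used for cohomology.\<close>

lemma homotopy_exists:
  assumes "cring R" "module R X" "free_resolution R X b D \<epsilon>"
    "\<And>i. lin R (finite_free R (b i)) (finite_free R (b i)) (h i)"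
    "\<And>x. x \<in> carrier (finite_free R (b 0)) \<Longrightarrow> \<epsilon> (h 0 x) = \<epsilon> x"
    "\<And>i x. x \<in> carrier (finite_free R (b (Suc i))) \<Longrightarrow> D i (h (Suc i) x) = h i (D i x)"
  obtains s where "\<And>i. lin R (finite_free R (b i)) (finite_free R (b (Suc i))) (s i)"
    "\<And>i x. x \<in> carrier (finite_free R (b (Suc i))) \<Longrightarrow>
      x \<ominus>\<^bsub>finite_free R (b (Suc i))\<^esub> h (Suc i) x = D (Suc i) (s (Suc i) x) \<oplus>\<^bsub>finite_free R (b (Suc i))\<^esub> s i (D i x)"
proof -
  let ?F = "\<lambda>i. finite_free R (b i)"
  note F = finite_free_module[OF assms(1)]
  note r = free_resolutionD[OF assms(3)] and h = assms(4)
  have idl: "lin R (?F i) (?F i) (\<lambda>x. x)" for i by (rule linI) auto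
  note df = lin_minus_fun[OF F F idl h]
  have im0: "x \<ominus>\<^bsub>?F 0\<^esub> h 0 x \<in> D 0 ` carrier (?F (Suc 0))" if x: "x \<in> carrier (?F 0)" for x
  proof -
    interpret X: module R X by fact
    have "\<epsilon> (x \<ominus>\<^bsub>?F 0\<^esub> h 0 x) = \<zero>\<^bsub>X\<^esub>"
      using lin_minus[OF F assms(2) r(1) x lin_closed[OF h x]] assms(5)[OF x] lin_closed[OF r(1) x] by (simp add: a_minus_def X.M.r_neg)
    hence "x \<ominus>\<^bsub>?F 0\<^esub> h 0 x \<in> mod_ker (?F 0) X \<epsilon>" using lin_closed[OF df x] by (simp add: mod_ker_def)
    thus ?thesis unfolding r(4) .
  qed
  obtain s0 where s0: "lin R (?F 0) (?F (Suc 0)) s0" "\<And>x. x \<in> carrier (?F 0) \<Longrightarrow> D 0 (s0 x) = x \<ominus>\<^bsub>?F 0\<^esub> h 0 x"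
    using free_lift[OF F F df r(2) im0] by metis
  \<comment> \<open>The invariant \<open>D s D = (1 - h) D\<close> is what remains of the homotopy
    formula after composition with the differential; it shows that the element to be lifted next is
    a cycle.\<close>
  define P where "P = (\<lambda>i s. lin R (?F i) (?F (Suc i)) s \<and>
    (\<forall>x\<in>carrier (?F (Suc i)). D i (s (D i x)) = D i x \<ominus>\<^bsub>?F i\<^esub> h i (D i x)))"
  define Q where "Q = (\<lambda>i s s'. \<forall>x\<in>carrier (?F (Suc i)).
     x \<ominus>\<^bsub>?F (Suc i)\<^esub> h (Suc i) x = D (Suc i) (s' x) \<oplus>\<^bsub>?F (Suc i)\<^esub> s (D i x))"
  have "\<exists>S. \<forall>n. P n (S n) \<and> Q n (S n) (S (Suc n))"
  proof (rule dependent_nat_choice)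
    show "\<exists>x. P 0 x" using s0 lin_closed[OF r(2)[of 0]] by (intro exI[of _ s0]) (simp add: P_def)
    fix s i assume s: "P i s"
    hence ls: "lin R (?F i) (?F (Suc i)) s" and ps: "\<And>x. x \<in> carrier (?F (Suc i)) \<Longrightarrow> D i (s (D i x)) = D i x \<ominus>\<^bsub>?F i\<^esub> h i (D i x)"
      by (auto simp: P_def)
    interpret F1: module R "?F (Suc i)" by (rule F)
    interpret F0: module R "?F i" by (rule F)
    have sD: "lin R (?F (Suc i)) (?F (Suc i)) (\<lambda>x. s (D i x))" by (rule lin_comp[OF r(2) ls])
    note lw = lin_minus_fun[OF F F df sD]
    have im: "(x \<ominus>\<^bsub>?F (Suc i)\<^esub> h (Suc i) x) \<ominus>\<^bsub>?F (Suc i)\<^esub> s (D i x) \<in> D (Suc i) ` carrier (?F (Suc (Suc i)))"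
      if x: "x \<in> carrier (?F (Suc i))" for x
    proof -
      note hx = lin_closed[OF h x] and sx = lin_closed[OF sD x] and dx = lin_closed[OF r(2) x]
      have "D i ((x \<ominus>\<^bsub>?F (Suc i)\<^esub> h (Suc i) x) \<ominus>\<^bsub>?F (Suc i)\<^esub> s (D i x)) =
         (D i x \<ominus>\<^bsub>?F i\<^esub> h i (D i x)) \<ominus>\<^bsub>?F i\<^esub> (D i x \<ominus>\<^bsub>?F i\<^esub> h i (D i x))"
        using lin_minus[OF F F r(2) F1.M.minus_closed[OF x hx] sx] lin_minus[OF F F r(2) x hx] assms(6)[OF x] ps[OF x] by simp
      also have "\<dots> = \<zero>\<^bsub>?F i\<^esub>" using F0.M.minus_closed[OF dx lin_closed[OF h dx]]
        unfolding a_minus_def[of _ "D i x \<ominus>\<^bsub>?F i\<^esub> h i (D i x)"] by (rule F0.M.r_neg)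
      finally have "(x \<ominus>\<^bsub>?F (Suc i)\<^esub> h (Suc i) x) \<ominus>\<^bsub>?F (Suc i)\<^esub> s (D i x) \<in> mod_ker (?F (Suc i)) (?F i) (D i)"
        using lin_closed[OF lw x] by (simp add: mod_ker_def)
      thus ?thesis unfolding r(5) .
    qed
    obtain s' where s': "lin R (?F (Suc i)) (?F (Suc (Suc i))) s'"
      "\<And>x. x \<in> carrier (?F (Suc i)) \<Longrightarrow> D (Suc i) (s' x) = (x \<ominus>\<^bsub>?F (Suc i)\<^esub> h (Suc i) x) \<ominus>\<^bsub>?F (Suc i)\<^esub> s (D i x)"
      using free_lift[OF F F lw r(2) im] by metis
    have Q: "Q i s s'" unfolding Q_def
    proof
      fix x assume x: "x \<in> carrier (?F (Suc i))"
      show "x \<ominus>\<^bsub>?F (Suc i)\<^esub> h (Suc i) x = D (Suc i) (s' x) \<oplus>\<^bsub>?F (Suc i)\<^esub> s (D i x)"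
        unfolding s'(2)[OF x] by (rule F1.M.add_minus_cancel(3)[symmetric, OF lin_closed[OF df x] lin_closed[OF sD x]])
    qed
    have "D (Suc i) (s' (D (Suc i) x)) = D (Suc i) x \<ominus>\<^bsub>?F (Suc i)\<^esub> h (Suc i) (D (Suc i) x)"
      if x: "x \<in> carrier (?F (Suc (Suc i)))" for x
    proof -
      note dx = lin_closed[OF r(2) x]
      have "s (D i (D (Suc i) x)) = \<zero>\<^bsub>?F (Suc i)\<^esub>"
        using resolution_zero(1)[OF assms(3) x] lin_zero[OF F F ls] by simp
      thus ?thesis using s'(2)[OF dx] F1.M.minus_zero_right[OF lin_closed[OF df dx]] by simp
    qed
    thus "\<exists>s'. P (Suc i) s' \<and> Q i s s'" using s'(1) Q unfolding P_def by blast
  qed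
  then obtain S where S: "\<And>n. P n (S n)" "\<And>n. Q n (S n) (S (Suc n))" by blast
  show ?thesis by (rule that[of S]) (use S in \<open>auto simp: P_def Q_def\<close>)
qed

section \<open>Vanishing of Ext on an arbitrary resolution\<close>

text \<open>Vanishing of the cohomology of \<open>Hom(F, N)\<close> in degree \<open>i + 1\<close>,
  phrased with plain linear maps so that neither quotients nor extensional functions appear.\<close>

definition coboundaries_exact :: "('a, 'r) ring_scheme \<Rightarrow> ('a, 'n, 'y) module_scheme \<Rightarrow> (nat \<Rightarrow> nat) \<Rightarrow>
    (nat \<Rightarrow> (nat \<Rightarrow> 'a) \<Rightarrow> (nat \<Rightarrow> 'a)) \<Rightarrow> nat \<Rightarrow> bool" where
  "coboundaries_exact R N b D i \<longleftrightarrow> (\<forall>\<phi>. lin R (finite_free R (b (Suc i))) N \<phi> \<longrightarrow>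
     (\<forall>x\<in>carrier (finite_free R (b (Suc (Suc i)))). \<phi> (D (Suc i) x) = \<zero>\<^bsub>N\<^esub>) \<longrightarrow>
     (\<exists>\<psi>. lin R (finite_free R (b i)) N \<psi> \<and> (\<forall>x\<in>carrier (finite_free R (b (Suc i))). \<phi> x = \<psi> (D i x))))"

text \<open>\<open>Ext\<close> is formed with a resolution chosen by \<open>SOME\<close>, so its
  vanishing must be carried to the resolution under study. If \<open>\<psi>\<close> is a primitive
  of the transported cocycle, then \<open>\<psi> \<circ> f + \<phi> \<circ> s\<close> is a primitive
  of \<open>\<phi>\<close>, with comparison map \<open>f\<close> and homotopy
  \<open>s\<close>.\<close>

lemma coboundaries_exact_transfer:
  assumes "module R X" "module R N" "free_resolution R X b D \<epsilon>" "free_resolution R X b' D' \<epsilon>'"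
    "coboundaries_exact R N b' D' i"
  shows "coboundaries_exact R N b D i"
proof -
  interpret N: module R N by fact
  note cr = N.R.is_cring
  let ?F = "\<lambda>i. finite_free R (b i)" and ?G = "\<lambda>i. finite_free R (b' i)"
  note F = finite_free_module[OF cr] and r = free_resolutionD[OF assms(3)] and r' = free_resolutionD[OF assms(4)]
  obtain f where f: "\<And>i. lin R (?F i) (?G i) (f i)" "\<And>x. x \<in> carrier (?F 0) \<Longrightarrow> \<epsilon>' (f 0 x) = \<epsilon> x"
    "\<And>i x. x \<in> carrier (?F (Suc i)) \<Longrightarrow> D' i (f (Suc i) x) = f i (D i x)"
    using chain_map_exists[OF cr assms(1,3,4)] by metis
  obtain g where g: "\<And>i. lin R (?G i) (?F i) (g i)" "\<And>x. x \<in> carrier (?G 0) \<Longrightarrow> \<epsilon> (g 0 x) = \<epsilon>' x"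
    "\<And>i x. x \<in> carrier (?G (Suc i)) \<Longrightarrow> D i (g (Suc i) x) = g i (D' i x)"
    using chain_map_exists[OF cr assms(1,4,3)] by metis
  have h1: "lin R (?F i) (?F i) (\<lambda>x. g i (f i x))" for i by (rule lin_comp[OF f(1) g(1)])
  have h2: "\<epsilon> (g 0 (f 0 x)) = \<epsilon> x" if "x \<in> carrier (?F 0)" for x
    using g(2)[OF lin_closed[OF f(1) that]] f(2)[OF that] by simp
  have h3: "D i (g (Suc i) (f (Suc i) x)) = g i (f i (D i x))" if "x \<in> carrier (?F (Suc i))" for i x
    using g(3)[OF lin_closed[OF f(1) that]] f(3)[OF that] by simp
  obtain s where s: "\<And>i. lin R (?F i) (?F (Suc i)) (s i)"
    "\<And>i x. x \<in> carrier (?F (Suc i)) \<Longrightarrow>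
      x \<ominus>\<^bsub>?F (Suc i)\<^esub> g (Suc i) (f (Suc i) x) = D (Suc i) (s (Suc i) x) \<oplus>\<^bsub>?F (Suc i)\<^esub> s i (D i x)"
    using homotopy_exists[OF cr assms(1,3), of "\<lambda>i x. g i (f i x)", OF h1 h2 h3] by metis
  show ?thesis unfolding coboundaries_exact_def
  proof (intro allI impI)
    fix \<phi> assume phi: "lin R (?F (Suc i)) N \<phi>" "\<forall>x\<in>carrier (?F (Suc (Suc i))). \<phi> (D (Suc i) x) = \<zero>\<^bsub>N\<^esub>"
    have "\<phi> (g (Suc i) (D' (Suc i) x)) = \<zero>\<^bsub>N\<^esub>" if "x \<in> carrier (?G (Suc (Suc i)))" for x
      using g(3)[OF that] phi(2) lin_closed[OF g(1) that] by metis
    then obtain \<psi> where psi: "lin R (?G i) N \<psi>" "\<And>x. x \<in> carrier (?G (Suc i)) \<Longrightarrow> \<phi> (g (Suc i) x) = \<psi> (D' i x)"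
      using assms(5) lin_comp[OF g(1) phi(1)] unfolding coboundaries_exact_def by metis
    have l: "lin R (?F i) N (\<lambda>x. \<psi> (f i x) \<oplus>\<^bsub>N\<^esub> \<phi> (s i x))"
      by (rule lin_add_fun[OF F assms(2) lin_comp[OF f(1) psi(1)] lin_comp[OF s(1) phi(1)]])
    have "\<phi> x = \<psi> (f i (D i x)) \<oplus>\<^bsub>N\<^esub> \<phi> (s i (D i x))" if x: "x \<in> carrier (?F (Suc i))" for x
    proof -
      interpret F1: module R "?F (Suc i)" by (rule F)
      let ?h = "g (Suc i) (f (Suc i) x)"
      note fx = lin_closed[OF f(1) x]
      have hx: "?h \<in> carrier (?F (Suc i))" by (rule lin_closed[OF h1 x])
      have sx: "s i (D i x) \<in> carrier (?F (Suc i))" by (rule lin_closed[OF s(1) lin_closed[OF r(2) x]])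
      have sx': "s (Suc i) x \<in> carrier (?F (Suc (Suc i)))" by (rule lin_closed[OF s(1) x])
      have dsx: "D (Suc i) (s (Suc i) x) \<in> carrier (?F (Suc i))" by (rule lin_closed[OF r(2) sx'])
      have "x = (x \<ominus>\<^bsub>?F (Suc i)\<^esub> ?h) \<oplus>\<^bsub>?F (Suc i)\<^esub> ?h" by (rule F1.M.add_minus_cancel(3)[OF x hx, symmetric])
      hence "\<phi> x = \<phi> ((D (Suc i) (s (Suc i) x) \<oplus>\<^bsub>?F (Suc i)\<^esub> s i (D i x)) \<oplus>\<^bsub>?F (Suc i)\<^esub> ?h)"
        using s(2)[OF x] by simp
      also have "\<dots> = (\<phi> (D (Suc i) (s (Suc i) x)) \<oplus>\<^bsub>N\<^esub> \<phi> (s i (D i x))) \<oplus>\<^bsub>N\<^esub> \<phi> ?h"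
        using lin_add[OF phi(1) F1.M.a_closed[OF dsx sx] hx] lin_add[OF phi(1) dsx sx] by simp
      also have "\<dots> = \<phi> (s i (D i x)) \<oplus>\<^bsub>N\<^esub> \<psi> (f i (D i x))"
        using phi(2) sx' lin_closed[OF phi(1) sx] psi(2)[OF fx] f(3)[OF x] by simp
      also have "\<dots> = \<psi> (f i (D i x)) \<oplus>\<^bsub>N\<^esub> \<phi> (s i (D i x))"
        by (rule N.M.a_comm[OF lin_closed[OF phi(1) sx] lin_closed[OF psi(1) lin_closed[OF f(1) lin_closed[OF r(2) x]]]])
      finally show ?thesis .
    qed
    thus "\<exists>\<psi>. lin R (?F i) N \<psi> \<and> (\<forall>x\<in>carrier (?F (Suc i)). \<phi> x = \<psi> (D i x))" using l by blast
  qed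
qed

text \<open>A zero quotient has a single coset, so the coset of a cocycle is the set of
  coboundaries; since zero is a coboundary, the cocycle lies in it.\<close>

lemma cohomology_zero:
  assumes "module R N" "cring R" "\<And>j. lin R (finite_free R (b (Suc j))) (finite_free R (b j)) (D j)"
    "zero_module (cohomology (\<lambda>j. Hom_module R (finite_free R (b j)) N)
         (\<lambda>j \<phi>. compose (carrier (finite_free R (b (Suc j)))) \<phi> (D j)) (Suc i))"
  shows "coboundaries_exact R N b D i"
  unfolding coboundaries_exact_def
proof (intro allI impI)
  let ?F = "\<lambda>i. finite_free R (b i)"
  interpret N: module R N by fact
  note F = finite_free_module[OF assms(2)]
  fix \<phi> assume phi: "lin R (?F (Suc i)) N \<phi>" "\<forall>x\<in>carrier (?F (Suc (Suc i))). \<phi> (D (Suc i) x) = \<zero>\<^bsub>N\<^esub>"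
  let ?\<phi> = "restrict \<phi> (carrier (?F (Suc i)))"
  let ?H = "(\<lambda>\<psi>. compose (carrier (?F (Suc i))) \<psi> (D i)) ` mod_hom R (?F i) N"
  let ?K = "(Hom_module R (?F (Suc i)) N)\<lparr>carrier := mod_ker (Hom_module R (?F (Suc i)) N) (Hom_module R (?F (Suc (Suc i))) N)
     (\<lambda>\<phi>. compose (carrier (?F (Suc (Suc i)))) \<phi> (D (Suc i)))\<rparr>"
  have car: "carrier (Hom_module R A N) = mod_hom R A N" for A :: "('a, 'z) module" by (simp add: Hom_module_def)
  have phiK: "?\<phi> \<in> carrier ?K"
    using restrict_mod_hom[OF F phi(1)] phi(2) lin_closed[OF assms(3)]
    by (auto simp: mod_ker_def Hom_module_def compose_def fun_eq_iff restrict_def)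
  have "carrier (quot_module ?K ?H) = {?H}"
    using assms(4) unfolding zero_module_def cohomology_def by (simp add: car) (simp add: quot_module_def)
  moreover have "?H +>\<^bsub>?K\<^esub> ?\<phi> \<in> carrier (quot_module ?K ?H)"
    using phiK unfolding quot_module_def A_RCOSETS_def' by auto
  ultimately have eq: "?H +>\<^bsub>?K\<^esub> ?\<phi> = ?H" by simp
  have zl: "lin R (?F i) N (\<lambda>x. \<zero>\<^bsub>N\<^esub>)" by (rule linI) auto
  have z: "(\<lambda>x\<in>carrier (?F (Suc i)). \<zero>\<^bsub>N\<^esub>) \<in> ?H"
    by (rule image_eqI[OF _ restrict_mod_hom[OF F zl]])
      (use lin_closed[OF assms(3)] in \<open>auto simp: compose_def fun_eq_iff restrict_def\<close>)
  have "(\<lambda>x\<in>carrier (?F (Suc i)). \<zero>\<^bsub>N\<^esub>) \<oplus>\<^bsub>?K\<^esub> ?\<phi> = ?\<phi>"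
    using lin_closed[OF phi(1)] by (auto simp: Hom_module_def fun_eq_iff restrict_def)
  hence "?\<phi> \<in> ?H +>\<^bsub>?K\<^esub> ?\<phi>" using z unfolding a_r_coset_def' by force
  then obtain \<psi> where psi: "\<psi> \<in> mod_hom R (?F i) N" "?\<phi> = compose (carrier (?F (Suc i))) \<psi> (D i)" unfolding eq by blast
  have "\<phi> x = \<psi> (D i x)" if "x \<in> carrier (?F (Suc i))" for x
    using fun_cong[OF psi(2), of x] that by (simp add: compose_def)
  thus "\<exists>\<psi>. lin R (?F i) N \<psi> \<and> (\<forall>x\<in>carrier (?F (Suc i)). \<phi> x = \<psi> (D i x))"
    using mod_hom_lin[OF psi(1)] by blast
qed

lemma Ext_zero_exact:
  assumes "module R X" "module R N" "free_resolution R X b D \<epsilon>" "zero_module (Ext R (Suc i) X N)"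
  shows "coboundaries_exact R N b D i"
proof -
  interpret module R N by fact
  obtain b' D' \<epsilon>' where s: "(SOME (b, D, \<epsilon>). free_resolution R X b D \<epsilon>) = (b', D', \<epsilon>')"
    by (metis prod_cases3)
  have r: "free_resolution R X b' D' \<epsilon>'"
    using someI[of "\<lambda>(b, D, \<epsilon>). free_resolution R X b D \<epsilon>" "(b, D, \<epsilon>)"] assms(3) s by simp
  have "coboundaries_exact R N b' D' i"
    by (rule cohomology_zero[where b = b' and D = D', OF assms(2) R.is_cring free_resolutionD(2)[OF r]])
      (use assms(4) in \<open>simp add: Ext_def s\<close>)
  thus ?thesis by (rule coboundaries_exact_transfer[OF assms(1-3) r])
qed

section \<open>The complex of a resolution in coordinates\<close>

text \<open>Coordinates for \<open>Hom(F, N)\<close>: a map out of \<open>R^n\<close> becomes its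
  vector of values on unit vectors, and composition with \<open>D j\<close> becomes this map between
  powers of \<open>N\<close>, where regularity is inherited coordinatewise from
  \<open>N\<close>.\<close>

definition cochain :: "('a, 'r) ring_scheme \<Rightarrow> ('a, 'n, 'y) module_scheme \<Rightarrow> (nat \<Rightarrow> nat) \<Rightarrow>
    (nat \<Rightarrow> (nat \<Rightarrow> 'a) \<Rightarrow> (nat \<Rightarrow> 'a)) \<Rightarrow> nat \<Rightarrow> (nat \<Rightarrow> 'n) \<Rightarrow> nat \<Rightarrow> 'n" where
  "cochain R N b D j c = (\<lambda>s. if s < b (Suc j) then lincomb N (b j) c (D j (unit_vec R s)) else \<zero>\<^bsub>N\<^esub>)"

lemma lincomb_add_family:
  assumes "module R M" "\<And>i. i < n \<Longrightarrow> u i \<in> carrier M" "\<And>i. i < n \<Longrightarrow> v i \<in> carrier M" "\<And>i. i < n \<Longrightarrow> r i \<in> carrier R"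
  shows "lincomb M n (\<lambda>i. u i \<oplus>\<^bsub>M\<^esub> v i) r = lincomb M n u r \<oplus>\<^bsub>M\<^esub> lincomb M n v r"
proof -
  interpret module R M by fact
  have "lincomb M n (\<lambda>i. u i \<oplus>\<^bsub>M\<^esub> v i) r = (\<Oplus>\<^bsub>M\<^esub>i\<in>{..<n}. r i \<odot>\<^bsub>M\<^esub> u i \<oplus>\<^bsub>M\<^esub> r i \<odot>\<^bsub>M\<^esub> v i)"
    unfolding lincomb_def using assms(2-4) by (intro M.finsum_cong') (auto simp: smult_r_distr)
  also have "\<dots> = lincomb M n u r \<oplus>\<^bsub>M\<^esub> lincomb M n v r"
    unfolding lincomb_def using assms(2-4) by (intro M.finsum_addf) auto
  finally show ?thesis .
qed

lemma lincomb_smult_family: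
  assumes "module R M" "\<And>i. i < n \<Longrightarrow> u i \<in> carrier M" "\<And>i. i < n \<Longrightarrow> r i \<in> carrier R" "a \<in> carrier R"
  shows "lincomb M n (\<lambda>i. a \<odot>\<^bsub>M\<^esub> u i) r = a \<odot>\<^bsub>M\<^esub> lincomb M n u r"
proof -
  interpret module R M by fact
  have "lincomb M n (\<lambda>i. a \<odot>\<^bsub>M\<^esub> u i) r = (\<Oplus>\<^bsub>M\<^esub>i\<in>{..<n}. a \<odot>\<^bsub>M\<^esub> (r i \<odot>\<^bsub>M\<^esub> u i))"
    unfolding lincomb_def using assms(2-4) by (intro M.finsum_cong') (auto simp: R.m_comm simp flip: smult_assoc1)
  also have "\<dots> = a \<odot>\<^bsub>M\<^esub> lincomb M n u r"
    unfolding lincomb_def using assms(2-4) by (intro finsum_smult_ldistr[symmetric]) auto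
  finally show ?thesis .
qed

lemma cochain_eval:
  assumes "module R N" "lin R (finite_free R (b (Suc j))) (finite_free R (b j)) (D j)"
    "c \<in> carrier (pow_module N {..<b j})" "x \<in> carrier (finite_free R (b (Suc j)))"
  shows "lincomb N (b (Suc j)) (cochain R N b D j c) x = lincomb N (b j) c (D j x)"
proof -
  interpret module R N by fact
  have c: "c \<in> {..<b j} \<rightarrow> carrier N" using assms(3) by (auto simp: pow_carrier)
  note l = lin_comp[OF assms(2) lin_lincomb[OF assms(1) c]]
  have "lincomb N (b j) c (D j x) = lincomb N (b (Suc j)) (\<lambda>i. lincomb N (b j) c (D j (unit_vec R i))) x"
    by (rule lin_free_eq[OF assms(1) l assms(4)])
  also have "\<dots> = lincomb N (b (Suc j)) (cochain R N b D j c) x"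
    using lin_closed[OF l unit_vec_carrier[OF R.is_cring]] finite_free_val[OF R.is_cring assms(4)]
    by (intro lincomb_cong[OF assms(1)]) (auto simp: cochain_def)
  finally show ?thesis by simp
qed

lemma cochain_complex:
  assumes "module R N" "free_resolution R X b D \<epsilon>"
  shows "complex R (\<lambda>j. pow_module N {..<b j}) (cochain R N b D)"
proof (rule complex.intro)
  interpret module R N by fact
  note cr = R.is_cring and r = free_resolutionD[OF assms(2)]
  fix j
  show "Module.module R (pow_module N {..<b j})" by (rule pow_module_module[OF assms(1)])
  have dv: "D j (unit_vec R s) t \<in> carrier R" if "s < b (Suc j)" for s t
    using finite_free_val[OF cr lin_closed[OF r(2) unit_vec_carrier[OF cr that]]] .
  have cl: "cochain R N b D j c \<in> carrier (pow_module N {..<b (Suc j)})" if "c \<in> carrier (pow_module N {..<b j})" for j c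
  proof -
    have "c \<in> {..<b j} \<rightarrow> carrier N" using that by (auto simp: pow_carrier)
    from lin_closed[OF lin_lincomb[OF assms(1) this] lin_closed[OF r(2) unit_vec_carrier[OF cr]]]
    show ?thesis by (auto simp: pow_carrier cochain_def)
  qed
  show "lin R (pow_module N {..<b j}) (pow_module N {..<b (Suc j)}) (cochain R N b D j)"
  proof (rule linI)
    fix c e assume c: "c \<in> carrier (pow_module N {..<b j})" and e: "e \<in> carrier (pow_module N {..<b j})"
    show "cochain R N b D j (c \<oplus>\<^bsub>pow_module N {..<b j}\<^esub> e) =
       cochain R N b D j c \<oplus>\<^bsub>pow_module N {..<b (Suc j)}\<^esub> cochain R N b D j e"
      using lincomb_add_family[OF assms(1), of "b j" c e] dv pow_val[OF assms(1) c] pow_val[OF assms(1) e]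
      by (auto simp: cochain_def fun_eq_iff)
  next
    fix a c assume a: "a \<in> carrier R" and c: "c \<in> carrier (pow_module N {..<b j})"
    show "cochain R N b D j (a \<odot>\<^bsub>pow_module N {..<b j}\<^esub> c) = a \<odot>\<^bsub>pow_module N {..<b (Suc j)}\<^esub> cochain R N b D j c"
      using lincomb_smult_family[OF assms(1), of "b j" c _ a] dv pow_val[OF assms(1) c] a
      by (auto simp: cochain_def fun_eq_iff)
  qed (rule cl)
  fix c assume c: "c \<in> carrier (pow_module N {..<b j})"
  hence cc: "c \<in> {..<b j} \<rightarrow> carrier N" by (auto simp: pow_carrier)
  have "cochain R N b D (Suc j) (cochain R N b D j c) s = \<zero>\<^bsub>N\<^esub>" for s
  proof (cases "s < b (Suc (Suc j))")
    case True
    note u = unit_vec_carrier[OF cr True]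
    have "cochain R N b D (Suc j) (cochain R N b D j c) s = lincomb N (b j) c (D j (D (Suc j) (unit_vec R s)))"
      using True cochain_eval[where b = b and D = D and j = j, OF assms(1) r(2) c lin_closed[OF r(2) u]] by (simp add: cochain_def[of R N b D "Suc j"])
    also have "\<dots> = \<zero>\<^bsub>N\<^esub>"
      unfolding resolution_zero(1)[OF assms(2) u]
      by (rule lin_zero[OF finite_free_module[OF cr] assms(1) lin_lincomb[OF assms(1) cc]])
    finally show ?thesis .
  qed (simp add: cochain_def)
  thus "cochain R N b D (Suc j) (cochain R N b D j c) = \<zero>\<^bsub>pow_module N {..<b (Suc (Suc j))}\<^esub>" by (simp add: fun_eq_iff)
qed

lemma coboundaries_exact_mod:
  assumes "module R N" "free_resolution R X b D \<epsilon>" "coboundaries_exact R N b D i"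
  shows "exact_mod R (\<lambda>j. pow_module N {..<b j}) (cochain R N b D) {} i"
  unfolding exact_mod_empty[OF cochain_complex[OF assms(1,2)]]
proof (intro ballI impI)
  interpret module R N by fact
  note cr = R.is_cring and r = free_resolutionD[OF assms(2)]
  let ?F = "\<lambda>i. finite_free R (b i)"
  fix c assume c: "c \<in> carrier (pow_module N {..<b (Suc i)})" "cochain R N b D (Suc i) c = \<zero>\<^bsub>pow_module N {..<b (Suc (Suc i))}\<^esub>"
  have cc: "c \<in> {..<b (Suc i)} \<rightarrow> carrier N" using c(1) by (auto simp: pow_carrier)
  let ?\<phi> = "lincomb N (b (Suc i)) c"
  have "?\<phi> (D (Suc i) x) = \<zero>\<^bsub>N\<^esub>" if x: "x \<in> carrier (?F (Suc (Suc i)))" for x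
  proof -
    have "?\<phi> (D (Suc i) x) = lincomb N (b (Suc (Suc i))) (\<lambda>s. \<zero>\<^bsub>N\<^esub>) x"
      using cochain_eval[where b = b and D = D and j = "Suc i", OF assms(1) r(2) c(1) x] c(2) by simp
    also have "\<dots> = (\<Oplus>\<^bsub>N\<^esub>i\<in>{..<b (Suc (Suc i))}. \<zero>\<^bsub>N\<^esub>)"
      unfolding lincomb_def using finite_free_val[OF cr x] by (intro M.finsum_cong') auto
    finally show ?thesis by simp
  qed
  then obtain \<psi> where psi: "lin R (?F i) N \<psi>" "\<And>x. x \<in> carrier (?F (Suc i)) \<Longrightarrow> ?\<phi> x = \<psi> (D i x)"
    using assms(3) lin_lincomb[OF assms(1) cc] unfolding coboundaries_exact_def by metis
  define e where "e = (\<lambda>t. if t < b i then \<psi> (unit_vec R t) else \<zero>\<^bsub>N\<^esub>)"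
  have e: "e \<in> carrier (pow_module N {..<b i})"
    using lin_closed[OF psi(1) unit_vec_carrier[OF cr]] by (auto simp: e_def pow_carrier)
  have pe: "\<psi> x = lincomb N (b i) e x" if x: "x \<in> carrier (?F i)" for x
    unfolding lin_free_eq[OF assms(1) psi(1) x]
    using lin_closed[OF psi(1) unit_vec_carrier[OF cr]] finite_free_val[OF cr x]
    by (intro lincomb_cong[OF assms(1)]) (auto simp: e_def)
  have "c s = cochain R N b D i e s" for s
  proof (cases "s < b (Suc i)")
    case True
    note u = unit_vec_carrier[OF cr True]
    have "c s = ?\<phi> (unit_vec R s)" by (rule lincomb_unit[OF assms(1) cc True, symmetric])
    also have "\<dots> = lincomb N (b i) e (D i (unit_vec R s))" using psi(2)[OF u] pe[OF lin_closed[OF r(2) u]] by simp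
    finally show ?thesis using True by (simp add: cochain_def)
  next
    case False
    thus ?thesis using c(1) by (simp add: cochain_def pow_carrier)
  qed
  thus "\<exists>e\<in>carrier (pow_module N {..<b i}). c = cochain R N b D i e" using e by blast
qed

text \<open>Exactness at \<open>i\<close> modulo one more element uses exactness at \<open>i\<close>
  and \<open>i + 1\<close> modulo the previous ones. For \<open>k = length xs\<close> only the place
  \<open>0\<close> is left.\<close>

lemma (in complex) exact_mod_regular:
  assumes "\<And>i. i \<le> length xs \<Longrightarrow> exact_mod R C \<delta> {} i" "\<And>i. regular_list R (C i) xs" "set xs \<subseteq> carrier R"
  shows "i + k \<le> length xs \<Longrightarrow> exact_mod R C \<delta> (set (take k xs)) i"
proof (induction k arbitrary: i)
  case 0 thus ?case using assms(1) by simp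
next
  case (Suc k)
  have k: "k < length xs" using Suc.prems by simp
  have "set (take (Suc k) xs) = insert (xs ! k) (set (take k xs))" using k by (simp add: take_Suc_conv_app_nth)
  moreover have "exact_mod R C \<delta> (insert (xs ! k) (set (take k xs))) i"
    using Suc.IH[of i] Suc.IH[of "Suc i"] Suc.prems assms(2,3) k nth_mem[OF k] set_take_carr[OF assms(3)]
    by (intro exact_step_up) (auto simp: regular_list_def)
  ultimately show ?case by simp
qed

section \<open>Tensor products\<close>

lemma free_on_module:
  assumes "cring R" shows "module R (free_on R S)"
proof -
  interpret cring R by fact
  let ?P = "pow_module (ring_module R) S"
  let ?H = "{f \<in> carrier ?P. finite {s. f s \<noteq> \<zero>\<^bsub>R\<^esub>}}"
  note P = pow_module_module[OF ring_module_module[OF assms], of S]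
  interpret P: module R ?P by (rule P)
  have "submodule ?H R ?P"
  proof (rule subI[OF P])
    fix x y assume xy: "x \<in> ?H" "y \<in> ?H"
    have "finite {s. x s \<oplus>\<^bsub>R\<^esub> y s \<noteq> \<zero>\<^bsub>R\<^esub>}"
      by (rule finite_subset[of _ "{s. x s \<noteq> \<zero>\<^bsub>R\<^esub>} \<union> {s. y s \<noteq> \<zero>\<^bsub>R\<^esub>}"]) (use xy in auto)
    thus "x \<oplus>\<^bsub>?P\<^esub> y \<in> ?H" using P.M.a_closed[of x y] xy by simp
  next
    fix a x assume ax: "a \<in> carrier R" "x \<in> ?H"
    have "finite {s. a \<otimes>\<^bsub>R\<^esub> x s \<noteq> \<zero>\<^bsub>R\<^esub>}"
      by (rule finite_subset[of _ "{s. x s \<noteq> \<zero>\<^bsub>R\<^esub>}"]) (use ax in auto)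
    thus "a \<odot>\<^bsub>?P\<^esub> x \<in> ?H" using P.smult_closed[of a x] ax by simp
  qed (auto simp: pow_carrier)
  moreover have "free_on R S = ?P\<lparr>carrier := ?H\<rparr>"
    by (auto simp: free_on_def pow_module_def ring_module_def fun_eq_iff)
  ultimately show ?thesis using sub_module[OF P] by simp
qed

lemma free_on_simps [simp]:
  "\<zero>\<^bsub>free_on R S\<^esub> = (\<lambda>s. \<zero>\<^bsub>R\<^esub>)" "f \<oplus>\<^bsub>free_on R S\<^esub> g = (\<lambda>s. f s \<oplus>\<^bsub>R\<^esub> g s)"
  "a \<odot>\<^bsub>free_on R S\<^esub> f = (\<lambda>s. a \<otimes>\<^bsub>R\<^esub> f s)"
  by (simp_all add: free_on_def)

lemma free_on_carrier: "f \<in> carrier (free_on R S) \<longleftrightarrow>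
    (\<forall>s\<in>S. f s \<in> carrier R) \<and> (\<forall>s. s \<notin> S \<longrightarrow> f s = \<zero>\<^bsub>R\<^esub>) \<and> finite {s. f s \<noteq> \<zero>\<^bsub>R\<^esub>}"
  by (simp add: free_on_def)

lemma free_on_val: "cring R \<Longrightarrow> f \<in> carrier (free_on R S) \<Longrightarrow> f s \<in> carrier R"
proof -
  assume "cring R" "f \<in> carrier (free_on R S)"
  then interpret cring R by blast
  show ?thesis using \<open>f \<in> _\<close> by (cases "s \<in> S") (auto simp: free_on_carrier)
qed

lemma unit_vec_free_on:
  assumes "cring R" "p \<in> S" shows "unit_vec R p \<in> carrier (free_on R S)"
proof -
  interpret cring R by fact
  have "finite {s. unit_vec R p s \<noteq> \<zero>\<^bsub>R\<^esub>}" by (rule finite_subset[of _ "{p}"]) (auto simp: unit_vec_def)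
  thus ?thesis using assms(2) by (auto simp: free_on_carrier unit_vec_def)
qed

lemma free_on_induct:
  assumes "cring R" "submodule L R (free_on R S)" "\<And>p. p \<in> S \<Longrightarrow> unit_vec R p \<in> L" "f \<in> carrier (free_on R S)"
  shows "f \<in> L"
proof -
  interpret cring R by fact
  have "f \<in> L" if "finite A" "f \<in> carrier (free_on R S)" "{s. f s \<noteq> \<zero>\<^bsub>R\<^esub>} \<subseteq> A" "A \<subseteq> S" for A f
    using that
  proof (induction A arbitrary: f rule: finite_induct)
    case empty
    hence "f = \<zero>\<^bsub>free_on R S\<^esub>" by auto
    thus ?case using sub_zero[OF assms(2)] by simp
  next
    case (insert p A)
    note v = free_on_val[OF assms(1) insert.prems(1)]
    let ?g = "f(p := \<zero>\<^bsub>R\<^esub>)"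
    have "finite {s. ?g s \<noteq> \<zero>\<^bsub>R\<^esub>}" using insert.prems(1)
      by (auto simp: free_on_carrier elim: rev_finite_subset)
    hence g1: "?g \<in> carrier (free_on R S)" using insert.prems(1) by (auto simp: free_on_carrier)
    have g2: "{s. ?g s \<noteq> \<zero>\<^bsub>R\<^esub>} \<subseteq> A" using insert.prems(2) by auto
    have g: "?g \<in> L" by (rule insert.IH[OF g1 g2]) (use insert.prems(3) in simp)
    have "f p \<odot>\<^bsub>free_on R S\<^esub> unit_vec R p \<in> L"
      using insert.prems(3) v by (intro sub_smult[OF assms(2)] assms(3)) auto
    hence "?g \<oplus>\<^bsub>free_on R S\<^esub> f p \<odot>\<^bsub>free_on R S\<^esub> unit_vec R p \<in> L" by (rule sub_add[OF assms(2) g])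
    moreover have "?g \<oplus>\<^bsub>free_on R S\<^esub> f p \<odot>\<^bsub>free_on R S\<^esub> unit_vec R p = f"
      using v by (auto simp: unit_vec_def fun_eq_iff)
    ultimately show ?case by simp
  qed
  thus ?thesis using assms(4) by (auto simp: free_on_carrier)
qed

lemma free_on_extend:
  assumes "module R Y" "\<And>p. p \<in> S \<Longrightarrow> \<kappa> p \<in> carrier Y"
  obtains \<Phi> where "lin R (free_on R S) Y \<Phi>" "\<And>p. p \<in> S \<Longrightarrow> \<Phi> (unit_vec R p) = \<kappa> p"
proof -
  interpret module R Y by fact
  note cr = R.is_cring
  define \<Phi> where "\<Phi> = (\<lambda>f. \<Oplus>\<^bsub>Y\<^esub>p\<in>{p. f p \<noteq> \<zero>\<^bsub>R\<^esub>}. f p \<odot>\<^bsub>Y\<^esub> \<kappa> p)"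
  \<comment> \<open>The sum may be taken over any finite set containing the support, so that two
    functions can be summed over a common set.\<close>
  have e: "\<Phi> f = (\<Oplus>\<^bsub>Y\<^esub>p\<in>A. f p \<odot>\<^bsub>Y\<^esub> \<kappa> p)"
    if "f \<in> carrier (free_on R S)" "finite A" "{p. f p \<noteq> \<zero>\<^bsub>R\<^esub>} \<subseteq> A" "A \<subseteq> S" for f A
    unfolding \<Phi>_def using that assms(2) free_on_val[OF cr that(1)]
    by (intro M.add.finprod_mono_neutral_cong_left) (auto intro!: smult_closed)
  have sp: "finite {p. f p \<noteq> \<zero>\<^bsub>R\<^esub>}" "{p. f p \<noteq> \<zero>\<^bsub>R\<^esub>} \<subseteq> S" if "f \<in> carrier (free_on R S)" for f
    using that by (auto simp: free_on_carrier)
  interpret F: module R "free_on R S" by (rule free_on_module[OF cr])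
  show ?thesis
  proof (rule that)
    show "lin R (free_on R S) Y \<Phi>"
    proof (rule linI)
      fix f g assume f: "f \<in> carrier (free_on R S)" and g: "g \<in> carrier (free_on R S)"
      note vf = free_on_val[OF cr f] and vg = free_on_val[OF cr g]
      show "\<Phi> f \<in> carrier Y" unfolding \<Phi>_def using vf assms(2) sp(2)[OF f] by (intro M.finsum_closed) auto
      let ?A = "{p. f p \<noteq> \<zero>\<^bsub>R\<^esub>} \<union> {p. g p \<noteq> \<zero>\<^bsub>R\<^esub>}"
      have A: "finite ?A" "?A \<subseteq> S" using sp[OF f] sp[OF g] by auto
      hence k: "\<kappa> p \<in> carrier Y" if "p \<in> ?A" for p using assms(2) that by auto
      have "\<Phi> (f \<oplus>\<^bsub>free_on R S\<^esub> g) = (\<Oplus>\<^bsub>Y\<^esub>p\<in>?A. (f \<oplus>\<^bsub>free_on R S\<^esub> g) p \<odot>\<^bsub>Y\<^esub> \<kappa> p)"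
        by (rule e[OF F.M.a_closed[OF f g] A(1) _ A(2)]) auto
      also have "\<dots> = (\<Oplus>\<^bsub>Y\<^esub>p\<in>?A. f p \<odot>\<^bsub>Y\<^esub> \<kappa> p \<oplus>\<^bsub>Y\<^esub> g p \<odot>\<^bsub>Y\<^esub> \<kappa> p)"
        using vf vg k by (intro M.finsum_cong') (auto simp: smult_l_distr)
      also have "\<dots> = \<Phi> f \<oplus>\<^bsub>Y\<^esub> \<Phi> g"
        unfolding e[OF f A(1) Un_upper1 A(2)] e[OF g A(1) Un_upper2 A(2)]
        using vf vg k by (intro M.finsum_addf) auto
      finally show "\<Phi> (f \<oplus>\<^bsub>free_on R S\<^esub> g) = \<Phi> f \<oplus>\<^bsub>Y\<^esub> \<Phi> g" .
    next
      fix a f assume a: "a \<in> carrier R" and f: "f \<in> carrier (free_on R S)"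
      note vf = free_on_val[OF cr f]
      let ?A = "{p. f p \<noteq> \<zero>\<^bsub>R\<^esub>}"
      have k: "\<kappa> p \<in> carrier Y" if "p \<in> ?A" for p using assms(2) that sp(2)[OF f] by auto
      have "\<Phi> (a \<odot>\<^bsub>free_on R S\<^esub> f) = (\<Oplus>\<^bsub>Y\<^esub>p\<in>?A. (a \<odot>\<^bsub>free_on R S\<^esub> f) p \<odot>\<^bsub>Y\<^esub> \<kappa> p)"
        by (rule e[OF F.smult_closed[OF a f] sp(1)[OF f] _ sp(2)[OF f]]) (use a in auto)
      also have "\<dots> = (\<Oplus>\<^bsub>Y\<^esub>p\<in>?A. a \<odot>\<^bsub>Y\<^esub> (f p \<odot>\<^bsub>Y\<^esub> \<kappa> p))"
        using vf k a by (intro M.finsum_cong') (auto simp: smult_assoc1)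
      also have "\<dots> = a \<odot>\<^bsub>Y\<^esub> \<Phi> f" unfolding \<Phi>_def
        using vf k a sp(1)[OF f] by (intro finsum_smult_ldistr[symmetric]) auto
      finally show "\<Phi> (a \<odot>\<^bsub>free_on R S\<^esub> f) = a \<odot>\<^bsub>Y\<^esub> \<Phi> f" .
    qed
    show "\<Phi> (unit_vec R p) = \<kappa> p" if p: "p \<in> S" for p
    proof -
      have "\<Phi> (unit_vec R p) = (\<Oplus>\<^bsub>Y\<^esub>q\<in>{p}. unit_vec R p q \<odot>\<^bsub>Y\<^esub> \<kappa> q)"
        using p by (intro e[OF unit_vec_free_on[OF cr p]]) (auto simp: unit_vec_def)
      also have "\<dots> = \<kappa> p" using assms(2)[OF p] by (simp add: unit_vec_def)
      finally show ?thesis .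
    qed
  qed
qed

definition pure :: "('a, 'r) ring_scheme \<Rightarrow> ('a, 'm, 'x) module_scheme \<Rightarrow> ('a, 'n, 'y) module_scheme \<Rightarrow>
    'm \<Rightarrow> 'n \<Rightarrow> ('m \<times> 'n \<Rightarrow> 'a) set" where
  "pure R M N x y = gen_submodule R (free_on R (carrier M \<times> carrier N)) (tensor_relations R M N)
     +>\<^bsub>free_on R (carrier M \<times> carrier N)\<^esub> unit_vec R (x, y)"

lemma tensor_relE:
  assumes "f \<in> tensor_relations R M N"
  obtains (add_left) x x' y where "x \<in> carrier M" "x' \<in> carrier M" "y \<in> carrier N"
      "f = unit_vec R (x \<oplus>\<^bsub>M\<^esub> x', y) \<ominus>\<^bsub>free_on R (carrier M \<times> carrier N)\<^esub>
        (unit_vec R (x, y) \<oplus>\<^bsub>free_on R (carrier M \<times> carrier N)\<^esub> unit_vec R (x', y))"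
    | (add_right) x y y' where "x \<in> carrier M" "y \<in> carrier N" "y' \<in> carrier N"
      "f = unit_vec R (x, y \<oplus>\<^bsub>N\<^esub> y') \<ominus>\<^bsub>free_on R (carrier M \<times> carrier N)\<^esub>
        (unit_vec R (x, y) \<oplus>\<^bsub>free_on R (carrier M \<times> carrier N)\<^esub> unit_vec R (x, y'))"
    | (smult_left) a x y where "a \<in> carrier R" "x \<in> carrier M" "y \<in> carrier N"
      "f = unit_vec R (a \<odot>\<^bsub>M\<^esub> x, y) \<ominus>\<^bsub>free_on R (carrier M \<times> carrier N)\<^esub>
        (a \<odot>\<^bsub>free_on R (carrier M \<times> carrier N)\<^esub> unit_vec R (x, y))"
    | (smult_right) a x y where "a \<in> carrier R" "x \<in> carrier M" "y \<in> carrier N"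
      "f = unit_vec R (x, a \<odot>\<^bsub>N\<^esub> y) \<ominus>\<^bsub>free_on R (carrier M \<times> carrier N)\<^esub>
        (a \<odot>\<^bsub>free_on R (carrier M \<times> carrier N)\<^esub> unit_vec R (x, y))"
  using assms 
  apply (unfold tensor_relations_def Let_def)
  apply (unfold Un_iff mem_Collect_eq)
  apply (erule disjE)
  apply (erule disjE)
  apply (erule disjE)
  apply (elim exE conjE)
  apply (rule that(1)[rotated 3], assumption, assumption, assumption, assumption)
  apply (elim exE conjE)
  apply (rule that(2)[rotated 3], assumption, assumption, assumption, assumption)
  apply (elim exE conjE)
  apply (rule that(3)[rotated 3], assumption, assumption, assumption, assumption)
  apply (elim exE conjE)
  apply (rule that(4)[rotated 3], assumption, assumption, assumption, assumption)
  done

lemma tensor_rel_carrier: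
  assumes "module R M" "module R N"
  shows "tensor_relations R M N \<subseteq> carrier (free_on R (carrier M \<times> carrier N))"
proof -
  interpret M: module R M by fact
  interpret N: module R N by fact
  interpret F: module R "free_on R (carrier M \<times> carrier N)" by (rule free_on_module[OF M.R.is_cring])
  have u: "unit_vec R (x, y) \<in> carrier (free_on R (carrier M \<times> carrier N))"
    if "x \<in> carrier M" "y \<in> carrier N" for x y by (rule unit_vec_free_on[OF M.R.is_cring]) (use that in simp)
  show ?thesis
  proof
    fix f assume "f \<in> tensor_relations R M N"
    thus "f \<in> carrier (free_on R (carrier M \<times> carrier N))"
      by (cases rule: tensor_relE) (simp_all add: u del: free_on_simps)
  qed
qed

lemma tensor_sub:
  assumes "module R M" "module R N"
  shows "submodule (gen_submodule R (free_on R (carrier M \<times> carrier N)) (tensor_relations R M N)) R (free_on R (carrier M \<times> carrier N))"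
  using assms by (intro gen_sub free_on_module tensor_rel_carrier) (simp_all add: module_def)

lemma tensor_module:
  assumes "module R M" "module R N" shows "module R (tensor R M N)"
  unfolding tensor_def Let_def using assms
  by (intro quot_module_module tensor_sub free_on_module) (simp_all add: module_def)

lemma pure_closed_bilinear:
  assumes "module R M" "module R N"
  shows "x \<in> carrier M \<Longrightarrow> y \<in> carrier N \<Longrightarrow> pure R M N x y \<in> carrier (tensor R M N)"
    and "y \<in> carrier N \<Longrightarrow> lin R M (tensor R M N) (\<lambda>x. pure R M N x y)"
    and "x \<in> carrier M \<Longrightarrow> lin R N (tensor R M N) (\<lambda>y. pure R M N x y)"
proof -
  interpret M: module R M by fact
  interpret N: module R N by fact
  let ?F = "free_on R (carrier M \<times> carrier N)"
  let ?G = "gen_submodule R ?F (tensor_relations R M N)"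
  note F = free_on_module[OF M.R.is_cring, of "carrier M \<times> carrier N"] and G = tensor_sub[OF assms]
  interpret F: module R ?F by (rule F)
  note q = quot_simps[OF F G]
  have T: "tensor R M N = quot_module ?F ?G" by (simp add: tensor_def Let_def)
  have u: "unit_vec R (x, y) \<in> carrier ?F" if "x \<in> carrier M" "y \<in> carrier N" for x y
    by (rule unit_vec_free_on[OF M.R.is_cring]) (use that in simp)
  have c: "pure R M N x y \<in> carrier (tensor R M N)" if "x \<in> carrier M" "y \<in> carrier N" for x y
    unfolding T q(1) pure_def using u[OF that] by (rule imageI)
  show "x \<in> carrier M \<Longrightarrow> y \<in> carrier N \<Longrightarrow> pure R M N x y \<in> carrier (tensor R M N)" by (rule c)
  have rel: "z \<in> ?G" if "z \<in> tensor_relations R M N" for z using that gen_incl[of "tensor_relations R M N" R ?F] by auto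
  show "lin R M (tensor R M N) (\<lambda>x. pure R M N x y)" if y: "y \<in> carrier N"
  proof (rule linI)
    fix x x' assume x: "x \<in> carrier M" "x' \<in> carrier M"
    have "unit_vec R (x \<oplus>\<^bsub>M\<^esub> x', y) \<ominus>\<^bsub>?F\<^esub> (unit_vec R (x, y) \<oplus>\<^bsub>?F\<^esub> unit_vec R (x', y)) \<in> ?G"
      using x y by (intro rel) (auto simp: tensor_relations_def Let_def simp del: free_on_simps)
    thus "pure R M N (x \<oplus>\<^bsub>M\<^esub> x') y = pure R M N x y \<oplus>\<^bsub>tensor R M N\<^esub> pure R M N x' y"
      unfolding T pure_def q(2)[OF u[OF x(1) y] u[OF x(2) y]]
      by (subst coset_eq_iff[OF F G]) (use x y u in \<open>auto simp del: free_on_simps\<close>)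
  next
    fix a x assume x: "a \<in> carrier R" "x \<in> carrier M"
    have "unit_vec R (a \<odot>\<^bsub>M\<^esub> x, y) \<ominus>\<^bsub>?F\<^esub> (a \<odot>\<^bsub>?F\<^esub> unit_vec R (x, y)) \<in> ?G"
      using x y by (intro rel) (auto simp: tensor_relations_def Let_def simp del: free_on_simps)
    thus "pure R M N (a \<odot>\<^bsub>M\<^esub> x) y = a \<odot>\<^bsub>tensor R M N\<^esub> pure R M N x y"
      unfolding T pure_def q(3)[OF x(1) u[OF x(2) y]]
      by (subst coset_eq_iff[OF F G]) (use x y u in \<open>auto simp del: free_on_simps\<close>)
  qed (rule c[OF _ y])
  show "lin R N (tensor R M N) (\<lambda>y. pure R M N x y)" if x: "x \<in> carrier M"
  proof (rule linI)
    fix y y' assume y: "y \<in> carrier N" "y' \<in> carrier N"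
    have "unit_vec R (x, y \<oplus>\<^bsub>N\<^esub> y') \<ominus>\<^bsub>?F\<^esub> (unit_vec R (x, y) \<oplus>\<^bsub>?F\<^esub> unit_vec R (x, y')) \<in> ?G"
      using x y by (intro rel) (auto simp: tensor_relations_def Let_def simp del: free_on_simps)
    thus "pure R M N x (y \<oplus>\<^bsub>N\<^esub> y') = pure R M N x y \<oplus>\<^bsub>tensor R M N\<^esub> pure R M N x y'"
      unfolding T pure_def q(2)[OF u[OF x y(1)] u[OF x y(2)]]
      by (subst coset_eq_iff[OF F G]) (use x y u in \<open>auto simp del: free_on_simps\<close>)
  next
    fix a y assume y: "a \<in> carrier R" "y \<in> carrier N"
    have "unit_vec R (x, a \<odot>\<^bsub>N\<^esub> y) \<ominus>\<^bsub>?F\<^esub> (a \<odot>\<^bsub>?F\<^esub> unit_vec R (x, y)) \<in> ?G"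
      using x y by (intro rel) (auto simp: tensor_relations_def Let_def simp del: free_on_simps)
    thus "pure R M N x (a \<odot>\<^bsub>N\<^esub> y) = a \<odot>\<^bsub>tensor R M N\<^esub> pure R M N x y"
      unfolding T pure_def q(3)[OF y(1) u[OF x y(2)]]
      by (subst coset_eq_iff[OF F G]) (use x y u in \<open>auto simp del: free_on_simps\<close>)
  qed (rule c[OF x])
qed

lemma tensor_induct:
  assumes "module R M" "module R N" "submodule L R (tensor R M N)"
    "\<And>x y. x \<in> carrier M \<Longrightarrow> y \<in> carrier N \<Longrightarrow> pure R M N x y \<in> L" "w \<in> carrier (tensor R M N)"
  shows "w \<in> L"
proof -
  interpret M: module R M by fact
  let ?F = "free_on R (carrier M \<times> carrier N)"
  let ?G = "gen_submodule R ?F (tensor_relations R M N)"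
  note F = free_on_module[OF M.R.is_cring, of "carrier M \<times> carrier N"] and G = tensor_sub[OF assms(1,2)]
  have T: "tensor R M N = quot_module ?F ?G" by (simp add: tensor_def Let_def)
  have L: "submodule {f \<in> carrier ?F. ?G +>\<^bsub>?F\<^esub> f \<in> L} R ?F"
    using assms(3) unfolding T by (rule sub_vimage[OF F quot_module_module[OF F G] lin_quot[OF F G]])
  obtain f where f: "f \<in> carrier ?F" "w = ?G +>\<^bsub>?F\<^esub> f" using assms(5) unfolding T quot_simps(1)[OF F G] by auto
  have "f \<in> {f \<in> carrier ?F. ?G +>\<^bsub>?F\<^esub> f \<in> L}"
  proof (rule free_on_induct[OF M.R.is_cring L _ f(1)])
    fix p assume p: "p \<in> carrier M \<times> carrier N"
    thus "unit_vec R p \<in> {f \<in> carrier ?F. ?G +>\<^bsub>?F\<^esub> f \<in> L}"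
      using assms(4)[of "fst p" "snd p"] unit_vec_free_on[OF M.R.is_cring p] by (auto simp: pure_def)
  qed
  thus ?thesis using f(2) by simp
qed

section \<open>The tensor product from a presentation\<close>

text \<open>The map \<open>D \<otimes> N : N\<^sup>k \<rightarrow> N\<^sup>n\<close>, whose cokernel is \<open>M \<otimes> N\<close> for a presentation \<open>D\<close> of \<open>M\<close>.\<close>

definition tensor_map :: "('a, 'r) ring_scheme \<Rightarrow> ('a, 'n, 'y) module_scheme \<Rightarrow> nat \<Rightarrow> nat \<Rightarrow>
    ((nat \<Rightarrow> 'a) \<Rightarrow> (nat \<Rightarrow> 'a)) \<Rightarrow> (nat \<Rightarrow> 'n) \<Rightarrow> nat \<Rightarrow> 'n" where
  "tensor_map R N n k D c = (\<lambda>i. if i < n then lincomb N k c (\<lambda>j. D (unit_vec R j) i) else \<zero>\<^bsub>N\<^esub>)"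

text \<open>The image of \<open>r \<otimes> y\<close> under the isomorphism of
  \<open>R^n \<otimes> N\<close> with \<open>N^n\<close>.\<close>

definition scaled :: "('a, 'n, 'y) module_scheme \<Rightarrow> nat \<Rightarrow> (nat \<Rightarrow> 'a) \<Rightarrow> 'n \<Rightarrow> nat \<Rightarrow> 'n" where
  "scaled N n r y = (\<lambda>i. if i < n then r i \<odot>\<^bsub>N\<^esub> y else \<zero>\<^bsub>N\<^esub>)"

locale presentation = M?: module R M + N?: module R N
  for R (structure) and M :: "('a, 'm, 'x) module_scheme" and N :: "('a, 'n, 'y) module_scheme" +
  fixes n k :: nat and u :: "nat \<Rightarrow> 'm" and D :: "(nat \<Rightarrow> 'a) \<Rightarrow> (nat \<Rightarrow> 'a)"
  assumes gens_u: "gens R M n u" and lin_D: "lin R (finite_free R k) (finite_free R n) D"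
    and ker_D: "\<And>r. r \<in> carrier (finite_free R n) \<Longrightarrow>
      lincomb M n u r = \<zero>\<^bsub>M\<^esub> \<longleftrightarrow> r \<in> D ` carrier (finite_free R k)"
begin

lemma Mm: "module R M" and Nm: "module R N" by unfold_locales

lemma cr: "cring R" by (rule M.R.is_cring)

abbreviation "Nn \<equiv> pow_module N {..<n}"
abbreviation "Nk \<equiv> pow_module N {..<k}"

lemma Nn: "module R Nn" and Nk: "module R Nk" by (rule pow_module_module[OF Nm])+

lemma F: "module R (finite_free R i)" by (rule finite_free_module[OF cr])

lemma uc: "u \<in> {..<n} \<rightarrow> carrier M" using gens_u unfolding gens_def by (rule conjunct1)

lemma D_val: "j < k \<Longrightarrow> D (unit_vec R j) i \<in> carrier R"
  by (rule finite_free_val[OF cr lin_closed[OF lin_D unit_vec_carrier[OF cr]]])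

lemma lin_tensor_map: "lin R Nk Nn (tensor_map R N n k D)"
proof (rule linI)
  fix c e assume c: "c \<in> carrier Nk" and e: "e \<in> carrier Nk"
  show "tensor_map R N n k D c \<in> carrier Nn" unfolding tensor_map_def pow_carrier
    using pow_val[OF Nm c] D_val by (auto intro!: lincomb_closed[OF Nm])
  show "tensor_map R N n k D (c \<oplus>\<^bsub>Nk\<^esub> e) = tensor_map R N n k D c \<oplus>\<^bsub>Nn\<^esub> tensor_map R N n k D e"
    using lincomb_add_family[OF Nm, of k c e] D_val pow_val[OF Nm c] pow_val[OF Nm e]
    by (auto simp: tensor_map_def fun_eq_iff)
next
  fix a c assume a: "a \<in> carrier R" and c: "c \<in> carrier Nk"
  show "tensor_map R N n k D (a \<odot>\<^bsub>Nk\<^esub> c) = a \<odot>\<^bsub>Nn\<^esub> tensor_map R N n k D c"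
    using lincomb_smult_family[OF Nm, of k c _ a] D_val pow_val[OF Nm c] a
    by (auto simp: tensor_map_def fun_eq_iff)
qed

abbreviation "B \<equiv> tensor_map R N n k D ` carrier Nk"

lemma B_sub: "submodule B R Nn"
  by (rule sub_image[OF Nk Nn lin_tensor_map sub_carrier[OF Nk]])

lemma lin_scaled_left: "y \<in> carrier N \<Longrightarrow> lin R (finite_free R n) Nn (\<lambda>r. scaled N n r y)"
  by (rule linI)
    (auto simp: scaled_def pow_carrier fun_eq_iff N.smult_l_distr N.smult_assoc1 finite_free_val[OF cr] intro!: N.smult_closed)

lemma lin_scaled_right: "r \<in> carrier (finite_free R n) \<Longrightarrow> lin R N Nn (scaled N n r)"
  using finite_free_val[OF cr, of r n]
  by (intro linI) (auto simp: scaled_def pow_carrier fun_eq_iff N.smult_r_distr M.R.m_comm simp flip: N.smult_assoc1)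

lemma single_carrier: "j < i \<Longrightarrow> y \<in> carrier N \<Longrightarrow> single N j y \<in> carrier (pow_module N {..<i})"
  by (rule lin_closed[OF lin_single[OF Nm]]) auto

lemma tensor_map_single:
  assumes "j < k" "y \<in> carrier N"
  shows "tensor_map R N n k D (single N j y) = scaled N n (D (unit_vec R j)) y"
proof -
  have "lincomb N k (single N j y) (\<lambda>j. D (unit_vec R j) i) = D (unit_vec R j) i \<odot>\<^bsub>N\<^esub> y" for i
  proof -
    have "lincomb N k (single N j y) (\<lambda>j. D (unit_vec R j) i) =
       (\<Oplus>\<^bsub>N\<^esub>l\<in>{..<k}. if j = l then D (unit_vec R l) i \<odot>\<^bsub>N\<^esub> y else \<zero>\<^bsub>N\<^esub>)"
      unfolding lincomb_def using D_val assms by (intro N.M.finsum_cong') (auto simp: single_def)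
    also have "\<dots> = D (unit_vec R j) i \<odot>\<^bsub>N\<^esub> y"
      using D_val assms by (intro N.M.finsum_singleton) auto
    finally show ?thesis .
  qed
  thus ?thesis by (auto simp: tensor_map_def scaled_def fun_eq_iff)
qed

text \<open>By linearity in the relation it is enough to treat the columns of \<open>D\<close>,
  which are images of one-coordinate vectors.\<close>

lemma scaled_rel:
  assumes "r \<in> carrier (finite_free R n)" "lincomb M n u r = \<zero>\<^bsub>M\<^esub>" "y \<in> carrier N"
  shows "scaled N n r y \<in> B"
proof -
  obtain s where s: "s \<in> carrier (finite_free R k)" "r = D s" using ker_D[OF assms(1)] assms(2) by auto
  note l = lin_comp[OF lin_D lin_scaled_left[OF assms(3)]]
  have "scaled N n (D s) y = lincomb Nn k (\<lambda>j. scaled N n (D (unit_vec R j)) y) s"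
    by (rule lin_free_eq[OF Nn l s(1)])
  also have "\<dots> \<in> B"
  proof (rule lincomb_in_sub[OF Nn B_sub])
    fix j assume j: "j < k"
    have "scaled N n (D (unit_vec R j)) y \<in> B"
      using tensor_map_single[OF j assms(3)] single_carrier[OF j assms(3)] by (metis imageI)
    thus "s j \<odot>\<^bsub>Nn\<^esub> scaled N n (D (unit_vec R j)) y \<in> B"
      by (rule sub_smult[OF B_sub finite_free_val[OF cr s(1)]])
  qed
  finally show ?thesis using s(2) by simp
qed

text \<open>An arbitrary choice of coefficients, in general not linear in \<open>x\<close>. Its
  failures to be linear are relations between the generators, which become elements of
  \<open>B\<close> after tensoring.\<close>

definition coords :: "'m \<Rightarrow> nat \<Rightarrow> 'a" where
  "coords x = (SOME r. r \<in> carrier (finite_free R n) \<and> lincomb M n u r = x)"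

lemma coords:
  assumes "x \<in> carrier M" shows "coords x \<in> carrier (finite_free R n)" "lincomb M n u (coords x) = x"
proof -
  have "\<exists>r. r \<in> carrier (finite_free R n) \<and> lincomb M n u r = x"
    using assms gens_u by (auto simp: gens_def)
  from someI_ex[OF this] show "coords x \<in> carrier (finite_free R n)" "lincomb M n u (coords x) = x"
    by (auto simp: coords_def)
qed

definition \<Theta> :: "(nat \<Rightarrow> 'n) \<Rightarrow> ('m \<times> 'n \<Rightarrow> 'a) set" where
  "\<Theta> c = (\<Oplus>\<^bsub>tensor R M N\<^esub>i\<in>{..<n}. pure R M N (u i) (c i))"

abbreviation "W \<equiv> tensor R M N"

lemma W: "module R W" by (rule tensor_module[OF Mm Nm])

lemma ui: "i < n \<Longrightarrow> u i \<in> carrier M" using uc by auto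

lemma lin_\<Theta>: "lin R Nn W \<Theta>"
proof (rule linI)
  interpret W: module R W by (rule W)
  note pr = pure_closed_bilinear[OF Mm Nm]
  fix c e assume c: "c \<in> carrier Nn" and e: "e \<in> carrier Nn"
  note vc = pow_val[OF Nm c] and ve = pow_val[OF Nm e]
  show "\<Theta> c \<in> carrier W" unfolding \<Theta>_def using pr(1) vc ui by (intro W.M.finsum_closed) auto
  have "\<Theta> (c \<oplus>\<^bsub>Nn\<^esub> e) = (\<Oplus>\<^bsub>W\<^esub>i\<in>{..<n}. pure R M N (u i) (c i) \<oplus>\<^bsub>W\<^esub> pure R M N (u i) (e i))"
    unfolding \<Theta>_def using pr(1) vc ve ui lin_add[OF pr(3)] by (intro W.M.finsum_cong') auto
  also have "\<dots> = \<Theta> c \<oplus>\<^bsub>W\<^esub> \<Theta> e" unfolding \<Theta>_def using pr(1) vc ve ui by (intro W.M.finsum_addf) auto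
  finally show "\<Theta> (c \<oplus>\<^bsub>Nn\<^esub> e) = \<Theta> c \<oplus>\<^bsub>W\<^esub> \<Theta> e" .
next
  interpret W: module R W by (rule W)
  note pr = pure_closed_bilinear[OF Mm Nm]
  fix a c assume a: "a \<in> carrier R" and c: "c \<in> carrier Nn"
  note vc = pow_val[OF Nm c]
  have "\<Theta> (a \<odot>\<^bsub>Nn\<^esub> c) = (\<Oplus>\<^bsub>W\<^esub>i\<in>{..<n}. a \<odot>\<^bsub>W\<^esub> pure R M N (u i) (c i))"
    unfolding \<Theta>_def using pr(1) vc ui a lin_smult[OF pr(3)] by (intro W.M.finsum_cong') auto
  also have "\<dots> = a \<odot>\<^bsub>W\<^esub> \<Theta> c" unfolding \<Theta>_def
    using pr(1) vc ui a by (intro W.finsum_smult_ldistr[symmetric]) auto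
  finally show "\<Theta> (a \<odot>\<^bsub>Nn\<^esub> c) = a \<odot>\<^bsub>W\<^esub> \<Theta> c" .
qed

lemma \<Theta>_scaled:
  assumes "r \<in> carrier (finite_free R n)" "y \<in> carrier N"
  shows "\<Theta> (scaled N n r y) = pure R M N (lincomb M n u r) y"
proof -
  interpret W: module R W by (rule W)
  note pr = pure_closed_bilinear[OF Mm Nm]
  note v = finite_free_val[OF cr assms(1)]
  have "pure R M N (lincomb M n u r) y = lincomb W n (\<lambda>i. pure R M N (u i) y) r"
    using v by (intro lin_lincomb_comp[OF Mm W pr(2)[OF assms(2)] uc]) auto
  also have "\<dots> = \<Theta> (scaled N n r y)" unfolding \<Theta>_def lincomb_def scaled_def
    using v pr(1) ui assms(2) lin_smult[OF pr(3)] by (intro W.M.finsum_cong') auto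
  finally show ?thesis by simp
qed

lemma \<Theta>_surj: "\<Theta> ` carrier Nn = carrier W"
proof
  show "\<Theta> ` carrier Nn \<subseteq> carrier W" using lin_closed[OF lin_\<Theta>] by auto
  show "carrier W \<subseteq> \<Theta> ` carrier Nn"
  proof
    fix w assume "w \<in> carrier W"
    thus "w \<in> \<Theta> ` carrier Nn"
    proof (rule tensor_induct[OF Mm Nm sub_image[OF Nn W lin_\<Theta> sub_carrier[OF Nn]], rotated])
      fix x y assume x: "x \<in> carrier M" and y: "y \<in> carrier N"
      have "pure R M N x y = \<Theta> (scaled N n (coords x) y)" using \<Theta>_scaled[OF coords(1)[OF x] y] coords(2)[OF x] by simp
      thus "pure R M N x y \<in> \<Theta> ` carrier Nn" using lin_closed[OF lin_scaled_left[OF y] coords(1)[OF x]] by simp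
    qed
  qed
qed

lemma \<Theta>_B: "b \<in> B \<Longrightarrow> \<Theta> b = \<zero>\<^bsub>W\<^esub>"
proof -
  assume "b \<in> B"
  then obtain c where c: "c \<in> carrier Nk" "b = tensor_map R N n k D c" by auto
  have K: "submodule {c \<in> carrier Nk. tensor_map R N n k D c \<in> mod_ker Nn W \<Theta>} R Nk"
    by (rule sub_vimage[OF Nk Nn lin_tensor_map sub_ker[OF Nn W lin_\<Theta>]])
  have "(\<Oplus>\<^bsub>Nk\<^esub>j\<in>{..<k}. single N j (c j)) \<in> {c \<in> carrier Nk. tensor_map R N n k D c \<in> mod_ker Nn W \<Theta>}"
  proof (rule sub_finsum[OF Nk K finite_lessThan], rule funcsetI)
    fix j assume j: "j \<in> {..<k}"
    note y = pow_val[OF Nm c(1), of j]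
    have s: "single N j (c j) \<in> carrier Nk" using j y by (intro single_carrier) auto
    have Dj: "D (unit_vec R j) \<in> carrier (finite_free R n)" using j by (intro lin_closed[OF lin_D] unit_vec_carrier[OF cr]) auto
    have "lincomb M n u (D (unit_vec R j)) = \<zero>\<^bsub>M\<^esub>"
      unfolding ker_D[OF Dj] using j by (intro imageI unit_vec_carrier[OF cr]) auto
    moreover have "pure R M N \<zero>\<^bsub>M\<^esub> (c j) = \<zero>\<^bsub>W\<^esub>" by (rule lin_zero[OF Mm W pure_closed_bilinear(2)[OF Mm Nm y]])
    ultimately have "\<Theta> (tensor_map R N n k D (single N j (c j))) = \<zero>\<^bsub>W\<^esub>"
      using tensor_map_single[OF _ y] \<Theta>_scaled[OF Dj y] j by simp
    thus "single N j (c j) \<in> {c \<in> carrier Nk. tensor_map R N n k D c \<in> mod_ker Nn W \<Theta>}"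
      using s lin_closed[OF lin_tensor_map s] by (simp add: mod_ker_def)
  qed
  thus ?thesis using pow_decomp[OF Nm _ c(1)] c(2) by (simp add: mod_ker_def)
qed

text \<open>The map \<open>\<Phi>\<close> on the free module over all pairs sends the basis element
  \<open>(x, y)\<close> to \<open>coords x \<otimes> y\<close>. It takes every tensor relation into
  \<open>B\<close>, so vanishing in the tensor product is detected in \<open>N^n\<close> modulo
  \<open>B\<close>.\<close>

lemma \<Theta>_zeroD:
  assumes "c \<in> carrier Nn" "\<Theta> c = \<zero>\<^bsub>W\<^esub>" shows "c \<in> B"
proof -
  let ?S = "carrier M \<times> carrier N"
  let ?F = "free_on R ?S"
  let ?G = "gen_submodule R ?F (tensor_relations R M N)"
  note Fm = free_on_module[OF cr, of ?S] and G = tensor_sub[OF Mm Nm]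
  interpret F: module R ?F by (rule Fm)
  interpret Nn: module R Nn by (rule Nn)
  have T: "W = quot_module ?F ?G" by (simp add: tensor_def Let_def)
  define \<kappa> where "\<kappa> = (\<lambda>p. scaled N n (coords (fst p)) (snd p))"
  have kc: "\<kappa> (x, y) \<in> carrier Nn" if "x \<in> carrier M" "y \<in> carrier N" for x y
    unfolding \<kappa>_def using lin_closed[OF lin_scaled_left coords(1)] that by simp
  obtain \<Phi> where Phi: "lin R ?F Nn \<Phi>" "\<And>p. p \<in> ?S \<Longrightarrow> \<Phi> (unit_vec R p) = \<kappa> p"
    using free_on_extend[OF Nn, of ?S \<kappa>] kc by auto
  \<comment> \<open>Two coefficient vectors of the same element differ by a relation of
    \<open>M\<close>, so modulo \<open>B\<close> the choice made by \<open>coords\<close> is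
    invisible.\<close>
  have rel: "scaled N n r y \<ominus>\<^bsub>Nn\<^esub> scaled N n r' y \<in> B"
    if "r \<in> carrier (finite_free R n)" "r' \<in> carrier (finite_free R n)" "lincomb M n u r = lincomb M n u r'" "y \<in> carrier N" for r r' y
  proof -
    interpret Fn: module R "finite_free R n" by (rule F)
    have "lincomb M n u (r \<ominus>\<^bsub>finite_free R n\<^esub> r') = \<zero>\<^bsub>M\<^esub>"
      using lin_minus[OF F Mm lin_lincomb[OF Mm uc] that(1,2)] that(3) lin_closed[OF lin_lincomb[OF Mm uc] that(2)]
      by (simp add: a_minus_def M.M.r_neg)
    hence "scaled N n (r \<ominus>\<^bsub>finite_free R n\<^esub> r') y \<in> B" using that by (intro scaled_rel) auto
    thus ?thesis using lin_minus[OF F Nn lin_scaled_left[OF that(4)] that(1,2)] by simp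
  qed
  have uv: "unit_vec R (x, y) \<in> carrier ?F" if "x \<in> carrier M" "y \<in> carrier N" for x y
    by (rule unit_vec_free_on[OF cr]) (use that in simp)
  have P: "\<Phi> (unit_vec R (x, y)) = scaled N n (coords x) y" if "x \<in> carrier M" "y \<in> carrier N" for x y
    using Phi(2)[of "(x, y)"] that by (simp add: \<kappa>_def)
  have V: "submodule {f \<in> carrier ?F. \<Phi> f \<in> B} R ?F" by (rule sub_vimage[OF Fm Nn Phi(1) B_sub])
  have zB: "z \<ominus>\<^bsub>Nn\<^esub> z \<in> B" if "z \<in> carrier Nn" for z
    using that sub_zero[OF B_sub] by (simp add: a_minus_def Nn.M.r_neg del: pow_simps)
  have "tensor_relations R M N \<subseteq> {f \<in> carrier ?F. \<Phi> f \<in> B}"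
  proof
    fix f assume f: "f \<in> tensor_relations R M N"
    have fF: "f \<in> carrier ?F" using tensor_rel_carrier[OF Mm Nm] f by auto
    note cc = coords
    from f have "\<Phi> f \<in> B"
    proof (cases rule: tensor_relE)
      case (add_left x x' y)
      note x = add_left(1-3) and sm = M.M.a_closed[OF add_left(1,2)]
      have "\<Phi> f = scaled N n (coords (x \<oplus>\<^bsub>M\<^esub> x')) y \<ominus>\<^bsub>Nn\<^esub> (scaled N n (coords x) y \<oplus>\<^bsub>Nn\<^esub> scaled N n (coords x') y)"
        unfolding add_left(4) using lin_minus[OF Fm Nn Phi(1) uv[OF sm x(3)] F.M.a_closed[OF uv[OF x(1,3)] uv[OF x(2,3)]]]
          lin_add[OF Phi(1) uv[OF x(1,3)] uv[OF x(2,3)]] P x sm by simp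
      also have "scaled N n (coords x) y \<oplus>\<^bsub>Nn\<^esub> scaled N n (coords x') y = scaled N n (coords x \<oplus>\<^bsub>finite_free R n\<^esub> coords x') y"
        by (rule lin_add[OF lin_scaled_left[OF x(3)] cc(1)[OF x(1)] cc(1)[OF x(2)], symmetric])
      finally show ?thesis
      proof (elim ssubst, intro rel)
        interpret Fn: module R "finite_free R n" by (rule F)
        show "coords x \<oplus>\<^bsub>finite_free R n\<^esub> coords x' \<in> carrier (finite_free R n)"
          by (rule Fn.M.a_closed[OF cc(1)[OF x(1)] cc(1)[OF x(2)]])
        show "lincomb M n u (coords (x \<oplus>\<^bsub>M\<^esub> x')) = lincomb M n u (coords x \<oplus>\<^bsub>finite_free R n\<^esub> coords x')"
          unfolding lin_add[OF lin_lincomb[OF Mm uc] cc(1)[OF x(1)] cc(1)[OF x(2)]] using cc(2) x sm by simp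
      qed (use cc(1)[OF sm] x in auto)
    next
      case (add_right x y y')
      note x = add_right(1-3) and sm = N.M.a_closed[OF add_right(2,3)]
      have "\<Phi> f = scaled N n (coords x) (y \<oplus>\<^bsub>N\<^esub> y') \<ominus>\<^bsub>Nn\<^esub> (scaled N n (coords x) y \<oplus>\<^bsub>Nn\<^esub> scaled N n (coords x) y')"
        unfolding add_right(4) using lin_minus[OF Fm Nn Phi(1) uv[OF x(1) sm] F.M.a_closed[OF uv[OF x(1,2)] uv[OF x(1,3)]]]
          lin_add[OF Phi(1) uv[OF x(1,2)] uv[OF x(1,3)]] P x sm by simp
      thus ?thesis using zB lin_add[OF lin_scaled_right[OF cc(1)[OF x(1)]] x(2,3)]
          lin_closed[OF lin_scaled_right[OF cc(1)[OF x(1)]] sm] by simp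
    next
      case (smult_left a x y)
      note x = smult_left(1-3) and sm = M.smult_closed[OF smult_left(1,2)]
      have "\<Phi> f = scaled N n (coords (a \<odot>\<^bsub>M\<^esub> x)) y \<ominus>\<^bsub>Nn\<^esub> (a \<odot>\<^bsub>Nn\<^esub> scaled N n (coords x) y)"
        unfolding smult_left(4) using lin_minus[OF Fm Nn Phi(1) uv[OF sm x(3)] F.smult_closed[OF x(1) uv[OF x(2,3)]]]
          lin_smult[OF Phi(1) x(1) uv[OF x(2,3)]] P x sm by simp
      also have "a \<odot>\<^bsub>Nn\<^esub> scaled N n (coords x) y = scaled N n (a \<odot>\<^bsub>finite_free R n\<^esub> coords x) y"
        by (rule lin_smult[OF lin_scaled_left[OF x(3)] x(1) cc(1)[OF x(2)], symmetric])
      finally show ?thesis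
      proof (elim ssubst, intro rel)
        interpret Fn: module R "finite_free R n" by (rule F)
        show "a \<odot>\<^bsub>finite_free R n\<^esub> coords x \<in> carrier (finite_free R n)"
          by (rule Fn.smult_closed[OF x(1) cc(1)[OF x(2)]])
        show "lincomb M n u (coords (a \<odot>\<^bsub>M\<^esub> x)) = lincomb M n u (a \<odot>\<^bsub>finite_free R n\<^esub> coords x)"
          unfolding lin_smult[OF lin_lincomb[OF Mm uc] x(1) cc(1)[OF x(2)]] using cc(2) x sm by simp
      qed (use cc(1)[OF sm] x in auto)
    next
      case (smult_right a x y)
      note x = smult_right(1-3) and sm = N.smult_closed[OF smult_right(1,3)]
      have "\<Phi> f = scaled N n (coords x) (a \<odot>\<^bsub>N\<^esub> y) \<ominus>\<^bsub>Nn\<^esub> (a \<odot>\<^bsub>Nn\<^esub> scaled N n (coords x) y)"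
        unfolding smult_right(4) using lin_minus[OF Fm Nn Phi(1) uv[OF x(2) sm] F.smult_closed[OF x(1) uv[OF x(2,3)]]]
          lin_smult[OF Phi(1) x(1) uv[OF x(2,3)]] P x sm by simp
      thus ?thesis using zB lin_smult[OF lin_scaled_right[OF cc(1)[OF x(2)]] x(1,3)]
          lin_closed[OF lin_scaled_right[OF cc(1)[OF x(2)]] sm] by simp
    qed
    thus "f \<in> {f \<in> carrier ?F. \<Phi> f \<in> B}" using fF by simp
  qed
  hence GV: "?G \<subseteq> {f \<in> carrier ?F. \<Phi> f \<in> B}" by (rule gen_least[OF V])
  note vc = pow_val[OF Nm assms(1)]
  have ucF: "(\<lambda>i. unit_vec R (u i, c i)) \<in> {..<n} \<rightarrow> carrier ?F" using uv ui vc by auto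
  let ?g = "\<Oplus>\<^bsub>?F\<^esub>i\<in>{..<n}. unit_vec R (u i, c i)"
  have gF: "?g \<in> carrier ?F" by (rule F.M.finsum_closed[OF ucF])
  have "\<Theta> c = ?G +>\<^bsub>?F\<^esub> ?g"
    unfolding \<Theta>_def pure_def
    using lin_finsum[OF Fm quot_module_module[OF Fm G] lin_quot[OF Fm G] finite_lessThan ucF] by (simp add: T)
  hence "?g \<in> ?G" using assms(2) quot_zero_iff[OF Fm G gF] by (simp add: T)
  hence g: "\<Phi> ?g \<in> B" using GV by auto
  have Pg: "\<Phi> ?g = (\<Oplus>\<^bsub>Nn\<^esub>i\<in>{..<n}. \<Phi> (unit_vec R (u i, c i)))"
    by (rule lin_finsum[OF Fm Nn Phi(1) finite_lessThan ucF])
  have sc: "(\<lambda>i. single N i (c i)) \<in> {..<n} \<rightarrow> carrier Nn" using single_carrier vc by auto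
  have pc: "\<Phi> (unit_vec R (u i, c i)) \<in> carrier Nn" if "i < n" for i using lin_closed[OF Phi(1) uv[OF ui[OF that] vc]] .
  \<comment> \<open>Return from \<open>\<Phi>\<close> to \<open>c\<close>: the unit vector at
    \<open>i\<close> and \<open>coords (u i)\<close> both represent \<open>u i\<close>, so the two
    sums agree modulo \<open>B\<close> term by term.\<close>
  have "(\<Oplus>\<^bsub>Nn\<^esub>i\<in>{..<n}. single N i (c i) \<ominus>\<^bsub>Nn\<^esub> \<Phi> (unit_vec R (u i, c i))) \<in> B"
  proof (rule sub_finsum[OF Nn B_sub finite_lessThan], rule funcsetI)
    fix i assume i: "i \<in> {..<n}"
    have "single N i (c i) = scaled N n (unit_vec R i) (c i)"
      using i vc by (auto simp: single_def scaled_def unit_vec_def fun_eq_iff)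
    moreover have "scaled N n (unit_vec R i) (c i) \<ominus>\<^bsub>Nn\<^esub> scaled N n (coords (u i)) (c i) \<in> B"
      using i vc by (intro rel unit_vec_carrier[OF cr] coords(1) ui) (auto simp: lincomb_unit[OF Mm uc] coords(2) ui)
    ultimately show "single N i (c i) \<ominus>\<^bsub>Nn\<^esub> \<Phi> (unit_vec R (u i, c i)) \<in> B" using P[OF ui vc] i by simp
  qed
  also have "(\<Oplus>\<^bsub>Nn\<^esub>i\<in>{..<n}. single N i (c i) \<ominus>\<^bsub>Nn\<^esub> \<Phi> (unit_vec R (u i, c i))) =
     (\<Oplus>\<^bsub>Nn\<^esub>i\<in>{..<n}. single N i (c i)) \<ominus>\<^bsub>Nn\<^esub> (\<Oplus>\<^bsub>Nn\<^esub>i\<in>{..<n}. \<Phi> (unit_vec R (u i, c i)))"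
  proof -
    have "(\<Oplus>\<^bsub>Nn\<^esub>i\<in>{..<n}. \<ominus>\<^bsub>Nn\<^esub> \<Phi> (unit_vec R (u i, c i))) = \<ominus>\<^bsub>Nn\<^esub> (\<Oplus>\<^bsub>Nn\<^esub>i\<in>{..<n}. \<Phi> (unit_vec R (u i, c i)))"
      using pc by (intro lin_finsum[OF Nn Nn lin_neg_fun[OF Nn Nn], symmetric]) (auto simp: lin_def)
    thus ?thesis unfolding a_minus_def using pc sc by (subst Nn.M.finsum_addf) auto
  qed
  also have "\<dots> = c \<ominus>\<^bsub>Nn\<^esub> \<Phi> ?g" unfolding Pg using pow_decomp[OF Nm finite_lessThan assms(1)] by simp
  finally show "c \<in> B" using g assms(1) by (rule sub_minus_cancel[OF Nn B_sub])
qed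

end

section \<open>Homomorphism modules and the transpose\<close>

lemma Hom_simps [simp]:
  "carrier (Hom_module R M N) = mod_hom R M N"
  "\<zero>\<^bsub>Hom_module R M N\<^esub> = (\<lambda>x\<in>carrier M. \<zero>\<^bsub>N\<^esub>)"
  "f \<oplus>\<^bsub>Hom_module R M N\<^esub> g = (\<lambda>x\<in>carrier M. f x \<oplus>\<^bsub>N\<^esub> g x)"
  "a \<odot>\<^bsub>Hom_module R M N\<^esub> f = (\<lambda>x\<in>carrier M. a \<odot>\<^bsub>N\<^esub> f x)"
  by (simp_all add: Hom_module_def)

lemma Hom_module_module:
  assumes "module R M" "module R N" shows "module R (Hom_module R M N)"
proof -
  interpret M: module R M by fact
  interpret N: module R N by fact
  have val: "f x \<in> carrier N" if "f \<in> mod_hom R M N" "x \<in> carrier M" for f x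
    by (rule lin_closed[OF mod_hom_lin[OF that(1)] that(2)])
  have ext: "f = g" if "f \<in> mod_hom R M N" "g \<in> extensional (carrier M)" "\<And>x. x \<in> carrier M \<Longrightarrow> f x = g x" for f g
    using that by (intro extensionalityI[of f "carrier M" g]) (auto simp: mod_hom_iff)
  have add: "(\<lambda>x\<in>carrier M. f x \<oplus>\<^bsub>N\<^esub> g x) \<in> mod_hom R M N" if "f \<in> mod_hom R M N" "g \<in> mod_hom R M N" for f g
    by (rule restrict_mod_hom[OF assms(1) lin_add_fun[OF assms mod_hom_lin[OF that(1)] mod_hom_lin[OF that(2)]]])
  have sm: "(\<lambda>x\<in>carrier M. a \<odot>\<^bsub>N\<^esub> f x) \<in> mod_hom R M N" if "f \<in> mod_hom R M N" "a \<in> carrier R" for f a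
    by (rule restrict_mod_hom[OF assms(1) lin_smult_fun[OF assms mod_hom_lin[OF that(1)] that(2)]])
  have ng: "(\<lambda>x\<in>carrier M. \<ominus>\<^bsub>N\<^esub> f x) \<in> mod_hom R M N" if "f \<in> mod_hom R M N" for f
    by (rule restrict_mod_hom[OF assms(1) lin_neg_fun[OF assms mod_hom_lin[OF that(1)]]])
  have zr: "(\<lambda>x\<in>carrier M. \<zero>\<^bsub>N\<^esub>) \<in> mod_hom R M N"
    by (rule restrict_mod_hom[OF assms(1)]) (rule linI, simp_all)
  show ?thesis
  proof (intro moduleI abelian_groupI)
    fix f assume "f \<in> carrier (Hom_module R M N)"
    thus "\<exists>g\<in>carrier (Hom_module R M N). g \<oplus>\<^bsub>Hom_module R M N\<^esub> f = \<zero>\<^bsub>Hom_module R M N\<^esub>"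
      by (intro bexI[of _ "\<lambda>x\<in>carrier M. \<ominus>\<^bsub>N\<^esub> f x"]) (auto simp: ng val N.M.l_neg fun_eq_iff)
  next
    fix f assume f: "f \<in> carrier (Hom_module R M N)"
    thus "\<zero>\<^bsub>Hom_module R M N\<^esub> \<oplus>\<^bsub>Hom_module R M N\<^esub> f = f"
      by (intro ext[symmetric]) (auto simp: val)
    show "\<one>\<^bsub>R\<^esub> \<odot>\<^bsub>Hom_module R M N\<^esub> f = f" using f
      by (intro ext[symmetric]) (auto simp: val)
  qed (auto simp: add sm zr val fun_eq_iff N.M.a_ac N.smult_l_distr N.smult_r_distr N.smult_assoc1 M.R.is_cring)
qed

section \<open>Transposed matrices and the transpose of a module\<close>

text \<open>The functional with coordinate vector \<open>r\<close>. Identifying \<open>R^n\<close>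
  with its dual brings the dual of a presentation into the shape of \<open>free_resolution\<close>,
  whose terms are all \<open>finite_free\<close>.\<close>

definition dual_vec :: "('a, 'r) ring_scheme \<Rightarrow> nat \<Rightarrow> (nat \<Rightarrow> 'a) \<Rightarrow> (nat \<Rightarrow> 'a) \<Rightarrow> 'a" where
  "dual_vec R n r = restrict (lincomb (ring_module R) n r) (carrier (finite_free R n))"

text \<open>The transposed matrix of \<open>D\<close>, that is, the dual map in the coordinates of
  \<open>dual_vec\<close>; see \<open>compose_dual_vec\<close>.\<close>

definition dual_map :: "('a, 'r) ring_scheme \<Rightarrow> nat \<Rightarrow> nat \<Rightarrow> ((nat \<Rightarrow> 'a) \<Rightarrow> (nat \<Rightarrow> 'a)) \<Rightarrow> (nat \<Rightarrow> 'a) \<Rightarrow> nat \<Rightarrow> 'a" where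
  "dual_map R n k D s = (\<lambda>j. if j < k then lincomb (ring_module R) n s (D (unit_vec R j)) else \<zero>\<^bsub>R\<^esub>)"

lemma free_pow_carrier: "c \<in> carrier (pow_module (ring_module R) {..<n}) \<longleftrightarrow> c \<in> carrier (finite_free R n)"
  by (simp add: finite_free_pow)

lemma free_family: "c \<in> carrier (finite_free R n) \<Longrightarrow> c \<in> {..<n} \<rightarrow> carrier (ring_module R)"
  by (simp add: finite_free_carrier)

context cring
begin

lemma RM: "module R (ring_module R)" by (rule ring_module_module[OF is_cring])

lemma FF: "module R (finite_free R n)" by (rule finite_free_module[OF is_cring])

lemma dual_vec_hom: "r \<in> carrier (finite_free R n) \<Longrightarrow> dual_vec R n r \<in> mod_hom R (finite_free R n) (ring_module R)"
  unfolding dual_vec_def by (intro restrict_mod_hom[OF FF] lin_lincomb[OF RM] free_family)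

lemma dual_vec_unit: "r \<in> carrier (finite_free R n) \<Longrightarrow> i < n \<Longrightarrow> dual_vec R n r (unit_vec R i) = r i"
  unfolding dual_vec_def using lincomb_unit[OF RM free_family, of r n i] unit_vec_carrier[OF is_cring, of i n] by simp

lemma dual_vec_inj:
  assumes "r \<in> carrier (finite_free R n)" "s \<in> carrier (finite_free R n)" "dual_vec R n r = dual_vec R n s"
  shows "r = s"
proof
  fix i show "r i = s i"
    using dual_vec_unit[OF assms(1), of i] dual_vec_unit[OF assms(2), of i] assms
    by (cases "i < n") (auto simp: finite_free_carrier)
qed

lemma dual_vec_surj: "carrier (dual R (finite_free R n)) = dual_vec R n ` carrier (finite_free R n)"
proof
  show "dual_vec R n ` carrier (finite_free R n) \<subseteq> carrier (dual R (finite_free R n))"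
    by (auto simp: dual_def intro: dual_vec_hom)
  show "carrier (dual R (finite_free R n)) \<subseteq> dual_vec R n ` carrier (finite_free R n)"
  proof
    fix f assume "f \<in> carrier (dual R (finite_free R n))"
    hence f: "lin R (finite_free R n) (ring_module R) f" "f \<in> extensional (carrier (finite_free R n))"
      by (auto simp: dual_def mod_hom_iff)
    let ?r = "\<lambda>i. if i < n then f (unit_vec R i) else \<zero>"
    have v: "f (unit_vec R i) \<in> carrier R" if "i < n" for i
      using lin_closed[OF f(1) unit_vec_carrier[OF is_cring that]] by simp
    have r: "?r \<in> carrier (finite_free R n)" using v by (auto simp: finite_free_carrier)
    have "f = dual_vec R n ?r"
    proof (rule extensionalityI[OF f(2)])
      show "dual_vec R n ?r \<in> extensional (carrier (finite_free R n))" by (simp add: dual_vec_def)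
      fix x assume x: "x \<in> carrier (finite_free R n)"
      have "f x = lincomb (ring_module R) n (\<lambda>i. f (unit_vec R i)) x" by (rule lin_free_eq[OF RM f(1) x])
      also have "\<dots> = lincomb (ring_module R) n ?r x"
        using v finite_free_val[OF is_cring x] by (intro lincomb_cong[OF RM]) auto
      finally show "f x = dual_vec R n ?r x" using x by (simp add: dual_vec_def)
    qed
    thus "f \<in> dual_vec R n ` carrier (finite_free R n)" using r by (rule image_eqI)
  qed
qed

lemma dual_free_module: "module R (dual R (finite_free R n))"
  unfolding dual_def by (rule Hom_module_module[OF FF RM])

lemma lin_dual_vec: "lin R (finite_free R n) (dual R (finite_free R n)) (dual_vec R n)"
proof (rule linI)
  fix r s assume r: "r \<in> carrier (finite_free R n)" and s: "s \<in> carrier (finite_free R n)"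
  note vr = finite_free_val[OF is_cring r] and vs = finite_free_val[OF is_cring s]
  show "dual_vec R n r \<in> carrier (dual R (finite_free R n))" using dual_vec_hom[OF r] by (simp add: dual_def)
  show "dual_vec R n (r \<oplus>\<^bsub>finite_free R n\<^esub> s) = dual_vec R n r \<oplus>\<^bsub>dual R (finite_free R n)\<^esub> dual_vec R n s"
    using lincomb_add_family[OF RM, of n r s] vr vs finite_free_val[OF is_cring]
    by (auto simp: dual_vec_def dual_def fun_eq_iff)
next
  fix a r assume a: "a \<in> carrier R" and r: "r \<in> carrier (finite_free R n)"
  show "dual_vec R n (a \<odot>\<^bsub>finite_free R n\<^esub> r) = a \<odot>\<^bsub>dual R (finite_free R n)\<^esub> dual_vec R n r"
    using lincomb_smult_family[OF RM, of n r _ a] finite_free_val[OF is_cring r] finite_free_val[OF is_cring] a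
    by (auto simp: dual_vec_def dual_def fun_eq_iff)
qed

lemma dual_map_eval:
  assumes "lin R (finite_free R k) (finite_free R n) D" "s \<in> carrier (finite_free R n)" "x \<in> carrier (finite_free R k)"
  shows "lincomb (ring_module R) k (dual_map R n k D s) x = lincomb (ring_module R) n s (D x)"
proof -
  \<comment> \<open>Auxiliary ranks, \<open>n\<close> in degree \<open>0\<close> and
    \<open>k\<close> above, turn the single map \<open>D\<close> into input for
    \<open>cochain_eval\<close>.\<close>
  let ?b = "\<lambda>i. if i = (0::nat) then n else k"
  have l: "lin R (finite_free R (?b (Suc 0))) (finite_free R (?b 0)) ((\<lambda>_. D) (0::nat))" using assms(1) by simp
  have "cochain R (ring_module R) ?b (\<lambda>_. D) 0 s = dual_map R n k D s" by (auto simp: cochain_def dual_map_def fun_eq_iff)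
  thus ?thesis
    using cochain_eval[where b = ?b and D = "\<lambda>_. D" and j = 0, OF RM l, of s x] assms(2,3)
    by (simp add: free_pow_carrier)
qed

lemma lin_dual_map:
  assumes "lin R (finite_free R k) (finite_free R n) D"
  shows "lin R (finite_free R n) (finite_free R k) (dual_map R n k D)"
proof (rule linI)
  fix r s assume r: "r \<in> carrier (finite_free R n)" and s: "s \<in> carrier (finite_free R n)"
  have D: "D (unit_vec R j) i \<in> carrier R" if "j < k" for i j
    by (rule finite_free_val[OF is_cring lin_closed[OF assms unit_vec_carrier[OF is_cring that]]])
  show "dual_map R n k D r \<in> carrier (finite_free R k)"
    using lincomb_closed[OF RM free_family[OF r]] D by (auto simp: dual_map_def finite_free_carrier)
  show "dual_map R n k D (r \<oplus>\<^bsub>finite_free R n\<^esub> s) = dual_map R n k D r \<oplus>\<^bsub>finite_free R k\<^esub> dual_map R n k D s"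
    using lincomb_add_family[OF RM, of n r s] finite_free_val[OF is_cring r] finite_free_val[OF is_cring s] D
    by (auto simp: dual_map_def fun_eq_iff)
next
  fix a r assume a: "a \<in> carrier R" and r: "r \<in> carrier (finite_free R n)"
  have D: "D (unit_vec R j) i \<in> carrier R" if "j < k" for i j
    by (rule finite_free_val[OF is_cring lin_closed[OF assms unit_vec_carrier[OF is_cring that]]])
  show "dual_map R n k D (a \<odot>\<^bsub>finite_free R n\<^esub> r) = a \<odot>\<^bsub>finite_free R k\<^esub> dual_map R n k D r"
    using lincomb_smult_family[OF RM, of n r _ a] finite_free_val[OF is_cring r] a D
    by (auto simp: dual_map_def fun_eq_iff)
qed

lemma dual_map_unit:
  assumes "lin R (finite_free R k) (finite_free R n) D" "i < n" "j < k"
  shows "dual_map R n k D (unit_vec R i) j = D (unit_vec R j) i"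
proof -
  have D: "D (unit_vec R j) l \<in> carrier R" for l
    by (rule finite_free_val[OF is_cring lin_closed[OF assms(1) unit_vec_carrier[OF is_cring assms(3)]]])
  interpret RM: module R "ring_module R" by (rule RM)
  have "lincomb (ring_module R) n (unit_vec R i) (D (unit_vec R j)) =
     (\<Oplus>\<^bsub>ring_module R\<^esub>l\<in>{..<n}. if i = l then D (unit_vec R j) l else \<zero>\<^bsub>ring_module R\<^esub>)"
    unfolding lincomb_def using D by (intro RM.M.finsum_cong') (auto simp: unit_vec_def)
  also have "\<dots> = D (unit_vec R j) i" using D assms(2) by (intro RM.M.finsum_singleton) auto
  finally show ?thesis using assms(3) by (simp add: dual_map_def)
qed

lemma compose_dual_vec:
  assumes "lin R (finite_free R k) (finite_free R n) D" "s \<in> carrier (finite_free R n)"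
  shows "compose (carrier (finite_free R k)) (dual_vec R n s) D = dual_vec R k (dual_map R n k D s)"
  using dual_map_eval[OF assms] lin_closed[OF assms(1)]
  by (auto simp: compose_def dual_vec_def fun_eq_iff restrict_def)

text \<open>The augmentation is the coordinate isomorphism onto the dual followed by the quotient
  map; its kernel is the image of the transposed matrix because \<open>dual_vec\<close> is
  injective.\<close>

lemma transpose_start:
  assumes "lin R (finite_free R k) (finite_free R n) D"
  defines "X \<equiv> quot_module (dual R (finite_free R k))
      ((\<lambda>\<phi>. compose (carrier (finite_free R k)) \<phi> D) ` carrier (dual R (finite_free R n)))"
  shows "module R X" and "\<exists>\<epsilon>. \<epsilon> \<in> mod_hom R (finite_free R k) X \<and> \<epsilon> ` carrier (finite_free R k) = carrier X \<and>
    mod_ker (finite_free R k) X \<epsilon> = dual_map R n k D ` carrier (finite_free R n)"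
proof -
  let ?Fk = "finite_free R k" and ?Fn = "finite_free R n"
  let ?H = "(\<lambda>\<phi>. compose (carrier ?Fk) \<phi> D) ` carrier (dual R ?Fn)"
  have H: "?H = dual_vec R k ` dual_map R n k D ` carrier ?Fn"
    unfolding dual_vec_surj image_image using compose_dual_vec[OF assms(1)] by (rule image_cong[OF refl])
  note ld = lin_dual_map[OF assms(1)] and dk = dual_free_module[of k]
  have Hs: "submodule ?H R (dual R ?Fk)" unfolding H
    by (rule sub_image[OF FF dk lin_dual_vec sub_image[OF FF FF ld sub_carrier[OF FF]]])
  note q = lin_quot[OF dk Hs] and l = lin_comp[OF lin_dual_vec lin_quot[OF dk Hs]]
  show X: "module R X" unfolding X_def by (rule quot_module_module[OF dk Hs])
  let ?\<epsilon> = "restrict (\<lambda>r. ?H +>\<^bsub>dual R ?Fk\<^esub> dual_vec R k r) (carrier ?Fk)"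
  have 1: "?\<epsilon> \<in> mod_hom R ?Fk X" unfolding X_def by (rule restrict_mod_hom[OF FF l])
  have 2: "?\<epsilon> ` carrier ?Fk = carrier X" unfolding X_def quot_simps(1)[OF dk Hs] dual_vec_surj[of k] image_image
    by (rule image_cong[OF refl]) simp
  have 3: "mod_ker ?Fk X ?\<epsilon> = dual_map R n k D ` carrier ?Fn"
  proof -
    have "r \<in> mod_ker ?Fk X ?\<epsilon> \<longleftrightarrow> dual_vec R k r \<in> ?H" if r: "r \<in> carrier ?Fk" for r
      using quot_zero_iff[OF dk Hs lin_closed[OF lin_dual_vec r]] r by (simp add: mod_ker_def X_def)
    moreover have "dual_vec R k r \<in> ?H \<longleftrightarrow> r \<in> dual_map R n k D ` carrier ?Fn" if r: "r \<in> carrier ?Fk" for r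
    proof
      assume "dual_vec R k r \<in> ?H"
      then obtain s where s: "s \<in> carrier ?Fn" "dual_vec R k r = dual_vec R k (dual_map R n k D s)" unfolding H by auto
      hence "r = dual_map R n k D s" using dual_vec_inj[OF r lin_closed[OF ld s(1)]] by simp
      thus "r \<in> dual_map R n k D ` carrier ?Fn" using s(1) by (rule image_eqI)
    next
      assume "r \<in> dual_map R n k D ` carrier ?Fn"
      thus "dual_vec R k r \<in> ?H" unfolding H by (rule imageI)
    qed
    ultimately show ?thesis using lin_closed[OF ld] by (auto simp: mod_ker_def)
  qed
  show "\<exists>\<epsilon>. \<epsilon> \<in> mod_hom R ?Fk X \<and> \<epsilon> ` carrier ?Fk = carrier X \<and> mod_ker ?Fk X \<epsilon> = dual_map R n k D ` carrier ?Fn"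
    using 1 2 3 by (intro exI[of _ ?\<epsilon>] conjI)
qed

end

text \<open>The presentation has to be the one selected in the definition of the transpose, so it is
  taken from the same \<open>SOME\<close> term. The ranks trade places: the transpose is covered by
  \<open>R^k\<close>, and \<open>R^n\<close> comes next.\<close>

lemma transpose_resolution:
  assumes "local_ring R" "finite_module R M"
  obtains n k D \<epsilon> b DD \<eta> where "minimal_presentation R M n k D \<epsilon>" "module R (transpose_module R M)"
    "free_resolution R (transpose_module R M) b DD \<eta>" "b 0 = k" "b (Suc 0) = n"
    "\<And>s. s \<in> carrier (finite_free R n) \<Longrightarrow> DD 0 s = dual_map R n k D s"
proof -
  interpret cring R by (rule local_cring[OF assms(1)])
  obtain n k D \<epsilon> where e: "(SOME (b0, b1, D, \<epsilon>). minimal_presentation R M b0 b1 D \<epsilon>) = (n, k, D, \<epsilon>)"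
    by (metis prod_cases4)
  have mp: "minimal_presentation R M n k D \<epsilon>"
  proof -
    obtain q where "(\<lambda>(b0, b1, D, \<epsilon>). minimal_presentation R M b0 b1 D \<epsilon>) q"
      using minimal_presentation_exists[OF assms] by auto
    from someI[of "\<lambda>(b0, b1, D, \<epsilon>). minimal_presentation R M b0 b1 D \<epsilon>", OF this] show ?thesis using e by simp
  qed
  have D: "lin R (finite_free R k) (finite_free R n) D"
    using mp by (auto simp: minimal_presentation_def Let_def mod_hom_lin)
  have T: "transpose_module R M = quot_module (dual R (finite_free R k))
      ((\<lambda>\<phi>. compose (carrier (finite_free R k)) \<phi> D) ` carrier (dual R (finite_free R n)))"
    by (simp add: transpose_module_def e Let_def)
  note X = transpose_start(1)[OF D, folded T]
  obtain \<eta> where eta: "\<eta> \<in> mod_hom R (finite_free R k) (transpose_module R M)"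
    "\<eta> ` carrier (finite_free R k) = carrier (transpose_module R M)"
    "mod_ker (finite_free R k) (transpose_module R M) \<eta> = dual_map R n k D ` carrier (finite_free R n)"
    using transpose_start(2)[OF D, folded T] by auto
  let ?d = "restrict (dual_map R n k D) (carrier (finite_free R n))"
  have d: "?d \<in> mod_hom R (finite_free R n) (finite_free R k)" by (rule restrict_mod_hom[OF FF lin_dual_map[OF D]])
  have "mod_ker (finite_free R k) (transpose_module R M) \<eta> = ?d ` carrier (finite_free R n)" using eta(3) by simp
  from free_resolution_extend[OF is_cring local_noetherian[OF assms(1)] X eta(1) d eta(2) this]
  obtain b DD where b: "free_resolution R (transpose_module R M) b DD \<eta>" "b 0 = k" "b 1 = n" "DD 0 = ?d" by auto
  show ?thesis by (rule that[OF mp X b(1)]) (use b(2-4) in auto)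
qed

lemma minimal_presentationD:
  assumes "local_ring R" "module R M" "minimal_presentation R M n k D \<epsilon>"
  defines "u \<equiv> \<lambda>i. \<epsilon> (unit_vec R i)"
  shows "gens R M n u" and "rels_in R M n u (max_ideal R)" and "lin R (finite_free R k) (finite_free R n) D"
    and "\<And>r. r \<in> carrier (finite_free R n) \<Longrightarrow> lincomb M n u r = \<zero>\<^bsub>M\<^esub> \<longleftrightarrow> r \<in> D ` carrier (finite_free R k)"
proof -
  note cr = local_cring[OF assms(1)]
  have p: "lin R (finite_free R n) M \<epsilon>" "lin R (finite_free R k) (finite_free R n) D" "\<epsilon> ` carrier (finite_free R n) = carrier M"
    "mod_ker (finite_free R n) M \<epsilon> = D ` carrier (finite_free R k)"
    "D ` carrier (finite_free R k) \<subseteq> ideal_smult R (max_ideal R) (finite_free R n)"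
    using assms(3) by (auto simp: minimal_presentation_def Let_def mod_hom_lin)
  have e: "\<epsilon> r = lincomb M n u r" if "r \<in> carrier (finite_free R n)" for r
    unfolding u_def by (rule lin_free_eq[OF assms(2) p(1) that])
  show "gens R M n u" unfolding gens_def
  proof
    show "u \<in> {..<n} \<rightarrow> carrier M" unfolding u_def using lin_closed[OF p(1) unit_vec_carrier[OF cr]] by auto
    show "carrier M = lincomb M n u ` carrier (finite_free R n)" unfolding p(3)[symmetric]
      using e by (rule image_cong[OF refl])
  qed
  show ker: "lincomb M n u r = \<zero>\<^bsub>M\<^esub> \<longleftrightarrow> r \<in> D ` carrier (finite_free R k)" if "r \<in> carrier (finite_free R n)" for r
    unfolding p(4)[symmetric] using e[OF that] that by (simp add: mod_ker_def)
  show "rels_in R M n u (max_ideal R)" unfolding rels_in_def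
  proof (intro ballI impI allI)
    fix r i assume r: "r \<in> carrier (finite_free R n)" "lincomb M n u r = \<zero>\<^bsub>M\<^esub>" and i: "i < n"
    have "r \<in> ideal_smult R (max_ideal R) (finite_free R n)" using ker[OF r(1)] r(2) p(5) by auto
    thus "r i \<in> max_ideal R" by (rule ismult_vec[OF cr max_ideal_ideal[OF assms(1)] _ i])
  qed
  show "lin R (finite_free R k) (finite_free R n) D" by (rule p(2))
qed

section \<open>Freeness modulo an ideal\<close>

lemma (in cring) ideal_coset_eq_self:
  assumes "ideal I R" "a \<in> carrier R" shows "I +> a = I \<longleftrightarrow> a \<in> I"
  using ideal.rcos_const_imp_mem[OF assms] a_rcos_zero[OF assms(1)] by metis

lemma lincomb_ring_comm:
  assumes "cring R" "\<And>i. i < n \<Longrightarrow> r i \<in> carrier R" "\<And>i. i < n \<Longrightarrow> s i \<in> carrier R"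
  shows "lincomb (ring_module R) n r s = lincomb (ring_module R) n s r"
proof -
  interpret cring R by fact
  interpret RM: module R "ring_module R" by (rule RM)
  show ?thesis unfolding lincomb_def using assms(2,3) by (intro RM.M.finsum_cong') (auto simp: m_comm)
qed

locale module_mod_ideal = module R X for R (structure) and X :: "('a, 'm, 'x) module_scheme" +
  fixes I :: "'a set"
  assumes ideal_I: "ideal I R"
begin

lemma Xm: "module R X" by unfold_locales

lemma IR: "I \<subseteq> carrier R" using ideal.Icarr[OF ideal_I] by auto

abbreviation "H \<equiv> ideal_smult R I X"
abbreviation "V \<equiv> quot_module X H"
abbreviation "OV \<equiv> over_quot V"
abbreviation "q x \<equiv> H +>\<^bsub>X\<^esub> x"

lemma H: "submodule H R X" by (rule ismult_sub[OF Xm IR])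

lemma Vm: "module R V" by (rule quot_module_module[OF Xm H])

lemma OV_simps: "carrier OV = carrier V" "\<zero>\<^bsub>OV\<^esub> = \<zero>\<^bsub>V\<^esub>" "x \<oplus>\<^bsub>OV\<^esub> y = x \<oplus>\<^bsub>V\<^esub> y"
  by (simp_all add: over_quot_def)

lemma OV_finsum: "finsum OV f A = finsum V f A"
  by (simp add: finsum_def finprod_def over_quot_def)

text \<open>Justifies the \<open>THE\<close> in \<open>over_quot\<close>: two representatives of a
  coset of \<open>I\<close> differ by an element of \<open>I\<close>, which annihilates
  \<open>X / I X\<close>.\<close>

lemma OV_smult:
  assumes "a \<in> carrier R" "x \<in> carrier X"
  shows "(I +> a) \<odot>\<^bsub>OV\<^esub> q x = q (a \<odot>\<^bsub>X\<^esub> x)"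
proof -
  have "b \<odot>\<^bsub>V\<^esub> q x = q (a \<odot>\<^bsub>X\<^esub> x)" if bI: "b \<in> I +> a" for b
  proof -
    obtain i where i: "i \<in> I" "b = i \<oplus> a" using bI unfolding a_r_coset_def' by (elim UN_E singletonE)
    have ic: "i \<in> carrier R" using i(1) IR by auto
    hence b: "b \<in> carrier R" using i(2) assms(1) by simp
    have "b \<odot>\<^bsub>X\<^esub> x \<ominus>\<^bsub>X\<^esub> a \<odot>\<^bsub>X\<^esub> x = i \<odot>\<^bsub>X\<^esub> x" using ic assms i(2)
      by (simp add: smult_l_distr M.add_minus_cancel)
    moreover have "i \<odot>\<^bsub>X\<^esub> x \<in> H" by (rule ismult_mem[OF i(1) assms(2)])
    ultimately have "q (b \<odot>\<^bsub>X\<^esub> x) = q (a \<odot>\<^bsub>X\<^esub> x)"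
      using assms b by (subst coset_eq_iff[OF Xm H]) auto
    thus ?thesis using quot_simps(3)[OF Xm H b assms(2)] by simp
  qed
  moreover have "a \<in> I +> a"
  proof -
    have "\<zero> \<oplus> a \<in> I +> a" using ideal_zero[OF ideal_I] unfolding a_r_coset_def' by (intro UN_I[of \<zero>]) simp_all
    thus ?thesis using assms(1) by simp
  qed
  ultimately show ?thesis unfolding over_quot_def by simp (rule the_equality, metis, metis)
qed

lemma Quot_carrier: "carrier (R Quot I) = (\<lambda>a. I +> a) ` carrier R"
  by (auto simp: FactRing_def A_RCOSETS_def')

lemma Quot_ops: "a \<in> carrier R \<Longrightarrow> b \<in> carrier R \<Longrightarrow> (I +> a) \<oplus>\<^bsub>R Quot I\<^esub> (I +> b) = I +> (a \<oplus> b)"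
  "a \<in> carrier R \<Longrightarrow> b \<in> carrier R \<Longrightarrow> (I +> a) \<otimes>\<^bsub>R Quot I\<^esub> (I +> b) = I +> (a \<otimes> b)"
  "\<one>\<^bsub>R Quot I\<^esub> = I +> \<one>" "\<zero>\<^bsub>R Quot I\<^esub> = I"
  by (simp_all add: FactRing_def ideal.a_rcos_sum[OF ideal_I] ideal.rcoset_mult_add[OF ideal_I])

lemma OV_module: "module (R Quot I) OV"
proof (rule moduleI)
  show "cring (R Quot I)" by (rule ideal.quotient_is_cring[OF ideal_I R.is_cring])
  interpret V: module R V by (rule Vm)
  show "abelian_group OV"
  proof (rule abelian_groupI)
    fix x assume "x \<in> carrier OV"
    thus "\<exists>y\<in>carrier OV. y \<oplus>\<^bsub>OV\<^esub> x = \<zero>\<^bsub>OV\<^esub>"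
      by (intro bexI[of _ "\<ominus>\<^bsub>V\<^esub> x"]) (simp_all add: OV_simps V.M.l_neg)
  qed (simp_all add: OV_simps V.M.a_ac)
  note vs = quot_simps[OF Xm H]
  fix A x assume A: "A \<in> carrier (R Quot I)" and x: "x \<in> carrier OV"
  obtain a where a: "a \<in> carrier R" "A = I +> a" using A by (auto simp: Quot_carrier)
  obtain u where u: "u \<in> carrier X" "x = q u" using x by (auto simp: OV_simps vs(1))
  show "A \<odot>\<^bsub>OV\<^esub> x \<in> carrier OV" using a u by (simp add: OV_smult OV_simps vs(1))
  {
    fix B assume "B \<in> carrier (R Quot I)"
    then obtain b where b: "b \<in> carrier R" "B = I +> b" by (auto simp: Quot_carrier)
    show "(A \<oplus>\<^bsub>R Quot I\<^esub> B) \<odot>\<^bsub>OV\<^esub> x = A \<odot>\<^bsub>OV\<^esub> x \<oplus>\<^bsub>OV\<^esub> B \<odot>\<^bsub>OV\<^esub> x"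
      using a b u by (simp add: Quot_ops OV_smult OV_simps vs(2) smult_l_distr)
    show "(A \<otimes>\<^bsub>R Quot I\<^esub> B) \<odot>\<^bsub>OV\<^esub> x = A \<odot>\<^bsub>OV\<^esub> (B \<odot>\<^bsub>OV\<^esub> x)"
      using a b u by (simp add: Quot_ops OV_smult smult_assoc1)
  next
    fix y assume "y \<in> carrier OV"
    then obtain v where v: "v \<in> carrier X" "y = q v" by (auto simp: OV_simps vs(1))
    show "A \<odot>\<^bsub>OV\<^esub> (x \<oplus>\<^bsub>OV\<^esub> y) = A \<odot>\<^bsub>OV\<^esub> x \<oplus>\<^bsub>OV\<^esub> A \<odot>\<^bsub>OV\<^esub> y"
      using a u v by (simp add: OV_smult OV_simps vs(2) smult_r_distr)
  }
next
  fix x assume "x \<in> carrier OV"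
  then obtain u where u: "u \<in> carrier X" "x = q u" by (auto simp: OV_simps quot_simps(1)[OF Xm H])
  thus "\<one>\<^bsub>R Quot I\<^esub> \<odot>\<^bsub>OV\<^esub> x = x" by (simp add: Quot_ops OV_smult)
qed

lemma q_lincomb:
  assumes "w \<in> {..<m} \<rightarrow> carrier X" "r \<in> {..<m} \<rightarrow> carrier R"
  shows "q (lincomb X m w r) = (\<Oplus>\<^bsub>OV\<^esub>j\<in>{..<m}. (I +> r j) \<odot>\<^bsub>OV\<^esub> q (w j))"
proof -
  interpret OV: module "R Quot I" OV by (rule OV_module)
  have w: "w j \<in> carrier X" "r j \<in> carrier R" if "j < m" for j using assms that by auto
  have "q (lincomb X m w r) = (\<Oplus>\<^bsub>OV\<^esub>j\<in>{..<m}. q (r j \<odot>\<^bsub>X\<^esub> w j))"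
    unfolding lincomb_def OV_finsum using w by (intro lin_finsum[OF Xm Vm lin_quot[OF Xm H]]) auto
  also have "\<dots> = (\<Oplus>\<^bsub>OV\<^esub>j\<in>{..<m}. (I +> r j) \<odot>\<^bsub>OV\<^esub> q (w j))"
  proof (rule OV.M.finsum_cong')
    show "(\<lambda>j. (I +> r j) \<odot>\<^bsub>OV\<^esub> q (w j)) \<in> {..<m} \<rightarrow> carrier OV"
      using w by (auto simp: OV_smult OV_simps quot_simps(1)[OF Xm H])
  qed (use w in \<open>simp_all add: OV_smult\<close>)
  finally show ?thesis .
qed

lemma q_eq_iff: "x \<in> carrier X \<Longrightarrow> y \<in> carrier X \<Longrightarrow> q x = q y \<longleftrightarrow> x \<ominus>\<^bsub>X\<^esub> y \<in> H"
  by (rule coset_eq_iff[OF Xm H])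

lemma q_zero_iff: "x \<in> carrier X \<Longrightarrow> q x = \<zero>\<^bsub>OV\<^esub> \<longleftrightarrow> x \<in> H"
  unfolding OV_simps by (rule quot_zero_iff[OF Xm H])

lemma OV_smult_zero: "b \<in> carrier OV \<Longrightarrow> I \<odot>\<^bsub>OV\<^esub> b = \<zero>\<^bsub>OV\<^esub>"
proof -
  assume b: "b \<in> carrier OV"
  interpret OV: module "R Quot I" OV by (rule OV_module)
  show ?thesis using OV.smult_l_null[OF b] by (simp add: Quot_ops)
qed

text \<open>Of a basis of \<open>X / I X\<close> only the finitely many elements occurring in
  expansions of the \<open>u i\<close> are kept, and \<open>w\<close> lifts them to
  \<open>X\<close>. The last clause is their independence over \<open>R / I\<close>.\<close>

lemma free_family_exists:
  fixes n :: nat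
  assumes "free_mod_ideal R I X" "u \<in> {..<n} \<rightarrow> carrier X"
  shows "\<exists>m w. w \<in> {..<m} \<rightarrow> carrier X \<and>
    (\<forall>i<n. \<exists>r\<in>carrier (finite_free R m). u i \<ominus>\<^bsub>X\<^esub> lincomb X m w r \<in> H) \<and>
    (\<forall>r\<in>carrier (finite_free R m). lincomb X m w r \<in> H \<longrightarrow> (\<forall>j<m. r j \<in> I))"
proof -
  interpret OV: module "R Quot I" OV by (rule OV_module)
  obtain Bs where Bs: "module_basis (R Quot I) OV Bs"
    using assms(1) unfolding free_mod_ideal_def free_module_def by auto
  have BO: "Bs \<subseteq> carrier OV" using Bs by (simp add: module_basis_def)
  have qu: "q (u i) \<in> carrier OV" if "i < n" for i
    using assms(2) that by (auto simp: OV_simps quot_simps(1)[OF Xm H])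
  define expansion where "expansion = (\<lambda>i F c. finite F \<and> F \<subseteq> Bs \<and> c \<in> F \<rightarrow> carrier (R Quot I) \<and>
     q (u i) = (\<Oplus>\<^bsub>OV\<^esub>b\<in>F. c b \<odot>\<^bsub>OV\<^esub> b))"
  have "\<exists>F c. expansion i F c" if "i < n" for i
    using Bs qu[OF that] unfolding module_basis_def expansion_def by simp
  then obtain F c where ex: "\<And>i. i < n \<Longrightarrow> expansion i (F i) (c i)" by metis
  have F: "finite (F i)" "F i \<subseteq> Bs" "c i \<in> F i \<rightarrow> carrier (R Quot I)" "q (u i) = (\<Oplus>\<^bsub>OV\<^esub>b\<in>F i. c i b \<odot>\<^bsub>OV\<^esub> b)"
    if "i < n" for i using ex[OF that] unfolding expansion_def by simp_all
  define G where "G = (\<Union>i\<in>{..<n}. F i)"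
  have G: "finite G" "G \<subseteq> Bs" unfolding G_def using F(1,2) by (auto intro!: finite_UN_I UN_least finite_lessThan)
  have FG: "F i \<subseteq> G" if "i < n" for i using that by (auto simp: G_def)
  obtain f where f0: "bij_betw f {0..<card G} G" using ex_bij_betw_nat_finite[OF G(1)] by (rule exE)
  let ?m = "card G"
  have f: "inj_on f {..<?m}" "f ` {..<?m} = G" using f0 by (auto simp: bij_betw_def atLeast0LessThan)
  have fO: "f j \<in> carrier OV" if "j < ?m" for j using f(2) that G(2) BO by auto
  have "\<exists>x. x \<in> carrier X \<and> f j = q x" if "j < ?m" for j
    using fO[OF that] by (auto simp: OV_simps quot_simps(1)[OF Xm H])
  then obtain w where w: "\<And>j. j < ?m \<Longrightarrow> w j \<in> carrier X" "\<And>j. j < ?m \<Longrightarrow> f j = q (w j)" by metis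
  have wc: "w \<in> {..<?m} \<rightarrow> carrier X" using w(1) by auto
  have rep: "\<exists>a. a \<in> carrier R \<and> A = I +> a" if "A \<in> carrier (R Quot I)" for A
    using that by (auto simp: Quot_carrier)
  show ?thesis
  proof (intro exI[of _ ?m] exI[of _ w] conjI allI impI ballI wc)
    fix i assume i: "i < n"
    \<comment> \<open>The coset \<open>I\<close> is the zero of \<open>R Quot I\<close>; it is the
      coefficient of the basis elements outside the expansion of \<open>u i\<close>, so that all
      sums run over the same set.\<close>
    let ?A = "\<lambda>j. if f j \<in> F i then c i (f j) else I"
    have A: "?A j \<in> carrier (R Quot I)" for j
      using F(3)[OF i] OV.R.zero_closed by (auto simp: Quot_ops)
    obtain r0 where r0: "\<And>j. r0 j \<in> carrier R" "\<And>j. ?A j = I +> r0 j" using rep[OF A] by metis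
    let ?r = "\<lambda>j. if j < ?m then r0 j else \<zero>"
    have rF: "?r \<in> carrier (finite_free R ?m)" using r0 by (auto simp: finite_free_carrier)
    have rP: "?r \<in> {..<?m} \<rightarrow> carrier R" using r0 by auto
    let ?g = "\<lambda>b. (if b \<in> F i then c i b else I) \<odot>\<^bsub>OV\<^esub> b"
    have gc: "?g b \<in> carrier OV" if "b \<in> G" for b
      using that G(2) BO F(3)[OF i] OV.R.zero_closed by (auto simp: Quot_ops intro!: OV.smult_closed)
    have "q (lincomb X ?m w ?r) = (\<Oplus>\<^bsub>OV\<^esub>j\<in>{..<?m}. (I +> ?r j) \<odot>\<^bsub>OV\<^esub> q (w j))" by (rule q_lincomb[OF wc rP])
    also have "\<dots> = (\<Oplus>\<^bsub>OV\<^esub>j\<in>{..<?m}. ?g (f j))"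
    proof (rule OV.M.finsum_cong'[OF refl])
      show "(\<lambda>j. ?g (f j)) \<in> {..<?m} \<rightarrow> carrier OV" using gc f(2) by auto
      show "(I +> ?r j) \<odot>\<^bsub>OV\<^esub> q (w j) = ?g (f j)" if "j \<in> {..<?m}" for j
        using that r0(2)[of j, symmetric] w(2)[of j] by simp
    qed
    also have "\<dots> = (\<Oplus>\<^bsub>OV\<^esub>b\<in>G. ?g b)"
      using OV.M.finsum_reindex[of ?g f "{..<?m}"] f gc by auto
    also have "\<dots> = (\<Oplus>\<^bsub>OV\<^esub>b\<in>F i. c i b \<odot>\<^bsub>OV\<^esub> b)"
    proof (rule OV.M.add.finprod_mono_neutral_cong_right[OF G(1) FG[OF i]])
      show "?g \<in> G \<rightarrow> carrier OV" using gc by auto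
      show "?g b = \<zero>\<^bsub>OV\<^esub>" if "b \<in> G - F i" for b
        using that OV_smult_zero[of b] G(2) BO by auto
    qed auto
    also have "\<dots> = q (u i)" using F(4)[OF i] by simp
    finally have "q (u i) = q (lincomb X ?m w ?r)" by simp
    hence "u i \<ominus>\<^bsub>X\<^esub> lincomb X ?m w ?r \<in> H"
      using q_eq_iff[of "u i" "lincomb X ?m w ?r"] assms(2) i lincomb_closed[OF Xm wc rP] by auto
    thus "\<exists>r\<in>carrier (finite_free R ?m). u i \<ominus>\<^bsub>X\<^esub> lincomb X ?m w r \<in> H" using rF by (intro bexI)
  next
    fix r j assume r: "r \<in> carrier (finite_free R ?m)" and h: "lincomb X ?m w r \<in> H" and j: "j < ?m"
    have rP: "r \<in> {..<?m} \<rightarrow> carrier R" using r by (auto simp: finite_free_carrier)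
    define d where "d = (\<lambda>b. I +> r (inv_into {..<?m} f b))"
    have df: "d (f j) = I +> r j" if "j < ?m" for j using inv_into_f_f[OF f(1), of j] that by (simp add: d_def)
    have dG: "d \<in> G \<rightarrow> carrier (R Quot I)"
    proof
      fix b assume "b \<in> G"
      then obtain j where "j < ?m" "b = f j" using f(2) by auto
      thus "d b \<in> carrier (R Quot I)" using df rP by (auto simp: Quot_carrier)
    qed
    have "\<zero>\<^bsub>OV\<^esub> = q (lincomb X ?m w r)" using q_zero_iff[OF lincomb_closed[OF Xm wc rP]] h by simp
    also have "\<dots> = (\<Oplus>\<^bsub>OV\<^esub>j\<in>{..<?m}. (I +> r j) \<odot>\<^bsub>OV\<^esub> q (w j))" by (rule q_lincomb[OF wc rP])
    also have "\<dots> = (\<Oplus>\<^bsub>OV\<^esub>j\<in>{..<?m}. d (f j) \<odot>\<^bsub>OV\<^esub> f j)"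
    proof (rule OV.M.finsum_cong'[OF refl])
      show "(\<lambda>j. d (f j) \<odot>\<^bsub>OV\<^esub> f j) \<in> {..<?m} \<rightarrow> carrier OV" using dG f(2) fO by (auto intro!: OV.smult_closed)
      show "(I +> r j) \<odot>\<^bsub>OV\<^esub> q (w j) = d (f j) \<odot>\<^bsub>OV\<^esub> f j" if "j \<in> {..<?m}" for j
        using that df[of j] w(2)[of j] by (metis lessThan_iff)
    qed
    also have "\<dots> = (\<Oplus>\<^bsub>OV\<^esub>b\<in>G. d b \<odot>\<^bsub>OV\<^esub> b)"
    proof -
      have "(\<lambda>b. d b \<odot>\<^bsub>OV\<^esub> b) \<in> f ` {..<?m} \<rightarrow> carrier OV"
        unfolding f(2) using dG G(2) BO by (auto intro!: OV.smult_closed)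
      from OV.M.finsum_reindex[OF this f(1)] show ?thesis unfolding f(2) by simp
    qed
    finally have "(\<Oplus>\<^bsub>OV\<^esub>b\<in>G. d b \<odot>\<^bsub>OV\<^esub> b) = \<zero>\<^bsub>OV\<^esub>" by simp
    hence "\<forall>b\<in>G. d b = \<zero>\<^bsub>R Quot I\<^esub>" using Bs G dG unfolding module_basis_def by simp
    hence "d (f j) = I" using j f(2) by (auto simp: Quot_ops)
    thus "r j \<in> I" using df[OF j] ideal_coset_eq_self[OF ideal_I] rP j by auto
  qed
qed

lemma free_mod_idealI:
  assumes "\<one> \<notin> I" "gens R X n u"
    "\<And>r i. r \<in> carrier (finite_free R n) \<Longrightarrow> lincomb X n u r \<in> H \<Longrightarrow> i < n \<Longrightarrow> r i \<in> I"
  shows "free_mod_ideal R I X"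
proof -
  interpret OV: module "R Quot I" OV by (rule OV_module)
  have uc: "u \<in> {..<n} \<rightarrow> carrier X" using assms(2) unfolding gens_def by (rule conjunct1)
  have uX: "u i \<in> carrier X" if "i < n" for i using uc that by auto
  have gX: "\<exists>r\<in>carrier (finite_free R n). x = lincomb X n u r" if "x \<in> carrier X" for x
    using assms(2) that unfolding gens_def by auto
  note l = lin_lincomb[OF Xm uc] and F = finite_free_module[OF R.is_cring, of n]
  let ?f = "\<lambda>i. q (u i)"
  have fO: "?f i \<in> carrier OV" if "i < n" for i using uX[OF that] by (auto simp: OV_simps quot_simps(1)[OF Xm H])
  \<comment> \<open>A basis is a set, so the cosets of the generators must be distinct: if two
    agreed, the difference of two unit vectors would be a relation modulo \<open>I X\<close> with
    coefficient one.\<close>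
  have inj: "inj_on ?f {..<n}"
  proof (rule inj_onI, rule ccontr)
    fix i j assume ij: "i \<in> {..<n}" "j \<in> {..<n}" "?f i = ?f j" "i \<noteq> j"
    have ui: "unit_vec R i \<in> carrier (finite_free R n)" and uj: "unit_vec R j \<in> carrier (finite_free R n)"
      using ij unit_vec_carrier[OF R.is_cring] by auto
    have "u i \<ominus>\<^bsub>X\<^esub> u j \<in> H" using q_eq_iff uX ij by auto
    hence "lincomb X n u (unit_vec R i \<ominus>\<^bsub>finite_free R n\<^esub> unit_vec R j) \<in> H"
      using lin_minus[OF F Xm l ui uj] lincomb_unit[OF Xm uc] ij by simp
    moreover have "unit_vec R i \<ominus>\<^bsub>finite_free R n\<^esub> unit_vec R j \<in> carrier (finite_free R n)"
      using ui uj module.axioms(2)[OF F] abelian_group.minus_closed by fast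
    ultimately have "(unit_vec R i \<ominus>\<^bsub>finite_free R n\<^esub> unit_vec R j) i \<in> I" using assms(3) ij(1) by simp
    moreover have "(unit_vec R i \<ominus>\<^bsub>finite_free R n\<^esub> unit_vec R j) i = \<one>"
    proof -
      interpret RM: module R "ring_module R" by (rule ring_module_module[OF R.is_cring])
      have "(unit_vec R i \<ominus>\<^bsub>finite_free R n\<^esub> unit_vec R j) i = unit_vec R i i \<ominus>\<^bsub>ring_module R\<^esub> unit_vec R j i"
        using fun_cong[OF pow_minus[OF RM.module_axioms ui[unfolded finite_free_pow] uj[unfolded finite_free_pow]], of i]
        unfolding finite_free_pow .
      also have "\<dots> = \<one> \<ominus>\<^bsub>ring_module R\<^esub> \<zero>\<^bsub>ring_module R\<^esub>" using ij(4) by (simp add: unit_vec_def)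
      also have "\<dots> = \<one>" by (rule RM.M.minus_zero_right) simp
      finally show ?thesis .
    qed
    ultimately show False using assms(1) by simp
  qed
  have sm: "(I +> a) \<odot>\<^bsub>OV\<^esub> ?f i \<in> carrier OV" if "a \<in> carrier R" "i < n" for a i
    using that fO by (intro OV.smult_closed) (auto simp: Quot_carrier)
  have "module_basis (R Quot I) OV (?f ` {..<n})"
    unfolding module_basis_def
  proof (intro conjI ballI allI impI)
    show "?f ` {..<n} \<subseteq> carrier OV" using fO by auto
    fix x assume "x \<in> carrier OV"
    then obtain y where y: "y \<in> carrier X" "x = q y" by (auto simp: OV_simps quot_simps(1)[OF Xm H])
    obtain r where r: "r \<in> carrier (finite_free R n)" "y = lincomb X n u r" using gX[OF y(1)] by auto
    note rv = finite_free_val[OF R.is_cring r(1)]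
    define c where "c = (\<lambda>b. I +> r (inv_into {..<n} ?f b))"
    have cf: "c (?f i) = I +> r i" if "i < n" for i using inv_into_f_f[OF inj, of i] that by (simp add: c_def)
    have "x = (\<Oplus>\<^bsub>OV\<^esub>i\<in>{..<n}. (I +> r i) \<odot>\<^bsub>OV\<^esub> ?f i)" unfolding y(2) r(2) using rv by (intro q_lincomb[OF uc]) auto
    also have "\<dots> = (\<Oplus>\<^bsub>OV\<^esub>i\<in>{..<n}. c (?f i) \<odot>\<^bsub>OV\<^esub> ?f i)" using cf sm rv by (intro OV.M.finsum_cong') auto
    also have "\<dots> = (\<Oplus>\<^bsub>OV\<^esub>b\<in>?f ` {..<n}. c b \<odot>\<^bsub>OV\<^esub> b)"
      using cf sm rv by (intro OV.M.finsum_reindex[OF _ inj, symmetric]) auto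
    finally show "\<exists>F c. finite F \<and> F \<subseteq> ?f ` {..<n} \<and> c \<in> F \<rightarrow> carrier (R Quot I) \<and> x = (\<Oplus>\<^bsub>OV\<^esub>b\<in>F. c b \<odot>\<^bsub>OV\<^esub> b)"
      using cf rv by (intro exI[of _ "?f ` {..<n}"] exI[of _ c]) (auto simp: Quot_carrier)
  next
    fix F c b assume Fc: "finite F \<and> F \<subseteq> ?f ` {..<n} \<and> c \<in> F \<rightarrow> carrier (R Quot I) \<and> (\<Oplus>\<^bsub>OV\<^esub>b\<in>F. c b \<odot>\<^bsub>OV\<^esub> b) = \<zero>\<^bsub>OV\<^esub>"
      and b: "b \<in> F"
    let ?A = "\<lambda>i. if ?f i \<in> F then c (?f i) else I"
    have A: "?A i \<in> carrier (R Quot I)" for i using Fc OV.R.zero_closed by (auto simp: Quot_ops)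
    have "\<exists>a. a \<in> carrier R \<and> ?A i = I +> a" for i using A[of i] by (auto simp: Quot_carrier)
    then obtain r0 where r0: "\<And>i. r0 i \<in> carrier R" "\<And>i. ?A i = I +> r0 i" by metis
    let ?r = "\<lambda>i. if i < n then r0 i else \<zero>"
    have rF: "?r \<in> carrier (finite_free R n)" using r0 by (auto simp: finite_free_carrier)
    let ?g = "\<lambda>b. (if b \<in> F then c b else I) \<odot>\<^bsub>OV\<^esub> b"
    have gc: "?g b \<in> carrier OV" if "b \<in> ?f ` {..<n}" for b
      using that Fc OV.R.zero_closed fO by (auto simp: Quot_ops intro!: OV.smult_closed)
    have "q (lincomb X n u ?r) = (\<Oplus>\<^bsub>OV\<^esub>i\<in>{..<n}. (I +> ?r i) \<odot>\<^bsub>OV\<^esub> ?f i)" using r0 by (intro q_lincomb[OF uc]) auto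
    also have "\<dots> = (\<Oplus>\<^bsub>OV\<^esub>i\<in>{..<n}. ?g (?f i))"
    proof (rule OV.M.finsum_cong'[OF refl])
      show "(\<lambda>i. ?g (?f i)) \<in> {..<n} \<rightarrow> carrier OV" using gc by auto
      show "(I +> ?r i) \<odot>\<^bsub>OV\<^esub> ?f i = ?g (?f i)" if "i \<in> {..<n}" for i
        using that r0(2)[of i, symmetric] by simp
    qed
    also have "\<dots> = (\<Oplus>\<^bsub>OV\<^esub>b\<in>?f ` {..<n}. ?g b)"
      by (rule OV.M.finsum_reindex[OF _ inj, symmetric]) (use gc in auto)
    also have "\<dots> = (\<Oplus>\<^bsub>OV\<^esub>b\<in>F. c b \<odot>\<^bsub>OV\<^esub> b)"
    proof (rule OV.M.add.finprod_mono_neutral_cong_right)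
      show "?g \<in> ?f ` {..<n} \<rightarrow> carrier OV" using gc by auto
      show "?g b = \<zero>\<^bsub>OV\<^esub>" if "b \<in> ?f ` {..<n} - F" for b using that OV_smult_zero[of b] fO by auto
    qed (use Fc in auto)
    finally have "q (lincomb X n u ?r) = \<zero>\<^bsub>OV\<^esub>" using Fc by simp
    hence "lincomb X n u ?r \<in> H" using q_zero_iff[OF lin_closed[OF l rF]] by simp
    moreover obtain i where i: "i < n" "b = ?f i" using b Fc by auto
    ultimately have "r0 i \<in> I" using assms(3)[OF rF _ i(1)] i(1) by simp
    hence "I +> r0 i = I" using ideal_coset_eq_self[OF ideal_I r0(1)] by simp
    thus "c b = \<zero>\<^bsub>R Quot I\<^esub>" using r0(2)[of i] b i(2) by (simp add: Quot_ops)
  qed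
  thus ?thesis unfolding free_mod_ideal_def free_module_def using OV_module by auto
qed

end

text \<open>A combination lying in \<open>I X\<close> can be rewritten with coefficients in
  \<open>I\<close>; subtracting these leaves a true relation, and \<open>J\<close> contains what was
  subtracted.\<close>

lemma rels_in_ismult:
  assumes "module R X" "ideal I R" "ideal J R" "I \<subseteq> J" "gens R X n u" "rels_in R X n u J"
    "r \<in> carrier (finite_free R n)" "lincomb X n u r \<in> ideal_smult R I X" "i < n"
  shows "r i \<in> J"
proof -
  interpret module R X by fact
  note F = finite_free_module[OF R.is_cring, of n]
  interpret F: module R "finite_free R n" by (rule F)
  have uc: "u \<in> {..<n} \<rightarrow> carrier X" using assms(5) unfolding gens_def by (rule conjunct1)
  have uX: "carrier X = lincomb X n u ` carrier (finite_free R n)" using assms(5) unfolding gens_def by (rule conjunct2)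
  note l = lin_lincomb[OF assms(1) uc]
  obtain c where c: "c \<in> carrier (finite_free R n)" "\<forall>i<n. c i \<in> I" "lincomb X n u r = lincomb X n u c"
    using assms(8) unfolding ismult_family[OF assms(1,2) uc uX] by auto
  have "lincomb X n u (r \<ominus>\<^bsub>finite_free R n\<^esub> c) = \<zero>\<^bsub>X\<^esub>"
    using lin_minus[OF F assms(1) l assms(7) c(1)] c(3) lin_closed[OF l c(1)] by (simp add: a_minus_def M.r_neg)
  hence "(r \<ominus>\<^bsub>finite_free R n\<^esub> c) i \<in> J" using assms(6,7,9) c(1) unfolding rels_in_def by simp
  moreover have "r = (r \<ominus>\<^bsub>finite_free R n\<^esub> c) \<oplus>\<^bsub>finite_free R n\<^esub> c"
    by (rule F.M.add_minus_cancel(3)[OF assms(7) c(1), symmetric])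
  hence "r i = (r \<ominus>\<^bsub>finite_free R n\<^esub> c) i \<oplus>\<^bsub>R\<^esub> c i" by (metis finite_free_simps(2))
  ultimately show ?thesis using ideal_add[OF assms(3)] c(2) assms(4,9) by auto
qed

text \<open>
  If \<open>X / I X\<close> is free, comparing a basis with minimal generators by maps \<open>P\<close> and \<open>S\<close> gives a relation
  \<open>c\<close> with \<open>P c\<close> in \<open>I\<close> and \<open>c - S P c\<close> in \<open>max_ideal R\<close> times \<open>c\<close>, so \<open>c\<close> is in \<open>I\<close> by Nakayama's lemma.
\<close>

lemma free_mod_ideal_iff:
  assumes "local_ring R" "module R X" "ideal I R" "\<one>\<^bsub>R\<^esub> \<notin> I" "gens R X n u" "rels_in R X n u (max_ideal R)"
  shows "free_mod_ideal R I X \<longleftrightarrow> rels_in R X n u I"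
proof
  interpret X: module_mod_ideal R X I by (intro module_mod_ideal.intro module_mod_ideal_axioms.intro assms)
  note cr = local_cring[OF assms(1)]
  {
    assume "rels_in R X n u I"
    thus "free_mod_ideal R I X"
      by (intro X.free_mod_idealI[OF assms(4,5)] rels_in_ismult[OF assms(2,3,3) subset_refl assms(5)])
  }
  assume free: "free_mod_ideal R I X"
  have uc: "u \<in> {..<n} \<rightarrow> carrier X" using assms(5) unfolding gens_def by (rule conjunct1)
  have uX: "carrier X = lincomb X n u ` carrier (finite_free R n)" using assms(5) unfolding gens_def by (rule conjunct2)
  obtain m w where w: "w \<in> {..<m} \<rightarrow> carrier X"
    "\<forall>i<n. \<exists>r\<in>carrier (finite_free R m). u i \<ominus>\<^bsub>X\<^esub> lincomb X m w r \<in> X.H"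
    "\<forall>r\<in>carrier (finite_free R m). lincomb X m w r \<in> X.H \<longrightarrow> (\<forall>j<m. r j \<in> I)"
    using X.free_family_exists[OF free uc] by (elim exE conjE)
  let ?Fn = "finite_free R n" and ?Fm = "finite_free R m"
  have F: "module R (finite_free R n)" for n by (rule finite_free_module[OF cr])
  interpret Fn: module R ?Fn by (rule F)
  note lu = lin_lincomb[OF assms(2) uc] and lw = lin_lincomb[OF assms(2) w(1)]
  obtain p where p: "\<And>i. i < n \<Longrightarrow> p i \<in> carrier ?Fm" "\<And>i. i < n \<Longrightarrow> u i \<ominus>\<^bsub>X\<^esub> lincomb X m w (p i) \<in> X.H"
    using w(2) by metis
  \<comment> \<open>\<open>?P\<close> expresses the generators in the lifted basis modulo
    \<open>I X\<close>, while \<open>S\<close> will express the lifted basis in the generators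
    exactly.\<close>
  let ?P = "lincomb ?Fm n p"
  have pc: "p \<in> {..<n} \<rightarrow> carrier ?Fm" using p(1) by auto
  have lP: "lin R ?Fn ?Fm ?P" by (rule lin_lincomb[OF F pc])
  obtain S where S: "lin R ?Fm ?Fn S" "\<And>x. x \<in> carrier ?Fm \<Longrightarrow> lincomb X n u (S x) = lincomb X m w x"
    using free_lift[OF assms(2) F lw lu] lin_closed[OF lw] uX by metis
  have P: "lincomb X n u r \<ominus>\<^bsub>X\<^esub> lincomb X m w (?P r) \<in> X.H" if r: "r \<in> carrier ?Fn" for r
  proof -
    note ld = lin_minus_fun[OF F assms(2) lu lin_comp[OF lP lw]]
    show ?thesis unfolding lin_free_eq[OF assms(2) ld r]
    proof (rule lincomb_in_sub[OF assms(2) X.H])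
      fix i assume i: "i < n"
      have "lincomb X n u (unit_vec R i) \<ominus>\<^bsub>X\<^esub> lincomb X m w (?P (unit_vec R i)) \<in> X.H"
        using lincomb_unit[OF assms(2) uc i] lincomb_unit[OF F pc i] p(2)[OF i] by simp
      thus "r i \<odot>\<^bsub>X\<^esub> (lincomb X n u (unit_vec R i) \<ominus>\<^bsub>X\<^esub> lincomb X m w (?P (unit_vec R i))) \<in> X.H"
        by (rule sub_smult[OF X.H finite_free_val[OF cr r]])
    qed
  qed
  have Im: "I \<subseteq> max_ideal R" by (rule ideal_le_max[OF assms(1,3,4)])
  \<comment> \<open>The matrix of \<open>1 - S P\<close> has entries in the maximal ideal: its
    values give combinations lying in \<open>I X\<close>, and the generators are minimal.\<close>
  let ?E = "\<lambda>r. r \<ominus>\<^bsub>?Fn\<^esub> S (?P r)"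
  have lid: "lin R ?Fn ?Fn (\<lambda>r. r)" by (rule linI) auto
  note lSP = lin_comp[OF lP S(1)]
  have lE: "lin R ?Fn ?Fn ?E" by (rule lin_minus_fun[OF F F lid lSP])
  have E: "?E r i \<in> max_ideal R" if r: "r \<in> carrier ?Fn" and i: "i < n" for r i
  proof -
    have "lincomb X n u (?E r) \<in> X.H"
      using P[OF r] lin_minus[OF F assms(2) lu r lin_closed[OF lSP r]] S(2)[OF lin_closed[OF lP r]] by simp
    thus ?thesis
      by (rule rels_in_ismult[OF assms(2,3) max_ideal_ideal[OF assms(1)] Im assms(5,6) lin_closed[OF lE r] _ i])
  qed
  show "rels_in R X n u I" unfolding rels_in_def
  proof (intro ballI impI allI)
    fix c i assume c: "c \<in> carrier ?Fn" "lincomb X n u c = \<zero>\<^bsub>X\<^esub>" and i: "i < n"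
    note cv = finite_free_val[OF cr c(1)] and Pc = lin_closed[OF lP c(1)]
    have "lincomb X n u c \<ominus>\<^bsub>X\<^esub> (lincomb X n u c \<ominus>\<^bsub>X\<^esub> lincomb X m w (?P c)) = lincomb X m w (?P c)"
      using X.M.add_minus_cancel(4) lin_closed[OF lu c(1)] lin_closed[OF lw Pc] by simp
    moreover have "lincomb X n u c \<in> X.H" unfolding c(2) by (rule sub_zero[OF X.H])
    ultimately have "lincomb X m w (?P c) \<in> X.H" using sub_minus[OF X.H _ P[OF c(1)]] by metis
    hence "\<forall>j<m. ?P c j \<in> I" using w(3) Pc by simp
    hence "?P c \<in> ideal_smult R I ?Fm" by (intro ideal_vec_ismult[OF cr assms(3) Pc]) simp
    hence SPc: "S (?P c) \<in> ideal_smult R I ?Fn" by (rule lin_ismult[OF F F S(1) X.IR])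
    let ?RM = "ring_module R"
    have RM: "module R ?RM" by (rule ring_module_module[OF cr])
    show "c i \<in> I"
    \<comment> \<open>The ring serves as a module over itself, with \<open>I\<close> as submodule
      and the coefficients of \<open>c\<close> as family. In \<open>c = S P c + E c\<close> the
      first term has entries in \<open>I\<close>, and the entries of the second are combinations of
      the \<open>c i\<close> with coefficients in the maximal ideal.\<close>
    proof (rule nakayama[OF assms(1) RM _ _ _ i])
      show "submodule I R ?RM" using assms(3) by (simp add: ideal_iff_submodule[OF cr])
      show "c \<in> {..<n} \<rightarrow> carrier ?RM" using cv by auto
      fix l assume l: "l < n"
      let ?e = "\<lambda>i. ?E (unit_vec R i)"
      have eF: "?e i \<in> carrier ?Fn" if "i < n" for i by (rule lin_closed[OF lE unit_vec_carrier[OF cr that]])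
      have "c = S (?P c) \<oplus>\<^bsub>?Fn\<^esub> ?E c"
        using Fn.M.add_minus_cancel(3)[OF c(1) lin_closed[OF lSP c(1)]]
          Fn.M.a_comm[OF lin_closed[OF lE c(1)] lin_closed[OF lSP c(1)]] by metis
      hence e1: "c l = S (?P c) l \<oplus>\<^bsub>R\<^esub> ?E c l" by (metis finite_free_simps(2))
      have e2: "?E c l = lincomb ?RM n (\<lambda>i. ?e i l) c"
      proof -
        have "?E c = lincomb ?Fn n ?e c" by (rule lin_free_eq[OF F lE c(1)])
        moreover have "lincomb ?Fn n ?e c l = lincomb ?RM n (\<lambda>i. ?e i l) c"
          using eF cv unfolding finite_free_pow
          by (intro lin_lincomb_comp[OF _ RM lin_pow_eval[OF RM]]) (auto intro: pow_module_module[OF RM])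
        ultimately show ?thesis by simp
      qed
      have e3: "lincomb ?RM n (\<lambda>i. ?e i l) c = lincomb ?RM n c (\<lambda>i. ?e i l)"
        using finite_free_val[OF cr eF] cv by (intro lincomb_ring_comm[OF cr])
      have a1: "c l = S (?P c) l \<oplus>\<^bsub>?RM\<^esub> lincomb ?RM n c (\<lambda>i. ?e i l)"
        unfolding ring_module_simps e3[symmetric] e2[symmetric] by (rule e1)
      have a2: "S (?P c) l \<in> I" by (rule ismult_vec[OF cr assms(3) SPc l])
      have a3: "(\<lambda>i. ?e i l) \<in> {..<n} \<rightarrow> max_ideal R" using E[OF unit_vec_carrier[OF cr] l] by auto
      show "\<exists>b\<in>I. \<exists>d\<in>{..<n} \<rightarrow> max_ideal R. c l = b \<oplus>\<^bsub>?RM\<^esub> lincomb ?RM n c d"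
        by (rule bexI[of _ "S (?P c) l"], rule bexI[of _ "\<lambda>i. ?e i l"]) (rule a1, rule a3, rule a2)
    qed
  qed
qed

section \<open>Tensor products under vanishing of Ext\<close>

context presentation
begin

lemma xsub_tensor:
  assumes "X \<subseteq> carrier R" shows "xsub R W X = \<Theta> ` xsub R Nn X"
proof
  note sN = xsub_sub[OF Nn assms]
  show "xsub R W X \<subseteq> \<Theta> ` xsub R Nn X"
  proof (rule xsub_least[OF W assms sub_image[OF Nn W lin_\<Theta> sN]])
    fix x w assume x: "x \<in> X" and "w \<in> carrier W"
    then obtain c where c: "c \<in> carrier Nn" "w = \<Theta> c" using \<Theta>_surj by auto
    have "x \<odot>\<^bsub>W\<^esub> w = \<Theta> (x \<odot>\<^bsub>Nn\<^esub> c)" using lin_smult[OF lin_\<Theta> subsetD[OF assms x] c(1)] c(2) by simp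
    moreover have "x \<odot>\<^bsub>Nn\<^esub> c \<in> xsub R Nn X" by (rule xsub_mem[OF x c(1)])
    ultimately show "x \<odot>\<^bsub>W\<^esub> w \<in> \<Theta> ` xsub R Nn X" by (rule image_eqI)
  qed
  show "\<Theta> ` xsub R Nn X \<subseteq> xsub R W X"
    by (rule image_subsetI, rule lin_xsub[OF Nn W lin_\<Theta> assms])
qed

text \<open>Let \<open>X\<close> be an initial part of \<open>xs\<close>. Exactness at
  \<open>N^n\<close> modulo \<open>X\<close> says that the next differential embeds
  \<open>W / (X) W\<close> into a power of \<open>N\<close> modulo \<open>X\<close>. The second
  claim is this embedding for all of \<open>xs\<close>; the first follows because the next element
  of \<open>xs\<close> is regular on that power modulo \<open>X\<close>.\<close>

lemma tensor_of_exact: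
  assumes "free_resolution R T b DD \<eta>" "b 0 = k" "b (Suc 0) = n"
    "\<And>s. s \<in> carrier (finite_free R n) \<Longrightarrow> DD 0 s = dual_map R n k D s"
    "\<And>i. i \<le> length xs \<Longrightarrow> coboundaries_exact R N b DD i" "regular_list R N xs" "set xs \<subseteq> carrier R"
  shows "regular_list R W xs"
    and "c \<in> carrier Nn \<Longrightarrow> cochain R N b DD (Suc 0) c \<in> xsub R (pow_module N {..<b (Suc (Suc 0))}) (set xs) \<Longrightarrow>
      \<Theta> c \<in> xsub R W (set xs)"
proof -
  let ?C = "\<lambda>j. pow_module N {..<b j}"
  let ?d = "cochain R N b DD"
  interpret C: complex R ?C ?d by (rule cochain_complex[OF Nm assms(1)])
  have C0: "?C 0 = Nk" and C1: "?C (Suc 0) = Nn" by (simp_all add: assms(2,3))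
  \<comment> \<open>The resolution starts with the transpose of \<open>D\<close>, and passing to
    cochains transposes once more, so the differential in degree \<open>0\<close> is
    \<open>D \<otimes> N\<close>.\<close>
  have d0: "?d 0 c = tensor_map R N n k D c" if c: "c \<in> carrier Nk" for c
  proof -
    have "lincomb N k c (DD 0 (unit_vec R s)) = lincomb N k c (\<lambda>j. D (unit_vec R j) s)" if s: "s < n" for s
      using assms(4)[OF unit_vec_carrier[OF cr s]] M.R.dual_map_unit[OF lin_D s] pow_val[OF Nm c] D_val
      by (intro lincomb_cong[OF Nm]) auto
    thus ?thesis by (auto simp: cochain_def tensor_map_def assms(2,3) fun_eq_iff)
  qed
  have reg: "regular_list R (?C i) xs" for i
    using assms(6) set_take_carr[OF assms(7)]
    by (auto simp: regular_list_def intro!: regular_mod_pow[OF Nm finite_lessThan])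
  have ex: "exact_mod R ?C ?d (set (take j xs)) 0" if "j \<le> length xs" for j
    using that by (intro C.exact_mod_regular[OF _ reg assms(7)] coboundaries_exact_mod[OF Nm assms(1) assms(5)]) simp_all
  have key: "\<Theta> c \<in> xsub R W (set (take j xs))"
    if c: "c \<in> carrier Nn" and dc: "?d (Suc 0) c \<in> xsub R (?C (Suc (Suc 0))) (set (take j xs))" and j: "j \<le> length xs" for c j
  proof -
    interpret Nn: module R Nn by (rule Nn)
    interpret W: module R W by (rule W)
    obtain e where e: "e \<in> carrier (?C 0)" "c \<ominus>\<^bsub>?C (Suc 0)\<^esub> ?d 0 e \<in> xsub R (?C (Suc 0)) (set (take j xs))"
      by (rule exact_modE[OF ex[OF j], of c]) (use c dc C1 in simp_all)
    have eB: "?d 0 e \<in> B" using d0 e(1) unfolding C0 by auto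
    have bc: "?d 0 e \<in> carrier Nn" by (rule sub_carr[OF B_sub eB])
    have "\<Theta> (c \<ominus>\<^bsub>Nn\<^esub> ?d 0 e) = \<Theta> c"
      using lin_minus[OF Nn W lin_\<Theta> c bc] \<Theta>_B[OF eB] lin_closed[OF lin_\<Theta> c] by simp
    thus ?thesis using e(2) unfolding C1 xsub_tensor[OF set_take_carr[OF assms(7)]] by (metis imageI)
  qed
  show "c \<in> carrier Nn \<Longrightarrow> ?d (Suc 0) c \<in> xsub R (?C (Suc (Suc 0))) (set xs) \<Longrightarrow> \<Theta> c \<in> xsub R W (set xs)"
    using key[of c "length xs"] by simp
  show "regular_list R W xs" unfolding regular_list_def regular_mod_def
  proof (intro allI impI ballI)
    fix i w assume i: "i < length xs" and w: "w \<in> carrier W" "xs ! i \<odot>\<^bsub>W\<^esub> w \<in> xsub R W (set (take i xs))"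
    let ?X = "set (take i xs)"
    note X = set_take_carr[OF assms(7), of i]
    have x: "xs ! i \<in> carrier R" using assms(7) nth_mem[OF i] by auto
    obtain c where c: "c \<in> carrier Nn" "w = \<Theta> c" using w(1) \<Theta>_surj by auto
    interpret Nn: module R Nn by (rule Nn)
    interpret W: module R W by (rule W)
    interpret C2: module R "?C (Suc (Suc 0))" by (rule C.mod)
    have xc: "xs ! i \<odot>\<^bsub>Nn\<^esub> c \<in> carrier Nn" by (rule Nn.smult_closed[OF x c(1)])
    obtain l where l: "l \<in> xsub R Nn ?X" "xs ! i \<odot>\<^bsub>W\<^esub> w = \<Theta> l" using w(2) unfolding xsub_tensor[OF X] by auto
    have lc: "l \<in> carrier Nn" by (rule sub_carr[OF xsub_sub[OF Nn X] l(1)])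
    have "\<Theta> (xs ! i \<odot>\<^bsub>Nn\<^esub> c) = \<Theta> l" using l(2) lin_smult[OF lin_\<Theta> x c(1)] c(2) by simp
    hence "\<Theta> ((xs ! i \<odot>\<^bsub>Nn\<^esub> c) \<ominus>\<^bsub>Nn\<^esub> l) = \<zero>\<^bsub>W\<^esub>"
      using lin_minus[OF Nn W lin_\<Theta> xc lc] lin_closed[OF lin_\<Theta> lc] by (simp add: a_minus_def W.M.r_neg)
    hence "(xs ! i \<odot>\<^bsub>Nn\<^esub> c) \<ominus>\<^bsub>Nn\<^esub> l \<in> B" using \<Theta>_zeroD[OF Nn.M.minus_closed[OF xc lc]] by simp
    then obtain e where e: "e \<in> carrier Nk" "(xs ! i \<odot>\<^bsub>Nn\<^esub> c) \<ominus>\<^bsub>Nn\<^esub> l = ?d 0 e" using d0 by auto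
    have l1: "lin R Nn (?C (Suc (Suc 0))) (?d (Suc 0))" using C.lin_\<delta>[of "Suc 0"] unfolding C1 .
    have "?d (Suc 0) ((xs ! i \<odot>\<^bsub>Nn\<^esub> c) \<ominus>\<^bsub>Nn\<^esub> l) = \<zero>\<^bsub>?C (Suc (Suc 0))\<^esub>"
      unfolding e(2) using C.\<delta>\<delta>[of e 0] e(1) unfolding C0 .
    hence z: "xs ! i \<odot>\<^bsub>?C (Suc (Suc 0))\<^esub> ?d (Suc 0) c \<ominus>\<^bsub>?C (Suc (Suc 0))\<^esub> ?d (Suc 0) l = \<zero>\<^bsub>?C (Suc (Suc 0))\<^esub>"
      unfolding lin_minus[OF Nn C.mod l1 xc lc] lin_smult[OF l1 x c(1)] .
    have s2: "submodule (xsub R (?C (Suc (Suc 0))) ?X) R (?C (Suc (Suc 0)))" by (rule xsub_sub[OF C.mod X])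
    have "xs ! i \<odot>\<^bsub>?C (Suc (Suc 0))\<^esub> ?d (Suc 0) c \<in> xsub R (?C (Suc (Suc 0))) ?X"
      by (rule sub_minus_cancel[OF C.mod s2 _ lin_xsub[OF Nn C.mod l1 X l(1)]])
        (use z sub_zero[OF s2] x lin_closed[OF l1 c(1)] in \<open>simp_all del: pow_simps\<close>)
    hence "?d (Suc 0) c \<in> xsub R (?C (Suc (Suc 0))) ?X"
      using reg[of "Suc (Suc 0)"] i lin_closed[OF l1 c(1)] unfolding regular_list_def regular_mod_def by blast
    thus "w \<in> xsub R W ?X" unfolding c(2) using key[OF c(1), of i] i by simp
  qed
qed

text \<open>The columns of \<open>D\<close> are relations of \<open>M\<close>, so all entries of its
  matrix lie in \<open>J\<close>.\<close>

lemma B_in_ideal: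
  assumes "ideal J R" "rels_in R M n u J" shows "B \<subseteq> ideal_smult R J Nn"
proof
  fix x assume "x \<in> B"
  then obtain c where c: "c \<in> carrier Nk" "x = tensor_map R N n k D c" by auto
  have JR: "J \<subseteq> carrier R" using ideal.Icarr[OF assms(1)] by auto
  have DJ: "D (unit_vec R j) i \<in> J" if "j < k" "i < n" for i j
  proof -
    have "D (unit_vec R j) \<in> carrier (finite_free R n)" by (rule lin_closed[OF lin_D unit_vec_carrier[OF cr that(1)]])
    moreover from this have "lincomb M n u (D (unit_vec R j)) = \<zero>\<^bsub>M\<^esub>"
      using ker_D unit_vec_carrier[OF cr that(1)] by auto
    ultimately show ?thesis using assms(2) that(2) unfolding rels_in_def by blast
  qed
  have "x i \<in> ideal_smult R J N" if "i < n" for i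
    unfolding c(2) tensor_map_def using that DJ pow_val[OF Nm c(1)]
    by (auto intro!: lincomb_in_sub[OF Nm ismult_sub[OF Nm JR]] ismult_mem)
  thus "x \<in> ideal_smult R J Nn"
    using pow_ismult[OF Nm finite_lessThan JR] sub_carr[OF B_sub \<open>x \<in> B\<close>] by simp
qed

end

section \<open>Products of generators in the tensor product\<close>

text \<open>The pair \<open>(i, j)\<close> with \<open>i < n\<close> and \<open>j < m\<close> is numbered \<open>i * m + j\<close>.\<close>

locale presentation_gens = presentation R M N n k u D
  for R (structure) and M :: "('a, 'm, 'x) module_scheme" and N :: "('a, 'n, 'y) module_scheme"
    and n k :: nat and u D +
  fixes m :: nat and v :: "nat \<Rightarrow> 'n"
  assumes gens_v: "gens R N m v"
begin

definition uv :: "nat \<Rightarrow> ('m \<times> 'n \<Rightarrow> 'a) set" where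
  "uv t = \<Theta> (single N (t div m) (v (t mod m)))"

text \<open>\<open>r\<close> is read as an \<open>n\<close> by \<open>m\<close> matrix and each row
  is evaluated at the generators \<open>v\<close>; the result is a preimage in \<open>N^n\<close> of
  the combination of the products \<open>u i \<otimes> v j\<close>.\<close>

definition rows :: "(nat \<Rightarrow> 'a) \<Rightarrow> nat \<Rightarrow> 'n" where
  "rows r = (\<lambda>i. if i < n then lincomb N m v (\<lambda>j. r (i * m + j)) else \<zero>\<^bsub>N\<^esub>)"

lemma vc: "v \<in> {..<m} \<rightarrow> carrier N" using gens_v unfolding gens_def by (rule conjunct1)

lemma vN: "carrier N = lincomb N m v ` carrier (finite_free R m)"
  using gens_v unfolding gens_def by (rule conjunct2)

lemma index: "t < n * m \<Longrightarrow> t div m < n" "t < n * m \<Longrightarrow> t mod m < m"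
proof -
  show "t < n * m \<Longrightarrow> t div m < n" by (rule less_mult_imp_div_less)
  show "t < n * m \<Longrightarrow> t mod m < m" by (cases "m = 0") auto
qed

lemma index_less: "i < n \<Longrightarrow> j < m \<Longrightarrow> i * m + j < n * m"
proof -
  assume "i < n" "j < m"
  hence "i * m + j < Suc i * m" by simp
  also have "\<dots> \<le> n * m" using \<open>i < n\<close> by (intro mult_le_mono1) simp
  finally show ?thesis .
qed

lemma vt: "t < n * m \<Longrightarrow> v (t mod m) \<in> carrier N" using vc index(2) by auto

lemma single_uv: "t < n * m \<Longrightarrow> single N (t div m) (v (t mod m)) \<in> carrier Nn"
  by (rule single_carrier[OF index(1) vt])

lemma uv_carrier: "uv \<in> {..<n * m} \<rightarrow> carrier W"
  unfolding uv_def using lin_closed[OF lin_\<Theta> single_uv] by auto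

lemma rows_carrier: "r \<in> carrier (finite_free R (n * m)) \<Longrightarrow> rows r \<in> carrier Nn"
  unfolding rows_def pow_carrier using finite_free_val[OF cr] by (auto intro!: lincomb_closed[OF Nm vc])

lemma lincomb_uv:
  assumes r: "r \<in> carrier (finite_free R (n * m))"
  shows "lincomb W (n * m) uv r = \<Theta> (rows r)"
proof -
  note rv = finite_free_val[OF cr r]
  let ?s = "\<lambda>t. single N (t div m) (v (t mod m))"
  have sc: "?s \<in> {..<n * m} \<rightarrow> carrier Nn" using single_uv by auto
  have "lincomb W (n * m) uv r = \<Theta> (lincomb Nn (n * m) ?s r)"
    unfolding uv_def using rv by (intro lin_lincomb_comp[OF Nn W lin_\<Theta> sc, symmetric]) auto
  also have "lincomb Nn (n * m) ?s r = rows r"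
  proof
    fix i
    have "lincomb Nn (n * m) ?s r i = lincomb N (n * m) (\<lambda>t. ?s t i) r"
      using rv by (intro lin_lincomb_comp[OF Nn Nm lin_pow_eval[OF Nm] sc]) auto
    also have "\<dots> = rows r i"
    proof (cases "i < n")
      case True
      have e: "{t \<in> {..<n * m}. t div m = i} = (\<lambda>j. i * m + j) ` {..<m}"
      proof
        show "{t \<in> {..<n * m}. t div m = i} \<subseteq> (\<lambda>j. i * m + j) ` {..<m}"
        proof
          fix t assume t: "t \<in> {t \<in> {..<n * m}. t div m = i}"
          hence "t = i * m + t mod m" "t mod m < m" using index(2)[of t] by auto
          thus "t \<in> (\<lambda>j. i * m + j) ` {..<m}" by (intro image_eqI[of _ _ "t mod m"]) simp_all
        qed
        show "(\<lambda>j. i * m + j) ` {..<m} \<subseteq> {t \<in> {..<n * m}. t div m = i}" using index_less[OF True] by auto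
      qed
      have "lincomb N (n * m) (\<lambda>t. ?s t i) r = (\<Oplus>\<^bsub>N\<^esub>t\<in>{t \<in> {..<n * m}. t div m = i}. r t \<odot>\<^bsub>N\<^esub> v (t mod m))"
        unfolding lincomb_def
        by (rule N.M.add.finprod_mono_neutral_cong_right) (use rv vt in \<open>auto simp: single_def\<close>)
      also have "\<dots> = (\<Oplus>\<^bsub>N\<^esub>j\<in>{..<m}. r (i * m + j) \<odot>\<^bsub>N\<^esub> v ((i * m + j) mod m))"
        unfolding e using rv vc by (intro N.M.finsum_reindex) (auto simp: inj_on_def Pi_iff)
      also have "\<dots> = lincomb N m v (\<lambda>j. r (i * m + j))"
        unfolding lincomb_def using rv vc by (intro N.M.finsum_cong') (auto simp: Pi_iff)
      finally show ?thesis using True by (simp add: rows_def)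
    next
      case False
      have "lincomb N (n * m) (\<lambda>t. ?s t i) r = (\<Oplus>\<^bsub>N\<^esub>t\<in>{..<n * m}. \<zero>\<^bsub>N\<^esub>)"
        unfolding lincomb_def
      proof (rule N.M.finsum_cong'[OF refl])
        fix t assume "t \<in> {..<n * m}"
        hence "t div m \<noteq> i" using index(1)[of t] False by auto
        thus "r t \<odot>\<^bsub>N\<^esub> ?s t i = \<zero>\<^bsub>N\<^esub>" using rv by (simp add: single_def)
      qed simp
      thus ?thesis using False by (simp add: rows_def)
    qed
    finally show "lincomb Nn (n * m) ?s r i = rows r i" .
  qed
  finally show ?thesis .
qed

lemma gens_uv: "gens R W (n * m) uv"
  unfolding gens_def
proof (intro conjI uv_carrier antisym)
  show "lincomb W (n * m) uv ` carrier (finite_free R (n * m)) \<subseteq> carrier W"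
    using lin_closed[OF lin_lincomb[OF W uv_carrier]] by auto
  show "carrier W \<subseteq> lincomb W (n * m) uv ` carrier (finite_free R (n * m))"
  proof
    fix w assume "w \<in> carrier W"
    then obtain c where c: "c \<in> carrier Nn" "w = \<Theta> c" using \<Theta>_surj by auto
    have "\<exists>s. s \<in> carrier (finite_free R m) \<and> c i = lincomb N m v s" for i
      using pow_val[OF Nm c(1), of i] vN by auto
    then obtain s where s: "\<And>i. s i \<in> carrier (finite_free R m)" "\<And>i. c i = lincomb N m v (s i)" by metis
    let ?r = "\<lambda>t. if t < n * m then s (t div m) (t mod m) else \<zero>"
    have r: "?r \<in> carrier (finite_free R (n * m))" using finite_free_val[OF cr s(1)] by (auto simp: finite_free_carrier)
    have "rows ?r i = c i" for i
    proof (cases "i < n")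
      case True
      have "rows ?r i = lincomb N m v (\<lambda>j. ?r (i * m + j))" using True by (simp add: rows_def)
      also have "\<dots> = lincomb N m v (s i)"
        using index_less[OF True] finite_free_val[OF cr s(1)] vc by (intro lincomb_cong[OF Nm]) auto
      finally show ?thesis using s(2) by simp
    next
      case False
      thus ?thesis using c(1) by (simp add: rows_def pow_carrier)
    qed
    hence "rows ?r = c" by (rule ext)
    hence "w = lincomb W (n * m) uv ?r" using lincomb_uv[OF r] c(2) by metis
    thus "w \<in> lincomb W (n * m) uv ` carrier (finite_free R (n * m))" using r by (rule image_eqI)
  qed
qed

text \<open>The vector \<open>rows r\<close> lies in \<open>B\<close>, hence in \<open>J\<close>
  times \<open>N^n\<close>, so each row of \<open>r\<close> is a relation of \<open>v\<close> modulo
  \<open>J N\<close>. With the maximal ideal this gives minimality of the products, with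
  \<open>I\<close> freeness of \<open>W\<close> modulo \<open>I\<close>.\<close>

lemma rels_uv:
  assumes "ideal J R" "rels_in R M n u J" "rels_in R N m v J"
  shows "rels_in R W (n * m) uv J"
  unfolding rels_in_def
proof (intro ballI impI allI)
  fix r t assume r: "r \<in> carrier (finite_free R (n * m))" "lincomb W (n * m) uv r = \<zero>\<^bsub>W\<^esub>" and t: "t < n * m"
  have JR: "J \<subseteq> carrier R" using ideal.Icarr[OF assms(1)] by auto
  have "rows r \<in> B" using \<Theta>_zeroD[OF rows_carrier[OF r(1)]] r lincomb_uv by simp
  hence "rows r \<in> ideal_smult R J Nn" using B_in_ideal[OF assms(1,2)] by auto
  hence "rows r (t div m) \<in> ideal_smult R J N"
    using pow_ismult[OF Nm finite_lessThan JR] index(1)[OF t] by simp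
  hence h: "lincomb N m v (\<lambda>j. r (t div m * m + j)) \<in> ideal_smult R J N" using index(1)[OF t] by (simp add: rows_def)
  let ?s = "\<lambda>j. if j < m then r (t div m * m + j) else \<zero>"
  have s: "?s \<in> carrier (finite_free R m)" using finite_free_val[OF cr r(1)] by (auto simp: finite_free_carrier)
  have "lincomb N m v ?s = lincomb N m v (\<lambda>j. r (t div m * m + j))"
    using finite_free_val[OF cr r(1)] vc by (intro lincomb_cong[OF Nm]) auto
  hence "?s (t mod m) \<in> J"
    using h index(2)[OF t] by (intro rels_in_ismult[OF Nm assms(1,1) subset_refl gens_v assms(3) s]) simp_all
  thus "r t \<in> J" using index(2)[OF t] by simp
qed

text \<open>A relation of \<open>v\<close> is multiplied by \<open>u 0\<close>, which exists as
  \<open>n > 0\<close>. In the chosen numbering row \<open>0\<close> occupies the first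
  \<open>m\<close> places, so the coefficient vector stays the same.\<close>

lemma rels_right:
  assumes "n > 0" "rels_in R W (n * m) uv J" shows "rels_in R N m v J"
  unfolding rels_in_def
proof (intro ballI impI allI)
  fix s j assume s: "s \<in> carrier (finite_free R m)" "lincomb N m v s = \<zero>\<^bsub>N\<^esub>" and j: "j < m"
  note sv = finite_free_val[OF cr s(1)]
  have le: "t < n * m" if "t < m" for t using index_less[OF assms(1) that] by simp
  have sF: "s \<in> carrier (finite_free R (n * m))"
  proof -
    have mn: "m \<le> n * m" using assms(1) by simp
    have "s t = \<zero>" if "t \<ge> n * m" for t using s(1) le_trans[OF mn that] by (simp add: finite_free_carrier)
    thus ?thesis using sv by (simp add: finite_free_carrier)
  qed
  have "rows s i = \<zero>\<^bsub>N\<^esub>" for i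
  proof (cases "i = 0")
    case True thus ?thesis using s(2) by (simp add: rows_def)
  next
    case False
    have "lincomb N m v (\<lambda>j. s (i * m + j)) = (\<Oplus>\<^bsub>N\<^esub>j\<in>{..<m}. \<zero>\<^bsub>N\<^esub>)"
      unfolding lincomb_def
    proof (rule N.M.finsum_cong'[OF refl])
      fix j assume "j \<in> {..<m}"
      moreover have "i * m + j \<ge> m" using False by (cases i) auto
      ultimately show "s (i * m + j) \<odot>\<^bsub>N\<^esub> v j = \<zero>\<^bsub>N\<^esub>" using s(1) vc by (auto simp: finite_free_carrier Pi_iff)
    qed simp
    thus ?thesis by (simp add: rows_def)
  qed
  hence "rows s = \<zero>\<^bsub>Nn\<^esub>" by (simp add: fun_eq_iff)
  hence "lincomb W (n * m) uv s = \<zero>\<^bsub>W\<^esub>" using lincomb_uv[OF sF] lin_zero[OF Nn W lin_\<Theta>] by simp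
  thus "s j \<in> J" using assms(2) sF le[OF j] unfolding rels_in_def by blast
qed

text \<open>A relation of \<open>u\<close> is multiplied by \<open>v 0\<close>: its coefficients go
  to the first column, that is, to the places divisible by \<open>m\<close>.\<close>

lemma rels_left:
  assumes "m > 0" "rels_in R W (n * m) uv J" shows "rels_in R M n u J"
  unfolding rels_in_def
proof (intro ballI impI allI)
  fix c i assume c: "c \<in> carrier (finite_free R n)" "lincomb M n u c = \<zero>\<^bsub>M\<^esub>" and i: "i < n"
  note cv = finite_free_val[OF cr c(1)]
  let ?r = "\<lambda>t. if t < n * m \<and> t mod m = 0 then c (t div m) else \<zero>"
  have r: "?r \<in> carrier (finite_free R (n * m))" using cv by (auto simp: finite_free_carrier)
  have v0: "v 0 \<in> carrier N" using vc assms(1) by auto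
  have "rows ?r l = scaled N n c (v 0) l" for l
  proof (cases "l < n")
    case True
    have "rows ?r l = lincomb N m v (\<lambda>j. ?r (l * m + j))" using True by (simp add: rows_def)
    also have "\<dots> = lincomb N m v (c l \<odot>\<^bsub>finite_free R m\<^esub> unit_vec R 0)"
      using index_less[OF True] cv vc by (intro lincomb_cong[OF Nm]) (auto simp: unit_vec_def)
    also have "\<dots> = c l \<odot>\<^bsub>N\<^esub> v 0"
      using lin_smult[OF lin_lincomb[OF Nm vc] cv unit_vec_carrier[OF cr assms(1)]] lincomb_unit[OF Nm vc assms(1)] by simp
    finally show ?thesis using True by (simp add: scaled_def)
  qed (simp add: rows_def scaled_def)
  hence "rows ?r = scaled N n c (v 0)" by (rule ext)
  hence "lincomb W (n * m) uv ?r = \<zero>\<^bsub>W\<^esub>"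
    using lincomb_uv[OF r] \<Theta>_B[OF scaled_rel[OF c v0]] by simp
  moreover have im: "i * m < n * m" using i assms(1) by simp
  ultimately have "?r (i * m) \<in> J" using assms(2) r unfolding rels_in_def by blast
  thus "c i \<in> J" using im assms(1) by simp
qed

lemma W_finite: "finite_module R W"
  unfolding finite_module_fg using W gens_uv unfolding gens_def
  by (intro conjI fgI_family[OF W uv_carrier]) auto

text \<open>If \<open>W\<close> were zero, a unit vector would be a relation, and its coefficient
  one would lie in a proper ideal.\<close>

lemma W_nonzero:
  assumes "ideal J R" "\<one> \<notin> J" "rels_in R M n u J" "rels_in R N m v J" "n > 0" "m > 0"
  shows "\<not> zero_module W"
proof
  assume z: "zero_module W"
  have nm: "0 < n * m" using assms(5,6) by simp
  note e = unit_vec_carrier[OF cr nm]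
  have "lincomb W (n * m) uv (unit_vec R 0) = \<zero>\<^bsub>W\<^esub>"
    using z lin_closed[OF lin_lincomb[OF W uv_carrier] e] unfolding zero_module_def by auto
  hence "unit_vec R (0::nat) (0::nat) \<in> J"
    using rels_uv[OF assms(1,3,4)] e nm unfolding rels_in_def by blast
  thus False using assms(2) by (simp add: unit_vec_def)
qed

end

section \<open>Functionals on \<open>M\<close> from the transposed matrix\<close>

text \<open>A row in the kernel of the transposed matrix annihilates the columns of
  \<open>D\<close>, hence all relations between the \<open>u i\<close>, and therefore descends from
  \<open>R^n\<close> to \<open>M\<close>.\<close>

lemma (in presentation) functional_exists:
  assumes "s \<in> carrier (finite_free R n)" "dual_map R n k D s = \<zero>\<^bsub>finite_free R k\<^esub>"
  shows "\<exists>\<phi>\<in>mod_hom R M (ring_module R). \<forall>i<n. \<phi> (u i) = s i"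
proof -
  note RM = ring_module_module[OF cr]
  interpret RM: module R "ring_module R" by (rule RM)
  have Fn: "module R (finite_free R n)" by (rule F)
  interpret Fn: module R "finite_free R n" by (rule F)
  let ?s = "lincomb (ring_module R) n s"
  have ls: "lin R (finite_free R n) (ring_module R) ?s" by (rule lin_lincomb[OF RM free_family[OF assms(1)]])
  note lu = lin_lincomb[OF Mm uc]
  have z: "?s r = \<zero>" if r: "r \<in> carrier (finite_free R n)" "lincomb M n u r = \<zero>\<^bsub>M\<^esub>" for r
  proof -
    obtain t where t: "t \<in> carrier (finite_free R k)" "r = D t" using ker_D[OF r(1)] r(2) by auto
    have "?s r = lincomb (ring_module R) k (\<lambda>_. \<zero>) t"
      using M.R.dual_map_eval[OF lin_D assms(1) t(1)] assms(2) t(2) by simp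
    also have "\<dots> = (\<Oplus>\<^bsub>ring_module R\<^esub>i\<in>{..<k}. \<zero>\<^bsub>ring_module R\<^esub>)"
      unfolding lincomb_def using finite_free_val[OF cr t(1)] by (intro RM.M.finsum_cong') auto
    finally have "?s r = \<zero>\<^bsub>ring_module R\<^esub>" by (simp only: RM.M.finsum_zero)
    thus ?thesis by simp
  qed
  have eq: "?s r = ?s r'" if r: "r \<in> carrier (finite_free R n)" "r' \<in> carrier (finite_free R n)" "lincomb M n u r = lincomb M n u r'" for r r'
  proof -
    have "lincomb M n u (r \<ominus>\<^bsub>finite_free R n\<^esub> r') = \<zero>\<^bsub>M\<^esub>"
      using lin_minus[OF Fn Mm lu r(1,2)] r(3) lin_closed[OF lu r(2)] by (simp add: a_minus_def M.M.r_neg)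
    from z[OF Fn.M.minus_closed[OF r(1,2)] this]
    have "?s r \<ominus>\<^bsub>ring_module R\<^esub> ?s r' = \<zero>\<^bsub>ring_module R\<^esub>" using lin_minus[OF Fn RM ls r(1,2)] by simp
    thus ?thesis using RM.M.add_minus_cancel(3)[OF lin_closed[OF ls r(1)] lin_closed[OF ls r(2)]]
        RM.M.l_zero[OF lin_closed[OF ls r(2)]] by simp
  qed
  have "lin R M (ring_module R) (\<lambda>x. ?s (coords x))"
  proof (rule linI)
    fix x y assume x: "x \<in> carrier M" and y: "y \<in> carrier M"
    note cx = coords[OF x] and cy = coords[OF y] and cxy = coords[OF M.M.a_closed[OF x y]]
    show "?s (coords x) \<in> carrier (ring_module R)" by (rule lin_closed[OF ls cx(1)])
    have "?s (coords (x \<oplus>\<^bsub>M\<^esub> y)) = ?s (coords x \<oplus>\<^bsub>finite_free R n\<^esub> coords y)"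
      by (rule eq[OF cxy(1) Fn.M.a_closed[OF cx(1) cy(1)]]) (use lin_add[OF lu cx(1) cy(1)] cx cy cxy in simp)
    thus "?s (coords (x \<oplus>\<^bsub>M\<^esub> y)) = ?s (coords x) \<oplus>\<^bsub>ring_module R\<^esub> ?s (coords y)"
      using lin_add[OF ls cx(1) cy(1)] by simp
  next
    fix a x assume a: "a \<in> carrier R" and x: "x \<in> carrier M"
    note cx = coords[OF x] and cax = coords[OF M.smult_closed[OF a x]]
    have "?s (coords (a \<odot>\<^bsub>M\<^esub> x)) = ?s (a \<odot>\<^bsub>finite_free R n\<^esub> coords x)"
      by (rule eq[OF cax(1) Fn.smult_closed[OF a cx(1)]]) (use lin_smult[OF lu a cx(1)] cx cax in simp)
    thus "?s (coords (a \<odot>\<^bsub>M\<^esub> x)) = a \<odot>\<^bsub>ring_module R\<^esub> ?s (coords x)"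
      using lin_smult[OF ls a cx(1)] by simp
  qed
  note h = restrict_mod_hom[OF Mm this]
  have "?s (coords (u i)) = s i" if i: "i < n" for i
  proof -
    have "?s (coords (u i)) = ?s (unit_vec R i)"
      using coords[OF ui[OF i]] lincomb_unit[OF Mm uc i] by (intro eq unit_vec_carrier[OF cr i]) simp_all
    also have "\<dots> = s i" by (rule lincomb_unit[OF RM free_family[OF assms(1)] i])
    finally show ?thesis .
  qed
  thus ?thesis using ui by (intro bexI[OF _ h]) simp
qed

text \<open>With \<open>c\<close> fixed, the pairing is a linear map out of the dual, so it sends
  \<open>Q\<close>-multiples to \<open>Q\<close>-multiples. This passes the equality of
  \<open>I\<close>- and \<open>Q\<close>-multiples from the dual of \<open>M\<close> to values in
  \<open>N\<close>.\<close>

lemma (in presentation) functional_pairing: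
  assumes "c \<in> carrier Nn"
  shows "lin R (dual R M) N (\<lambda>\<psi>. lincomb N n c (\<lambda>i. if i < n then \<psi> (u i) else \<zero>))"
proof -
  have cc: "c \<in> {..<n} \<rightarrow> carrier N" using pow_val[OF Nm assms] by auto
  have "lin R (dual R M) (finite_free R n) (\<lambda>\<psi> i. if i < n then \<psi> (u i) else \<zero>)"
  proof (rule linI)
    fix \<psi> assume "\<psi> \<in> carrier (dual R M)"
    hence "lin R M (ring_module R) \<psi>" by (simp add: dual_def mod_hom_lin)
    from lin_closed[OF this ui] show "(\<lambda>i. if i < n then \<psi> (u i) else \<zero>) \<in> carrier (finite_free R n)"
      by (auto simp: finite_free_carrier)
  qed (auto simp: dual_def fun_eq_iff ui)
  from lin_comp[OF this lin_lincomb[OF Nm cc]] show ?thesis .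
qed

lemma gens_nonzero:
  assumes "module R X" "gens R X n u" "\<not> zero_module X" shows "n > 0"
proof (rule ccontr)
  assume n: "\<not> n > 0"
  interpret module R X by fact
  have "x = \<zero>\<^bsub>X\<^esub>" if "x \<in> carrier X" for x
    using that assms(2) n unfolding gens_def lincomb_def by auto
  thus False using assms(3) unfolding zero_module_def by auto
qed

text \<open>The zero module has infinite depth, which differs from a finite dimension.\<close>

lemma MCM_nonzero: "krull_dim R = enat d \<Longrightarrow> MCM R X \<Longrightarrow> \<not> zero_module X"
  by (auto simp: MCM_def depth_def)

lemma dual_nonzero:
  assumes "module R M" "\<not> zero_module (dual R M)" shows "\<not> zero_module M"
proof
  assume z: "zero_module M"
  interpret module R M by fact
  have "f = \<zero>\<^bsub>dual R M\<^esub>" if f: "f \<in> carrier (dual R M)" for f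
  proof -
    have h: "f \<in> mod_hom R M (ring_module R)" using f by (simp add: dual_def)
    have "f \<zero>\<^bsub>M\<^esub> = \<zero>\<^bsub>ring_module R\<^esub>"
      by (rule lin_zero[OF assms(1) ring_module_module[OF R.is_cring] mod_hom_lin[OF h]])
    thus ?thesis using h z
      by (intro extensionalityI[of f "carrier M"]) (auto simp: dual_def mod_hom_iff zero_module_def)
  qed
  hence "carrier (dual R M) \<subseteq> {\<zero>\<^bsub>dual R M\<^esub>}" by (intro subsetI) simp
  moreover have "{\<zero>\<^bsub>dual R M\<^esub>} \<subseteq> carrier (dual R M)"
    using sub_zero[OF sub_carrier[OF Hom_module_module[OF assms(1) ring_module_module[OF R.is_cring]]]]
    unfolding dual_def by simp
  ultimately show False using assms(2) unfolding zero_module_def by (metis equalityI)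
qed

section \<open>The two criteria for \<open>M \<otimes> N\<close> to be Ulrich\<close>

theorem theorem4p5:
  fixes R :: "('a, 'r) ring_scheme"
    and K :: "('a, 'k, 'z) module_scheme"
    and M :: "('a, 'm, 'x) module_scheme"
    and N :: "('a, 'n, 'y) module_scheme"
    and I Q :: "'a set" and d :: nat
  assumes "CM_local_ring R" and "krull_dim R = enat d" and "d \<ge> 1"
    and "canonical_module R K"
    and "max_primary R I" and "parameter_ideal R Q" and "reduction R Q I"
    and "gorenstein_local_ring (R Quot I)"
    and "finite_module R M" and "finite_module R N"
    and "\<forall>i\<in>{1..d + 1}. zero_module (Ext R i (transpose_module R M) N)"
  shows "(free_mod_ideal R I M \<and> ulrich R I Q (dual R M) \<and> MCM R N \<longrightarrow>
            (ulrich R I Q (tensor R M N) \<longleftrightarrow> free_mod_ideal R I N)) \<and>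
         (MCM R (dual R M) \<and> ulrich R I Q N \<longrightarrow>
            (ulrich R I Q (tensor R M N) \<longleftrightarrow> free_mod_ideal R I M))"
proof -
  have loc: "local_ring R" using assms(1) by (simp add: CM_local_ring_def)
  note cr = local_cring[OF loc] and mx = max_ideal_ideal[OF loc]
  interpret cring R by (rule cr)
  have Mm: "module R M" and Nm: "module R N" using assms(9,10) by (simp_all add: finite_module_def)
  have I: "ideal I R" "\<one>\<^bsub>R\<^esub> \<notin> I"
    using assms(5) ideal.one_imp_carrier[of I R] by (auto simp: max_primary_def primary_ideal_def)
  have IR: "I \<subseteq> carrier R" using ideal.Icarr[OF I(1)] by auto
  have QI: "Q \<subseteq> I" using assms(7) by (simp add: reduction_def)
  obtain xs where xs: "system_of_parameters R xs" "Q = genideal R (set xs)"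
    using assms(6) by (auto simp: parameter_ideal_def)
  have lxs: "length xs = d" and xm: "set xs \<subseteq> max_ideal R"
    using xs(1) assms(2) by (auto simp: system_of_parameters_def)
  have xc: "set xs \<subseteq> carrier R" using xm max_ideal_carr[OF loc] by auto
  have rad: "\<exists>n::nat. y [^]\<^bsub>R\<^esub> n \<in> genideal R (set xs)" if "y \<in> max_ideal R" for y
  proof -
    have "radical R (genideal R (set xs)) = max_ideal R"
      using xs(1) by (simp add: system_of_parameters_def max_primary_def)
    thus ?thesis using that by (auto simp: radical_def)
  qed
  have Qx: "ideal_smult R Q X = xsub R X (set xs)" for X :: "('a, 'w) module" by (simp add: xsub_def xs(2))
  have QxN: "ideal_smult R Q N = xsub R N (set xs)" by (simp add: xsub_def xs(2))
  obtain n k D \<epsilon> b DD \<eta> where tr: "minimal_presentation R M n k D \<epsilon>" "module R (transpose_module R M)"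
    "free_resolution R (transpose_module R M) b DD \<eta>" "b 0 = k" "b (Suc 0) = n"
    "\<And>s. s \<in> carrier (finite_free R n) \<Longrightarrow> DD 0 s = dual_map R n k D s"
    using transpose_resolution[OF loc assms(9)] by metis
  define u where "u = (\<lambda>i. \<epsilon> (unit_vec R i))"
  note mp = minimal_presentationD[OF loc Mm tr(1), folded u_def]
  obtain m v where v: "gens R N m v" "rels_in R N m v (max_ideal R)" using min_gens_exist[OF loc assms(10)] .
  interpret presentation_gens R M N n k u D m v
    by (intro presentation_gens.intro presentation.intro presentation_axioms.intro presentation_gens_axioms.intro
        Mm Nm mp(1,3,4) v(1))
  \<comment> \<open>The index shifts by one: \<open>Ext\<close> in degrees
    \<open>1, ..., d + 1\<close> gives exactness at the places \<open>0, ..., d\<close>.\<close>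
  have ext: "coboundaries_exact R N b DD i" if "i \<le> length xs" for i
    using assms(11) that lxs by (intro Ext_zero_exact[OF tr(2) Nm tr(3)]) auto
  note l1 = complex.lin_\<delta>[OF cochain_complex[OF Nm tr(3)], of "Suc 0", unfolded tr(5)]
  have Wnm: "\<not> zero_module W" if "\<not> zero_module M" "\<not> zero_module N"
    using that gens_nonzero[OF Mm mp(1)] gens_nonzero[OF Nm v(1)]
    by (intro W_nonzero[OF mx max_ideal_one[OF loc] mp(2) v(2)])
  \<comment> \<open>The regular sequence of length \<open>d\<close> supplied by the depth of
    \<open>N\<close> is exchanged for the given parameters \<open>xs\<close>, whose regularity then
    passes to \<open>W\<close> and determines its depth.\<close>
  have WMCM: "MCM R W" if N: "MCM R N" and M: "\<not> zero_module M"
  proof -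
    have dN: "depth R N = enat d" using N assms(2) by (simp add: MCM_def)
    obtain ys where ys: "set ys \<subseteq> max_ideal R" "length ys = d" "regular_list R N ys"
      using depth_regular_list(2)[OF loc assms(10) dN] by auto
    have "regular_list R N xs"
      using ys rad lxs by (intro regular_exchange[OF loc assms(10) xm ys(1)]) auto
    hence "regular_list R W xs" by (intro tensor_of_exact(1)[OF tr(3-6) ext _ xc])
    hence "depth R W = enat d"
      using depth_eqI[OF loc W_finite Wnm[OF M depth_regular_list(1)[OF loc assms(10) dN]] xm rad] lxs by simp
    thus ?thesis using W_finite assms(2) by (simp add: MCM_def)
  qed
  \<comment> \<open>Assumption \<open>e\<close> says that the next differential sends
    \<open>I\<close>-multiples in \<open>N^n\<close> to multiples by \<open>xs\<close>; the
    embedding of \<open>W\<close> modulo \<open>Q\<close> then places \<open>I W\<close> inside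
    \<open>Q W\<close>.\<close>
  have IQ: "ideal_smult R I W = ideal_smult R Q W"
    if N: "MCM R N" and e: "\<And>a c. a \<in> I \<Longrightarrow> c \<in> carrier Nn \<Longrightarrow>
      cochain R N b DD (Suc 0) (a \<odot>\<^bsub>Nn\<^esub> c) \<in> xsub R (pow_module N {..<b (Suc (Suc 0))}) (set xs)"
  proof
    have dN: "depth R N = enat d" using N assms(2) by (simp add: MCM_def)
    obtain ys where ys: "set ys \<subseteq> max_ideal R" "length ys = d" "regular_list R N ys"
      using depth_regular_list(2)[OF loc assms(10) dN] by auto
    have reg: "regular_list R N xs"
      using ys rad lxs by (intro regular_exchange[OF loc assms(10) xm ys(1)]) auto
    show "ideal_smult R Q W \<subseteq> ideal_smult R I W" by (rule ismult_mono[OF QI])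
    interpret Nn: module R Nn by (rule Nn)
    show "ideal_smult R I W \<subseteq> ideal_smult R Q W" unfolding Qx
    proof (rule ismult_least[OF xsub_sub[OF W xc]])
      fix a w assume a: "a \<in> I" and "w \<in> carrier W"
      then obtain c where c: "c \<in> carrier Nn" "w = \<Theta> c" using \<Theta>_surj by auto
      have aR: "a \<in> carrier R" using a IR by auto
      have "\<Theta> (a \<odot>\<^bsub>Nn\<^esub> c) \<in> xsub R W (set xs)"
        by (rule tensor_of_exact(2)[OF tr(3-6) ext reg xc Nn.smult_closed[OF aR c(1)] e[OF a c(1)]])
      thus "a \<odot>\<^bsub>W\<^esub> w \<in> xsub R W (set xs)" using lin_smult[OF lin_\<Theta> aR c(1)] c(2) by simp
    qed
  qed
  note freeM = free_mod_ideal_iff[OF loc Mm I mp(1,2)] and freeN = free_mod_ideal_iff[OF loc Nm I v]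
    and freeW = free_mod_ideal_iff[OF loc W I gens_uv rels_uv[OF mx mp(2) v(2)]]
  have a: "ulrich R I Q W \<longleftrightarrow> free_mod_ideal R I N"
    if fM: "free_mod_ideal R I M" and U: "ulrich R I Q (dual R M)" and N: "MCM R N"
  proof -
    have dn: "\<not> zero_module (dual R M)" using U unfolding ulrich_def by (intro MCM_nonzero[OF assms(2)]) simp
    \<comment> \<open>The zero module is not maximal Cohen-Macaulay, so \<open>W\<close> must be
      nonzero; this rests on \<open>M\<close> being nonzero, which is inherited from its
      dual.\<close>
    have M0: "\<not> zero_module M" by (rule dual_nonzero[OF Mm dn])
    have dm: "module R (dual R M)" unfolding dual_def by (rule Hom_module_module[OF Mm RM])
    \<comment> \<open>Each coordinate of the differential pairs \<open>c\<close> with a functional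
      on \<open>M\<close> evaluated at the \<open>u i\<close>. A factor \<open>a\<close> in
      \<open>I\<close> puts that functional into \<open>I\<close> times the dual, which equals
      \<open>Q\<close> times the dual, so the pairing lands in \<open>Q N\<close>.\<close>
    have "cochain R N b DD (Suc 0) (a \<odot>\<^bsub>Nn\<^esub> c) \<in> xsub R (pow_module N {..<b (Suc (Suc 0))}) (set xs)"
      if aI: "a \<in> I" and c: "c \<in> carrier Nn" for a c
    proof -
      interpret Nn: module R Nn by (rule Nn)
      have aR: "a \<in> carrier R" using aI IR by auto
      have cc: "c \<in> {..<n} \<rightarrow> carrier N" using pow_val[OF Nm c] by auto
      note ac = Nn.smult_closed[OF aR c]
      have "cochain R N b DD (Suc 0) (a \<odot>\<^bsub>Nn\<^esub> c) l \<in> xsub R N (set xs)" if l: "l < b (Suc (Suc 0))" for l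
      proof -
        let ?s = "DD (Suc 0) (unit_vec R l)"
        note e = unit_vec_carrier[OF cr l]
        have s: "?s \<in> carrier (finite_free R n)" using lin_closed[OF free_resolutionD(2)[OF tr(3), of "Suc 0"] e] tr(5) by simp
        have "dual_map R n k D ?s = \<zero>\<^bsub>finite_free R k\<^esub>"
          using resolution_zero(1)[OF tr(3) e] tr(4,6) s by simp
        from functional_exists[OF s this] obtain \<phi> where phi: "\<phi> \<in> mod_hom R M (ring_module R)" "\<forall>i<n. \<phi> (u i) = ?s i" by auto
        let ?\<phi> = "a \<odot>\<^bsub>dual R M\<^esub> \<phi>"
        have "?\<phi> \<in> ideal_smult R I (dual R M)"
          using phi(1) by (intro ismult_mem[OF aI]) (simp add: dual_def)
        hence p: "?\<phi> \<in> xsub R (dual R M) (set xs)" using U by (simp add: ulrich_def Qx)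
        have sv: "?s i \<in> carrier R" for i by (rule finite_free_val[OF cr s])
        have "lincomb N n c (\<lambda>i. if i < n then ?\<phi> (u i) else \<zero>\<^bsub>R\<^esub>) \<in> xsub R N (set xs)"
          by (rule lin_xsub[OF dm Nm functional_pairing[OF c] xc p])
        also have "lincomb N n c (\<lambda>i. if i < n then ?\<phi> (u i) else \<zero>\<^bsub>R\<^esub>) = lincomb N n c (a \<odot>\<^bsub>finite_free R n\<^esub> ?s)"
          using phi(2) ui sv aR cc by (intro lincomb_cong[OF Nm]) (auto simp: dual_def)
        also have "\<dots> = a \<odot>\<^bsub>N\<^esub> lincomb N n c ?s" by (rule lin_smult[OF lin_lincomb[OF Nm cc] aR s])
        also have "\<dots> = lincomb N n (a \<odot>\<^bsub>Nn\<^esub> c) ?s"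
          using lincomb_smult_family[OF Nm, of n c ?s a] pow_val[OF Nm c] sv aR by simp
        also have "\<dots> = cochain R N b DD (Suc 0) (a \<odot>\<^bsub>Nn\<^esub> c) l" using l tr(5) by (simp add: cochain_def)
        finally show ?thesis .
      qed
      thus ?thesis using pow_xsub[OF Nm finite_lessThan xc] lin_closed[OF l1 ac] by simp
    qed
    hence "ulrich R I Q W \<longleftrightarrow> free_mod_ideal R I W" using WMCM[OF N M0] IQ[OF N] by (simp add: ulrich_def)
    \<comment> \<open>As the relations of \<open>u\<close> lie in \<open>I\<close>, those of the
      products lie in \<open>I\<close> exactly when those of \<open>v\<close> do; a nonzero
      \<open>M\<close> gives \<open>n > 0\<close>, so that \<open>u 0\<close> is available.\<close>
    also have "\<dots> \<longleftrightarrow> free_mod_ideal R I N"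
      unfolding freeW freeN
      using rels_right[OF gens_nonzero[OF Mm mp(1) M0]] rels_uv[OF I(1)] fM freeM by blast
    finally show ?thesis .
  qed
  have b: "ulrich R I Q W \<longleftrightarrow> free_mod_ideal R I M"
    if dM: "MCM R (dual R M)" and U: "ulrich R I Q N"
  proof -
    have N: "MCM R N" and fN: "free_mod_ideal R I N" and IN: "ideal_smult R I N = xsub R N (set xs)"
      using U by (simp_all add: ulrich_def QxN)
    have M0: "\<not> zero_module M" by (rule dual_nonzero[OF Mm MCM_nonzero[OF assms(2) dM]])
    \<comment> \<open>Here \<open>a c\<close> already lies in \<open>Q\<close> times
      \<open>N^n\<close>, because \<open>I N = Q N\<close>, and the differential preserves multiples
      by the parameters.\<close>
    have "cochain R N b DD (Suc 0) (a \<odot>\<^bsub>Nn\<^esub> c) \<in> xsub R (pow_module N {..<b (Suc (Suc 0))}) (set xs)"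
      if aI: "a \<in> I" and c: "c \<in> carrier Nn" for a c
    proof -
      interpret Nn: module R Nn by (rule Nn)
      have aR: "a \<in> carrier R" using aI IR by auto
      have "a \<odot>\<^bsub>N\<^esub> c i \<in> xsub R N (set xs)" for i
        unfolding IN[symmetric] by (rule ismult_mem[OF aI pow_val[OF Nm c]])
      hence "a \<odot>\<^bsub>Nn\<^esub> c \<in> xsub R Nn (set xs)"
        using pow_xsub[OF Nm finite_lessThan xc] Nn.smult_closed[OF aR c] by simp
      from lin_xsub[OF Nn pow_module_module[OF Nm] l1 xc this] show ?thesis .
    qed
    hence "ulrich R I Q W \<longleftrightarrow> free_mod_ideal R I W" using WMCM[OF N M0] IQ[OF N] by (simp add: ulrich_def)
    \<comment> \<open>The factors exchange roles: now the relations of \<open>v\<close> lie in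
      \<open>I\<close>, and a nonzero \<open>N\<close> provides \<open>v 0\<close> for the
      converse.\<close>
    also have "\<dots> \<longleftrightarrow> free_mod_ideal R I M"
      unfolding freeW freeM
      using rels_left[OF gens_nonzero[OF Nm v(1) MCM_nonzero[OF assms(2) N]]] rels_uv[OF I(1)] fN freeN by blast
    finally show ?thesis .
  qed
  from a b show ?thesis by blast
qed

end
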